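(* Let $T>0$, $\alpha_0,\alpha_1\in(0,1)$, $0<p_0,p_1,q_0,q_1\le\infty$, and set $\gamma=\alpha_0+\alpha_1$, $\frac1{p_2}=\frac1{p_0}+\frac1{p_1}$, $\frac1{q_2}=\frac1{q_0}+\frac1{q_1}$. Let $f\in B^{\alpha_0}_{p_0,q_0}([0,T])$ and $g\in B^{\alpha_1}_{p_1,q_1}([0,T])$ be real-valued. For a partition $P=\{0=\tau_0<\dots<\tau_N=1\}$ of $[0,1]$ let $$\mathscr I^P_{st}=\sum_{k=1}^Nf_{s+\tau_{k-1}(t-s)}\big(g_{s+\tau_k(t-s)}-g_{s+\tau_{k-1}(t-s)}\big),\qquad (s,t)\in\Delta_2(0,T).$$ (a) If $\gamma>1\vee\frac1{p_2}$, then there exists $\mathscr I\in B^{\alpha_1}_{p_2,q_1}([0,T])$, written $\mathscr I_t=\int_0^tf_s\,dg_s$, such that for all $r\in(0,\infty)$ with $r>1/\gamma$ and $r\ge q_2$, $\lim_{\|P\|\to0}\|\mathscr I^P-\delta\mathscr I\|_{\mathbb B^\gamma_{p_2,r}([0,T])}=0$. Moreover $$\|\delta\mathscr I-f\delta g\|_{\mathbb B^\gamma_{p_2,q_2}([0,T])}\lesssim_{\gamma,p_2,q_2}[f]_{B^{\alpha_0}_{p_0,q_0}}[g]_{B^{\alpha_1}_{p_1,q_1}},$$ $$[\mathscr I]_{B^{\alpha_1}_{p_2,q_1}}\lesssim_{\alpha_0,\alpha_1,p_0,p_1,q_0,q_1}\big(\|f\|_{L^{p_0}([0,T])}+T^{\alpha_0}[f]_{B^{\alpha_0}_{p_0,q_0}}\big)[g]_{B^{\alpha_1}_{p_1,q_1}}.$$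 If, in addition, $\alpha_0>\frac1{p_0}$ and $\alpha_1>\frac1{p_1}$, then $$[\mathscr I]_{B^{\alpha_1}_{p_1,q_1}}\lesssim_{\alpha_0,\alpha_1,p_0,p_1,q_0,q_1}\big(|f(0)|+T^{\alpha_0-\frac1{p_0}}[f]_{B^{\alpha_0}_{p_0,q_0}}\big)[g]_{B^{\alpha_1}_{p_1,q_1}}.$$ (b) If $\gamma=1\vee\frac1{p_2}\le\frac1{q_2}$, let $(\ell_r)_{0<r\le\infty}$ be a fixed log-like family and $\omega_r(h)=h^{1\vee\frac1{p_2}}\ell_r(h)$ (see context). Then there exists $\mathscr I\in B^{\alpha_1}_{p_2,q_1}([0,T])$ with $\lim_{\|P\|\to0}\|\mathscr I^P-\delta\mathscr I\|_{\mathbb B^{1\vee\frac1{p_2}}_{p_2,\infty}([0,T])}=0$ and, with implicit constants that may also depend on $(\ell_r)$, $$\|\delta\mathscr I-f\delta g\|_{\mathbb B^{\omega_r}_{p_2,r}([0,T])}\lesssim_{p_2,r}[f]_{B^{\alpha_0}_{p_0,q_0}}[g]_{B^{\alpha_1}_{p_1,q_1}}\quad\text{for all }r\in[q_2,\infty],$$ $$[\mathscr I]_{B^{\alpha_1}_{p_2,q_1}}\lesssim_{\alpha_0,\alpha_1,p_0,p_1,q_0,q_1}\big(\|f\|_{L^{p_0}([0,T])}+T^{\alpha_0}\ell_{q_2}(T)[f]_{B^{\alpha_0}_{p_0,q_0}}\big)[g]_{B^{\alpha_1}_{p_1,q_1}}.$$ If, in addition, $\alpha_0>\frac1{p_0}$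 and $\alpha_1>\frac1{p_1}$ (which implies $\gamma=1$), then $$[\mathscr I]_{B^{\alpha_1}_{p_1,q_1}}\lesssim_{\alpha_0,\alpha_1,p_0,p_1,q_0,q_1}\big(|f(0)|+T^{\alpha_0-\frac1{p_0}}(1+\ell_{q_2}(T))[f]_{B^{\alpha_0}_{p_0,q_0}}\big)[g]_{B^{\alpha_1}_{p_1,q_1}}.$$
   Context: Notation: $\Delta_2(0,T)=\{(s,t)\in[0,T]^2:s\le t\}$; $\delta f_{st}=f_t-f_s$; $(f\delta g)_{st}=f_s(g_t-g_s)$; $\|P\|$ is the mesh of the partition $P$. $\lesssim_{a,b,\dots}$ means $\le C\,\cdot$ with $C$ depending only on $a,b,\dots$. $1/\infty=0$; exponents $\infty$ are read as (essential) suprema. Functions are identified if equal a.e.; when $\alpha>1/p$ every element of $B^\alpha_{pq}$ has a continuous version, and $f(0)$ refers to it. Besov spaces: for measurable $f:[0,T]\to\mathbb R$, $\omega_p(f,\tau)=\sup_{0\le h\le\tau}\big(\int_0^{T-h}|f_{s+h}-f_s|^p\,ds\big)^{1/p}$, $[f]_{B^\alpha_{pq}([0,T])}=\big[\int_0^T(\omega_p(f,\tau)/\tau^\alpha)^q\frac{d\tau}\tau\big]^{1/q}$, and $f\in B^\alpha_{pq}([0,T])$ iff $f\in L^p([0,T])$ and $[f]_{B^\alpha_{pq}}<\infty$. For measurable $A:\Delta_2(0,T)\to\mathbb R$, $\Omega_p(A,\tau)=\sup_{0\le h\le\tau}\big(\int_0^{T-h}|A_{r,r+h}|^p\,dr\big)^{1/p}$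 and $\|A\|_{\mathbb B^\omega_{pq}([0,T])}=\big[\int_0^T(\Omega_p(A,\tau)/\omega(\tau))^q\frac{d\tau}\tau\big]^{1/q}$; $\mathbb B^\gamma_{pq}$ is the case $\omega(\tau)=\tau^\gamma$. Log-like functions: $(\ell_r)_{0<r\le\infty}$ is a fixed family of functions $\ell_r:(0,T]\to(0,\infty)$ such that, for each $r$, $\ell_r$ is non-increasing; $\int_0^T\ell_r(h)^{-r}\frac{dh}h<\infty$ (for $r=\infty$: $\sup 1/\ell_\infty<\infty$); and for all $\eta,\zeta>0$, $\delta\in(0,T]$, $\int_0^\delta\ell_r(h)^\eta h^\zeta\frac{dh}h\lesssim_{r,\eta,\zeta}\ell_r(\delta)^\eta\delta^\zeta$. *)

theory Defs
  imports "HOL-Probability.Essential_Supremum"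
begin

text \<open>
  All integrability and smoothness exponents have type \<^typ>\<open>ennreal\<close>, so that infinity is
  admitted and \<^prop>\<open>inverse (top :: ennreal) = 0\<close>. Norms are \<^typ>\<open>ennreal\<close>-valued.
  Functions on \<open>[0,T]\<close> are total functions whose values outside \<open>[0,T]\<close> are never inspected,
  and ``measurable'' means Lebesgue measurable.
\<close>

text \<open>Only meant for exponents \<open>a > 0\<close>, where it is the continuous extension of \<open>powr\<close>.\<close>

definition enn_powr :: "ennreal \<Rightarrow> real \<Rightarrow> ennreal" where
  "enn_powr x a = (if x = \<infinity> then \<infinity> else ennreal (enn2real x powr a))"

definition Lp_qnorm :: "'a measure \<Rightarrow> ennreal \<Rightarrow> ('a \<Rightarrow> ennreal) \<Rightarrow> ennreal" where
  "Lp_qnorm M p F =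
     (if p = \<infinity> then esssup M F
      else enn_powr (\<integral>\<^sup>+x. enn_powr (F x) (enn2real p) \<partial>M) (1 / enn2real p))"

text \<open>The measure \<open>d\<tau>/\<tau>\<close> on \<open>(0,T]\<close>.\<close>

definition dlog :: "real \<Rightarrow> real measure" where
  "dlog T = density (lebesgue_on {0<..T}) (\<lambda>\<tau>. ennreal (1 / \<tau>))"

definition Lp_norm_on :: "real \<Rightarrow> ennreal \<Rightarrow> (real \<Rightarrow> real) \<Rightarrow> ennreal" where
  "Lp_norm_on T p f = Lp_qnorm (lebesgue_on {0..T}) p (\<lambda>s. ennreal \<bar>f s\<bar>)"

definition modulus2 :: "real \<Rightarrow> ennreal \<Rightarrow> (real \<Rightarrow> real \<Rightarrow> real) \<Rightarrow> real \<Rightarrow> ennreal" where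
  "modulus2 T p A \<tau> = (SUP h\<in>{0..\<tau>}. Lp_norm_on (T - h) p (\<lambda>r. A r (r + h)))"

definition besov2_norm ::
    "real \<Rightarrow> (real \<Rightarrow> real) \<Rightarrow> ennreal \<Rightarrow> ennreal \<Rightarrow> (real \<Rightarrow> real \<Rightarrow> real) \<Rightarrow> ennreal" where
  "besov2_norm T \<omega> p q A = Lp_qnorm (dlog T) q (\<lambda>\<tau>. modulus2 T p A \<tau> / ennreal (\<omega> \<tau>))"

definition incr :: "(real \<Rightarrow> real) \<Rightarrow> real \<Rightarrow> real \<Rightarrow> real" where
  "incr f s t = f t - f s"

definition modulus :: "real \<Rightarrow> ennreal \<Rightarrow> (real \<Rightarrow> real) \<Rightarrow> real \<Rightarrow> ennreal" where
  "modulus T p f \<tau> = (SUP h\<in>{0..\<tau>}. Lp_norm_on (T - h) p (\<lambda>s. f (s + h) - f s))"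

definition besov_seminorm :: "real \<Rightarrow> real \<Rightarrow> ennreal \<Rightarrow> ennreal \<Rightarrow> (real \<Rightarrow> real) \<Rightarrow> ennreal" where
  "besov_seminorm T \<alpha> p q f = Lp_qnorm (dlog T) q (\<lambda>\<tau>. modulus T p f \<tau> / ennreal (\<tau> powr \<alpha>))"

definition besov_space :: "real \<Rightarrow> real \<Rightarrow> ennreal \<Rightarrow> ennreal \<Rightarrow> (real \<Rightarrow> real) set" where
  "besov_space T \<alpha> p q =
     {f. f \<in> borel_measurable (lebesgue_on {0..T}) \<and>
         Lp_norm_on T p f < \<infinity> \<and> besov_seminorm T \<alpha> p q f < \<infinity>}"

definition continuous_version :: "real \<Rightarrow> (real \<Rightarrow> real) \<Rightarrow> (real \<Rightarrow> real) \<Rightarrow> bool" where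
  "continuous_version T f f' \<longleftrightarrow>
     continuous_on {0..T} f' \<and> (AE s in lebesgue_on {0..T}. f' s = f s)"

text \<open>A partition of \<open>[0,1]\<close> is the list of its points in increasing order.\<close>

definition unit_partition :: "real list \<Rightarrow> bool" where
  "unit_partition P \<longleftrightarrow> P \<noteq> [] \<and> hd P = 0 \<and> last P = 1 \<and> sorted_wrt (<) P"

definition mesh :: "real list \<Rightarrow> real" where
  "mesh P = Max ((\<lambda>k. P ! k - P ! (k - 1)) ` {1..<length P})"

definition mesh_to_0 :: "real list filter" where
  "mesh_to_0 = inf (filtercomap mesh (at_right 0)) (principal {P. unit_partition P})"

definition riemann_sum ::
    "(real \<Rightarrow> real) \<Rightarrow> (real \<Rightarrow> real) \<Rightarrow> real list \<Rightarrow> real \<Rightarrow> real \<Rightarrow> real" where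
  "riemann_sum f g P s t =
     (\<Sum>k\<in>{1..<length P}. f (s + P ! (k - 1) * (t - s)) *
        (g (s + P ! k * (t - s)) - g (s + P ! (k - 1) * (t - s))))"

text \<open>A log-like family is indexed by \<open>0 < r \<le> \<infinity>\<close>, and \<open>L r\<close> is used only on \<open>(0,T]\<close>.\<close>

definition log_like :: "real \<Rightarrow> (ennreal \<Rightarrow> real \<Rightarrow> real) \<Rightarrow> bool" where
  "log_like T L \<longleftrightarrow> (\<forall>r>0.
     (\<forall>h\<in>{0<..T}. 0 < L r h) \<and>
     antimono_on {0<..T} (L r) \<and>
     (if r = \<infinity> then bdd_above ((\<lambda>h. 1 / L r h) ` {0<..T})
      else (\<integral>\<^sup>+h. ennreal (L r h powr (- enn2real r)) \<partial>dlog T) < \<infinity>) \<and>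
     (\<forall>\<eta>>0. \<forall>\<zeta>>0. \<exists>C::real. \<forall>\<delta>\<in>{0<..T}.
        (\<integral>\<^sup>+h. ennreal (L r h powr \<eta> * h powr \<zeta>) \<partial>dlog \<delta>)
          \<le> ennreal (C * (L r \<delta> powr \<eta> * \<delta> powr \<zeta>))))"

end

theory Submission imports Defs begin

text \<open>
  Let \<open>\<rho> = min 1 p2\<close>, so that the \<open>\<rho>\<close>-th power of the \<open>L\<^sup>p\<^sup>2\<close> quasi-norm is subadditive. Bisecting an interval of
  length \<open>h\<close> changes the germ \<open>f \<delta>g\<close> by \<open>\<delta>f \<delta>g\<close>, whose norm is at most \<open>Z(h) = \<omega>\<^sub>p\<^sub>0(f,h) \<omega>\<^sub>p\<^sub>1(g,h)\<close> by Hoelder; hence every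
  partition sum differs from the germ by at most \<open>\<Psi>(h)\<close> in \<open>\<rho>\<close>-th power, where \<open>\<Psi>(h) = \<Sum>\<^sub>n 2\<^sup>n\<^sup>+\<^sup>1 Z(2\<^sup>-\<^sup>n h)\<^sup>\<rho>\<close>. The dyadic
  sums converge for almost every base point, and Fubini turns their almost additive limit into the increments of a
  function. What remains is to sum \<open>\<Psi>\<close>: for \<open>\<gamma> > 1/\<rho>\<close> by Minkowski's inequality in the scale variable, for \<open>\<gamma> = 1/\<rho>\<close> because
  \<open>q2 \<le> \<rho>\<close> makes \<open>\<Sum>\<^sub>n (Z(2\<^sup>-\<^sup>n h) / (2\<^sup>-\<^sup>n h)\<^sup>\<gamma>)\<^sup>\<rho>\<close> finite. If \<open>\<alpha>0 > 1/p0\<close>, the germ is bounded by the supremum of the continuous version of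
  \<open>f\<close>, and chaining controls the sums of \<open>|\<delta>f|\<^sup>p\<^sup>0\<close> over dyadic cells, which upgrades the remainder estimate from \<open>L\<^sup>p\<^sup>2\<close> to \<open>L\<^sup>p\<^sup>1\<close>.
\<close>

subsection \<open>Powers of extended nonnegative reals and \<open>L\<^sup>p\<close> quasi-norms\<close>

text \<open>The obstacle is that functions here have no values at given points: each identity holds
  for almost every base point, off a null set that depends on the step. So norms are taken over the
  base point at a fixed step, and a primitive has to be extracted from a two-parameter limit by
  choosing a good base point. Both smoothness indices are below 1, so \<gamma> < 2, and 1/p2 \<le>
  \<gamma> forces every integrability exponent to be at least 1/2. Hence doubling the scale costs a
  factor 4 per modulus whatever the exponents are. Together with the window [\<tau>/4,\<tau>] this
  produces the numerals 16 and 256. The bounds are uniform in T because d\<tau>/\<tau> is invariant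
  under dilation; T enters constants only through the log-like weights. For the L^p1 estimate,
  Hoelder on each cell separately would lead back to L^p2. Instead the increments of f over all
  cells are bounded jointly for every base point, so that only the factor g is measured in the base
  point; this needs values of f at every point, hence its continuous version.\<close>

lemma enn_powr_ennreal: "0 \<le> x \<Longrightarrow> enn_powr (ennreal x) a = ennreal (x powr a)"
  by (simp add: enn_powr_def)

lemma enn_powr_top [simp]: "enn_powr top a = top"
  by (simp add: enn_powr_def)

lemma enn_powr_0 [simp]: "enn_powr 0 a = 0"
  by (simp add: enn_powr_def)

lemma enn_powr_1 [simp]: "enn_powr 1 a = 1"
  by (simp add: enn_powr_def)

lemma enn_powr_one [simp]: "enn_powr x 1 = x"
  by (cases x) (auto simp: enn_powr_def)

lemma enn_powr_mono: "x \<le> y \<Longrightarrow> 0 \<le> a \<Longrightarrow> enn_powr x a \<le> enn_powr y a"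
  by (cases x; cases y) (auto simp: enn_powr_def top_unique intro!: ennreal_leI powr_mono2)

lemma enn_powr_powr: "enn_powr (enn_powr x a) b = enn_powr x (a * b)"
  by (cases x) (auto simp: enn_powr_def powr_powr)

lemma enn_powr_mult: "enn_powr (x * y) a = enn_powr x a * enn_powr y a"
proof (cases x; cases y)
  fix r s :: real assume "0 \<le> r" "0 \<le> s" "x = ennreal r" "y = ennreal s"
  then show ?thesis
    by (simp add: enn_powr_ennreal powr_mult flip: ennreal_mult)
next
  fix r :: real assume "0 \<le> r" "x = ennreal r" "y = top"
  then show ?thesis
    by (cases "r = 0") (auto simp: enn_powr_ennreal ennreal_mult_top)
next
  fix s :: real assume "0 \<le> s" "x = top" "y = ennreal s"
  then show ?thesis
    by (cases "s = 0") (auto simp: enn_powr_ennreal ennreal_top_mult)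
qed auto

lemma enn_powr_inverse_cancel [simp]:
  "0 < a \<Longrightarrow> enn_powr (enn_powr x (1 / a)) a = x"
  "0 < a \<Longrightarrow> enn_powr (enn_powr x a) (1 / a) = x"
  by (simp_all add: enn_powr_powr)

lemma enn_powr_le_iff: "0 < a \<Longrightarrow> enn_powr x a \<le> enn_powr y a \<longleftrightarrow> x \<le> y"
  by (metis enn_powr_inverse_cancel(2) enn_powr_mono less_eq_real_def zero_le_divide_1_iff)

lemma enn_powr_le_swap: "0 < a \<Longrightarrow> enn_powr x a \<le> y \<longleftrightarrow> x \<le> enn_powr y (1 / a)"
  by (metis enn_powr_inverse_cancel(1) enn_powr_le_iff)

lemma enn_powr_eq_0_iff [simp]: "enn_powr x a = 0 \<longleftrightarrow> x = 0"
  by (cases x) (auto simp: enn_powr_def)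

lemma enn_powr_eq_top_iff [simp]: "enn_powr x a = top \<longleftrightarrow> x = top"
  by (auto simp: enn_powr_def)

lemma enn_powr_less_top_iff [simp]: "enn_powr x a < top \<longleftrightarrow> x < top"
  by (auto simp: enn_powr_def less_top)

lemma enn_powr_nonzero: "0 < x \<Longrightarrow> x < \<infinity> \<Longrightarrow> \<exists>r>0. x = ennreal r"
  by (cases x) auto

text \<open>A monotone map with open range is continuous; the range is everything because the power
  1/a inverts the power a.\<close>

lemma continuous_on_enn_powr: "0 < a \<Longrightarrow> continuous_on UNIV (\<lambda>x. enn_powr x a)"
proof (rule continuous_onI_mono)
  assume "0 < a"
  then have "range (\<lambda>x. enn_powr x a) = UNIV"
    by (metis (no_types, lifting) enn_powr_inverse_cancel(1) surj_def)
  then show "open (range (\<lambda>x. enn_powr x a))" by simp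
qed (auto intro: enn_powr_mono)

lemma tendsto_enn_powr:
  "0 < a \<Longrightarrow> (f \<longlongrightarrow> l) F \<Longrightarrow> ((\<lambda>x. enn_powr (f x) a) \<longlongrightarrow> enn_powr l a) F"
  using continuous_on_enn_powr[of a]
  by (auto simp: continuous_on_eq_continuous_at isCont_def intro: tendsto_compose isCont_tendsto_compose)

lemma measurable_enn_powr [measurable (raw)]:
  assumes [measurable]: "f \<in> borel_measurable M"
  shows "(\<lambda>x. enn_powr (f x) a) \<in> borel_measurable M"
  unfolding enn_powr_def by measurable

lemma enn_powr_Liminf:
  fixes f :: "nat \<Rightarrow> ennreal"
  assumes "0 < a"
  shows "enn_powr (liminf f) a = liminf (\<lambda>n. enn_powr (f n) a)"
  using Liminf_compose_continuous_mono[of "\<lambda>x. enn_powr x a" sequentially f]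
    continuous_on_enn_powr[OF assms] enn_powr_mono[of _ _ a] assms
  by (simp add: mono_def)

lemma enn_powr_add_le:
  assumes "0 < a" "a \<le> 1"
  shows "enn_powr (x + y) a \<le> enn_powr x a + enn_powr y a"
proof (cases x; cases y)
  fix r s :: real assume rs: "0 \<le> r" "0 \<le> s" "x = ennreal r" "y = ennreal s"
  have "(r + s) powr a \<le> r powr a + s powr a"
  proof (cases "r + s = 0")
    case False
    then have p: "r + s > 0" using rs by auto
    \<comment> \<open>Used for the shares r/(r+s) and s/(r+s), which lie in [0,1] and add up to
      1.\<close>
    have le: "z \<le> z powr a" if "0 \<le> z" "z \<le> 1" for z :: real
      using that assms by (cases "z = 0") (use powr_mono'[of a 1 z] in auto)
    have "1 = r / (r + s) + s / (r + s)" using p by (simp add: add_divide_distrib[symmetric])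
    also have "\<dots> \<le> (r / (r + s)) powr a + (s / (r + s)) powr a"
      using rs p by (intro add_mono le) auto
    also have "\<dots> = (r powr a + s powr a) / (r + s) powr a"
      using rs p by (simp add: powr_divide add_divide_distrib)
    finally show ?thesis using p by (simp add: field_simps)
  qed (use rs assms in auto)
  then show ?thesis using rs
    by (auto simp: enn_powr_ennreal simp flip: ennreal_plus)
qed auto

lemma enn_powr_sum_le:
  assumes "0 < a" "a \<le> 1"
  shows "enn_powr (\<Sum>k\<in>K. x k) a \<le> (\<Sum>k\<in>K. enn_powr (x k) a)"
proof (induction K rule: infinite_finite_induct)
  case (insert k K)
  then show ?case
    using enn_powr_add_le[OF assms, of "x k" "\<Sum>k\<in>K. x k"] by (auto intro: order_trans add_left_mono)
qed auto

lemma tendsto_suminf_ennreal: "(\<lambda>n. \<Sum>k<n. f k) \<longlonglongrightarrow> (\<Sum>k. f k :: ennreal)"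
  using summable_LIMSEQ[of f] by simp

lemma enn_powr_suminf_le:
  assumes "0 < a" "a \<le> 1"
  shows "enn_powr (\<Sum>k. x k) a \<le> (\<Sum>k. enn_powr (x k) a)"
proof (rule LIMSEQ_le)
  show "(\<lambda>n. enn_powr (\<Sum>k<n. x k) a) \<longlonglongrightarrow> enn_powr (\<Sum>k. x k) a"
    by (intro tendsto_enn_powr assms tendsto_suminf_ennreal)
  show "(\<lambda>n. \<Sum>k<n. enn_powr (x k) a) \<longlonglongrightarrow> (\<Sum>k. enn_powr (x k) a)"
    by (rule tendsto_suminf_ennreal)
qed (use enn_powr_sum_le[OF assms] in auto)

section \<open>Quasi-norms: Fatou, Minkowski and subadditive powers\<close>

lemma Lp_qnorm_top: "Lp_qnorm M top F = esssup M F"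
  by (simp add: Lp_qnorm_def)

lemma Lp_qnorm_ennreal:
  "0 < p \<Longrightarrow> Lp_qnorm M (ennreal p) F = enn_powr (\<integral>\<^sup>+x. enn_powr (F x) p \<partial>M) (1 / p)"
  by (simp add: Lp_qnorm_def)

lemma esssup_le_iff:
  fixes F :: "'a \<Rightarrow> ennreal"
  shows "F \<in> borel_measurable M \<Longrightarrow> esssup M F \<le> c \<longleftrightarrow> (AE x in M. F x \<le> c)"
  using esssup_AE[of F M] by (auto intro: esssup_I elim: eventually_mono)

lemma ennreal_exponent_cases [case_names fin top, consumes 1]:
  fixes p :: ennreal
  assumes "0 < p"
  obtains r where "0 < r" "p = ennreal r" | "p = \<infinity>"
  using assms by (cases p) auto

lemma Lp_qnorm_mono_AE:
  assumes p: "0 < p" and [measurable]: "F \<in> borel_measurable M"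
    and le: "AE x in M. F x \<le> G x"
  shows "Lp_qnorm M p F \<le> Lp_qnorm M p G"
  using p
proof (cases rule: ennreal_exponent_cases)
  case (fin r)
  then show ?thesis
    using le by (auto simp: Lp_qnorm_ennreal intro!: enn_powr_mono nn_integral_mono_AE elim!: eventually_mono)
qed (use le in \<open>auto simp: Lp_qnorm_top intro: esssup_AE_mono\<close>)

lemma Lp_qnorm_mono:
  assumes "0 < p" "F \<in> borel_measurable M" "\<And>x. x \<in> space M \<Longrightarrow> F x \<le> G x"
  shows "Lp_qnorm M p F \<le> Lp_qnorm M p G"
  by (rule Lp_qnorm_mono_AE) (use assms in auto)

lemma Lp_qnorm_cong_AE:
  assumes p: "0 < p" and [measurable]: "F \<in> borel_measurable M" "G \<in> borel_measurable M"
    and "AE x in M. F x = G x"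
  shows "Lp_qnorm M p F = Lp_qnorm M p G"
  by (rule antisym; rule Lp_qnorm_mono_AE) (use assms in \<open>auto elim: eventually_mono\<close>)

text \<open>The definition of \<open>esssup\<close> tests measurability, but measurability too
  depends only on the values on \<open>space M\<close>; hence the functions need not be
  measurable.\<close>

lemma Lp_qnorm_cong:
  "(\<And>x. x \<in> space M \<Longrightarrow> F x = G x) \<Longrightarrow> Lp_qnorm M p F = Lp_qnorm M p G"
  unfolding Lp_qnorm_def esssup_def
  by (auto cong: nn_integral_cong measurable_cong intro!: Limsup_eq arg_cong2[where f=enn_powr] nn_integral_cong)

lemma Lp_qnorm_0: "0 < p \<Longrightarrow> Lp_qnorm M p (\<lambda>x. 0) = 0"
  by (cases rule: ennreal_exponent_cases) (auto simp: Lp_qnorm_ennreal Lp_qnorm_top esssup_le_iff simp flip: le_zero_eq)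

lemma Lp_qnorm_eq_0:
  assumes p: "0 < p" and [measurable]: "F \<in> borel_measurable M" and "Lp_qnorm M p F = 0"
  shows "AE x in M. F x = 0"
  using p
proof (cases rule: ennreal_exponent_cases)
  case (fin r)
  then show ?thesis using assms(3) by (auto simp: Lp_qnorm_ennreal nn_integral_0_iff_AE)
next
  case top
  then show ?thesis using assms(3) esssup_AE[of F M] by (auto simp: Lp_qnorm_top)
qed

lemma Lp_qnorm_powr:
  assumes p: "0 < p" and m: "0 < m" and [measurable]: "F \<in> borel_measurable M"
  shows "Lp_qnorm M p (\<lambda>x. enn_powr (F x) m) = enn_powr (Lp_qnorm M (p * ennreal m) F) m"
  using p
proof (cases rule: ennreal_exponent_cases)
  case (fin r)
  then have "p * ennreal m = ennreal (r * m)" using m by (simp flip: ennreal_mult)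
  then show ?thesis using fin m by (simp add: Lp_qnorm_ennreal enn_powr_powr mult.commute)
next
  case top
  have "esssup M (\<lambda>x. enn_powr (F x) m) \<le> c \<longleftrightarrow> enn_powr (esssup M F) m \<le> c" for c
    using m by (subst esssup_le_iff) (auto simp: enn_powr_le_swap esssup_le_iff)
  then show ?thesis using top m
    by (auto simp: Lp_qnorm_top ennreal_top_mult intro!: antisym)
qed

lemma Lp_qnorm_cmult:
  assumes p: "0 < p" and c: "c < \<infinity>" and [measurable]: "F \<in> borel_measurable M"
  shows "Lp_qnorm M p (\<lambda>x. c * F x) = c * Lp_qnorm M p F"
  using p
proof (cases rule: ennreal_exponent_cases)
  case (fin r)
  then show ?thesis by (simp add: Lp_qnorm_ennreal enn_powr_mult nn_integral_cmult)
next
  case top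
  show ?thesis
  proof (cases "c = 0")
    case True
    then show ?thesis using p by (simp add: Lp_qnorm_0)
  next
    case False
    then obtain r where r: "0 < r" "c = ennreal r" using c by (metis enn_powr_nonzero not_gr_zero)
    \<comment> \<open>Multiplication by a positive finite \<open>c\<close> is adjoint to division by
      \<open>c\<close>, so both sides of the claim have the same upper bounds.\<close>
    have *: "c * x \<le> y \<longleftrightarrow> x \<le> y / c" for x y
    proof -
      have "y = c * (y / c)"
        using r by (simp add: ennreal_times_divide mult_divide_eq_ennreal mult.commute)
      then show ?thesis
        using ennreal_mult_le_mult_iff[of c x "y / c"] r by simp
    qed
    have "esssup M (\<lambda>x. c * F x) \<le> d \<longleftrightarrow> c * esssup M F \<le> d" for d
      by (subst esssup_le_iff) (auto simp: * esssup_le_iff)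
    then show ?thesis using top by (auto simp: Lp_qnorm_top intro!: antisym)
  qed
qed

lemma Lp_qnorm_Fatou:
  assumes p: "0 < p" and [measurable]: "\<And>n::nat. F n \<in> borel_measurable M" "G \<in> borel_measurable M"
    and le: "AE x in M. G x \<le> liminf (\<lambda>n. F n x)"
  shows "Lp_qnorm M p G \<le> liminf (\<lambda>n. Lp_qnorm M p (F n))"
  using p
proof (cases rule: ennreal_exponent_cases)
  case (fin r)
  have "(\<integral>\<^sup>+x. enn_powr (G x) r \<partial>M) \<le> (\<integral>\<^sup>+x. liminf (\<lambda>n. enn_powr (F n x) r) \<partial>M)"
    using le fin by (intro nn_integral_mono_AE) (auto simp flip: enn_powr_Liminf intro: enn_powr_mono elim!: eventually_mono)
  also have "\<dots> \<le> liminf (\<lambda>n. \<integral>\<^sup>+x. enn_powr (F n x) r \<partial>M)"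
    by (intro nn_integral_liminf) auto
  finally show ?thesis
    using fin by (auto simp: Lp_qnorm_ennreal simp flip: enn_powr_Liminf intro!: enn_powr_mono)
next
  case top
  have "AE x in M. \<forall>n. F n x \<le> esssup M (F n)"
    by (subst AE_all_countable) (auto intro: esssup_AE)
  with le have "AE x in M. G x \<le> liminf (\<lambda>n. esssup M (F n))"
    by eventually_elim (erule order_trans, intro Liminf_mono always_eventually, simp)
  then show ?thesis using top by (auto simp: Lp_qnorm_top esssup_le_iff)
qed

text \<open>Convexity of the power s, applied to x + y = l (x/l) + (1-l) (y/(1-l)). The weight l
  stays free, because Minkowski's inequality results from choosing it according to the two
  norms.\<close>

lemma ennreal_convex_powr:
  assumes s: "1 \<le> s" and l: "0 < l" "l < 1"
  shows "enn_powr (x + y) s \<le> ennreal (l powr (1 - s)) * enn_powr x s + ennreal ((1 - l) powr (1 - s)) * enn_powr y s"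
proof -
  have one: "1 \<le> l powr (1 - s)" "1 \<le> (1 - l) powr (1 - s)"
    using s l powr_mono'[of "1 - s" 0 l] powr_mono'[of "1 - s" 0 "1 - l"] by auto
  consider "x = 0" | "y = 0" | "x = top \<or> y = top"
    | a b where "0 < a" "0 < b" "x = ennreal a" "y = ennreal b"
    by (cases x; cases y) (force simp: less_le)+
  then show ?thesis
  proof cases
    case 1
    then show ?thesis using mult_right_mono[of 1 "ennreal ((1 - l) powr (1 - s))" "enn_powr y s"] one by simp
  next
    case 2
    then show ?thesis using mult_right_mono[of 1 "ennreal (l powr (1 - s))" "enn_powr x s"] one by simp
  next
    case 3
    then show ?thesis using l by (auto simp: ennreal_mult_top)
  next
  case ab: (4 a b)
  have "(l * (a / l) + (1 - l) * (b / (1 - l))) powr s \<le> l * (a / l) powr s + (1 - l) * (b / (1 - l)) powr s"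
    using convex_onD[OF powr_convex[OF s], of "1 - l" "a / l" "b / (1 - l)"] l ab by auto
  also have "l * (a / l) powr s = l powr (1 - s) * a powr s"
    using l ab by (simp add: powr_divide powr_diff)
  also have "(1 - l) * (b / (1 - l)) powr s = (1 - l) powr (1 - s) * b powr s"
    using l ab by (simp add: powr_divide powr_diff)
  finally have "(a + b) powr s \<le> l powr (1 - s) * a powr s + (1 - l) powr (1 - s) * b powr s"
    using l by simp
  then show ?thesis using ab
    by (auto simp: enn_powr_ennreal simp flip: ennreal_plus ennreal_mult)
qed
qed

lemma Lp_qnorm_add:
  assumes p: "1 \<le> p" and [measurable]: "F \<in> borel_measurable M" "G \<in> borel_measurable M"
  shows "Lp_qnorm M p (\<lambda>x. F x + G x) \<le> Lp_qnorm M p F + Lp_qnorm M p G"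
proof -
  have p0: "0 < p" using p by (metis less_le_trans zero_less_one)
  then show ?thesis
  proof (cases rule: ennreal_exponent_cases)
    case top
    have "AE x in M. F x + G x \<le> esssup M F + esssup M G"
      using esssup_AE[of F M] esssup_AE[of G M] by eventually_elim (rule add_mono)
    then show ?thesis using top by (auto simp: Lp_qnorm_top)
  next
    case (fin s)
    then have s: "1 \<le> s" using p by simp
    let ?A = "Lp_qnorm M p F" and ?B = "Lp_qnorm M p G"
    have I: "(\<integral>\<^sup>+x. enn_powr (F x) s \<partial>M) = enn_powr ?A s" "(\<integral>\<^sup>+x. enn_powr (G x) s \<partial>M) = enn_powr ?B s"
      using fin by (auto simp: Lp_qnorm_ennreal)
    consider "?A = \<infinity> \<or> ?B = \<infinity>" | "?A = 0" | "?B = 0" | "0 < ?A" "?A < \<infinity>" "0 < ?B" "?B < \<infinity>"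
      by (cases "?A = 0"; cases "?B = 0") (auto simp flip: less_top simp: zero_less_iff_neq_zero)
    then show ?thesis
    proof cases
      case 1 then show ?thesis by auto
    next
      case 2
      have "Lp_qnorm M p (\<lambda>x. F x + G x) \<le> Lp_qnorm M p G"
        using Lp_qnorm_eq_0[OF p0 _ 2] by (intro Lp_qnorm_mono_AE p0) auto
      then show ?thesis using 2 by simp
    next
      case 3
      have "Lp_qnorm M p (\<lambda>x. F x + G x) \<le> Lp_qnorm M p F"
        using Lp_qnorm_eq_0[OF p0 _ 3] by (intro Lp_qnorm_mono_AE p0) auto
      then show ?thesis using 3 by simp
    next
      case 4
      then obtain a b where ab: "0 < a" "?A = ennreal a" "0 < b" "?B = ennreal b"
        by (metis enn_powr_nonzero)
      \<comment> \<open>With the share of the first norm as weight, the integrated convexity bound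
        equals (a+b)^s exactly.\<close>
      define l where "l = a / (a + b)"
      have l: "0 < l" "l < 1" "1 - l = b / (a + b)" using ab by (auto simp: l_def field_simps)
      have "(\<integral>\<^sup>+x. enn_powr (F x + G x) s \<partial>M) \<le>
          (\<integral>\<^sup>+x. ennreal (l powr (1 - s)) * enn_powr (F x) s + ennreal ((1 - l) powr (1 - s)) * enn_powr (G x) s \<partial>M)"
        using s l by (intro nn_integral_mono ennreal_convex_powr) auto
      also have "\<dots> = ennreal (l powr (1 - s)) * ennreal (a powr s) + ennreal ((1 - l) powr (1 - s)) * ennreal (b powr s)"
        using ab I by (simp add: nn_integral_add nn_integral_cmult enn_powr_ennreal)
      also have "\<dots> = ennreal (l powr (1 - s) * a powr s + (1 - l) powr (1 - s) * b powr s)"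
        by (simp add: ennreal_mult)
      also have "l powr (1 - s) * a powr s + (1 - l) powr (1 - s) * b powr s
          = (a + b) powr (s - 1) * (a + b)"
      proof -
        have "(c / (a + b)) powr (1 - s) * c powr s = c * (a + b) powr (s - 1)" if "0 < c" for c
          using that ab by (simp add: powr_divide powr_diff)
        from this[of a] this[of b] show ?thesis
          using ab unfolding l(3) by (simp add: l_def distrib_left)
      qed
      also have "\<dots> = (a + b) powr s" using ab by (simp add: powr_diff)
      finally have "Lp_qnorm M p (\<lambda>x. F x + G x) \<le> enn_powr (ennreal ((a + b) powr s)) (1 / s)"
        using fin by (auto simp: Lp_qnorm_ennreal intro!: enn_powr_mono)
      also have "\<dots> = ?A + ?B" using ab fin by (simp add: enn_powr_ennreal powr_powr)
      finally show ?thesis .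
    qed
  qed
qed

lemma Lp_qnorm_sum:
  assumes p: "1 \<le> p" and [measurable]: "\<And>k. F k \<in> borel_measurable M"
  shows "Lp_qnorm M p (\<lambda>x. \<Sum>k\<in>K. F k x) \<le> (\<Sum>k\<in>K. Lp_qnorm M p (F k))"
proof -
  have p0: "0 < p" using p by (metis less_le_trans zero_less_one)
  show ?thesis
  proof (induction K rule: infinite_finite_induct)
    case (insert k K)
    then show ?case
      using Lp_qnorm_add[OF p, of "F k" M "\<lambda>x. \<Sum>k\<in>K. F k x"] by (auto intro: order_trans add_left_mono)
  qed (auto simp: Lp_qnorm_0 p0)
qed

lemma Lp_qnorm_suminf:
  assumes p: "1 \<le> p" and [measurable]: "\<And>k. F k \<in> borel_measurable M"
  shows "Lp_qnorm M p (\<lambda>x. \<Sum>k. F k x) \<le> (\<Sum>k. Lp_qnorm M p (F k))"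
proof -
  have p0: "0 < p" using p by (metis less_le_trans zero_less_one)
  have "liminf (\<lambda>n. \<Sum>k<n. F k x) = (\<Sum>k. F k x)" for x
    by (intro lim_imp_Liminf tendsto_suminf_ennreal) simp
  then have "Lp_qnorm M p (\<lambda>x. \<Sum>k. F k x) \<le> liminf (\<lambda>n. Lp_qnorm M p (\<lambda>x. \<Sum>k<n. F k x))"
    by (intro Lp_qnorm_Fatou p0) auto
  also have "\<dots> \<le> (\<Sum>k. Lp_qnorm M p (F k))"
    by (intro Liminf_le always_eventually allI order_trans[OF Lp_qnorm_sum[OF p]] sum_le_suminf) auto
  finally show ?thesis .
qed

lemma mult_div_exponent:
  fixes p :: ennreal and m :: real
  assumes "0 < m" shows "p / ennreal m * ennreal m = p"
  using assms by (simp add: ennreal_divide_times ennreal_mult_divide_eq)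

text \<open>Trades a power of the function against the exponent. For m \<le> p the new exponent p/m
  is at least 1, so Minkowski's inequality applies to m-th powers; the quasi-triangle inequalities
  arise this way.\<close>

lemma Lp_qnorm_powr':
  assumes p: "0 < p" and m: "0 < m" and [measurable]: "F \<in> borel_measurable M"
  shows "Lp_qnorm M (p / ennreal m) (\<lambda>x. enn_powr (F x) m) = enn_powr (Lp_qnorm M p F) m"
  using assms by (subst Lp_qnorm_powr) (auto simp: mult_div_exponent ennreal_zero_less_divide)

lemma one_le_exponent_div: "0 < m \<Longrightarrow> ennreal m \<le> p \<Longrightarrow> 1 \<le> p / ennreal m"
  using divide_right_mono_ennreal[of "ennreal m" p "ennreal m"] by simp

text \<open>Minkowski's inequality in the exponent p/m for the m-th powers. In mixed-norm terms, an
  l^m norm may be pulled out of L^p whenever m \<le> p; m may exceed 1.\<close>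

lemma Lp_qnorm_suminf_powr:
  assumes m: "0 < m" "ennreal m \<le> p" and [measurable]: "\<And>k. F k \<in> borel_measurable M"
  shows "enn_powr (Lp_qnorm M p (\<lambda>x. enn_powr (\<Sum>k. enn_powr (F k x) m) (1 / m))) m
    \<le> (\<Sum>k. enn_powr (Lp_qnorm M p (F k)) m)"
proof -
  have p: "0 < p" using m by (metis ennreal_less_zero_iff less_le_trans)
  show ?thesis
    using Lp_qnorm_suminf[OF one_le_exponent_div[OF m], of "\<lambda>k x. enn_powr (F k x) m" M] m p
    by (simp add: enn_powr_powr flip: Lp_qnorm_powr'[OF p m(1)])
qed

lemma Lp_qnorm_sum_powr:
  assumes m: "0 < m" "ennreal m \<le> p" and [measurable]: "\<And>k. F k \<in> borel_measurable M"
  shows "enn_powr (Lp_qnorm M p (\<lambda>x. enn_powr (\<Sum>k\<in>K. enn_powr (F k x) m) (1 / m))) m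
    \<le> (\<Sum>k\<in>K. enn_powr (Lp_qnorm M p (F k)) m)"
proof -
  have p: "0 < p" using m by (metis ennreal_less_zero_iff less_le_trans)
  show ?thesis
    using Lp_qnorm_sum[OF one_le_exponent_div[OF m], of "\<lambda>k x. enn_powr (F k x) m" M] m p
    by (simp add: enn_powr_powr flip: Lp_qnorm_powr'[OF p m(1)])
qed

text \<open>For m \<le> 1 a plain sum is at most the l^m norm of its terms, which reduces the claim
  to the mixed-norm inequality.\<close>

lemma Lp_qnorm_suminf_quasi:
  assumes m: "0 < m" "m \<le> 1" "ennreal m \<le> p" and [measurable]: "\<And>k. F k \<in> borel_measurable M"
  shows "enn_powr (Lp_qnorm M p (\<lambda>x. \<Sum>k. F k x)) m \<le> (\<Sum>k. enn_powr (Lp_qnorm M p (F k)) m)"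
proof (rule order_trans[OF _ Lp_qnorm_suminf_powr])
  have "(\<Sum>k. F k x) \<le> enn_powr (\<Sum>k. enn_powr (F k x) m) (1 / m)" for x
    using enn_powr_suminf_le[OF m(1,2)] m by (simp add: enn_powr_le_swap)
  moreover have "0 < p" using m by (metis ennreal_less_zero_iff less_le_trans)
  ultimately show "enn_powr (Lp_qnorm M p (\<lambda>x. \<Sum>k. F k x)) m
      \<le> enn_powr (Lp_qnorm M p (\<lambda>x. enn_powr (\<Sum>k. enn_powr (F k x) m) (1 / m))) m"
    using m by (intro enn_powr_mono Lp_qnorm_mono) auto
qed (use m in auto)

lemma Lp_qnorm_sum_quasi:
  assumes m: "0 < m" "m \<le> 1" "ennreal m \<le> p" and [measurable]: "\<And>k. F k \<in> borel_measurable M"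
  shows "enn_powr (Lp_qnorm M p (\<lambda>x. \<Sum>k\<in>K. F k x)) m \<le> (\<Sum>k\<in>K. enn_powr (Lp_qnorm M p (F k)) m)"
proof (rule order_trans[OF _ Lp_qnorm_sum_powr])
  have "(\<Sum>k\<in>K. F k x) \<le> enn_powr (\<Sum>k\<in>K. enn_powr (F k x) m) (1 / m)" for x
    using enn_powr_sum_le[OF m(1,2)] m by (simp add: enn_powr_le_swap)
  moreover have "0 < p" using m by (metis ennreal_less_zero_iff less_le_trans)
  ultimately show "enn_powr (Lp_qnorm M p (\<lambda>x. \<Sum>k\<in>K. F k x)) m
      \<le> enn_powr (Lp_qnorm M p (\<lambda>x. enn_powr (\<Sum>k\<in>K. enn_powr (F k x) m) (1 / m))) m"
    using m by (intro enn_powr_mono Lp_qnorm_mono) auto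
qed (use m in auto)

lemma Lp_qnorm_add_quasi:
  assumes m: "0 < m" "m \<le> 1" "ennreal m \<le> p" and [measurable]: "F \<in> borel_measurable M" "G \<in> borel_measurable M"
  shows "enn_powr (Lp_qnorm M p (\<lambda>x. F x + G x)) m \<le> enn_powr (Lp_qnorm M p F) m + enn_powr (Lp_qnorm M p G) m"
proof -
  have "(if k then F else G) \<in> borel_measurable M" for k by auto
  from Lp_qnorm_sum_quasi[of m p "\<lambda>k. if k then F else G", OF m this, where K = UNIV] show ?thesis
    by (simp add: UNIV_bool add.commute)
qed

subsection \<open>Hoelder's inequality and moduli of continuity\<close>

text \<open>The endpoint of Hoelder's inequality. With an infinite supremum the right side is
  infinite, except that 0 times \<open>top\<close> is 0; then \<open>G\<close> vanishes a.e. and so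
  does the product.\<close>

lemma Lp_qnorm_mult_esssup:
  assumes p: "0 < p" and [measurable]: "F \<in> borel_measurable M" "G \<in> borel_measurable M"
  shows "Lp_qnorm M p (\<lambda>x. F x * G x) \<le> esssup M F * Lp_qnorm M p G"
proof (cases "esssup M F = top")
  case True
  show ?thesis
  proof (cases "Lp_qnorm M p G = 0")
    case G: True
    have "Lp_qnorm M p (\<lambda>x. F x * G x) \<le> Lp_qnorm M p (\<lambda>x. 0)"
      using Lp_qnorm_eq_0[OF p _ G] by (intro Lp_qnorm_mono_AE p) auto
    then show ?thesis using p by (simp add: Lp_qnorm_0)
  qed (use True in \<open>simp add: ennreal_top_mult\<close>)
next
  case False
  have "Lp_qnorm M p (\<lambda>x. F x * G x) \<le> Lp_qnorm M p (\<lambda>x. esssup M F * G x)"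
    using esssup_AE[of F M] by (intro Lp_qnorm_mono_AE p) (auto intro: mult_right_mono elim!: eventually_mono)
  also have "\<dots> = esssup M F * Lp_qnorm M p G"
    using False p by (intro Lp_qnorm_cmult) (auto simp: less_top)
  finally show ?thesis .
qed

text \<open>Young's inequality for (x/a)^r0 and (y/b)^r1 with the weights r2/r0 and r2/r1, which add
  up to 1. The scalars a and b will be the norms of the two factors.\<close>

lemma Youngs_powr:
  fixes r0 r1 r2 x y a b :: real
  assumes "0 < r0" "0 < r1" "0 \<le> x" "0 \<le> y" and a: "0 < a" "0 < b"
    and r2: "1 / r2 = 1 / r0 + 1 / r1" "0 < r2"
  shows "(x * y) powr r2 \<le> (a * b) powr r2 * (r2 / r0) * a powr - r0 * x powr r0
     + (a * b) powr r2 * (r2 / r1) * b powr - r1 * y powr r1"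
proof (cases "x = 0 \<or> y = 0")
  case True
  then show ?thesis using assms by auto
next
  case False
  have "r2 * (1 / r2) = 1" using r2(2) by simp
  then have "r2 * (1 / r0 + 1 / r1) = 1" by (simp only: r2(1))
  then have *: "r2 / r0 + r2 / r1 = 1" by (simp add: distrib_left)
  have "((x / a) powr r0) powr (r2 / r0) * ((y / b) powr r1) powr (r2 / r1) \<le> (r2 / r0) * (x / a) powr r0 + (r2 / r1) * (y / b) powr r1"
    using assms * False by (intro Youngs_inequality_0) auto
  also have "((x / a) powr r0) powr (r2 / r0) * ((y / b) powr r1) powr (r2 / r1) = (x * y) powr r2 / (a * b) powr r2"
    using assms by (simp add: powr_powr powr_divide powr_mult)
  finally have "(x * y) powr r2 \<le> (a * b) powr r2 * ((r2 / r0) * (x / a) powr r0 + (r2 / r1) * (y / b) powr r1)"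
    using a by (simp add: field_simps)
  then show ?thesis using assms by (simp add: powr_divide powr_minus field_simps)
qed

lemma ennreal_inverse_inverse [simp]: "inverse (inverse x) = (x::ennreal)"
  using one_divide_one_divide_ennreal[of x] by (simp add: divide_ennreal_def)

lemma ennreal_inverse_le_iff [simp]: "inverse x \<le> inverse y \<longleftrightarrow> y \<le> (x::ennreal)"
proof -
  have "inverse x \<le> inverse y" if "y \<le> x" for x y :: ennreal
  proof (cases "y = 0")
    case False
    with that show ?thesis
      by (cases x; cases y) (auto simp: inverse_ennreal top_unique intro!: ennreal_leI le_imp_inverse_le)
  qed auto
  from this[of y x] this[of "inverse x" "inverse y"] show ?thesis by auto
qed

lemma Lp_qnorm_Holder:
  assumes p: "0 < p0" "0 < p1" "inverse p2 = inverse p0 + inverse p1"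
    and [measurable]: "F \<in> borel_measurable M" "G \<in> borel_measurable M"
  shows "Lp_qnorm M p2 (\<lambda>x. F x * G x) \<le> Lp_qnorm M p0 F * Lp_qnorm M p1 G"
proof -
  \<comment> \<open>\<open>inverse\<close> is injective on \<open>ennreal\<close>, 0 and
    \<open>top\<close> included, so the identity between the inverses determines \<open>p2\<close>;
    at the endpoints it becomes p2 = p1 or p2 = p0.\<close>
  have inv: "p = q" if "inverse p = inverse (q::ennreal)" for p q
    using that by (metis ennreal_inverse_inverse)
  show ?thesis
    using p(1)
  proof (cases rule: ennreal_exponent_cases)
    case top
    then have "p2 = p1" using p(3) by (simp add: inv)
    then show ?thesis using top Lp_qnorm_mult_esssup[OF p(2), of F M G] by (simp add: Lp_qnorm_top)
  next
    case r0: (fin r0)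
    show ?thesis
      using p(2)
    proof (cases rule: ennreal_exponent_cases)
      case top
      then have "p2 = p0" using p(3) by (simp add: inv)
      then show ?thesis using top Lp_qnorm_mult_esssup[OF p(1), of G M F] by (simp add: Lp_qnorm_top mult.commute)
    next
      case r1: (fin r1)
      define r2 where "r2 = 1 / (1 / r0 + 1 / r1)"
      have r2: "0 < r2" "1 / r2 = 1 / r0 + 1 / r1" using r0(1) r1(1) by (simp_all add: r2_def add_pos_pos)
      have "inverse p2 = ennreal (1 / r2)"
        using p(3) r0 r1 by (simp only: r2(2)) (simp add: inverse_ennreal inverse_eq_divide)
      moreover have "inverse (ennreal r2) = ennreal (1 / r2)" using r2(1) by (simp add: inverse_ennreal inverse_eq_divide)
      ultimately have p2: "p2 = ennreal r2" by (metis inv)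
      have p2p: "0 < p2" using p2 r2 by simp
      let ?A = "Lp_qnorm M p0 F" and ?B = "Lp_qnorm M p1 G"
      consider "?A = 0" | "?B = 0" | "?A \<noteq> 0" "?B \<noteq> 0" "?A = top \<or> ?B = top" | "0 < ?A" "?A < \<infinity>" "0 < ?B" "?B < \<infinity>"
        by (cases "?A = 0"; cases "?B = 0"; cases "?A = top"; cases "?B = top") (auto simp: less_top zero_less_iff_neq_zero)
      then show ?thesis
      proof cases
        case 1
        have "Lp_qnorm M p2 (\<lambda>x. F x * G x) \<le> Lp_qnorm M p2 (\<lambda>x. 0)"
          using Lp_qnorm_eq_0[OF p(1) _ 1] by (intro Lp_qnorm_mono_AE p2p) auto
        then show ?thesis using p2p by (simp add: Lp_qnorm_0)
      next
        case 2
        have "Lp_qnorm M p2 (\<lambda>x. F x * G x) \<le> Lp_qnorm M p2 (\<lambda>x. 0)"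
          using Lp_qnorm_eq_0[OF p(2) _ 2] by (intro Lp_qnorm_mono_AE p2p) auto
        then show ?thesis using p2p by (simp add: Lp_qnorm_0)
      next
        case 3
        then have "?A * ?B = top" by (simp add: ennreal_mult_eq_top_iff)
        then show ?thesis by simp
      next
        case 4
        then obtain a b where ab: "0 < a" "?A = ennreal a" "0 < b" "?B = ennreal b"
          by (metis enn_powr_nonzero)
        have I: "(\<integral>\<^sup>+x. enn_powr (F x) r0 \<partial>M) = enn_powr ?A r0" "(\<integral>\<^sup>+x. enn_powr (G x) r1 \<partial>M) = enn_powr ?B r1"
          using r0 r1 by (auto simp: Lp_qnorm_ennreal)
        \<comment> \<open>The coefficients of Young's inequality normalised by the two norms: after
          integration k0 a^r0 + k1 b^r1 collapses to (ab)^r2.\<close>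
        define k0 k1 where "k0 = (a * b) powr r2 * (r2 / r0) * a powr - r0" and "k1 = (a * b) powr r2 * (r2 / r1) * b powr - r1"
        have k: "0 < k0" "0 < k1" using ab r0 r1 r2 by (auto simp: k0_def k1_def)
        have pw: "enn_powr (x * y) r2 \<le> ennreal k0 * enn_powr x r0 + ennreal k1 * enn_powr y r1" for x y
        proof (cases x; cases y)
          fix u v :: real assume uv: "0 \<le> u" "0 \<le> v" "x = ennreal u" "y = ennreal v"
          have "(u * v) powr r2 \<le> k0 * u powr r0 + k1 * v powr r1"
            using Youngs_powr[OF r0(1) r1(1) uv(1,2) ab(1,3) r2(2,1)] by (simp add: k0_def k1_def)
          then show ?thesis using uv k
            by (auto simp: enn_powr_ennreal simp flip: ennreal_plus ennreal_mult)
        qed (use k in \<open>auto simp: ennreal_mult_top ennreal_top_mult\<close>)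
        have "(\<integral>\<^sup>+x. enn_powr (F x * G x) r2 \<partial>M) \<le> (\<integral>\<^sup>+x. ennreal k0 * enn_powr (F x) r0 + ennreal k1 * enn_powr (G x) r1 \<partial>M)"
          by (intro nn_integral_mono pw)
        also have "\<dots> = ennreal k0 * ennreal (a powr r0) + ennreal k1 * ennreal (b powr r1)"
          using ab I by (simp add: nn_integral_add nn_integral_cmult enn_powr_ennreal)
        also have "\<dots> = ennreal (k0 * a powr r0 + k1 * b powr r1)"
          using k by (simp add: ennreal_mult)
        also have "k0 * a powr r0 + k1 * b powr r1 = (a * b) powr r2 * (r2 / r0 + r2 / r1)"
          using ab by (simp add: k0_def k1_def powr_minus field_simps)
        also have "r2 / r0 + r2 / r1 = r2 * (1 / r0 + 1 / r1)" by (simp add: distrib_left)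
        also have "\<dots> = r2 * (1 / r2)" by (simp only: r2(2))
        also have "\<dots> = 1" using r2(1) by simp
        finally have "Lp_qnorm M p2 (\<lambda>x. F x * G x) \<le> enn_powr (ennreal ((a * b) powr r2)) (1 / r2)"
          using r2(1) by (auto simp: p2 Lp_qnorm_ennreal intro!: enn_powr_mono)
        also have "\<dots> = ?A * ?B"
          using ab r2(1) by (simp add: enn_powr_ennreal powr_powr ennreal_mult)
        finally show ?thesis .
      qed
    qed
  qed
qed

section \<open>Null sets, translations and norms on intervals\<close>

lemma AE_lebesgue_on_iff:
  fixes S :: "real set"
  assumes "S \<in> sets borel"
  shows "(AE x in lebesgue_on S. P x) \<longleftrightarrow> (AE x in lborel. x \<in> S \<longrightarrow> P x)"
proof -
  have "S \<in> sets lebesgue" using assms by simp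
  then show ?thesis by (subst AE_restrict_space_iff) (auto simp: AE_completion_iff)
qed

text \<open>\<open>P\<close> need not be measurable, so the exceptional set is first enlarged to a
  Borel null set.\<close>

lemma AE_lborel_affine:
  fixes P :: "real \<Rightarrow> bool"
  assumes "AE x in lborel. P x" "c \<noteq> 0"
  shows "AE x in lborel. P (t + c * x)"
proof -
  obtain N where N: "N \<in> null_sets lborel" "{x. \<not> P x} \<subseteq> N"
    using assms(1) by (auto simp: eventually_ae_filter)
  then have "AE x in lborel. x \<notin> N" by (intro AE_not_in)
  moreover have [measurable]: "N \<in> sets borel" using N by auto
  ultimately have "AE x in lborel. t + c * x \<notin> N"
    by (intro AE_borel_affine[OF assms(2)]) auto
  then show ?thesis using N by (auto elim!: eventually_mono)
qed

lemma AE_lborel_shift: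
  fixes P :: "real \<Rightarrow> bool"
  shows "AE x in lborel. P x \<Longrightarrow> AE x in lborel. P (x + t)"
  using AE_lborel_affine[of P 1 t] by (simp add: add.commute)

lemma AE_lebesgue_on_shift:
  assumes "AE x in lebesgue_on {0..c}. P x" "0 \<le> b" "a + b \<le> c"
  shows "AE x in lebesgue_on {0..a::real}. P (x + b)"
  using AE_lborel_shift[of "\<lambda>x. x \<in> {0..c} \<longrightarrow> P x" b] assms
  by (auto simp: AE_lebesgue_on_iff elim!: eventually_mono)

lemma nn_integral_lebesgue_on:
  fixes S :: "real set"
  assumes "S \<in> sets borel"
  shows "(\<integral>\<^sup>+x. F x \<partial>lebesgue_on S) = (\<integral>\<^sup>+x. F x * indicator S x \<partial>lborel)"
  using assms by (simp add: nn_integral_restrict_space nn_integral_completion)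

lemma nn_integral_lborel_shift:
  fixes F :: "real \<Rightarrow> ennreal"
  assumes [measurable]: "F \<in> borel_measurable borel"
  shows "(\<integral>\<^sup>+x. F (x + t) \<partial>lborel) = (\<integral>\<^sup>+x. F x \<partial>lborel)"
  using nn_integral_real_affine[of F 1 t] by (simp add: add.commute)

lemma measurable_lebesgue_on_borel [measurable (raw)]:
  fixes S :: "real set"
  assumes "f \<in> borel_measurable borel"
  shows "f \<in> borel_measurable (lebesgue_on S)"
  using assms by (auto intro!: measurable_restrict_space1 measurable_completion)

text \<open>Moving the base point by b carries [0,a] into [0,c], so translation invariance and
  monotonicity suffice. This is how increments attached to a moving point of [r,r+h] are compared
  with the modulus.\<close>

lemma Lp_qnorm_shift_le:
  assumes p: "0 < p" and F [measurable]: "F \<in> borel_measurable borel" and b: "0 \<le> b" "a + b \<le> c"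
  shows "Lp_qnorm (lebesgue_on {0..a}) p (\<lambda>r. F (r + b)) \<le> Lp_qnorm (lebesgue_on {0..c::real}) p F"
  using p
proof (cases rule: ennreal_exponent_cases)
  case (fin s)
  have "(\<integral>\<^sup>+x. enn_powr (F (x + b)) s * indicator {0..a} x \<partial>lborel)
      \<le> (\<integral>\<^sup>+x. enn_powr (F (x + b)) s * indicator {0..c} (x + b) \<partial>lborel)"
    using b by (intro nn_integral_mono mult_left_mono) (auto split: split_indicator)
  also have "\<dots> = (\<integral>\<^sup>+x. enn_powr (F x) s * indicator {0..c} x \<partial>lborel)"
    using nn_integral_lborel_shift[of "\<lambda>x. enn_powr (F x) s * indicator {0..c} x" b] by simp
  finally show ?thesis using fin
    by (auto simp: Lp_qnorm_ennreal nn_integral_lebesgue_on intro!: enn_powr_mono)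
next
  case top
  have "AE r in lebesgue_on {0..a}. F (r + b) \<le> esssup (lebesgue_on {0..c}) F"
    by (rule AE_lebesgue_on_shift[OF esssup_AE b])
  then show ?thesis using top by (auto simp: Lp_qnorm_top)
qed

lemma Lp_norm_on_shift_le:
  assumes "0 < p" "F \<in> borel_measurable borel" "0 \<le> b" "a + b \<le> c"
  shows "Lp_norm_on a p (\<lambda>r. F (r + b)) \<le> Lp_norm_on c p F"
  using Lp_qnorm_shift_le[of p "\<lambda>r. ennreal \<bar>F r\<bar>" b a c] assms by (simp add: Lp_norm_on_def)

lemma Lp_norm_on_cong_AE:
  assumes "0 < p" "F \<in> borel_measurable (lebesgue_on {0..T})" "G \<in> borel_measurable (lebesgue_on {0..T})"
    "AE r in lebesgue_on {0..T}. F r = G r"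
  shows "Lp_norm_on T p F = Lp_norm_on T p G"
  unfolding Lp_norm_on_def using assms by (intro Lp_qnorm_cong_AE) auto

lemma Lp_norm_on_cong:
  "(\<And>r. 0 \<le> r \<Longrightarrow> r \<le> T \<Longrightarrow> \<bar>F r\<bar> = \<bar>G r\<bar>) \<Longrightarrow> Lp_norm_on T p F = Lp_norm_on T p G"
  unfolding Lp_norm_on_def by (intro Lp_qnorm_cong) auto

lemma Lp_norm_on_add_quasi:
  assumes "0 < m" "m \<le> 1" "ennreal m \<le> p" and [measurable]: "F \<in> borel_measurable borel" "G \<in> borel_measurable borel"
  shows "enn_powr (Lp_norm_on T p (\<lambda>r. F r + G r)) m \<le> enn_powr (Lp_norm_on T p F) m + enn_powr (Lp_norm_on T p G) m"
proof -
  have p: "0 < p" using assms by (metis ennreal_less_zero_iff less_le_trans)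
  have "Lp_norm_on T p (\<lambda>r. F r + G r) \<le> Lp_qnorm (lebesgue_on {0..T}) p (\<lambda>r. ennreal \<bar>F r\<bar> + ennreal \<bar>G r\<bar>)"
    unfolding Lp_norm_on_def by (intro Lp_qnorm_mono p) (auto simp flip: ennreal_plus intro!: ennreal_leI)
  then have "enn_powr (Lp_norm_on T p (\<lambda>r. F r + G r)) m \<le> enn_powr (Lp_qnorm (lebesgue_on {0..T}) p (\<lambda>r. ennreal \<bar>F r\<bar> + ennreal \<bar>G r\<bar>)) m"
    using assms by (intro enn_powr_mono) auto
  also have "\<dots> \<le> enn_powr (Lp_norm_on T p F) m + enn_powr (Lp_norm_on T p G) m"
    unfolding Lp_norm_on_def using assms by (intro Lp_qnorm_add_quasi) auto
  finally show ?thesis .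
qed

lemma Lp_norm_on_sum_quasi:
  assumes "0 < m" "m \<le> 1" "ennreal m \<le> p" and [measurable]: "\<And>k. F k \<in> borel_measurable borel"
  shows "enn_powr (Lp_norm_on T p (\<lambda>r. \<Sum>k\<in>K. F k r)) m \<le> (\<Sum>k\<in>K. enn_powr (Lp_norm_on T p (F k)) m)"
proof -
  have p: "0 < p" using assms by (metis ennreal_less_zero_iff less_le_trans)
  have "Lp_norm_on T p (\<lambda>r. \<Sum>k\<in>K. F k r) \<le> Lp_qnorm (lebesgue_on {0..T}) p (\<lambda>r. \<Sum>k\<in>K. ennreal \<bar>F k r\<bar>)"
    unfolding Lp_norm_on_def by (intro Lp_qnorm_mono p) (auto intro!: ennreal_leI)
  then have "enn_powr (Lp_norm_on T p (\<lambda>r. \<Sum>k\<in>K. F k r)) m \<le> enn_powr (Lp_qnorm (lebesgue_on {0..T}) p (\<lambda>r. \<Sum>k\<in>K. ennreal \<bar>F k r\<bar>)) m"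
    using assms by (intro enn_powr_mono) auto
  also have "\<dots> \<le> (\<Sum>k\<in>K. enn_powr (Lp_norm_on T p (F k)) m)"
    unfolding Lp_norm_on_def using assms by (intro Lp_qnorm_sum_quasi) auto
  finally show ?thesis .
qed

lemma Lp_norm_on_triangle_quasi:
  assumes "0 < m" "m \<le> 1" "ennreal m \<le> p" and "F \<in> borel_measurable borel" "G \<in> borel_measurable borel" "H \<in> borel_measurable borel"
  shows "enn_powr (Lp_norm_on T p (\<lambda>r. F r - H r)) m \<le> enn_powr (Lp_norm_on T p (\<lambda>r. F r - G r)) m + enn_powr (Lp_norm_on T p (\<lambda>r. G r - H r)) m"
  using Lp_norm_on_add_quasi[of m p "\<lambda>r. F r - G r" "\<lambda>r. G r - H r"] assms by simp

lemma Lp_norm_on_Fatou: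
  assumes p: "0 < p" and [measurable]: "\<And>n. F n \<in> borel_measurable borel" "G \<in> borel_measurable borel"
    and lim: "AE r in lebesgue_on {0..T}. (\<lambda>n. F n r) \<longlonglongrightarrow> G r"
  shows "Lp_norm_on T p G \<le> liminf (\<lambda>n. Lp_norm_on T p (F n))"
  unfolding Lp_norm_on_def
proof (rule Lp_qnorm_Fatou[OF p])
  show "AE r in lebesgue_on {0..T}. ennreal \<bar>G r\<bar> \<le> liminf (\<lambda>n. ennreal \<bar>F n r\<bar>)"
    using lim
  proof eventually_elim
    case (elim r)
    then have "(\<lambda>n. ennreal \<bar>F n r\<bar>) \<longlonglongrightarrow> ennreal \<bar>G r\<bar>" by (intro tendsto_intros)
    from lim_imp_Liminf[OF _ this] show ?case by simp
  qed
qed auto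

lemma Lp_norm_on_Holder:
  assumes p: "0 < p0" "0 < p1" "inverse p2 = inverse p0 + inverse p1"
    and [measurable]: "F \<in> borel_measurable borel" "G \<in> borel_measurable borel"
  shows "Lp_norm_on T p2 (\<lambda>x. F x * G x) \<le> Lp_norm_on T p0 F * Lp_norm_on T p1 G"
  using Lp_qnorm_Holder[OF p, of "\<lambda>x. ennreal \<bar>F x\<bar>" "lebesgue_on {0..T}" "\<lambda>x. ennreal \<bar>G x\<bar>"]
  by (simp add: Lp_norm_on_def abs_mult ennreal_mult)

lemma exponent_sum_pos:
  fixes p0 p1 p2 :: ennreal
  assumes "0 < p0" "0 < p1" "inverse p2 = inverse p0 + inverse p1"
  shows "0 < p2" "p2 \<le> p0" "p2 \<le> p1"
proof -
  have "inverse p2 \<noteq> top" using assms by (auto simp: zero_less_iff_neq_zero)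
  then show "0 < p2" by (auto simp: zero_less_iff_neq_zero)
  have "inverse p0 \<le> inverse p2" "inverse p1 \<le> inverse p2" using assms by auto
  then show "p2 \<le> p0" "p2 \<le> p1" by simp_all
qed

section \<open>Monotonicity and doubling of the modulus\<close>

lemma modulus_mono: "x \<le> y \<Longrightarrow> modulus T p f x \<le> modulus T p f y"
  unfolding modulus_def by (rule SUP_subset_mono) auto

lemma modulus2_mono: "x \<le> y \<Longrightarrow> modulus2 T p f x \<le> modulus2 T p f y"
  unfolding modulus2_def by (rule SUP_subset_mono) auto

lemma modulus_upper: "0 \<le> h \<Longrightarrow> h \<le> \<tau> \<Longrightarrow> Lp_norm_on (T - h) p (\<lambda>s. f (s + h) - f s) \<le> modulus T p f \<tau>"
  unfolding modulus_def by (intro SUP_upper) auto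

text \<open>A step h consists of two steps h/2, and for p \<ge> 1/2 the square root of the
  quasi-norm is subadditive. Squaring 2 sqrt(M) gives the factor 4 for all these exponents at
  once.\<close>

lemma modulus_double:
  assumes p: "ennreal (1 / 2) \<le> p" and [measurable]: "f \<in> borel_measurable borel"
  shows "modulus T p f (2 * \<tau>) \<le> 4 * modulus T p f \<tau>"
  unfolding modulus_def[of T p f "2 * \<tau>"]
proof (rule SUP_least)
  fix h assume h: "h \<in> {0..2 * \<tau>}"
  have p0: "0 < p" using p by (metis ennreal_less_zero_iff less_le_trans half_gt_zero zero_less_one)
  let ?N = "\<lambda>F. Lp_norm_on (T - h) p F"
  let ?M = "modulus T p f \<tau>"
  have 1: "?N (\<lambda>s. f (s + h) - f (s + h / 2)) \<le> ?M"
    using Lp_norm_on_shift_le[OF p0, of "\<lambda>s. f (s + h / 2) - f s" "h / 2" "T - h" "T - h / 2"]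
      modulus_upper[of "h / 2" \<tau> T p f] h by (auto simp: add.assoc intro: order_trans)
  have 2: "?N (\<lambda>s. f (s + h / 2) - f s) \<le> ?M"
    using Lp_norm_on_shift_le[OF p0, of "\<lambda>s. f (s + h / 2) - f s" "0" "T - h" "T - h / 2"]
      modulus_upper[of "h / 2" \<tau> T p f] h by (auto simp: add.assoc intro: order_trans)
  have "enn_powr (?N (\<lambda>s. f (s + h) - f s)) (1 / 2)
      \<le> enn_powr (?N (\<lambda>s. f (s + h) - f (s + h / 2))) (1 / 2) + enn_powr (?N (\<lambda>s. f (s + h / 2) - f s)) (1 / 2)"
    using p by (intro Lp_norm_on_triangle_quasi) auto
  also have "\<dots> \<le> enn_powr ?M (1 / 2) + enn_powr ?M (1 / 2)"
    using 1 2 by (intro add_mono enn_powr_mono) auto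
  also have "\<dots> = enn_powr (4 * ?M) (1 / 2)"
    using enn_powr_ennreal[of 4 "1/2"] by (simp add: enn_powr_mult powr_half_sqrt mult_2)
  finally show "?N (\<lambda>s. f (s + h) - f s) \<le> 4 * ?M"
    by (subst (asm) enn_powr_le_iff) auto
qed

subsection \<open>Sewing along dyadic partitions\<close>

lemma ennreal_suminf_Suc: "(\<Sum>n. F n) = F 0 + (\<Sum>n. F (Suc n) :: ennreal)"
proof (rule LIMSEQ_unique)
  show "(\<lambda>n. \<Sum>k<Suc n. F k) \<longlonglongrightarrow> (\<Sum>n. F n)"
    by (rule LIMSEQ_Suc[OF tendsto_suminf_ennreal])
  show "(\<lambda>n. \<Sum>k<Suc n. F k) \<longlonglongrightarrow> F 0 + (\<Sum>n. F (Suc n))"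
    unfolding sum.lessThan_Suc_shift by (intro tendsto_add tendsto_const tendsto_suminf_ennreal)
qed

lemma ennreal_eq_diff: "a = b + c \<Longrightarrow> b \<noteq> top \<Longrightarrow> c = a - (b::ennreal)"
  using ennreal_add_diff_cancel[of b c] by (simp add: add.commute)

lemma ennreal_suminf_tail:
  fixes F :: "nat \<Rightarrow> ennreal"
  assumes "(\<Sum>n. F n) < top"
  shows "(\<lambda>n. \<Sum>k. F (k + n)) \<longlonglongrightarrow> 0"
proof -
  have split: "(\<Sum>n. F n) = (\<Sum>k<n. F k) + (\<Sum>k. F (k + n))" for n
  proof (induction n)
    case (Suc n)
    then show ?case by (simp add: ennreal_suminf_Suc[of "\<lambda>k. F (k + n)"] add.assoc)
  qed simp
  have fin: "(\<Sum>k<n. F k) \<noteq> top" for n using split[of n] assms by (metis ennreal_add_eq_top less_irrefl)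
  have tail: "(\<lambda>n. \<Sum>k. F (k + n)) = (\<lambda>n. (\<Sum>n. F n) - (\<Sum>k<n. F k))"
    by (rule ext, rule ennreal_eq_diff, rule split, rule fin)
  have "(\<lambda>n. (\<Sum>n. F n) - (\<Sum>k<n. F k)) \<longlonglongrightarrow> (\<Sum>n. F n) - (\<Sum>n. F n)"
    using assms by (intro tendsto_diff_ennreal tendsto_const tendsto_suminf_ennreal) auto
  moreover have "(\<Sum>n. F n) - (\<Sum>n. F n) = 0" by (rule diff_eq_0_ennreal) (use assms in auto)
  ultimately show ?thesis unfolding tail by (simp only:)
qed

lemma Lp_qnorm_finite_AE:
  assumes p: "0 < p" and [measurable]: "F \<in> borel_measurable M" and fin: "Lp_qnorm M p F < top"
  shows "AE x in M. F x < top"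
  using p
proof (cases rule: ennreal_exponent_cases)
  case (fin r)
  then have "(\<integral>\<^sup>+x. enn_powr (F x) r \<partial>M) \<noteq> top" using \<open>Lp_qnorm M p F < top\<close> by (simp add: Lp_qnorm_ennreal)
  then have "AE x in M. enn_powr (F x) r \<noteq> \<infinity>" by (intro nn_integral_noteq_infinite) auto
  then show ?thesis by (auto simp: less_top elim!: eventually_mono)
next
  case top
  then show ?thesis using fin esssup_AE[of F M] by (auto simp: Lp_qnorm_top elim!: eventually_mono)
qed

text \<open>Recursion on the list makes cutting a partition an append. The value type is polymorphic
  because one partition sums both the real germ and the \<open>ennreal\<close> error bounds.\<close>

fun chain_sum :: "(real \<Rightarrow> real \<Rightarrow> 'a::comm_monoid_add) \<Rightarrow> real list \<Rightarrow> 'a" where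
  "chain_sum \<phi> (u # v # xs) = \<phi> u v + chain_sum \<phi> (v # xs)"
| "chain_sum \<phi> [u] = 0"
| "chain_sum \<phi> [] = 0"

lemma chain_sum_nth: "chain_sum \<phi> P = (\<Sum>k\<in>{1..<length P}. \<phi> (P ! (k - 1)) (P ! k))"
proof (induction P rule: induct_list012)
  case (3 u v xs)
  have "(\<Sum>k\<in>{1..<length (u # v # xs)}. \<phi> ((u # v # xs) ! (k - 1)) ((u # v # xs) ! k))
     = \<phi> u v + (\<Sum>k\<in>{Suc 1..<Suc (length (v # xs))}. \<phi> ((u # v # xs) ! (k - 1)) ((u # v # xs) ! k))"
    by (subst sum.atLeast_Suc_lessThan) auto
  also have "(\<Sum>k\<in>{Suc 1..<Suc (length (v # xs))}. \<phi> ((u # v # xs) ! (k - 1)) ((u # v # xs) ! k))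
     = (\<Sum>k\<in>{1..<length (v # xs)}. \<phi> ((v # xs) ! (k - 1)) ((v # xs) ! k))"
    unfolding sum.shift_bounds_Suc_ivl by (intro sum.cong) (auto simp: nth_Cons')
  finally show ?case using 3 by simp
qed auto

lemma chain_sum_append:
  "xs \<noteq> [] \<Longrightarrow> ys \<noteq> [] \<Longrightarrow> chain_sum \<phi> (xs @ ys) = chain_sum \<phi> xs + \<phi> (last xs) (hd ys) + chain_sum \<phi> ys"
proof (induction xs rule: induct_list012)
  case (2 x)
  then show ?case by (cases ys) auto
qed (auto simp: add.assoc)

lemma chain_sum_map_upt: "chain_sum \<phi> (map a [0..<Suc n]) = (\<Sum>k<n. \<phi> (a k) (a (Suc k)))"
proof (induction n)
  case (Suc n)
  have "chain_sum \<phi> (map a [0..<Suc n] @ [a (Suc n)]) = chain_sum \<phi> (map a [0..<Suc n]) + \<phi> (a n) (a (Suc n))"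
    by (subst chain_sum_append) (auto simp: last_map)
  with Suc show ?case by simp
qed simp

section \<open>Riemann sums along partitions of the unit interval\<close>

lemma riemann_sum_chain_sum:
  "riemann_sum f g P s t = chain_sum (\<lambda>u v. f (s + u * (t - s)) * (g (s + v * (t - s)) - g (s + u * (t - s)))) P"
  by (simp add: riemann_sum_def chain_sum_nth)

lemma sorted_wrt_less_hd_le: "sorted_wrt (<) Q \<Longrightarrow> x \<in> set Q \<Longrightarrow> hd Q \<le> (x::real)"
  by (cases Q) auto

lemma sorted_wrt_less_le_last: "sorted_wrt (<) Q \<Longrightarrow> x \<in> set Q \<Longrightarrow> (x::real) \<le> last Q"
  by (induction Q rule: rev_induct) (auto simp: sorted_wrt_append)

lemma unit_partitionD:
  assumes "unit_partition P"
  shows "P \<noteq> []" "hd P = 0" "last P = 1" "sorted_wrt (<) P" "set P \<subseteq> {0..1}"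
  using assms sorted_wrt_less_hd_le[of P] sorted_wrt_less_le_last[of P] by (auto simp: unit_partition_def)

definition dyadic :: "nat \<Rightarrow> real list" where
  "dyadic n = map (\<lambda>k. real k / 2 ^ n) [0..<Suc (2 ^ n)]"

lemma unit_partition_map_upt:
  assumes "a 0 = 0" "a n = 1" "\<And>i j. i < j \<Longrightarrow> j \<le> n \<Longrightarrow> a i < a j"
  shows "unit_partition (map a [0..<Suc n])"
proof -
  have "hd (map a [0..<Suc n]) = 0" using assms(1) by (simp add: hd_map del: upt_Suc)
  moreover have "sorted_wrt (<) (map a [0..<Suc n])"
    using assms(3) by (auto simp: sorted_wrt_iff_nth_less simp del: upt_Suc)
  ultimately show ?thesis using assms(2) by (simp add: unit_partition_def)
qed

lemma unit_partition_dyadic: "unit_partition (dyadic n)"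
  unfolding dyadic_def by (rule unit_partition_map_upt) (auto simp: divide_strict_right_mono)

lemma riemann_sum_dyadic:
  "riemann_sum f g (dyadic n) s t = (\<Sum>k<2 ^ n. f (s + real k / 2 ^ n * (t - s)) *
     (g (s + real (Suc k) / 2 ^ n * (t - s)) - g (s + real k / 2 ^ n * (t - s))))"
  unfolding riemann_sum_chain_sum dyadic_def chain_sum_map_upt ..

lemma riemann_sum_trivial [simp]: "riemann_sum f g P s s = 0"
  by (simp add: riemann_sum_def)

lemma measurable_riemann_sum [measurable (raw)]:
  assumes [measurable]: "f \<in> borel_measurable borel" "g \<in> borel_measurable borel" "a \<in> borel_measurable M" "b \<in> borel_measurable M"
  shows "(\<lambda>x. riemann_sum f g P (a x) (b x)) \<in> borel_measurable M"
  unfolding riemann_sum_def by measurable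

lemma sum_double: "(\<Sum>k<2 * n. F k) = (\<Sum>k<n. F (2 * k) + F (Suc (2 * k)))"
  by (induction n) (auto simp: add.assoc)

lemma riemann_sum_dyadic_Suc:
  "riemann_sum f g (dyadic (Suc n)) s t - riemann_sum f g (dyadic n) s t =
    (\<Sum>k<2 ^ n. (f (s + real (2 * k + 1) / 2 ^ Suc n * (t - s)) - f (s + real (2 * k) / 2 ^ Suc n * (t - s)))
        * (g (s + real (2 * k + 2) / 2 ^ Suc n * (t - s)) - g (s + real (2 * k + 1) / 2 ^ Suc n * (t - s))))"
proof -
  have id: "x0 * (y1 - y0) + x1 * (y2 - y1) - x0 * (y2 - y0) = (x1 - x0) * (y2 - y1)" for x0 x1 y0 y1 y2 :: real
    by (simp add: algebra_simps)
  show ?thesis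
    unfolding riemann_sum_dyadic power_Suc[of "2::nat" n] sum_double sum_subtractf[symmetric]
  proof (intro sum.cong refl)
    fix k
    have e: "real k / 2 ^ n = real (2 * k) / 2 ^ Suc n" "real (Suc k) / 2 ^ n = real (2 * k + 2) / 2 ^ Suc n"
      "Suc (2 * k) = 2 * k + 1" "Suc (2 * k + 1) = 2 * k + 2" by (auto simp: field_simps)
    show "f (s + real (2 * k) / 2 ^ Suc n * (t - s)) * (g (s + real (Suc (2 * k)) / 2 ^ Suc n * (t - s)) - g (s + real (2 * k) / 2 ^ Suc n * (t - s)))
      + f (s + real (Suc (2 * k)) / 2 ^ Suc n * (t - s)) * (g (s + real (Suc (Suc (2 * k))) / 2 ^ Suc n * (t - s)) - g (s + real (Suc (2 * k)) / 2 ^ Suc n * (t - s)))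
      - f (s + real k / 2 ^ n * (t - s)) * (g (s + real (Suc k) / 2 ^ n * (t - s)) - g (s + real k / 2 ^ n * (t - s)))
      = (f (s + real (2 * k + 1) / 2 ^ Suc n * (t - s)) - f (s + real (2 * k) / 2 ^ Suc n * (t - s)))
        * (g (s + real (2 * k + 2) / 2 ^ Suc n * (t - s)) - g (s + real (2 * k + 1) / 2 ^ Suc n * (t - s)))"
      unfolding e by (rule id)
  qed
qed

text \<open>Fubini after the substitution t = c + k: a property known for almost every c at each
  fixed offset k becomes one for almost every pair. Facts about fixed steps thereby turn into facts
  about a fixed base point.\<close>

lemma AE_lborel_shear:
  fixes Q :: "real \<Rightarrow> real \<Rightarrow> bool"
  assumes [measurable]: "Measurable.pred (borel \<Otimes>\<^sub>M borel) (\<lambda>x. Q (fst x) (snd x))"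
    and ae: "\<And>k. AE c in lborel. Q c (c + k)"
  shows "AE c in lborel. AE t in lborel. Q c t"
proof -
  have "(\<lambda>x. (snd x, snd x + fst x)) \<in> (lborel :: real measure) \<Otimes>\<^sub>M lborel \<rightarrow>\<^sub>M borel \<Otimes>\<^sub>M (borel :: real measure)"
    by measurable
  from measurable_compose[OF this assms(1)]
  have Q: "Measurable.pred (lborel \<Otimes>\<^sub>M lborel) (\<lambda>x. Q (snd x) (snd x + fst x))"
    by simp
  have "AE k in lborel. AE c in lborel. Q c (c + k)" using ae by simp
  then have "AE c in lborel. AE k in lborel. Q c (c + k)"
    using lborel_pair.AE_commute[OF Q[unfolded pred_def]] by simp
  then show ?thesis
  proof eventually_elim
    case (elim c)
    from AE_lborel_shift[OF this, of "- c"] show ?case by simp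
  qed
qed

lemma AE_lborel_witness:
  assumes "AE x in lborel. P x" "a < (b::real)"
  obtains x where "a < x" "x < b" "P x"
proof (rule ccontr)
  assume "\<not> thesis"
  then have "AE x in lborel. x \<notin> {a<..<b}" using assms(1) that by (auto elim!: eventually_mono)
  then have "{a<..<b} \<in> null_sets lborel"
    by (subst (asm) AE_iff_null_sets[symmetric]) auto
  then show False using assms(2) by (auto simp: null_sets_def)
qed

lemma nn_integral_lborel_shear:
  fixes K :: "real \<Rightarrow> real \<Rightarrow> ennreal"
  assumes K: "(\<lambda>x. K (fst x) (snd x)) \<in> borel_measurable (borel \<Otimes>\<^sub>M borel)"
  shows "(\<integral>\<^sup>+c. \<integral>\<^sup>+t. K c t \<partial>lborel \<partial>lborel) = (\<integral>\<^sup>+h. \<integral>\<^sup>+c. K c (c + h) \<partial>lborel \<partial>lborel)"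
proof -
  have [measurable]: "(\<lambda>x. K (a x) (b x)) \<in> borel_measurable M"
    if [measurable]: "a \<in> borel_measurable M" "b \<in> borel_measurable M" for M and a b :: "'z \<Rightarrow> real"
    using measurable_compose[OF _ K, of "\<lambda>x. (a x, b x)" M] by simp
  have "(\<integral>\<^sup>+t. K c t \<partial>lborel) = (\<integral>\<^sup>+h. K c (c + h) \<partial>lborel)" for c
    using nn_integral_lborel_shift[of "K c" c] by (simp add: add.commute)
  moreover have "(\<integral>\<^sup>+c. \<integral>\<^sup>+h. K c (c + h) \<partial>lborel \<partial>lborel) = (\<integral>\<^sup>+h. \<integral>\<^sup>+c. K c (c + h) \<partial>lborel \<partial>lborel)"
    by (rule lborel_pair.Fubini') measurable
  ultimately show ?thesis by simp
qed

text \<open>What sewing uses of f and g: a monotone bound \<open>Z\<close> for the defect of the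
  germ when [u,w] is split at v. The times u, v, w are relative to [r,r+h], and r ranges over
  [0,T-h], so that no argument leaves [0,T].\<close>

locale germ =
  fixes T :: real and p :: ennreal and m :: real and f g :: "real \<Rightarrow> real" and Z :: "real \<Rightarrow> ennreal"
  assumes m: "0 < m" "m \<le> 1" "ennreal m \<le> p"
    and f [measurable]: "f \<in> borel_measurable borel" and g [measurable]: "g \<in> borel_measurable borel"
    and Z_mono: "\<And>x y. x \<le> y \<Longrightarrow> Z x \<le> Z y"
    and germ_bound: "\<And>h u v w. 0 \<le> h \<Longrightarrow> h \<le> T \<Longrightarrow> 0 \<le> u \<Longrightarrow> u \<le> v \<Longrightarrow> v \<le> w \<Longrightarrow> w \<le> 1 \<Longrightarrow>
      Lp_norm_on (T - h) p (\<lambda>r. (f (r + v * h) - f (r + u * h)) * (g (r + w * h) - g (r + v * h))) \<le> Z ((w - u) * h)"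
begin

lemma p_pos: "0 < p"
  using m by (metis ennreal_less_zero_iff less_le_trans)

text \<open>The solution by iteration of \<Psi>(\<tau>) = 2 Z(\<tau>)^m + 2 \<Psi>(\<tau>/2), the
  recursion met when an arbitrary partition is cut near its middle: two splitting defects and two
  halves.\<close>

definition Psi :: "real \<Rightarrow> ennreal" where
  "Psi \<tau> = (\<Sum>n. 2 ^ Suc n * enn_powr (Z (\<tau> / 2 ^ n)) m)"

lemma Psi_mono: "x \<le> y \<Longrightarrow> Psi x \<le> Psi y"
  unfolding Psi_def using m by (intro suminf_le) (auto intro!: mult_left_mono enn_powr_mono Z_mono divide_right_mono)

lemma Psi_half: "Psi \<tau> = 2 * enn_powr (Z \<tau>) m + 2 * Psi (\<tau> / 2)"
  unfolding Psi_def by (subst ennreal_suminf_Suc) (simp add: mult.assoc flip: ennreal_suminf_cmult)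

lemma Psi_tail: "2 ^ n * Psi (\<tau> / 2 ^ n) = (\<Sum>k. 2 ^ Suc (k + n) * enn_powr (Z (\<tau> / 2 ^ (k + n))) m)"
  unfolding Psi_def by (simp add: power_add ac_simps flip: ennreal_suminf_cmult)

lemma Psi_tail_tendsto:
  assumes "Psi \<tau> < top" shows "(\<lambda>n. 2 ^ n * Psi (\<tau> / 2 ^ n)) \<longlonglongrightarrow> 0"
  unfolding Psi_tail using assms unfolding Psi_def by (rule ennreal_suminf_tail)

text \<open>The m-th power is built in, so that \<open>N\<close> is subadditive.\<close>

definition N :: "real \<Rightarrow> (real \<Rightarrow> real) \<Rightarrow> ennreal" where
  "N h F = enn_powr (Lp_norm_on (T - h) p F) m"

lemma N_0: "N h (\<lambda>r. 0) = 0"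
  using p_pos by (simp add: N_def Lp_norm_on_def Lp_qnorm_0)

lemma N_triangle:
  "F \<in> borel_measurable borel \<Longrightarrow> G \<in> borel_measurable borel \<Longrightarrow> H \<in> borel_measurable borel \<Longrightarrow>
    N h (\<lambda>r. F r - H r) \<le> N h (\<lambda>r. F r - G r) + N h (\<lambda>r. G r - H r)"
  unfolding N_def by (rule Lp_norm_on_triangle_quasi[OF m])

lemma N_add:
  "F \<in> borel_measurable borel \<Longrightarrow> G \<in> borel_measurable borel \<Longrightarrow> N h (\<lambda>r. F r + G r) \<le> N h F + N h G"
  unfolding N_def by (rule Lp_norm_on_add_quasi[OF m])

lemma N_diff_commute: "N h (\<lambda>r. F r - G r) = N h (\<lambda>r. G r - F r)"
  unfolding N_def Lp_norm_on_def by (simp add: abs_minus_commute)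

text \<open>The germ in relative time, so that one partition of [0,1] serves every base point r and
  every step h.\<close>

definition phi :: "real \<Rightarrow> real \<Rightarrow> real \<Rightarrow> real \<Rightarrow> real" where
  "phi h r u v = f (r + u * h) * (g (r + v * h) - g (r + u * h))"

lemma riemann_sum_phi: "riemann_sum f g P r (r + h) = chain_sum (phi h r) P"
  by (simp add: riemann_sum_chain_sum phi_def[abs_def])

lemma measurable_phi [measurable]: "(\<lambda>r. phi h r u v) \<in> borel_measurable borel"
  unfolding phi_def by measurable

lemma measurable_chain_sum_phi [measurable]: "(\<lambda>r. chain_sum (phi h r) P) \<in> borel_measurable borel"
  unfolding chain_sum_nth by measurable

lemma N_germ:
  assumes "0 \<le> h" "h \<le> T" "0 \<le> u" "u \<le> v" "v \<le> w" "w \<le> 1" "(w - u) * h \<le> H"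
  shows "N h (\<lambda>r. phi h r u v + phi h r v w - phi h r u w) \<le> enn_powr (Z H) m"
proof -
  have "(\<lambda>r. phi h r u v + phi h r v w - phi h r u w) = (\<lambda>r. (f (r + v * h) - f (r + u * h)) * (g (r + w * h) - g (r + v * h)))"
    by (simp add: phi_def algebra_simps)
  then show ?thesis unfolding N_def
    using germ_bound[OF assms(1-6)] Z_mono[OF assms(7)] m by (auto intro!: enn_powr_mono)
qed

text \<open>Induction on the number of points. The list is cut at the midpoint c' of its span and
  not at its middle entry, so both parts span at most half however the points are spaced. With a'
  the last point up to c' and b' the first one beyond, the interval [a',b'] stays whole; splitting
  [a,b] at a' and then [a',b] at b' costs the defects \<open>?D1\<close> and
  \<open>?D2\<close>.\<close>

lemma sewing_bound:
  assumes h: "0 \<le> h" "h \<le> T" and "sorted_wrt (<) Q" "Q \<noteq> []" "set Q \<subseteq> {0..1}"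
  shows "N h (\<lambda>r. chain_sum (phi h r) Q - phi h r (hd Q) (last Q)) \<le> Psi ((last Q - hd Q) * h)"
  using assms(3-)
proof (induction "length Q" arbitrary: Q rule: less_induct)
  case less
  show ?case
  proof (cases "length Q = 1")
    case True
    then obtain a where "Q = [a]" by (auto simp: length_Suc_conv)
    then show ?thesis by (simp add: phi_def N_0)
  next
    case False
    then obtain a c Q' where Q: "Q = a # c # Q'" using less(3) by (cases Q; cases "tl Q") auto
    define b where "b = last Q"
    define c' where "c' = (a + b) / 2"
    have "a < b" using less(2) Q last_in_set[of "c # Q'"] by (auto simp: b_def)
    then have ab: "a < b" "a \<le> c'" "c' < b" by (auto simp: c'_def)
    define xs where "xs = takeWhile (\<lambda>x. x \<le> c') Q"
    define ys where "ys = dropWhile (\<lambda>x. x \<le> c') Q"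
    have Qxy: "Q = xs @ ys" by (simp add: xs_def ys_def)
    have xs0: "xs \<noteq> []" "hd xs = a" using ab by (auto simp: xs_def Q)
    have xsle: "x \<le> c'" if "x \<in> set xs" for x using that set_takeWhileD unfolding xs_def by fastforce
    have bin: "b \<in> set Q" using less(3) by (simp add: b_def)
    have ys0: "ys \<noteq> []" using xsle[of b] bin ab Qxy by fastforce
    have hdys: "c' < hd ys" using hd_dropWhile[of "\<lambda>x. x \<le> c'" Q] ys0 by (auto simp: ys_def)
    have lys: "last ys = b" using ys0 by (simp add: b_def Qxy)
    have srt: "sorted_wrt (<) xs" "sorted_wrt (<) ys" using less(2) by (auto simp: Qxy sorted_wrt_append)
    have sub: "set xs \<subseteq> {0..1}" "set ys \<subseteq> {0..1}" using less(4) by (auto simp: Qxy)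
    have len: "length xs < length Q" "length ys < length Q" using xs0 ys0 by (auto simp: Qxy)
    define a' b' where "a' = last xs" and "b' = hd ys"
    have a': "a \<le> a'" "a' \<le> c'" using sorted_wrt_less_hd_le[OF srt(1), of a'] xsle[of a'] xs0 by (auto simp: a'_def)
    have b': "c' < b'" "b' \<le> b" using sorted_wrt_less_hd_le[OF srt(2), of b] hdys ys0 lys last_in_set[OF ys0] by (auto simp: b'_def)
    have 01: "0 \<le> a" "b \<le> 1" using less(4) bin Q by auto
    let ?R = "\<lambda>xs r. chain_sum (phi h r) xs - phi h r (hd xs) (last xs)"
    let ?H = "(b - a) * h"
    have IH: "N h (?R xs) \<le> Psi (?H / 2)" "N h (?R ys) \<le> Psi (?H / 2)"
    proof -
      have "a' - a \<le> (b - a) / 2" "b - b' \<le> (b - a) / 2"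
        using a' b' by (auto simp: c'_def field_simps)
      note this[THEN mult_right_mono, OF h(1)]
      then show "N h (?R xs) \<le> Psi (?H / 2)" "N h (?R ys) \<le> Psi (?H / 2)"
        using less(1)[OF len(1) srt(1) xs0(1) sub(1)] less(1)[OF len(2) srt(2) ys0 sub(2)]
          Psi_mono[of "(a' - a) * h" "?H / 2"] Psi_mono[of "(b - b') * h" "?H / 2"] xs0 lys
        by (auto simp: a'_def b'_def intro: order_trans)
    qed
    let ?D1 = "\<lambda>r. phi h r a a' + phi h r a' b - phi h r a b"
    let ?D2 = "\<lambda>r. phi h r a' b' + phi h r b' b - phi h r a' b"
    have D: "N h ?D1 \<le> enn_powr (Z ?H) m" "N h ?D2 \<le> enn_powr (Z ?H) m"
      using h a' b' ab 01 by (auto intro!: N_germ mult_right_mono)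
    have decomp: "(\<lambda>r. chain_sum (phi h r) Q - phi h r (hd Q) (last Q)) = (\<lambda>r. (?R xs r + ?R ys r) + (?D1 r + ?D2 r))"
      unfolding Qxy chain_sum_append[OF xs0(1) ys0] using xs0 ys0 lys by (simp add: a'_def b'_def algebra_simps)
    have "N h (\<lambda>r. chain_sum (phi h r) Q - phi h r (hd Q) (last Q))
        \<le> (N h (?R xs) + N h (?R ys)) + (N h ?D1 + N h ?D2)"
    proof -
      have "N h (\<lambda>r. (?R xs r + ?R ys r) + (?D1 r + ?D2 r)) \<le> N h (\<lambda>r. ?R xs r + ?R ys r) + N h (\<lambda>r. ?D1 r + ?D2 r)"
        by (rule N_add) measurable
      also have "\<dots> \<le> (N h (?R xs) + N h (?R ys)) + (N h ?D1 + N h ?D2)"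
        by (intro add_mono N_add) measurable
      finally show ?thesis unfolding decomp .
    qed
    also have "\<dots> \<le> (Psi (?H / 2) + Psi (?H / 2)) + (enn_powr (Z ?H) m + enn_powr (Z ?H) m)"
      by (intro add_mono IH D)
    also have "\<dots> = Psi ?H" by (subst Psi_half[of ?H]) (simp add: mult_2 add.commute)
    finally show ?thesis by (simp add: b_def Q)
  qed
qed

text \<open>Inside each interval of \<open>P\<close> the points of \<open>Q\<close> form a chain to
  which \<open>sewing_bound\<close> applies. The recursion cuts \<open>Q\<close> at the second point
  of \<open>P\<close>.\<close>

lemma refinement_bound:
  assumes h: "0 \<le> h" "h \<le> T"
    and "sorted_wrt (<) P" "P \<noteq> []" "sorted_wrt (<) Q" "Q \<noteq> []"
    and "set P \<subseteq> set Q" "set Q \<subseteq> {0..1}" "hd Q = hd P" "last Q = last P"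
  shows "N h (\<lambda>r. chain_sum (phi h r) Q - chain_sum (phi h r) P) \<le> chain_sum (\<lambda>u v. Psi ((v - u) * h)) P"
  using assms(3-)
proof (induction P arbitrary: Q rule: induct_list012)
  case (2 a)
  then obtain Q' where "Q = a # Q'" by (cases Q) auto
  with 2 have "Q = [a]" using last_in_set[of Q'] by (cases Q') force+
  then show ?case by (simp add: N_0)
next
  case (3 a b P')
  obtain Q1 Q2 where Q: "Q = Q1 @ b # Q2" using 3(7) split_list[of b Q] by auto
  have "Q1 \<noteq> []" using 3 Q by (cases Q1) auto
  have hdQ1: "hd (Q1 @ [b]) = a" using 3 Q \<open>Q1 \<noteq> []\<close> by simp
  have srt: "sorted_wrt (<) (Q1 @ [b])" "sorted_wrt (<) (b # Q2)" using 3(5) by (auto simp: Q sorted_wrt_append)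
  have sub: "set (b # P') \<subseteq> set (b # Q2)"
  proof
    fix x assume x: "x \<in> set (b # P')"
    then have "x \<in> set Q" "b \<le> x" using 3 by auto
    then show "x \<in> set (b # Q2)" using srt(1) by (auto simp: Q sorted_wrt_append)
  qed
  have IH: "N h (\<lambda>r. chain_sum (phi h r) (b # Q2) - chain_sum (phi h r) (b # P')) \<le> chain_sum (\<lambda>u v. Psi ((v - u) * h)) (b # P')"
    using 3 srt sub by (intro 3(2)) (auto simp: Q)
  have "N h (\<lambda>r. chain_sum (phi h r) (Q1 @ [b]) - phi h r (hd (Q1 @ [b])) (last (Q1 @ [b]))) \<le> Psi ((last (Q1 @ [b]) - hd (Q1 @ [b])) * h)"
    using 3 by (intro sewing_bound h srt) (auto simp: Q)
  then have B: "N h (\<lambda>r. chain_sum (phi h r) (Q1 @ [b]) - phi h r a b) \<le> Psi ((b - a) * h)"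
    using hdQ1 by simp
  have "(\<lambda>r. chain_sum (phi h r) Q - chain_sum (phi h r) (a # b # P'))
      = (\<lambda>r. (chain_sum (phi h r) (Q1 @ [b]) - phi h r a b) + (chain_sum (phi h r) (b # Q2) - chain_sum (phi h r) (b # P')))"
    using \<open>Q1 \<noteq> []\<close> by (simp add: Q chain_sum_append algebra_simps)
  then have "N h (\<lambda>r. chain_sum (phi h r) Q - chain_sum (phi h r) (a # b # P'))
     \<le> N h (\<lambda>r. chain_sum (phi h r) (Q1 @ [b]) - phi h r a b) + N h (\<lambda>r. chain_sum (phi h r) (b # Q2) - chain_sum (phi h r) (b # P'))"
    by (auto intro!: N_add)
  also have "\<dots> \<le> Psi ((b - a) * h) + chain_sum (\<lambda>u v. Psi ((v - u) * h)) (b # P')"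
    by (intro add_mono B IH)
  finally show ?case by simp
qed simp

lemma partition_compare:
  assumes h: "0 \<le> h" "h \<le> T" and P: "unit_partition P" and D: "unit_partition D"
  shows "N h (\<lambda>r. chain_sum (phi h r) P - chain_sum (phi h r) D)
    \<le> chain_sum (\<lambda>u v. Psi ((v - u) * h)) P + chain_sum (\<lambda>u v. Psi ((v - u) * h)) D"
proof -
  note P = unit_partitionD[OF P] and D = unit_partitionD[OF D]
  define R where "R = sorted_list_of_set (set P \<union> set D)"
  have R: "set R = set P \<union> set D" "sorted_wrt (<) R" by (auto simp: R_def)
  have R0: "R \<noteq> []" using R(1) P(1) by auto
  have 01: "0 \<in> set P" "1 \<in> set P" using P hd_in_set last_in_set by metis+
  have Rsub: "set R \<subseteq> {0..1}" using R P D by auto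
  have "hd R \<in> {0..1}" "last R \<in> {0..1}" using hd_in_set[OF R0] last_in_set[OF R0] Rsub by blast+
  then have R01: "hd R = 0" "last R = 1"
    using sorted_wrt_less_hd_le[OF R(2), of 0] sorted_wrt_less_le_last[OF R(2), of 1] R(1) 01 by auto
  have "N h (\<lambda>r. chain_sum (phi h r) P - chain_sum (phi h r) D)
     \<le> N h (\<lambda>r. chain_sum (phi h r) P - chain_sum (phi h r) R) + N h (\<lambda>r. chain_sum (phi h r) R - chain_sum (phi h r) D)"
    by (intro N_triangle) auto
  also have "\<dots> \<le> chain_sum (\<lambda>u v. Psi ((v - u) * h)) P + chain_sum (\<lambda>u v. Psi ((v - u) * h)) D"
    using h P D R R0 R01 Rsub by (subst N_diff_commute) (intro add_mono refinement_bound; auto)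
  finally show ?thesis .
qed

lemma chain_sum_Psi_dyadic: "chain_sum (\<lambda>u v. Psi ((v - u) * h)) (dyadic n) = 2 ^ n * Psi (h / 2 ^ n)"
proof -
  have "real (Suc k) / 2 ^ n - real k / 2 ^ n = 1 / 2 ^ n" for k by (simp add: field_simps)
  then show ?thesis unfolding dyadic_def chain_sum_map_upt by simp
qed


lemma N_dyadic_Suc:
  assumes h: "0 \<le> h" "h \<le> T"
  shows "N h (\<lambda>r. riemann_sum f g (dyadic (Suc n)) r (r + h) - riemann_sum f g (dyadic n) r (r + h))
    \<le> 2 ^ n * enn_powr (Z (h / 2 ^ n)) m"
proof -
  let ?F = "\<lambda>k r. (f (r + real (2 * k + 1) / 2 ^ Suc n * h) - f (r + real (2 * k) / 2 ^ Suc n * h))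
        * (g (r + real (2 * k + 2) / 2 ^ Suc n * h) - g (r + real (2 * k + 1) / 2 ^ Suc n * h))"
  have "N h (\<lambda>r. riemann_sum f g (dyadic (Suc n)) r (r + h) - riemann_sum f g (dyadic n) r (r + h))
      = N h (\<lambda>r. \<Sum>k<2 ^ n. ?F k r)"
    unfolding riemann_sum_dyadic_Suc by simp
  also have "\<dots> \<le> (\<Sum>k<2 ^ n. N h (?F k))"
    unfolding N_def by (intro Lp_norm_on_sum_quasi m) measurable
  also have "\<dots> \<le> (\<Sum>k<(2::nat) ^ n. enn_powr (Z (h / 2 ^ n)) m)"
  proof (rule sum_mono)
    fix k assume k: "k \<in> {..<(2::nat) ^ n}"
    have "real (2 * k + 2) \<le> 2 ^ Suc n"
    proof -
      have "2 * k + 2 \<le> 2 * 2 ^ n" using k by simp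
      then have "real (2 * k + 2) \<le> real (2 * 2 ^ n)" by (simp only: of_nat_le_iff)
      then show ?thesis by simp
    qed
    moreover have le: "real (2 * k) / 2 ^ Suc n \<le> real (2 * k + 1) / 2 ^ Suc n" "real (2 * k + 1) / 2 ^ Suc n \<le> real (2 * k + 2) / 2 ^ Suc n"
      by (intro divide_right_mono; simp)+
    ultimately have "Lp_norm_on (T - h) p (?F k) \<le> Z ((real (2 * k + 2) / 2 ^ Suc n - real (2 * k) / 2 ^ Suc n) * h)"
      using le by (intro germ_bound h) auto
    also have "(real (2 * k + 2) / 2 ^ Suc n - real (2 * k) / 2 ^ Suc n) * h = h / 2 ^ n"
      by (simp add: field_simps)
    finally show "N h (?F k) \<le> enn_powr (Z (h / 2 ^ n)) m"
      unfolding N_def using m by (intro enn_powr_mono) auto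
  qed
  finally show ?thesis by simp
qed

text \<open>The series of absolute differences of consecutive dyadic sums has m-th power norm at
  most \<open>Psi h\<close>. A function of finite quasi-norm is finite a.e., so the differences are
  absolutely summable there.\<close>

lemma dyadic_convergent_AE:
  assumes h: "0 \<le> h" "h \<le> T" and fin: "Psi h < top"
  shows "AE r in lebesgue_on {0..T - h}. convergent (\<lambda>n. riemann_sum f g (dyadic n) r (r + h))"
proof -
  let ?D = "\<lambda>n r. riemann_sum f g (dyadic (Suc n)) r (r + h) - riemann_sum f g (dyadic n) r (r + h)"
  let ?M = "lebesgue_on {0..T - h}"
  have "enn_powr (Lp_qnorm ?M p (\<lambda>r. \<Sum>n. ennreal \<bar>?D n r\<bar>)) m \<le> (\<Sum>n. enn_powr (Lp_qnorm ?M p (\<lambda>r. ennreal \<bar>?D n r\<bar>)) m)"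
    by (intro Lp_qnorm_suminf_quasi m) measurable
  also have "\<dots> \<le> (\<Sum>n. 2 ^ Suc n * enn_powr (Z (h / 2 ^ n)) m)"
  proof (intro suminf_le)
    fix n
    have "(2::ennreal) ^ n \<le> 2 ^ Suc n" by (intro power_increasing) auto
    then show "enn_powr (Lp_qnorm ?M p (\<lambda>r. ennreal \<bar>?D n r\<bar>)) m \<le> 2 ^ Suc n * enn_powr (Z (h / 2 ^ n)) m"
      using order_trans[OF N_dyadic_Suc[OF h, of n] mult_right_mono] unfolding N_def Lp_norm_on_def by simp
  qed auto
  also have "\<dots> < top" using fin unfolding Psi_def .
  finally have "AE r in ?M. (\<Sum>n. ennreal \<bar>?D n r\<bar>) < top"
    by (intro Lp_qnorm_finite_AE[OF p_pos]) (auto, measurable)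
  then show ?thesis
  proof eventually_elim
    case (elim r)
    then have "summable (\<lambda>n. \<bar>?D n r\<bar>)" by (intro summable_suminf_not_top) auto
    then have "summable (\<lambda>n. ?D n r)" by (rule summable_rabs_cancel)
    then have "convergent (\<lambda>n. \<Sum>k<n. ?D k r)" by (simp add: summable_iff_convergent)
    then have "convergent (\<lambda>n. riemann_sum f g (dyadic 0) r (r + h) + (\<Sum>k<n. ?D k r))"
      by (intro convergent_add convergent_const)
    moreover have "(\<Sum>k<n. ?D k r) = riemann_sum f g (dyadic n) r (r + h) - riemann_sum f g (dyadic 0) r (r + h)" for n
      by (rule sum_lessThan_telescope)
    ultimately show ?case by simp
  qed
qed

text \<open>Comparing with dyadic partitions through a common refinement, every partition sum is close to
  any a.e. limit of the dyadic sums.\<close>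

lemma N_riemann_sum_limit:
  assumes h: "0 \<le> h" "h \<le> T" and fin: "Psi h < top" and P: "unit_partition P"
    and [measurable]: "F \<in> borel_measurable borel"
    and lim: "AE r in lebesgue_on {0..T - h}. (\<lambda>n. riemann_sum f g (dyadic n) r (r + h)) \<longlonglongrightarrow> F r"
  shows "N h (\<lambda>r. riemann_sum f g P r (r + h) - F r) \<le> chain_sum (\<lambda>u v. Psi ((v - u) * h)) P"
proof -
  let ?X = "\<lambda>n r. riemann_sum f g P r (r + h) - riemann_sum f g (dyadic n) r (r + h)"
  have "Lp_norm_on (T - h) p (\<lambda>r. riemann_sum f g P r (r + h) - F r) \<le> liminf (\<lambda>n. Lp_norm_on (T - h) p (?X n))"
    using lim by (intro Lp_norm_on_Fatou[OF p_pos]) (auto elim!: eventually_mono intro: tendsto_intros)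
  then have "N h (\<lambda>r. riemann_sum f g P r (r + h) - F r) \<le> liminf (\<lambda>n. N h (?X n))"
    unfolding N_def using m by (auto simp flip: enn_powr_Liminf intro!: enn_powr_mono)
  also have "\<dots> \<le> liminf (\<lambda>n. chain_sum (\<lambda>u v. Psi ((v - u) * h)) P + 2 ^ n * Psi (h / 2 ^ n))"
    using partition_compare[OF h P unit_partition_dyadic]
    by (intro Liminf_mono always_eventually) (simp add: chain_sum_Psi_dyadic riemann_sum_phi)
  also have "\<dots> = chain_sum (\<lambda>u v. Psi ((v - u) * h)) P + 0"
    by (intro lim_imp_Liminf tendsto_add tendsto_const Psi_tail_tendsto fin) simp
  finally show ?thesis by simp
qed

text \<open>As a limit of measurable functions \<open>J\<close> is jointly measurable in both times,
  which the Fubini arguments require; \<open>lim\<close> is total, so no convergence set has to be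
  carried along.\<close>

definition J :: "real \<Rightarrow> real \<Rightarrow> real" where
  "J s t = lim (\<lambda>n. riemann_sum f g (dyadic n) s t)"

lemma J_refl [simp]: "J s s = 0"
  by (simp add: J_def)

lemma measurable_J [measurable (raw)]:
  assumes [measurable]: "a \<in> borel_measurable M" "b \<in> borel_measurable M"
  shows "(\<lambda>x. J (a x) (b x)) \<in> borel_measurable M"
  unfolding J_def by measurable

lemma J_limit:
  assumes "0 \<le> h" "h \<le> T" "Psi h < top"
  shows "AE r in lebesgue_on {0..T - h}. (\<lambda>n. riemann_sum f g (dyadic n) r (r + h)) \<longlonglongrightarrow> J r (r + h)"
  using dyadic_convergent_AE[OF assms] unfolding J_def by (auto simp: convergent_LIMSEQ_iff elim!: eventually_mono)

text \<open>Not an algebraic identity: dyadic points of [r,r+a+b] miss r+a in general. The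
  partitions \<open>Q n\<close> glue the dyadic points of the two pieces. Their sums tend a.e. to
  the right side, and they approach the left side because their error 2^n \<Psi>(a/2^n) + 2^n
  \<Psi>(b/2^n) vanishes; Fatou identifies the two limits.\<close>

lemma J_additive:
  assumes h: "0 \<le> a" "0 \<le> b" "a + b \<le> T" and fin: "Psi T < top"
  shows "AE r in lebesgue_on {0..T - (a + b)}. J r (r + (a + b)) = J r (r + a) + J (r + a) (r + (a + b))"
proof (cases "a = 0 \<or> b = 0")
  case True
  then show ?thesis by auto
next
  case False
  then have ab: "0 < a" "0 < b" using h by auto
  let ?h = "a + b"
  have finh: "Psi x < top" if "x \<le> T" for x using Psi_mono[OF that] fin by (rule le_less_trans)
  \<comment> \<open>The relative position of r+a in [r,r+a+b].\<close>
  define l where "l = a / ?h"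
  have l: "0 < l" "l < 1" "l * ?h = a" "(1 - l) * ?h = b" using ab by (auto simp: l_def field_simps)
  define c where "c n k = (if k \<le> 2 ^ n then l * (real k / 2 ^ n) else l + (1 - l) * (real (k - 2 ^ n) / 2 ^ n))" for n k :: nat
  define Q where "Q n = map (c n) [0..<Suc (2 ^ n + 2 ^ n)]" for n
  have c2: "c n (2 ^ n + k) = l + (1 - l) * (real k / 2 ^ n)" for n k by (auto simp: c_def)
  have c1: "k \<le> 2 ^ n \<Longrightarrow> c n k = l * (real k / 2 ^ n)" for n k by (auto simp: c_def)
  have split: "(\<Sum>k<n + n. G k) = (\<Sum>k<n. G k) + (\<Sum>k<n. G (n + k))" for n and G :: "nat \<Rightarrow> 'z::comm_monoid_add"
  proof -
    have "{..<n + n} = {..<n} \<union> {n..<n + n}" by auto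
    then have "(\<Sum>k<n + n. G k) = (\<Sum>k<n. G k) + (\<Sum>k\<in>{n..<n + n}. G k)"
      by (simp add: sum.union_disjoint ivl_disj_int)
    also have "(\<Sum>k\<in>{n..<n + n}. G k) = (\<Sum>k<n. G (n + k))"
      by (intro sum.reindex_bij_witness[of _ "\<lambda>k. n + k" "\<lambda>k. k - n"]) auto
    finally show ?thesis .
  qed
  have csplit: "chain_sum \<phi> (Q n) = (\<Sum>k<2 ^ n. \<phi> (l * (real k / 2 ^ n)) (l * (real (Suc k) / 2 ^ n)))
     + (\<Sum>k<2 ^ n. \<phi> (l + (1 - l) * (real k / 2 ^ n)) (l + (1 - l) * (real (Suc k) / 2 ^ n)))"
    for \<phi> :: "real \<Rightarrow> real \<Rightarrow> 'z::comm_monoid_add" and n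
    unfolding Q_def chain_sum_map_upt split
    by (intro arg_cong2[where f="(+)"] sum.cong) (auto simp: c1 c2 simp flip: add_Suc_right)
  have Qp: "unit_partition (Q n)" for n
    unfolding Q_def
  proof (rule unit_partition_map_upt)
    show "c n 0 = 0" "c n (2 ^ n + 2 ^ n) = 1" by (simp add: c1) (simp add: c2)
    fix i j assume ij: "i < j" "j \<le> (2::nat) ^ n + 2 ^ n"
    show "c n i < c n j"
    proof (cases "j \<le> 2 ^ n")
      case True
      then show ?thesis using ij l by (simp add: c1 divide_strict_right_mono)
    next
      case False
      then obtain k where k: "j = 2 ^ n + k" "0 < k" using le_Suc_ex[of "2 ^ n" j] by auto
      show ?thesis
      proof (cases "i \<le> 2 ^ n")
        case True
        then have "real i \<le> 2 ^ n" by (metis of_nat_le_iff of_nat_numeral of_nat_power)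
        then have "c n i \<le> l" using True l by (simp add: c1 field_simps)
        also have "l < c n j" using k l by (simp add: c2)
        finally show ?thesis .
      next
        case False
        then obtain k' where k': "i = 2 ^ n + k'" using le_Suc_ex[of "2 ^ n" i] by auto
        then show ?thesis using ij k l by (simp add: c2 divide_strict_right_mono)
      qed
    qed
  qed
  have sumQ: "riemann_sum f g (Q n) r (r + ?h) = riemann_sum f g (dyadic n) r (r + a) + riemann_sum f g (dyadic n) (r + a) (r + ?h)" for n r
  proof -
    have e: "l * x * ?h = x * a" "(l + (1 - l) * x) * ?h = a + x * b" for x
    proof -
      have "l * x * ?h = x * (l * ?h)" "(l + (1 - l) * x) * ?h = l * ?h + x * ((1 - l) * ?h)"
        by (simp_all only: ac_simps distrib_left)
      then show "l * x * ?h = x * a" "(l + (1 - l) * x) * ?h = a + x * b" by (simp_all only: l)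
    qed
    have "phi ?h r (l * x) (l * y) = phi a r x y" for x y unfolding phi_def e ..
    moreover have "phi ?h r (l + (1 - l) * x) (l + (1 - l) * y) = phi b (r + a) x y" for x y
      unfolding phi_def e by (simp add: add.assoc)
    moreover have "riemann_sum f g (dyadic n) (r + a) (r + ?h) = chain_sum (phi b (r + a)) (dyadic n)"
      using riemann_sum_phi[of "dyadic n" "r + a" b] by (simp only: add.assoc)
    ultimately show ?thesis
      unfolding riemann_sum_phi csplit by (simp only: dyadic_def chain_sum_map_upt)
  qed
  have PsiQ: "chain_sum (\<lambda>u v. Psi ((v - u) * ?h)) (Q n) = 2 ^ n * Psi (a / 2 ^ n) + 2 ^ n * Psi (b / 2 ^ n)" for n
  proof -
    have d: "real (Suc k) / 2 ^ n - real k / 2 ^ n = 1 / 2 ^ n" for k by (simp add: field_simps)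
    have "(l * x - l * y) * ?h = (x - y) * (l * ?h)" "((l + (1 - l) * x) - (l + (1 - l) * y)) * ?h = (x - y) * ((1 - l) * ?h)" for x y
      by (simp_all add: algebra_simps)
    then have "(l * (real (Suc k) / 2 ^ n) - l * (real k / 2 ^ n)) * ?h = a / 2 ^ n"
      "((l + (1 - l) * (real (Suc k) / 2 ^ n)) - (l + (1 - l) * (real k / 2 ^ n))) * ?h = b / 2 ^ n" for k
      by (simp_all only: d l(3,4)) simp_all
    then show ?thesis unfolding csplit by simp
  qed
  let ?B = "\<lambda>r. J r (r + a) + J (r + a) (r + ?h)"
  have lim: "AE r in lebesgue_on {0..T - ?h}. (\<lambda>n. riemann_sum f g (Q n) r (r + ?h)) \<longlonglongrightarrow> ?B r"
  proof -
    have "AE r in lebesgue_on {0..T - a}. (\<lambda>n. riemann_sum f g (dyadic n) r (r + a)) \<longlonglongrightarrow> J r (r + a)"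
      using h by (intro J_limit finh) auto
    then have 1: "AE r in lebesgue_on {0..T - ?h}. (\<lambda>n. riemann_sum f g (dyadic n) r (r + a)) \<longlonglongrightarrow> J r (r + a)"
      using AE_lebesgue_on_shift[of _ "T - a" 0 "T - ?h"] ab by simp
    have "AE r in lebesgue_on {0..T - b}. (\<lambda>n. riemann_sum f g (dyadic n) r (r + b)) \<longlonglongrightarrow> J r (r + b)"
      using h by (intro J_limit finh) auto
    from AE_lebesgue_on_shift[OF this, of a "T - ?h"] ab
    have 2: "AE r in lebesgue_on {0..T - ?h}. (\<lambda>n. riemann_sum f g (dyadic n) (r + a) (r + ?h)) \<longlonglongrightarrow> J (r + a) (r + ?h)"
      by (simp add: add.assoc)
    from 1 2 show ?thesis unfolding sumQ by eventually_elim (rule tendsto_add)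
  qed
  have "Lp_norm_on (T - ?h) p (\<lambda>r. ?B r - J r (r + ?h)) \<le> liminf (\<lambda>n. Lp_norm_on (T - ?h) p (\<lambda>r. riemann_sum f g (Q n) r (r + ?h) - J r (r + ?h)))"
    using lim by (intro Lp_norm_on_Fatou[OF p_pos]) (auto elim!: eventually_mono intro: tendsto_intros)
  then have "N ?h (\<lambda>r. ?B r - J r (r + ?h)) \<le> liminf (\<lambda>n. N ?h (\<lambda>r. riemann_sum f g (Q n) r (r + ?h) - J r (r + ?h)))"
    unfolding N_def using m by (auto simp flip: enn_powr_Liminf intro!: enn_powr_mono)
  also have "\<dots> \<le> liminf (\<lambda>n. 2 ^ n * Psi (a / 2 ^ n) + 2 ^ n * Psi (b / 2 ^ n))"
    unfolding PsiQ[symmetric] using h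
    by (intro Liminf_mono always_eventually allI N_riemann_sum_limit Qp J_limit finh) auto
  also have "\<dots> = 0 + 0"
    using h by (intro lim_imp_Liminf tendsto_add Psi_tail_tendsto finh) auto
  finally have "Lp_norm_on (T - ?h) p (\<lambda>r. ?B r - J r (r + ?h)) = 0" by (simp add: N_def)
  then have "AE r in lebesgue_on {0..T - ?h}. ennreal \<bar>?B r - J r (r + ?h)\<bar> = 0"
    unfolding Lp_norm_on_def by (intro Lp_qnorm_eq_0[OF p_pos]) auto
  then show ?thesis by (auto elim!: eventually_mono)
qed


lemma J_additive_lborel:
  assumes h: "0 \<le> a" "0 \<le> b" and fin: "Psi T < top"
  shows "AE r in lborel. 0 \<le> r \<longrightarrow> r + (a + b) \<le> T \<longrightarrow> J r (r + (a + b)) = J r (r + a) + J (r + a) (r + (a + b))"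
proof (cases "a + b \<le> T")
  case True
  from J_additive[OF h True fin] show ?thesis
    by (auto simp: AE_lebesgue_on_iff elim!: eventually_mono)
next
  case False
  then have "0 \<le> r \<longrightarrow> \<not> r + (a + b) \<le> T" for r by auto
  then show ?thesis by simp
qed

text \<open>The oriented integral from c to t. The base point stays a parameter, because
  \<open>J\<close> is controlled for almost every starting point only and a good c has to be
  selected.\<close>

definition antideriv :: "real \<Rightarrow> real \<Rightarrow> real" where
  "antideriv c t = (if c \<le> t then J c t else - J t c)"

lemma measurable_antideriv [measurable (raw)]:
  assumes [measurable]: "a \<in> borel_measurable M" "b \<in> borel_measurable M"
  shows "(\<lambda>x. antideriv (a x) (b x)) \<in> borel_measurable M"
  unfolding antideriv_def by measurable

text \<open>The base point moves with r at a fixed offset k, so additivity for two fixed steps is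
  enough. The three cases put the base point to the right of r+h, between r and r+h, or to the left
  of r.\<close>

lemma antideriv_shift:
  assumes fin: "Psi T < top" and h: "0 \<le> h"
  shows "AE r in lborel. 0 \<le> r \<longrightarrow> r + h \<le> T \<longrightarrow> 0 \<le> r + k \<longrightarrow> r + k \<le> T \<longrightarrow>
    J r (r + h) = antideriv (r + k) (r + h) - antideriv (r + k) r"
proof -
  consider "h \<le> k" "0 < k" | "0 \<le> k" "k \<le> h" | "k < 0" using h by linarith
  then show ?thesis
  proof cases
    case 1
    with J_additive_lborel[of h "k - h", OF _ _ fin] h show ?thesis
      by (auto simp: antideriv_def elim!: eventually_mono)
  next
    case 2
    with J_additive_lborel[of k "h - k", OF _ _ fin] show ?thesis
      by (auto simp: antideriv_def elim!: eventually_mono)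
  next
    case 3
    with AE_lborel_shift[OF J_additive_lborel[of "- k" h, OF _ _ fin], of k] h show ?thesis
      by (auto simp: antideriv_def add.assoc elim!: eventually_mono)
  qed
qed

lemma antideriv_AE_AE:
  assumes fin: "Psi T < top" and h: "0 \<le> h"
  shows "AE c in lborel. AE r in lborel. 0 \<le> r \<longrightarrow> r + h \<le> T \<longrightarrow> 0 \<le> c \<longrightarrow> c \<le> T \<longrightarrow>
    J r (r + h) = antideriv c (r + h) - antideriv c r"
proof (rule AE_lborel_shear)
  fix k
  from AE_lborel_shift[OF antideriv_shift[OF fin h, of "- k"], of k]
  show "AE c in lborel. 0 \<le> c + k \<longrightarrow> (c + k) + h \<le> T \<longrightarrow> 0 \<le> c \<longrightarrow> c \<le> T \<longrightarrow>
    J (c + k) ((c + k) + h) = antideriv c ((c + k) + h) - antideriv c (c + k)"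
    by simp
qed measurable

text \<open>For almost every base point \<open>c\<close> the increments of \<open>antideriv c\<close> agree with \<open>J\<close> for almost every
  step \<open>h\<close> by Fubini; additivity of \<open>J\<close> then gives every step, as \<open>h\<close> is a sum of two good steps.\<close>

lemma antideriv_increment:
  assumes fin: "Psi T < top"
  shows "AE c in lborel. 0 \<le> c \<longrightarrow> c \<le> T \<longrightarrow> (\<forall>h. 0 \<le> h \<longrightarrow> h \<le> T \<longrightarrow>
    (AE r in lebesgue_on {0..T - h}. J r (r + h) = antideriv c (r + h) - antideriv c r))"
proof -
  define Q where "Q h c r \<longleftrightarrow> (0 \<le> h \<longrightarrow> 0 \<le> r \<longrightarrow> r + h \<le> T \<longrightarrow> 0 \<le> c \<longrightarrow> c \<le> T \<longrightarrow>
    J r (r + h) = antideriv c (r + h) - antideriv c r)" for h c r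
  have [measurable]: "Measurable.pred ((borel \<Otimes>\<^sub>M borel) \<Otimes>\<^sub>M borel) (\<lambda>x. Q (fst (fst x)) (snd (fst x)) (snd x))"
    unfolding Q_def by measurable
  \<comment> \<open>Writing the quantifier over r as a vanishing integral makes \<open>G\<close>
    measurable in (h,c), as exchanging the other two a.e. quantifiers requires.\<close>
  define G where "G h c \<longleftrightarrow> (\<integral>\<^sup>+r. indicator {r. \<not> Q h c r} r \<partial>lborel) = 0" for h c
  have [measurable]: "Measurable.pred (borel \<Otimes>\<^sub>M borel) (\<lambda>x. Q (fst x) (snd x) r)" for r
    unfolding Q_def by measurable
  have [measurable]: "Measurable.pred borel (\<lambda>r. Q h c r)" for h c
    unfolding Q_def by measurable
  have G_iff: "G h c \<longleftrightarrow> (AE r in lborel. Q h c r)" for h c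
    unfolding G_def by (subst nn_integral_0_iff_AE) (auto simp: indicator_eq_0_iff)
  have mG: "Measurable.pred (lborel \<Otimes>\<^sub>M lborel) (\<lambda>x. G (fst x) (snd x))"
  proof -
    have "(\<lambda>x. \<integral>\<^sup>+r. (if Q (fst x) (snd x) r then 0 else 1) \<partial>lborel) \<in> borel_measurable (lborel \<Otimes>\<^sub>M lborel)"
      by measurable
    moreover have "(\<lambda>x. \<integral>\<^sup>+r. (if Q (fst x) (snd x) r then 0 else 1) \<partial>lborel)
        = (\<lambda>x. \<integral>\<^sup>+r. indicator {r. \<not> Q (fst x) (snd x) r} r \<partial>lborel)"
      by (intro ext nn_integral_cong) (auto simp: indicator_def)
    ultimately have [measurable]: "(\<lambda>x. \<integral>\<^sup>+r. indicator {r. \<not> Q (fst x) (snd x) r} r \<partial>lborel) \<in> borel_measurable (lborel \<Otimes>\<^sub>M lborel)"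
      by simp
    show ?thesis unfolding G_def by measurable
  qed
  have "AE c in lborel. G h c" for h
  proof (cases "0 \<le> h")
    case True
    from antideriv_AE_AE[OF fin True] show ?thesis
      by eventually_elim (auto simp: G_iff Q_def elim!: eventually_mono)
  qed (simp add: G_iff Q_def)
  then have "AE h in lborel. AE c in lborel. G h c" by simp
  then have "AE c in lborel. AE h in lborel. G h c"
    using lborel_pair.AE_commute[OF mG[unfolded pred_def]] by simp
  then show ?thesis
  proof eventually_elim
    case (elim c)
    show ?case
    proof (intro impI allI)
      fix h assume c: "0 \<le> c" "c \<le> T" and h: "0 \<le> h" "h \<le> T"
      show "AE r in lebesgue_on {0..T - h}. J r (r + h) = antideriv c (r + h) - antideriv c r"
      proof (cases "h = 0")
        case False
        have "AE x in lborel. G (h - x) c" using AE_lborel_affine[OF elim, of "-1" h] by simp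
        with elim have "AE x in lborel. G x c \<and> G (h - x) c" by eventually_elim simp
        moreover have "0 < h" using False h by simp
        ultimately obtain x where x: "0 < x" "x < h" "G x c \<and> G (h - x) c"
          by (rule AE_lborel_witness)
        then have x: "0 < x" "x < h" "G x c" "G (h - x) c" by auto
        have "AE r in lborel. 0 \<le> r \<longrightarrow> r + h \<le> T \<longrightarrow> J r (r + h) = J r (r + x) + J (r + x) (r + h)"
          using J_additive_lborel[of x "h - x", OF _ _ fin] x by simp
        moreover have "AE r in lborel. 0 \<le> r \<longrightarrow> r + x \<le> T \<longrightarrow> J r (r + x) = antideriv c (r + x) - antideriv c r"
          using x c by (auto simp: G_iff Q_def elim!: eventually_mono)
        moreover have "AE r in lborel. 0 \<le> r + x \<longrightarrow> r + h \<le> T \<longrightarrow> J (r + x) (r + h) = antideriv c (r + h) - antideriv c (r + x)"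
          using AE_lborel_shift[OF x(4)[unfolded G_iff], of x] x c by (auto simp: Q_def elim!: eventually_mono)
        ultimately have "AE r in lborel. 0 \<le> r \<longrightarrow> r + h \<le> T \<longrightarrow> J r (r + h) = antideriv c (r + h) - antideriv c r"
          by eventually_elim (use x in auto)
        then show ?thesis by (auto simp: AE_lebesgue_on_iff elim!: eventually_mono)
      qed simp
    qed
  qed
qed

text \<open>For finite p, integrating |J|^p over both times is, after a shear, integrating the
  assumed bounds over the step, hence finite; so almost every section is finite. For p = \<infinity>
  the bound holds for almost every pair by the shear of null sets.\<close>

lemma antideriv_Lp:
  assumes T: "0 < T" and B: "B < top"
    and bound: "\<And>h. 0 \<le> h \<Longrightarrow> h \<le> T \<Longrightarrow> Lp_norm_on (T - h) p (\<lambda>r. J r (r + h)) \<le> B"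
  shows "AE c in lborel. 0 \<le> c \<longrightarrow> c \<le> T \<longrightarrow> Lp_norm_on T p (antideriv c) < top"
  using p_pos
proof (cases rule: ennreal_exponent_cases)
  case (fin s)
  define K where "K c t = (if 0 \<le> c \<and> c \<le> t \<and> t \<le> T then enn_powr (ennreal \<bar>J c t\<bar>) s else 0)" for c t
  have [measurable]: "(\<lambda>x. K (a x) (b x)) \<in> borel_measurable M"
    if [measurable]: "a \<in> borel_measurable M" "b \<in> borel_measurable M" for M and a b :: "'z \<Rightarrow> real"
    unfolding K_def by measurable
  let ?I = "\<integral>\<^sup>+c. \<integral>\<^sup>+t. K c t \<partial>lborel \<partial>lborel"
  have "?I = (\<integral>\<^sup>+h. \<integral>\<^sup>+c. K c (c + h) \<partial>lborel \<partial>lborel)"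
    by (rule nn_integral_lborel_shear) measurable
  also have "\<dots> \<le> (\<integral>\<^sup>+h. enn_powr B s * indicator {0..T} h \<partial>lborel)"
  proof (intro nn_integral_mono)
    fix h
    show "(\<integral>\<^sup>+c. K c (c + h) \<partial>lborel) \<le> enn_powr B s * indicator {0..T} h"
    proof (cases "h \<in> {0..T}")
      case True
      have "(\<integral>\<^sup>+c. K c (c + h) \<partial>lborel) = (\<integral>\<^sup>+c. enn_powr (ennreal \<bar>J c (c + h)\<bar>) s * indicator {0..T - h} c \<partial>lborel)"
        using True by (intro nn_integral_cong) (auto simp: K_def split: split_indicator)
      then show ?thesis
        using bound[of h] fin True by (simp add: Lp_norm_on_def Lp_qnorm_ennreal nn_integral_lebesgue_on enn_powr_le_swap)
    next
      case False
      then have "K c (c + h) = 0" for c by (auto simp: K_def)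
      then show ?thesis by simp
    qed
  qed
  also have "\<dots> < top"
    using T B by (simp add: nn_integral_cmult_indicator ennreal_mult_less_top)
  finally have I: "?I < top" .
  \<comment> \<open>Both orders of integration are needed, since \<open>antideriv c\<close> involves
    \<open>J c t\<close> for t \<ge> c and \<open>J t c\<close> for t < c.\<close>
  have "?I = (\<integral>\<^sup>+t. \<integral>\<^sup>+c. K c t \<partial>lborel \<partial>lborel)"
    by (rule lborel_pair.Fubini') measurable
  with I have I2: "(\<integral>\<^sup>+c. \<integral>\<^sup>+t. K t c \<partial>lborel \<partial>lborel) < top" by simp
  have "AE c in lborel. (\<integral>\<^sup>+t. K c t \<partial>lborel) \<noteq> \<infinity>"
    using I by (intro nn_integral_noteq_infinite) auto
  moreover have "AE c in lborel. (\<integral>\<^sup>+t. K t c \<partial>lborel) \<noteq> \<infinity>"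
    using I2 by (intro nn_integral_noteq_infinite) auto
  ultimately show ?thesis
  proof eventually_elim
    case (elim c)
    show ?case
    proof (intro impI)
      assume c: "0 \<le> c" "c \<le> T"
      have "(\<integral>\<^sup>+t. enn_powr (ennreal \<bar>antideriv c t\<bar>) s * indicator {0..T} t \<partial>lborel) \<le> (\<integral>\<^sup>+t. K c t + K t c \<partial>lborel)"
        using c by (intro nn_integral_mono) (auto simp: antideriv_def K_def split: split_indicator)
      also have "\<dots> = (\<integral>\<^sup>+t. K c t \<partial>lborel) + (\<integral>\<^sup>+t. K t c \<partial>lborel)"
        by (intro nn_integral_add) measurable
      also have "\<dots> < top" using elim by (auto simp: less_top)
      finally show "Lp_norm_on T p (antideriv c) < top"
        using fin by (simp add: Lp_norm_on_def Lp_qnorm_ennreal nn_integral_lebesgue_on)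
    qed
  qed
next
  case top
  define Q where "Q c t \<longleftrightarrow> (0 \<le> c \<longrightarrow> c \<le> T \<longrightarrow> 0 \<le> t \<longrightarrow> t \<le> T \<longrightarrow> ennreal \<bar>antideriv c t\<bar> \<le> B)" for c t
  have ess: "AE r in lborel. 0 \<le> r \<longrightarrow> r + h \<le> T \<longrightarrow> ennreal \<bar>J r (r + h)\<bar> \<le> B" if "0 \<le> h" for h
  proof (cases "h \<le> T")
    case True
    then have "AE r in lebesgue_on {0..T - h}. ennreal \<bar>J r (r + h)\<bar> \<le> B"
      using bound[OF that True] top by (subst esssup_le_iff[symmetric]) (auto simp: Lp_norm_on_def Lp_qnorm_top)
    then show ?thesis by (auto simp: AE_lebesgue_on_iff elim!: eventually_mono)
  next
    case False
    then have "0 \<le> r \<longrightarrow> \<not> r + h \<le> T" for r by auto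
    then show ?thesis by simp
  qed
  have "AE c in lborel. AE t in lborel. Q c t"
  proof (rule AE_lborel_shear)
    show "Measurable.pred (borel \<Otimes>\<^sub>M borel) (\<lambda>x. Q (fst x) (snd x))"
      unfolding Q_def by measurable
    show "AE c in lborel. Q c (c + k)" for k
    proof (cases "0 \<le> k")
      case True
      from ess[OF True] show ?thesis using True by (auto simp: Q_def antideriv_def elim!: eventually_mono)
    next
      case False
      with AE_lborel_shift[OF ess[of "- k"], of k] show ?thesis
        by (auto simp: Q_def antideriv_def elim!: eventually_mono)
    qed
  qed
  then show ?thesis
  proof eventually_elim
    case (elim c)
    show ?case
    proof (intro impI)
      assume "0 \<le> c" "c \<le> T"
      with elim have "AE t in lebesgue_on {0..T}. ennreal \<bar>antideriv c t\<bar> \<le> B"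
        by (auto simp: AE_lebesgue_on_iff Q_def elim!: eventually_mono)
      then have "Lp_norm_on T p (antideriv c) \<le> B"
        using top by (auto simp: Lp_norm_on_def Lp_qnorm_top)
      then show "Lp_norm_on T p (antideriv c) < top" using B by simp
    qed
  qed
qed

text \<open>The bound on \<open>f\<close> and \<open>g\<close> is only used to see that the primitive lies in \<open>L\<^sup>p\<close>.\<close>

theorem exists_integral:
  assumes T: "0 < T" and fin: "Psi T < top" and B: "B < top"
    and bound: "\<And>h. 0 \<le> h \<Longrightarrow> h \<le> T \<Longrightarrow> Lp_norm_on (T - h) p (\<lambda>r. f r * (g (r + h) - g r)) \<le> B"
  obtains I where "I \<in> borel_measurable borel" "Lp_norm_on T p I < top"
    "\<And>h. 0 \<le> h \<Longrightarrow> h \<le> T \<Longrightarrow>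
      AE r in lebesgue_on {0..T - h}. (\<lambda>n. riemann_sum f g (dyadic n) r (r + h)) \<longlonglongrightarrow> I (r + h) - I r"
proof -
  have finh: "Psi x < top" if "x \<le> T" for x using Psi_mono[OF that] fin by (rule le_less_trans)
  \<comment> \<open>The trivial partition yields the germ, bounded by \<open>B\<close>; the limit
    differs from it by at most \<open>Psi T\<close> in m-th power.\<close>
  let ?B = "enn_powr (enn_powr B m + Psi T) (1 / m)"
  have "Lp_norm_on (T - h) p (\<lambda>r. J r (r + h)) \<le> ?B" if h: "0 \<le> h" "h \<le> T" for h
  proof -
    have d0: "riemann_sum f g (dyadic 0) r (r + h) = f r * (g (r + h) - g r)" for r
      by (simp add: riemann_sum_dyadic)
    have "N h (\<lambda>r. riemann_sum f g (dyadic 0) r (r + h) - J r (r + h)) \<le> chain_sum (\<lambda>u v. Psi ((v - u) * h)) (dyadic 0)"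
      by (intro N_riemann_sum_limit h finh unit_partition_dyadic J_limit) auto
    also have "\<dots> \<le> Psi T" using h by (auto simp: chain_sum_Psi_dyadic intro: Psi_mono)
    finally have "N h (\<lambda>r. J r (r + h) - f r * (g (r + h) - g r)) \<le> Psi T"
      unfolding d0 by (subst N_diff_commute)
    moreover have "N h (\<lambda>r. f r * (g (r + h) - g r)) \<le> enn_powr B m"
      unfolding N_def using bound[OF h] m by (intro enn_powr_mono) auto
    moreover have "N h (\<lambda>r. f r * (g (r + h) - g r) + (J r (r + h) - f r * (g (r + h) - g r)))
      \<le> N h (\<lambda>r. f r * (g (r + h) - g r)) + N h (\<lambda>r. J r (r + h) - f r * (g (r + h) - g r))"
      by (rule N_add) measurable
    ultimately have "N h (\<lambda>r. J r (r + h)) \<le> enn_powr B m + Psi T"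
      by (simp add: add_mono order_trans)
    then show ?thesis unfolding N_def using m by (simp add: enn_powr_le_swap)
  qed
  moreover have "?B < top" using B fin by simp
  ultimately have "AE c in lborel. 0 \<le> c \<longrightarrow> c \<le> T \<longrightarrow> Lp_norm_on T p (antideriv c) < top"
    using T by (intro antideriv_Lp)
  with antideriv_increment[OF fin]
  have "AE c in lborel. 0 \<le> c \<longrightarrow> c \<le> T \<longrightarrow> Lp_norm_on T p (antideriv c) < top \<and> (\<forall>h. 0 \<le> h \<longrightarrow> h \<le> T \<longrightarrow>
    (AE r in lebesgue_on {0..T - h}. J r (r + h) = antideriv c (r + h) - antideriv c r))"
    by eventually_elim auto
  from AE_lborel_witness[OF this T] obtain c where "0 < c" "c < T" and
    "0 \<le> c \<longrightarrow> c \<le> T \<longrightarrow> Lp_norm_on T p (antideriv c) < top \<and> (\<forall>h. 0 \<le> h \<longrightarrow> h \<le> T \<longrightarrow>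
    (AE r in lebesgue_on {0..T - h}. J r (r + h) = antideriv c (r + h) - antideriv c r))" .
  then have c: "Lp_norm_on T p (antideriv c) < top" "\<And>h. 0 \<le> h \<Longrightarrow> h \<le> T \<Longrightarrow>
    (AE r in lebesgue_on {0..T - h}. J r (r + h) = antideriv c (r + h) - antideriv c r)"
    by auto
  show thesis
  proof (rule that[OF _ c(1)])
    fix h assume h: "0 \<le> h" "h \<le> T"
    from c(2)[OF h] J_limit[OF h finh[OF h(2)]]
    show "AE r in lebesgue_on {0..T - h}. (\<lambda>n. riemann_sum f g (dyadic n) r (r + h)) \<longlonglongrightarrow> antideriv c (r + h) - antideriv c r"
      by eventually_elim simp
  qed measurable
qed

end

subsection \<open>Moduli on dyadic scales\<close>

lemma space_dlog [simp]: "space (dlog T) = {0<..T}"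
  by (simp add: dlog_def)

lemma measurable_dlog [measurable (raw)]:
  "f \<in> borel_measurable borel \<Longrightarrow> f \<in> borel_measurable (dlog T)"
  unfolding dlog_def by (simp add: measurable_lebesgue_on_borel)

lemma nn_integral_dlog:
  assumes [measurable]: "F \<in> borel_measurable borel"
  shows "(\<integral>\<^sup>+\<tau>. F \<tau> \<partial>dlog T) = (\<integral>\<^sup>+\<tau>. F \<tau> * ennreal (1 / \<tau>) * indicator {0<..T} \<tau> \<partial>lborel)"
  unfolding dlog_def
  by (subst nn_integral_density) (auto simp: nn_integral_lebesgue_on ac_simps)

lemma AE_dlog_iff: "(AE \<tau> in dlog T. P \<tau>) \<longleftrightarrow> (AE \<tau> in lborel. 0 < \<tau> \<longrightarrow> \<tau> \<le> T \<longrightarrow> P \<tau>)"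
  unfolding dlog_def
  by (subst AE_density) (auto simp: AE_lebesgue_on_iff intro!: AE_cong)

text \<open>Invariance of d\<tau>/\<tau> under dilation: evaluating a function at smaller scales
  costs nothing in norm, and bounds come out uniform in T.\<close>

lemma Lp_qnorm_dlog_scale:
  assumes q: "0 < q" and c: "0 < c" and [measurable]: "F \<in> borel_measurable borel"
  shows "Lp_qnorm (dlog T) q (\<lambda>\<tau>. F (c * \<tau>)) = Lp_qnorm (dlog (c * T)) q F"
  using q
proof (cases rule: ennreal_exponent_cases)
  case (fin s)
  have "(\<integral>\<^sup>+\<tau>. enn_powr (F \<tau>) s * ennreal (1 / \<tau>) * indicator {0<..c * T} \<tau> \<partial>lborel)
     = (\<integral>\<^sup>+\<tau>. ennreal c * (enn_powr (F (c * \<tau>)) s * ennreal (1 / (c * \<tau>)) * indicator {0<..c * T} (c * \<tau>)) \<partial>lborel)"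
    using c by (subst nn_integral_real_affine[where c = c and t = 0]) (auto simp: nn_integral_cmult)
  also have "\<dots> = (\<integral>\<^sup>+\<tau>. enn_powr (F (c * \<tau>)) s * ennreal (1 / \<tau>) * indicator {0<..T} \<tau> \<partial>lborel)"
  proof (intro nn_integral_cong)
    fix \<tau>
    have "ennreal c * ennreal (1 / (c * \<tau>)) = ennreal (1 / \<tau>)" if "0 < \<tau>"
      using c that by (simp flip: ennreal_mult)
    then have "ennreal c * (x * ennreal (1 / (c * \<tau>))) = x * ennreal (1 / \<tau>)" if "0 < \<tau>" for x
      using that by (metis mult.left_commute)
    then show "ennreal c * (enn_powr (F (c * \<tau>)) s * ennreal (1 / (c * \<tau>)) * indicator {0<..c * T} (c * \<tau>))
       = enn_powr (F (c * \<tau>)) s * ennreal (1 / \<tau>) * indicator {0<..T} \<tau>"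
      using c by (auto simp: zero_less_mult_iff split: split_indicator)
  qed
  finally show ?thesis using fin by (simp add: Lp_qnorm_ennreal nn_integral_dlog)
next
  case top
  have "(AE \<tau> in dlog T. F (c * \<tau>) \<le> d) \<longleftrightarrow> (AE \<tau> in dlog (c * T). F \<tau> \<le> d)" for d
  proof
    assume "AE \<tau> in dlog T. F (c * \<tau>) \<le> d"
    from AE_lborel_affine[OF this[unfolded AE_dlog_iff], of "1 / c" 0] c
    show "AE \<tau> in dlog (c * T). F \<tau> \<le> d"
      by (auto simp: AE_dlog_iff field_simps elim!: eventually_mono)
  next
    assume "AE \<tau> in dlog (c * T). F \<tau> \<le> d"
    from AE_lborel_affine[OF this[unfolded AE_dlog_iff], of c 0] c
    show "AE \<tau> in dlog T. F (c * \<tau>) \<le> d"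
      by (auto simp: AE_dlog_iff elim!: eventually_mono)
  qed
  then have "esssup (dlog T) (\<lambda>\<tau>. F (c * \<tau>)) \<le> d \<longleftrightarrow> esssup (dlog (c * T)) F \<le> d" for d
    by (subst (1 2) esssup_le_iff) auto
  then show ?thesis using top by (auto simp: Lp_qnorm_top intro!: antisym)
qed

lemma Lp_qnorm_dlog_mono_interval:
  assumes q: "0 < q" and ST: "S \<le> T" and [measurable]: "F \<in> borel_measurable borel"
  shows "Lp_qnorm (dlog S) q F \<le> Lp_qnorm (dlog T) q F"
  using q
proof (cases rule: ennreal_exponent_cases)
  case (fin s)
  then show ?thesis using ST
    by (auto simp: Lp_qnorm_ennreal nn_integral_dlog intro!: enn_powr_mono nn_integral_mono mult_left_mono split: split_indicator)
next
  case top
  have "AE \<tau> in dlog T. F \<tau> \<le> esssup (dlog T) F" by (rule esssup_AE)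
  then have "AE \<tau> in dlog S. F \<tau> \<le> esssup (dlog T) F"
    using ST by (auto simp: AE_dlog_iff elim!: eventually_mono)
  then show ?thesis using top by (auto simp: Lp_qnorm_top)
qed

lemma borel_measurable_mono_ennreal:
  fixes F :: "real \<Rightarrow> ennreal"
  assumes "\<And>x y. x \<le> y \<Longrightarrow> F x \<le> F y"
  shows "F \<in> borel_measurable borel"
proof (rule borel_measurableI_greater)
  fix c
  have "is_interval {x. c < F x}"
    using assms by (auto simp: is_interval_1 intro: less_le_trans)
  then have "convex {x. c < F x}" by (simp add: is_interval_convex_1)
  then show "{x \<in> space borel. c < F x} \<in> sets borel" by (simp add: real_interval_borel_measurable is_interval_convex_1)
qed

lemma Lp_qnorm_dlog_powr:
  assumes q: "0 < q" and a: "0 < a"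
  shows "\<exists>C\<ge>0. \<forall>T>0. Lp_qnorm (dlog T) q (\<lambda>\<tau>. ennreal (\<tau> powr a)) \<le> ennreal (C * T powr a)"
  using q
proof (cases rule: ennreal_exponent_cases)
  case (fin s)
  have "Lp_qnorm (dlog T) q (\<lambda>\<tau>. ennreal (\<tau> powr a)) \<le> ennreal ((1 / (a * s)) powr (1 / s) * T powr a)" if T: "0 < T" for T
  proof -
    have "(\<integral>\<^sup>+\<tau>. enn_powr (ennreal (\<tau> powr a)) s \<partial>dlog T) = (\<integral>\<^sup>+\<tau>. ennreal (indicator {0..T} \<tau> * \<tau> powr (a * s - 1)) \<partial>lborel)"
    proof (subst nn_integral_dlog, measurable, intro nn_integral_cong)
      fix \<tau>
      show "enn_powr (ennreal (\<tau> powr a)) s * ennreal (1 / \<tau>) * indicator {0<..T} \<tau> = ennreal (indicator {0..T} \<tau> * \<tau> powr (a * s - 1))"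
        using T by (cases "\<tau> = 0") (auto simp: enn_powr_ennreal powr_powr powr_diff simp flip: ennreal_mult split: split_indicator)
    qed
    also have "\<dots> = ennreal (T powr (a * s - 1 + 1) / (a * s - 1 + 1))"
      using T a fin by (intro nn_integral_has_integral_lebesgue has_integral_powr_from_0) auto
    finally show ?thesis
      using fin a T by (simp add: Lp_qnorm_ennreal enn_powr_ennreal powr_divide powr_powr field_simps)
  qed
  then show ?thesis by (intro exI[of _ "(1 / (a * s)) powr (1 / s)"]) auto
next
  case top
  have "AE \<tau> in dlog T. ennreal (\<tau> powr a) \<le> ennreal (1 * T powr a)" for T
    using a by (auto simp: AE_dlog_iff intro!: ennreal_leI powr_mono2 AE_I2)
  then show ?thesis using top by (intro exI[of _ 1]) (auto simp: Lp_qnorm_top)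
qed

text \<open>The exact value is log 4. Bounding 1/u below by 2/\<tau> on the first piece and by
  1/\<tau> on the second gives 1/2 + 1/2.\<close>

lemma dlog_mass:
  assumes t: "0 < \<tau>"
  shows "1 \<le> (\<integral>\<^sup>+u. ennreal (1 / u) * indicator {\<tau> / 4<..\<tau>} u \<partial>lborel)"
proof -
  have "1 = ennreal (2 / \<tau> * (\<tau> / 2 - \<tau> / 4) + 1 / \<tau> * (\<tau> - \<tau> / 2))"
    using t by (simp add: field_simps)
  also have "\<dots> = ennreal (2 / \<tau>) * emeasure lborel {\<tau> / 4<..\<tau> / 2} + ennreal (1 / \<tau>) * emeasure lborel {\<tau> / 2<..\<tau>}"
  proof -
    have "ennreal (a * b + c * d) = ennreal a * ennreal b + ennreal c * ennreal d"
      if "0 \<le> a" "0 \<le> b" "0 \<le> c" "0 \<le> d" for a b c d using that by (simp add: ennreal_mult)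
    moreover have "emeasure lborel {\<tau> / 4<..\<tau> / 2} = ennreal (\<tau> / 2 - \<tau> / 4)" "emeasure lborel {\<tau> / 2<..\<tau>} = ennreal (\<tau> - \<tau> / 2)"
      using t by (auto intro!: emeasure_lborel_Ioc)
    moreover have "0 \<le> 2 / \<tau>" "0 \<le> \<tau> / 2 - \<tau> / 4" "0 \<le> 1 / \<tau>" "0 \<le> \<tau> - \<tau> / 2" using t by auto
    ultimately show ?thesis by (simp only:)
  qed
  also have "\<dots> = (\<integral>\<^sup>+u. ennreal (2 / \<tau>) * indicator {\<tau> / 4<..\<tau> / 2} u + ennreal (1 / \<tau>) * indicator {\<tau> / 2<..\<tau>} u \<partial>lborel)"
    by (subst nn_integral_add) (auto simp: nn_integral_cmult_indicator)
  also have "\<dots> \<le> (\<integral>\<^sup>+u. ennreal (1 / u) * indicator {\<tau> / 4<..\<tau>} u \<partial>lborel)"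
  proof (intro nn_integral_mono)
    fix u
    have "2 / \<tau> \<le> 1 / u" if "0 < u" "u \<le> \<tau> / 2" using t that by (simp add: field_simps)
    moreover have "1 / \<tau> \<le> 1 / u" if "0 < u" "u \<le> \<tau>" using t that by (simp add: field_simps)
    ultimately show "ennreal (2 / \<tau>) * indicator {\<tau> / 4<..\<tau> / 2} u + ennreal (1 / \<tau>) * indicator {\<tau> / 2<..\<tau>} u
       \<le> ennreal (1 / u) * indicator {\<tau> / 4<..\<tau>} u"
      using t by (auto split: split_indicator intro!: ennreal_leI)
  qed
  finally show ?thesis .
qed

text \<open>Log-mass at least 1 turns a lower bound on the window into one for the norm, with
  constant 1 for every q.\<close>

lemma Lp_qnorm_dlog_ge:
  assumes q: "0 < q" and t: "0 < \<tau>" "\<tau> \<le> T" and [measurable]: "F \<in> borel_measurable borel"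
    and c: "\<And>u. \<tau> / 4 < u \<Longrightarrow> u \<le> \<tau> \<Longrightarrow> c \<le> F u"
  shows "c \<le> Lp_qnorm (dlog T) q F"
  using q
proof (cases rule: ennreal_exponent_cases)
  case (fin s)
  have "enn_powr c s \<le> enn_powr c s * (\<integral>\<^sup>+u. ennreal (1 / u) * indicator {\<tau> / 4<..\<tau>} u \<partial>lborel)"
    using mult_left_mono[OF dlog_mass[OF t(1)], of "enn_powr c s"] by simp
  also have "\<dots> = (\<integral>\<^sup>+u. enn_powr c s * (ennreal (1 / u) * indicator {\<tau> / 4<..\<tau>} u) \<partial>lborel)"
    by (subst nn_integral_cmult) auto
  also have "\<dots> \<le> (\<integral>\<^sup>+u. enn_powr (F u) s * ennreal (1 / u) * indicator {0<..T} u \<partial>lborel)"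
    using t fin by (intro nn_integral_mono) (auto intro!: mult_right_mono enn_powr_mono c split: split_indicator)
  also have "\<dots> = (\<integral>\<^sup>+u. enn_powr (F u) s \<partial>dlog T)"
    by (simp add: nn_integral_dlog)
  finally show ?thesis using fin by (simp add: Lp_qnorm_ennreal enn_powr_le_swap)
next
  case top
  have "AE u in lborel. 0 < u \<longrightarrow> u \<le> T \<longrightarrow> F u \<le> esssup (dlog T) F"
    unfolding AE_dlog_iff[symmetric] by (rule esssup_AE)
  moreover have "\<tau> / 4 < \<tau>" using t by simp
  ultimately obtain u where "\<tau> / 4 < u" "u < \<tau>" "0 < u \<longrightarrow> u \<le> T \<longrightarrow> F u \<le> esssup (dlog T) F"
    by (rule AE_lborel_witness)
  then show ?thesis using c[of u] t top by (auto simp: Lp_qnorm_top)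
qed

lemma divide_powr_cancel: "0 < u \<Longrightarrow> x / ennreal (u powr a) * ennreal (u powr a) = x"
proof -
  assume "0 < u"
  then have "ennreal (u powr a) / ennreal (u powr a) = 1" by (intro ennreal_divide_self) auto
  then show ?thesis by (simp add: ennreal_divide_times)
qed

lemma divide_powr_mono:
  fixes x y :: ennreal
  assumes "x \<le> y" "0 < u" "u \<le> \<tau>" "0 \<le> a"
  shows "x / ennreal (\<tau> powr a) \<le> y / ennreal (u powr a)"
proof -
  have "inverse (ennreal (\<tau> powr a)) \<le> inverse (ennreal (u powr a))"
    using assms by (auto intro!: ennreal_leI powr_mono2)
  with assms show ?thesis unfolding divide_ennreal_def by (intro mult_mono) auto
qed

text \<open>The mass of \<open>[\<tau>/4,\<tau>]\<close> is at least one, so that the constants below do not depend on \<open>q\<close>.\<close>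

lemma weighted_sup_le:
  fixes X :: "real \<Rightarrow> ennreal"
  assumes q: "0 < q" and X: "\<And>x y. x \<le> y \<Longrightarrow> X x \<le> X y" and K: "\<And>x. X (2 * x) \<le> K * X x" "K < top"
    and t: "0 < \<tau>" "\<tau> \<le> T" and a: "0 \<le> a"
  shows "X \<tau> / ennreal (\<tau> powr a) \<le> K * K * Lp_qnorm (dlog T) q (\<lambda>u. X u / ennreal (u powr a))"
proof -
  have [measurable]: "X \<in> borel_measurable borel" using X by (rule borel_measurable_mono_ennreal)
  have "X \<tau> / ennreal (\<tau> powr a) \<le> Lp_qnorm (dlog T) q (\<lambda>u. K * K * (X u / ennreal (u powr a)))"
  proof (rule Lp_qnorm_dlog_ge[OF q t])
    fix u assume u: "\<tau> / 4 < u" "u \<le> \<tau>"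
    have "X \<tau> \<le> K * X (\<tau> / 2)" "X (\<tau> / 2) \<le> K * X (\<tau> / 4)" using K(1)[of "\<tau> / 2"] K(1)[of "\<tau> / 4"] by auto
    then have "X \<tau> \<le> K * (K * X (\<tau> / 4))" by (meson mult_left_mono order_trans zero_le)
    also have "\<dots> \<le> K * (K * X u)" using X[of "\<tau> / 4" u] u by (intro mult_left_mono) auto
    finally show "X \<tau> / ennreal (\<tau> powr a) \<le> K * K * (X u / ennreal (u powr a))"
      using divide_powr_mono[of "X \<tau>" "K * (K * X u)" u \<tau> a] u t a by (simp add: ennreal_times_divide mult.assoc)
  qed measurable
  also have "\<dots> = K * K * Lp_qnorm (dlog T) q (\<lambda>u. X u / ennreal (u powr a))"
    using K(2) q by (intro Lp_qnorm_cmult) (auto simp: ennreal_mult_less_top)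
  finally show ?thesis .
qed

section \<open>Sums over dyadic scales in the critical and the subcritical case\<close>

lemma suminf_pairs_ennreal: "(\<Sum>n. F n) = (\<Sum>n. F (2 * n) + F (Suc (2 * n)) :: ennreal)"
proof (rule LIMSEQ_unique)
  show "(\<lambda>n. \<Sum>k<2 * n. F k) \<longlonglongrightarrow> (\<Sum>n. F n)"
    by (rule filterlim_compose[OF tendsto_suminf_ennreal mult_nat_left_at_top]) simp
  show "(\<lambda>n. \<Sum>k<2 * n. F k) \<longlonglongrightarrow> (\<Sum>n. F (2 * n) + F (Suc (2 * n)))"
    unfolding sum_double by (rule tendsto_suminf_ennreal)
qed

text \<open>At the critical exponent 1/m the weight 4^n is absorbed exactly: 4^n Z(u)^m = \<tau>
  W(u)^m for u = \<tau>/4^n and \<open>W\<close> the weighted \<open>Z\<close>. Levels 2n and 2n+1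
  are paired (whence 3 = 1 + 2) so that the scales \<tau>/4^n fit the windows of log-mass at least
  1. These windows are disjoint, so the sum of the powers is at most one integral; comparison inside
  a window doubles twice, which gives \<open>K * K\<close>.\<close>

lemma critical_sum_le:
  fixes Z :: "real \<Rightarrow> ennreal"
  assumes m: "0 < m" and q: "0 < q" "q \<le> ennreal m" and Z: "\<And>x y. x \<le> y \<Longrightarrow> Z x \<le> Z y"
    and K: "\<And>x. Z (2 * x) \<le> K * Z x" "K < top" and t: "0 < \<tau>"
  shows "(\<Sum>n. 2 ^ n * enn_powr (Z (\<tau> / 2 ^ n)) m)
    \<le> 3 * ennreal \<tau> * enn_powr (K * K * Lp_qnorm (dlog \<tau>) q (\<lambda>u. Z u / ennreal (u powr (1 / m)))) m"
proof -
  have [measurable]: "Z \<in> borel_measurable borel" using Z by (rule borel_measurable_mono_ennreal)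
  obtain s where s: "0 < s" "q = ennreal s" using q by (cases q) (auto simp: top_unique)
  have sm: "s \<le> m" using q s m by simp
  have KK: "Z x \<le> K * (K * Z (x / 4))" for x
  proof -
    have "Z x \<le> K * Z (x / 2)" "Z (x / 2) \<le> K * Z (x / 4)" using K(1)[of "x / 2"] K(1)[of "x / 4"] by auto
    then show ?thesis by (meson mult_left_mono order_trans zero_le)
  qed
  define W where "W u = Z u / ennreal (u powr (1 / m))" for u
  have [measurable]: "W \<in> borel_measurable borel" unfolding W_def by measurable
  define G where "G u = enn_powr (K * K * W u) s" for u
  have [measurable]: "G \<in> borel_measurable borel" unfolding G_def by measurable
  have "(\<Sum>n. 2 ^ n * enn_powr (Z (\<tau> / 2 ^ n)) m) \<le> (\<Sum>n. 3 * ennreal \<tau> * enn_powr (W (\<tau> / 4 ^ n)) m)"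
  proof (subst suminf_pairs_ennreal, intro suminf_le)
    fix n
    have "Z (\<tau> / 2 ^ Suc (2 * n)) \<le> Z (\<tau> / 2 ^ (2 * n))"
      using t by (intro Z divide_left_mono) (auto intro: power_increasing)
    then have "2 ^ (2 * n) * enn_powr (Z (\<tau> / 2 ^ (2 * n))) m + 2 ^ Suc (2 * n) * enn_powr (Z (\<tau> / 2 ^ Suc (2 * n))) m
      \<le> 2 ^ (2 * n) * enn_powr (Z (\<tau> / 2 ^ (2 * n))) m + 2 ^ Suc (2 * n) * enn_powr (Z (\<tau> / 2 ^ (2 * n))) m"
      using m by (intro add_left_mono mult_left_mono enn_powr_mono) auto
    also have "\<dots> = 3 * (4 ^ n * enn_powr (Z (\<tau> / 4 ^ n)) m)"
    proof -
      have "(2::ennreal) ^ (2 * n) = 4 ^ n" "(2::real) ^ (2 * n) = 4 ^ n" by (simp_all add: power_mult)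
      moreover have "x + 2 * x = 3 * x" for x :: ennreal
        by (metis distrib_right mult_1 one_plus_numeral semiring_norm(4) semiring_norm(3) numeral_plus_one numeral_One add.commute)
      ultimately show ?thesis by (simp add: mult.assoc)
    qed
    also have "4 ^ n * enn_powr (Z (\<tau> / 4 ^ n)) m = ennreal \<tau> * enn_powr (W (\<tau> / 4 ^ n)) m"
    proof -
      let ?u = "\<tau> / 4 ^ n"
      have u: "0 < ?u" using t by simp
      have "Z ?u = W ?u * ennreal (?u powr (1 / m))"
        using u by (simp add: W_def divide_powr_cancel)
      then have "enn_powr (Z ?u) m = enn_powr (W ?u) m * ennreal ?u"
        using u m t by (simp add: enn_powr_mult enn_powr_ennreal powr_powr)
      moreover have "4 ^ n * ennreal ?u = ennreal \<tau>"
      proof -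
        have "(4::ennreal) ^ n = ennreal (4 ^ n)" by (metis ennreal_numeral ennreal_power zero_le_numeral)
        then show ?thesis using t by (simp flip: ennreal_mult)
      qed
      ultimately show ?thesis by (metis mult.assoc mult.commute)
    qed
    finally show "2 ^ (2 * n) * enn_powr (Z (\<tau> / 2 ^ (2 * n))) m + 2 ^ Suc (2 * n) * enn_powr (Z (\<tau> / 2 ^ Suc (2 * n))) m
       \<le> 3 * ennreal \<tau> * enn_powr (W (\<tau> / 4 ^ n)) m" by (simp add: mult.assoc)
  qed auto
  also have "\<dots> = 3 * ennreal \<tau> * (\<Sum>n. enn_powr (W (\<tau> / 4 ^ n)) m)" by simp
  \<comment> \<open>The inclusion of l^s in l^m for s \<le> m; this is where q \<le> m
    enters.\<close>
  also have "(\<Sum>n. enn_powr (W (\<tau> / 4 ^ n)) m) \<le> enn_powr (\<Sum>n. enn_powr (W (\<tau> / 4 ^ n)) s) (m / s)"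
    using enn_powr_suminf_le[of "s / m" "\<lambda>n. enn_powr (W (\<tau> / 4 ^ n)) m"] s m sm
    by (simp add: enn_powr_powr enn_powr_le_swap)
  also have "(\<Sum>n. enn_powr (W (\<tau> / 4 ^ n)) s) \<le> (\<integral>\<^sup>+u. G u \<partial>dlog \<tau>)"
  proof -
    define A where "A n = {\<tau> / 4 ^ Suc n<..\<tau> / 4 ^ n}" for n
    have mono: "\<tau> / 4 ^ j \<le> \<tau> / 4 ^ i" if "i \<le> j" for i j
      using t that by (intro divide_left_mono power_increasing) auto
    have disj: "disjoint_family A"
      unfolding disjoint_family_on_def
    proof (intro ballI impI)
      fix i j :: nat assume "i \<noteq> j"
      then consider "Suc i \<le> j" | "Suc j \<le> i" by linarith
      then show "A i \<inter> A j = {}"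
        by cases (use mono[of "Suc i" j] mono[of "Suc j" i] in \<open>auto simp: A_def\<close>)
    qed
    have "(\<Sum>n. enn_powr (W (\<tau> / 4 ^ n)) s) \<le> (\<Sum>n. \<integral>\<^sup>+u. G u * ennreal (1 / u) * indicator (A n) u \<partial>lborel)"
    proof (intro suminf_le)
      fix n
      let ?t = "\<tau> / 4 ^ n"
      have t0: "0 < ?t" using t by simp
      have A: "A n = {?t / 4<..?t}" by (simp add: A_def mult.commute)
      have le: "W ?t \<le> K * K * W u" if u: "?t / 4 < u" "u \<le> ?t" for u
      proof -
        have "Z ?t \<le> K * (K * Z (?t / 4))" by (rule KK)
        also have "\<dots> \<le> K * (K * Z u)" using Z[of "?t / 4" u] u by (intro mult_left_mono) auto
        finally show ?thesis
          unfolding W_def using divide_powr_mono[of "Z ?t" "K * (K * Z u)" u ?t "1 / m"] u t0 m by (simp add: ennreal_times_divide mult.assoc)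
      qed
      have "enn_powr (W ?t) s \<le> enn_powr (W ?t) s * (\<integral>\<^sup>+u. ennreal (1 / u) * indicator {?t / 4<..?t} u \<partial>lborel)"
        using mult_left_mono[OF dlog_mass[OF t0], of "enn_powr (W ?t) s"] by simp
      also have "\<dots> = (\<integral>\<^sup>+u. enn_powr (W ?t) s * (ennreal (1 / u) * indicator {?t / 4<..?t} u) \<partial>lborel)"
        by (subst nn_integral_cmult) auto
      also have "\<dots> \<le> (\<integral>\<^sup>+u. G u * ennreal (1 / u) * indicator (A n) u \<partial>lborel)"
        using le s unfolding A G_def
        by (intro nn_integral_mono) (auto intro!: mult_right_mono enn_powr_mono simp del: divide_divide_eq_left split: split_indicator)
      finally show "enn_powr (W ?t) s \<le> (\<integral>\<^sup>+u. G u * ennreal (1 / u) * indicator (A n) u \<partial>lborel)" .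
    qed auto
    also have "\<dots> = (\<integral>\<^sup>+u. (\<Sum>n. G u * ennreal (1 / u) * indicator (A n) u) \<partial>lborel)"
      by (intro nn_integral_suminf[symmetric]) (auto simp: A_def)
    also have "\<dots> = (\<integral>\<^sup>+u. G u * ennreal (1 / u) * indicator (\<Union>n. A n) u \<partial>lborel)"
      using disj by (simp add: suminf_indicator)
    also have "\<dots> \<le> (\<integral>\<^sup>+u. G u * ennreal (1 / u) * indicator {0<..\<tau>} u \<partial>lborel)"
    proof (intro nn_integral_mono mult_left_mono)
      have "(\<Union>n. A n) \<subseteq> {0<..\<tau>}"
      proof safe
        fix u n assume "u \<in> A n"
        then have "\<tau> / 4 ^ Suc n < u" "u \<le> \<tau> / 4 ^ n" by (auto simp: A_def)
        moreover have "0 < \<tau> / 4 ^ Suc n" using t by simp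
        ultimately show "u \<in> {0<..\<tau>}" using mono[of 0 n] by (auto simp del: power_Suc)
      qed
      then show "indicator (\<Union>n. A n) u \<le> (indicator {0<..\<tau>} u :: ennreal)" for u
        using subsetD[of "\<Union>n. A n" "{0<..\<tau>}" u] by (auto simp: indicator_def)
    qed auto
    also have "\<dots> = (\<integral>\<^sup>+u. G u \<partial>dlog \<tau>)" by (simp add: nn_integral_dlog)
    finally show ?thesis .
  qed
  also have "enn_powr (\<integral>\<^sup>+u. G u \<partial>dlog \<tau>) (m / s) = enn_powr (Lp_qnorm (dlog \<tau>) q (\<lambda>u. K * K * W u)) m"
    using s by (simp add: Lp_qnorm_ennreal G_def enn_powr_powr)
  also have "Lp_qnorm (dlog \<tau>) q (\<lambda>u. K * K * W u) = K * K * Lp_qnorm (dlog \<tau>) q W"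
    using K(2) q by (intro Lp_qnorm_cmult) (auto simp: ennreal_mult_less_top)
  finally show ?thesis
    using m s by (simp add: mult_left_mono enn_powr_mono W_def[abs_def])
qed

lemma suminf_geometric_ennreal:
  assumes "0 \<le> r" "r < 1"
  shows "(\<Sum>n. ennreal (r ^ n)) = ennreal (1 / (1 - r))"
  using assms by (simp add: suminf_ennreal2 suminf_geometric)

lemma min_exponent:
  assumes "0 < (q::ennreal)"
  shows "0 < enn2real (min 1 q)" "enn2real (min 1 q) \<le> 1" "ennreal (enn2real (min 1 q)) \<le> q"
    "ennreal (enn2real (min 1 q)) = min 1 q"
proof -
  have *: "ennreal (enn2real (min 1 q)) = min 1 q" by (intro ennreal_enn2real) (auto simp: min_less_iff_disj)
  then show "ennreal (enn2real (min 1 q)) = min 1 q" .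
  show "ennreal (enn2real (min 1 q)) \<le> q" using * by simp
  have "0 < ennreal (enn2real (min 1 q))" unfolding * using assms by simp
  then show "0 < enn2real (min 1 q)" by simp
  show "enn2real (min 1 q) \<le> 1" using * by (metis ennreal_le_1 min.cobounded1)
qed

text \<open>After division by \<tau>^a the series has the ratio r = c 2^-a < 1 and its terms are
  dilates of one weighted function, whose norms do not exceed the original one. The power l = min 1
  q makes the q-norm subadditive. \<open>C\<close> precedes T and \<open>X\<close>, so it depends on
  q, c and a alone.\<close>

lemma dyadic_scales_norm_le:
  assumes q: "0 < q" and c: "0 < c" "c < 2 powr a"
  shows "\<exists>C::real. 0 \<le> C \<and> (\<forall>T>0. \<forall>X. (\<forall>x y. x \<le> y \<longrightarrow> X x \<le> X y) \<longrightarrow>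
    Lp_qnorm (dlog T) q (\<lambda>\<tau>. (\<Sum>n. ennreal (c ^ n) * X (\<tau> / 2 ^ n)) / ennreal (\<tau> powr a))
     \<le> ennreal C * Lp_qnorm (dlog T) q (\<lambda>\<tau>. X \<tau> / ennreal (\<tau> powr a)))"
proof -
  define l where "l = enn2real (min 1 q)"
  have l: "0 < l" "l \<le> 1" "ennreal l \<le> q" using min_exponent[OF q] by (auto simp: l_def)
  define r where "r = c * 2 powr - a"
  have r: "0 < r" "r < 1" using c by (auto simp: r_def powr_minus field_simps)
  have rl: "0 \<le> r powr l" "r powr l < 1" using r l powr_less_mono2[of l r 1] by auto
  define S where "S = 1 / (1 - r powr l)"
  have S: "(\<Sum>n. ennreal ((r powr l) ^ n)) = ennreal S" "0 \<le> S"
    unfolding S_def by (rule suminf_geometric_ennreal[OF rl]) (use rl in simp)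
  show ?thesis
  proof (intro exI[of _ "S powr (1 / l)"] conjI allI impI)
    fix T :: real and X :: "real \<Rightarrow> ennreal" assume T: "0 < T" and X: "\<forall>x y. x \<le> y \<longrightarrow> X x \<le> X y"
    have [measurable]: "X \<in> borel_measurable borel" using X by (intro borel_measurable_mono_ennreal) auto
    define W where "W \<tau> = X \<tau> / ennreal (\<tau> powr a)" for \<tau>
    have [measurable]: "W \<in> borel_measurable borel" unfolding W_def by measurable
    have pw: "(\<Sum>n. ennreal (c ^ n) * X (\<tau> / 2 ^ n)) / ennreal (\<tau> powr a) = (\<Sum>n. ennreal (r ^ n) * W (\<tau> / 2 ^ n))" if t: "0 < \<tau>" for \<tau>
      unfolding ennreal_suminf_divide[symmetric]
    proof (intro arg_cong[where f = suminf] ext)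
      fix n
      let ?u = "\<tau> / 2 ^ n"
      have u: "0 < ?u" using t by simp
      have "ennreal (c ^ n) * X ?u / ennreal (\<tau> powr a) = ennreal (c ^ n) * (W ?u * ennreal (?u powr a)) / ennreal (\<tau> powr a)"
        using u by (simp add: W_def divide_powr_cancel)
      also have "\<dots> = (ennreal (c ^ n) * (ennreal (?u powr a) / ennreal (\<tau> powr a))) * W ?u"
        by (simp only: ennreal_times_divide divide_ennreal_def ac_simps)
      also have "ennreal (c ^ n) * (ennreal (?u powr a) / ennreal (\<tau> powr a)) = ennreal (c ^ n * (?u powr a / \<tau> powr a))"
        using t c by (simp add: divide_ennreal flip: ennreal_mult)
      also have "c ^ n * (?u powr a / \<tau> powr a) = r ^ n"
        using t by (simp add: r_def power_mult_distrib power_divide powr_divide powr_power powr_minus_divide powr_realpow[symmetric] powr_powr mult.commute)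
      finally show "ennreal (c ^ n) * X ?u / ennreal (\<tau> powr a) = ennreal (r ^ n) * W ?u" .
    qed
    have "enn_powr (Lp_qnorm (dlog T) q (\<lambda>\<tau>. \<Sum>n. ennreal (r ^ n) * W (\<tau> / 2 ^ n))) l
      \<le> (\<Sum>n. enn_powr (Lp_qnorm (dlog T) q (\<lambda>\<tau>. ennreal (r ^ n) * W (\<tau> / 2 ^ n))) l)"
      by (intro Lp_qnorm_suminf_quasi l) measurable
    also have "\<dots> \<le> (\<Sum>n. ennreal ((r powr l) ^ n) * enn_powr (Lp_qnorm (dlog T) q W) l)"
    proof (intro suminf_le)
      fix n
      have "Lp_qnorm (dlog T) q (\<lambda>\<tau>. W (1 / 2 ^ n * \<tau>)) = Lp_qnorm (dlog (1 / 2 ^ n * T)) q W"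
        using q by (intro Lp_qnorm_dlog_scale) auto
      also have "\<dots> \<le> Lp_qnorm (dlog T) q W"
      proof -
        have "1 / 2 ^ n * T \<le> 1 * T" using T by (intro mult_right_mono) (auto simp: field_simps)
        then show ?thesis using q by (intro Lp_qnorm_dlog_mono_interval) auto
      qed
      finally have "Lp_qnorm (dlog T) q (\<lambda>\<tau>. ennreal (r ^ n) * W (\<tau> / 2 ^ n)) \<le> ennreal (r ^ n) * Lp_qnorm (dlog T) q W"
        using q by (subst Lp_qnorm_cmult) (auto intro: mult_left_mono)
      then have "enn_powr (Lp_qnorm (dlog T) q (\<lambda>\<tau>. ennreal (r ^ n) * W (\<tau> / 2 ^ n))) l \<le> enn_powr (ennreal (r ^ n) * Lp_qnorm (dlog T) q W) l"
        using l by (intro enn_powr_mono) auto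
      also have "\<dots> = ennreal ((r powr l) ^ n) * enn_powr (Lp_qnorm (dlog T) q W) l"
      proof -
        have "(r ^ n) powr l = (r powr l) ^ n" using r by (simp add: powr_realpow[symmetric] powr_powr powr_power mult.commute)
        then show ?thesis using r by (simp add: enn_powr_mult enn_powr_ennreal)
      qed
      finally show "enn_powr (Lp_qnorm (dlog T) q (\<lambda>\<tau>. ennreal (r ^ n) * W (\<tau> / 2 ^ n))) l \<le> ennreal ((r powr l) ^ n) * enn_powr (Lp_qnorm (dlog T) q W) l" .
    qed auto
    also have "\<dots> = ennreal S * enn_powr (Lp_qnorm (dlog T) q W) l"
      unfolding ennreal_suminf_multc S(1) ..
    also have "\<dots> = enn_powr (ennreal (S powr (1 / l)) * Lp_qnorm (dlog T) q W) l"
      using S l by (simp add: enn_powr_mult enn_powr_ennreal powr_powr)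
    finally have "Lp_qnorm (dlog T) q (\<lambda>\<tau>. \<Sum>n. ennreal (r ^ n) * W (\<tau> / 2 ^ n)) \<le> ennreal (S powr (1 / l)) * Lp_qnorm (dlog T) q W"
      using l by (simp add: enn_powr_le_iff)
    also have "Lp_qnorm (dlog T) q (\<lambda>\<tau>. \<Sum>n. ennreal (r ^ n) * W (\<tau> / 2 ^ n))
      = Lp_qnorm (dlog T) q (\<lambda>\<tau>. (\<Sum>n. ennreal (c ^ n) * X (\<tau> / 2 ^ n)) / ennreal (\<tau> powr a))"
      by (intro Lp_qnorm_cong) (simp add: pw)
    finally show "Lp_qnorm (dlog T) q (\<lambda>\<tau>. (\<Sum>n. ennreal (c ^ n) * X (\<tau> / 2 ^ n)) / ennreal (\<tau> powr a))
     \<le> ennreal (S powr (1 / l)) * Lp_qnorm (dlog T) q (\<lambda>\<tau>. X \<tau> / ennreal (\<tau> powr a))"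
      by (simp add: W_def[abs_def])
  qed simp
qed

text \<open>The scale inequality for Z^m in the exponent q/m, with c = 2 and a = \<gamma> m; its
  condition c < 2^a is 1 < \<gamma> m.\<close>

lemma subcritical_norm_le:
  assumes m: "0 < m" and q: "0 < q" and g: "1 < \<gamma> * m"
  shows "\<exists>C::real. 0 \<le> C \<and> (\<forall>T>0. \<forall>Z. (\<forall>x y. x \<le> y \<longrightarrow> Z x \<le> Z y) \<longrightarrow>
    Lp_qnorm (dlog T) q (\<lambda>\<tau>. enn_powr (\<Sum>n. 2 ^ Suc n * enn_powr (Z (\<tau> / 2 ^ n)) m) (1 / m) / ennreal (\<tau> powr \<gamma>))
     \<le> ennreal C * Lp_qnorm (dlog T) q (\<lambda>\<tau>. Z \<tau> / ennreal (\<tau> powr \<gamma>)))"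
proof -
  have qm: "0 < q / ennreal m" using q by (simp add: ennreal_zero_less_divide)
  have "2 powr 1 < (2::real) powr (\<gamma> * m)" using g by (intro powr_less_mono) auto
  then obtain C :: real where C: "0 \<le> C" "\<And>T X. 0 < T \<Longrightarrow> \<forall>x y. x \<le> y \<longrightarrow> X x \<le> X y \<Longrightarrow>
    Lp_qnorm (dlog T) (q / ennreal m) (\<lambda>\<tau>. (\<Sum>n. ennreal (2 ^ n) * X (\<tau> / 2 ^ n)) / ennreal (\<tau> powr (\<gamma> * m)))
     \<le> ennreal C * Lp_qnorm (dlog T) (q / ennreal m) (\<lambda>\<tau>. X \<tau> / ennreal (\<tau> powr (\<gamma> * m)))"
    using dyadic_scales_norm_le[OF qm, of 2 "\<gamma> * m"] by auto
  show ?thesis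
  proof (intro exI[of _ "(2 * C) powr (1 / m)"] conjI allI impI)
    fix T :: real and Z :: "real \<Rightarrow> ennreal" assume T: "0 < T" and Z: "\<forall>x y. x \<le> y \<longrightarrow> Z x \<le> Z y"
    have [measurable]: "Z \<in> borel_measurable borel" using Z by (intro borel_measurable_mono_ennreal) auto
    let ?H = "\<lambda>\<tau>. enn_powr (\<Sum>n. 2 ^ Suc n * enn_powr (Z (\<tau> / 2 ^ n)) m) (1 / m) / ennreal (\<tau> powr \<gamma>)"
    have dp: "enn_powr (x / ennreal (\<tau> powr \<gamma>)) m = enn_powr x m / ennreal (\<tau> powr (\<gamma> * m))" if "0 < \<tau>" for x \<tau>
      using that by (simp add: divide_ennreal_def inverse_ennreal enn_powr_mult enn_powr_ennreal inverse_powr powr_powr flip: powr_minus)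
    have "enn_powr (Lp_qnorm (dlog T) q ?H) m = Lp_qnorm (dlog T) (q / ennreal m) (\<lambda>\<tau>. enn_powr (?H \<tau>) m)"
      by (rule Lp_qnorm_powr'[OF q m, symmetric]) measurable
    also have "\<dots> = Lp_qnorm (dlog T) (q / ennreal m) (\<lambda>\<tau>. 2 * ((\<Sum>n. ennreal (2 ^ n) * enn_powr (Z (\<tau> / 2 ^ n)) m) / ennreal (\<tau> powr (\<gamma> * m))))"
    proof (intro Lp_qnorm_cong)
      fix \<tau> assume "\<tau> \<in> space (dlog T)"
      then have t: "0 < \<tau>" by simp
      have "(\<Sum>n. 2 ^ Suc n * enn_powr (Z (\<tau> / 2 ^ n)) m) = 2 * (\<Sum>n. ennreal (2 ^ n) * enn_powr (Z (\<tau> / 2 ^ n)) m)"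
        by (simp add: mult.assoc flip: ennreal_power)
      then show "enn_powr (?H \<tau>) m = 2 * ((\<Sum>n. ennreal (2 ^ n) * enn_powr (Z (\<tau> / 2 ^ n)) m) / ennreal (\<tau> powr (\<gamma> * m)))"
        unfolding dp[OF t] using m by (simp only: enn_powr_inverse_cancel ennreal_times_divide)
    qed
    also have "\<dots> = 2 * Lp_qnorm (dlog T) (q / ennreal m) (\<lambda>\<tau>. (\<Sum>n. ennreal (2 ^ n) * enn_powr (Z (\<tau> / 2 ^ n)) m) / ennreal (\<tau> powr (\<gamma> * m)))"
      by (intro Lp_qnorm_cmult qm) auto
    also have "\<dots> \<le> 2 * (ennreal C * Lp_qnorm (dlog T) (q / ennreal m) (\<lambda>\<tau>. enn_powr (Z \<tau>) m / ennreal (\<tau> powr (\<gamma> * m))))"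
      using Z m by (intro mult_left_mono C T) (auto intro: enn_powr_mono)
    also have "Lp_qnorm (dlog T) (q / ennreal m) (\<lambda>\<tau>. enn_powr (Z \<tau>) m / ennreal (\<tau> powr (\<gamma> * m)))
      = Lp_qnorm (dlog T) (q / ennreal m) (\<lambda>\<tau>. enn_powr (Z \<tau> / ennreal (\<tau> powr \<gamma>)) m)"
      by (intro Lp_qnorm_cong) (simp add: dp)
    also have "\<dots> = enn_powr (Lp_qnorm (dlog T) q (\<lambda>\<tau>. Z \<tau> / ennreal (\<tau> powr \<gamma>))) m"
      by (rule Lp_qnorm_powr'[OF q m]) measurable
    also have "2 * (ennreal C * enn_powr (Lp_qnorm (dlog T) q (\<lambda>\<tau>. Z \<tau> / ennreal (\<tau> powr \<gamma>))) m)
      = enn_powr (ennreal ((2 * C) powr (1 / m)) * Lp_qnorm (dlog T) q (\<lambda>\<tau>. Z \<tau> / ennreal (\<tau> powr \<gamma>))) m"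
      using C(1) m by (simp add: enn_powr_mult enn_powr_ennreal powr_powr ennreal_mult mult.assoc)
    finally show "Lp_qnorm (dlog T) q ?H \<le> ennreal ((2 * C) powr (1 / m)) * Lp_qnorm (dlog T) q (\<lambda>\<tau>. Z \<tau> / ennreal (\<tau> powr \<gamma>))"
      using m by (simp add: enn_powr_le_iff)
  qed simp
qed

subsection \<open>The integral in Besov scales\<close>

text \<open>Absolute continuity of the integral. In the critical regime no positive power of the
  mesh is left over, and this supplies the smallness.\<close>

lemma Lp_qnorm_dlog_tendsto_0:
  assumes q: "0 < q" "q < top" and [measurable]: "F \<in> borel_measurable borel"
    and T: "0 < T" and fin: "Lp_qnorm (dlog T) q F < top"
  shows "((\<lambda>S. Lp_qnorm (dlog S) q F) \<longlongrightarrow> 0) (at_right 0)"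
proof -
  obtain s where s: "0 < s" "q = ennreal s" using q by (cases q) auto
  define G where "G u = enn_powr (F u) s * ennreal (1 / u)" for u
  have [measurable]: "G \<in> borel_measurable borel" unfolding G_def by measurable
  let ?I = "\<lambda>S. \<integral>\<^sup>+u. G u * indicator {0<..S} u \<partial>lborel"
  have I: "Lp_qnorm (dlog S) q F = enn_powr (?I S) (1 / s)" for S
    using s by (simp add: Lp_qnorm_ennreal nn_integral_dlog G_def)
  have finI: "?I T < top" using fin unfolding I by simp
  have lim: "(\<lambda>n. ?I (T / 2 ^ n)) \<longlonglongrightarrow> (\<integral>\<^sup>+u. 0 \<partial>(lborel :: real measure))"
  proof (rule nn_integral_dominated_convergence[where w = "\<lambda>u. G u * indicator {0<..T} u"])
    show "AE u in lborel. (\<lambda>n. G u * indicator {0<..T / 2 ^ n} u) \<longlonglongrightarrow> 0"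
    proof (rule AE_I2)
      fix u
      show "(\<lambda>n. G u * indicator {0<..T / 2 ^ n} u) \<longlonglongrightarrow> 0"
      proof (cases "0 < u")
        case True
        have "(\<lambda>n. T * (1 / 2) ^ n) \<longlonglongrightarrow> T * 0" by (intro tendsto_mult tendsto_const LIMSEQ_realpow_zero) auto
        then have "eventually (\<lambda>n. T / 2 ^ n < u) sequentially"
          using True by (auto simp: power_one_over field_simps dest!: order_tendstoD(2)[of _ _ _ u])
        then have "eventually (\<lambda>n. G u * indicator {0<..T / 2 ^ n} u = 0) sequentially"
          by eventually_elim (auto simp: indicator_def)
        then show ?thesis by (rule tendsto_eventually)
      qed (simp add: indicator_def)
    qed
    show "AE u in lborel. G u * indicator {0<..T / 2 ^ n} u \<le> G u * indicator {0<..T} u" for n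
    proof (rule AE_I2, rule mult_left_mono)
      fix u
      have "T / 2 ^ n \<le> T / 1" using T by (intro divide_left_mono) auto
      then show "indicator {0<..T / 2 ^ n} u \<le> (indicator {0<..T} u :: ennreal)" by (auto split: split_indicator)
    qed simp
  qed (use finI in auto)
  have "(\<lambda>n. Lp_qnorm (dlog (T / 2 ^ n)) q F) \<longlonglongrightarrow> enn_powr 0 (1 / s)"
    unfolding I using lim s by (intro tendsto_enn_powr) auto
  then have lim: "(\<lambda>n. Lp_qnorm (dlog (T / 2 ^ n)) q F) \<longlonglongrightarrow> 0" by simp
  show ?thesis
  proof (rule order_tendstoI)
    fix e :: ennreal assume "0 < e"
    with lim have "eventually (\<lambda>n. Lp_qnorm (dlog (T / 2 ^ n)) q F < e) sequentially" by (rule order_tendstoD(2))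
    then obtain n where n: "Lp_qnorm (dlog (T / 2 ^ n)) q F < e" by (auto simp: eventually_sequentially)
    have "eventually (\<lambda>S. S < T / 2 ^ n) (at_right 0)" using T by (intro eventually_at_right_less[THEN eventually_mono] order_tendstoD(2)[OF tendsto_ident_at]) auto
    then show "eventually (\<lambda>S. Lp_qnorm (dlog S) q F < e) (at_right 0)"
      by (rule eventually_mono) (rule le_less_trans[OF Lp_qnorm_dlog_mono_interval n], use q in auto)
  qed auto
qed

lemma mesh_to_0_tendsto:
  fixes X :: "real list \<Rightarrow> ennreal"
  assumes le: "\<And>P. unit_partition P \<Longrightarrow> X P \<le> \<Phi> (mesh P)" and lim: "(\<Phi> \<longlongrightarrow> 0) (at_right 0)"
  shows "(X \<longlongrightarrow> 0) mesh_to_0"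
proof (rule tendsto_sandwich[where f = "\<lambda>_. 0" and h = "\<lambda>P. \<Phi> (mesh P)"])
  have "filterlim mesh (at_right 0) mesh_to_0"
    unfolding mesh_to_0_def by (rule filterlim_mono[OF filterlim_filtercomap]) auto
  then show "((\<lambda>P. \<Phi> (mesh P)) \<longlongrightarrow> 0) mesh_to_0" by (rule filterlim_compose[OF lim])
  have "eventually unit_partition mesh_to_0"
    unfolding mesh_to_0_def by (auto simp: eventually_inf_principal)
  then show "eventually (\<lambda>P. X P \<le> \<Phi> (mesh P)) mesh_to_0" by eventually_elim (rule le)
qed auto

lemma chain_sum_telescope: "P \<noteq> [] \<Longrightarrow> chain_sum (\<lambda>u v. v - u :: real) P = last P - hd P"
  by (induction P rule: induct_list012) auto

text \<open>Bounds proportional to the interval length add up, because the lengths of a partition of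
  [0,1] sum to 1.\<close>

lemma chain_sum_mesh_le:
  fixes \<phi> :: "real \<Rightarrow> ennreal"
  assumes P: "unit_partition P" and le: "\<And>\<theta>. 0 < \<theta> \<Longrightarrow> \<theta> \<le> mesh P \<Longrightarrow> \<phi> \<theta> \<le> ennreal \<theta> * c"
  shows "chain_sum (\<lambda>u v. \<phi> (v - u)) P \<le> c"
proof -
  have inc: "0 < P ! k - P ! (k - 1)" "P ! k - P ! (k - 1) \<le> mesh P" if "k \<in> {1..<length P}" for k
  proof -
    show "0 < P ! k - P ! (k - 1)"
      using unit_partitionD(4)[OF P] that by (auto simp: sorted_wrt_iff_nth_less)
    show "P ! k - P ! (k - 1) \<le> mesh P" unfolding mesh_def using that by (intro Max_ge) auto
  qed
  have "chain_sum (\<lambda>u v. \<phi> (v - u)) P \<le> (\<Sum>k\<in>{1..<length P}. ennreal (P ! k - P ! (k - 1)) * c)"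
    unfolding chain_sum_nth using inc by (intro sum_mono le) auto
  also have "\<dots> = ennreal (\<Sum>k\<in>{1..<length P}. P ! k - P ! (k - 1)) * c"
    unfolding sum_distrib_right[symmetric] using inc by (subst sum_ennreal) (auto intro: less_imp_le)
  also have "(\<Sum>k\<in>{1..<length P}. P ! k - P ! (k - 1)) = 1"
    using chain_sum_telescope[of P] unit_partitionD[OF P] by (simp add: chain_sum_nth)
  finally show ?thesis by simp
qed

text \<open>The constant in the quasi-triangle inequality of \<open>L\<^sup>q\<close>.\<close>

definition quasi_const :: "ennreal \<Rightarrow> real" where
  "quasi_const q = 2 powr (1 / enn2real (min 1 q))"

lemma enn_powr_add_quasi:
  assumes m: "0 < m" and le: "enn_powr x m \<le> enn_powr a m + enn_powr b m"
  shows "x \<le> ennreal (2 powr (1 / m)) * (a + b)"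
proof -
  have "enn_powr a m + enn_powr b m \<le> enn_powr (a + b) m + enn_powr (a + b) m"
    using m by (intro add_mono enn_powr_mono) auto
  then have "enn_powr x m \<le> 2 * enn_powr (a + b) m"
    using le by (auto simp: mult_2 intro: order_trans)
  also have "\<dots> = enn_powr (ennreal (2 powr (1 / m)) * (a + b)) m"
    using m by (simp add: enn_powr_mult enn_powr_ennreal powr_powr)
  finally show ?thesis using m by (simp add: enn_powr_le_iff)
qed

lemma Lp_qnorm_add_const:
  assumes q: "0 < q" and [measurable]: "F \<in> borel_measurable M" "G \<in> borel_measurable M"
  shows "Lp_qnorm M q (\<lambda>x. F x + G x) \<le> ennreal (quasi_const q) * (Lp_qnorm M q F + Lp_qnorm M q G)"
  unfolding quasi_const_def using min_exponent[OF q]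
  by (intro enn_powr_add_quasi Lp_qnorm_add_quasi) auto

lemma Lp_norm_on_add_const:
  assumes q: "0 < q" and [measurable]: "F \<in> borel_measurable borel" "G \<in> borel_measurable borel"
  shows "Lp_norm_on T q (\<lambda>x. F x + G x) \<le> ennreal (quasi_const q) * (Lp_norm_on T q F + Lp_norm_on T q G)"
  unfolding quasi_const_def using min_exponent[OF q]
  by (intro enn_powr_add_quasi Lp_norm_on_add_quasi) auto

lemma quasi_const_pos: "0 < quasi_const q"
  by (simp add: quasi_const_def)

lemma besov2_norm_le:
  assumes q: "0 < q"
    and le: "\<And>\<tau>. 0 < \<tau> \<Longrightarrow> \<tau> \<le> T \<Longrightarrow> modulus2 T p A \<tau> \<le> X \<tau>"
  shows "besov2_norm T (\<lambda>\<tau>. \<tau> powr \<gamma>) p q A \<le> Lp_qnorm (dlog T) q (\<lambda>\<tau>. X \<tau> / ennreal (\<tau> powr \<gamma>))"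
proof -
  have [measurable]: "modulus2 T p A \<in> borel_measurable borel"
    by (rule borel_measurable_mono_ennreal[OF modulus2_mono])
  show ?thesis unfolding besov2_norm_def
    using le by (intro Lp_qnorm_mono[OF q]) (auto intro!: divide_right_mono_ennreal)
qed

text \<open>Here f and g are Borel representatives, so that shifts, products and Fubini stay
  measurable. \<open>gamma_ge\<close> admits equality, and both regimes share the locale.\<close>

locale young =
  fixes T \<alpha>0 \<alpha>1 :: real and p0 p1 p2 q0 q1 q2 :: ennreal and f g :: "real \<Rightarrow> real"
  assumes T: "0 < T" and \<alpha>: "0 < \<alpha>0" "\<alpha>0 < 1" "0 < \<alpha>1" "\<alpha>1 < 1"
    and p: "0 < p0" "0 < p1" "inverse p2 = inverse p0 + inverse p1"
    and q: "0 < q0" "0 < q1" "inverse q2 = inverse q0 + inverse q1"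
    and f [measurable]: "f \<in> borel_measurable borel" and g [measurable]: "g \<in> borel_measurable borel"
    and f_Lp: "Lp_norm_on T p0 f < top"
    and f_finite: "besov_seminorm T \<alpha>0 p0 q0 f < top" and g_finite: "besov_seminorm T \<alpha>1 p1 q1 g < top"
    and gamma_ge: "1 / enn2real (min 1 p2) \<le> \<alpha>0 + \<alpha>1"
begin

definition "\<gamma> = \<alpha>0 + \<alpha>1"
definition "\<rho> = enn2real (min 1 p2)"
definition "F = besov_seminorm T \<alpha>0 p0 q0 f"
definition "G = besov_seminorm T \<alpha>1 p1 q1 g"
definition "Z \<tau> = modulus T p0 f \<tau> * modulus T p1 g \<tau>"
definition "W \<tau> = Z \<tau> / ennreal (\<tau> powr \<gamma>)"

section \<open>Exponents, doubling and size of the moduli\<close>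

lemma p2: "0 < p2" "p2 \<le> p0" "p2 \<le> p1" by (rule exponent_sum_pos[OF p])+
lemma q2: "0 < q2" "q2 \<le> q0" "q2 \<le> q1" by (rule exponent_sum_pos[OF q])+

lemma \<gamma>: "0 < \<gamma>" "\<gamma> < 2" using \<alpha> by (auto simp: \<gamma>_def)

text \<open>From 1/\<rho> \<le> \<gamma> < 2 comes \<rho> > 1/2, so every integrability exponent is
  at least 1/2 and the doubling factors are absolute numbers.\<close>

lemma \<rho>: "0 < \<rho>" "\<rho> \<le> 1" "ennreal \<rho> \<le> p2" "1 / \<rho> \<le> \<gamma>" "1 / 2 < \<rho>" "1 \<le> \<gamma> * \<rho>"
proof -
  show *: "0 < \<rho>" "\<rho> \<le> 1" "ennreal \<rho> \<le> p2" using min_exponent[OF p2(1)] by (auto simp: \<rho>_def)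
  show "1 / \<rho> \<le> \<gamma>" using gamma_ge by (simp add: \<rho>_def \<gamma>_def)
  then show "1 \<le> \<gamma> * \<rho>" using *(1) by (simp add: field_simps)
  also have "\<dots> < 2 * \<rho>" using \<gamma> *(1) by simp
  finally show "1 / 2 < \<rho>" by simp
qed

lemma p_ge: "ennreal (1 / 2) \<le> p2" "ennreal (1 / 2) \<le> p0" "ennreal (1 / 2) \<le> p1"
proof -
  have "ennreal (1 / 2) \<le> ennreal \<rho>" using \<rho>(5) by (intro ennreal_leI) auto
  then show "ennreal (1 / 2) \<le> p2" using \<rho>(3) by (rule order_trans)
  then show "ennreal (1 / 2) \<le> p0" "ennreal (1 / 2) \<le> p1" using p2 by (auto elim: order_trans)
qed

lemma modulus_double_f: "modulus T p0 f (2 * x) \<le> 4 * modulus T p0 f x"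
  using p_ge by (intro modulus_double) auto

lemma modulus_double_g: "modulus T p1 g (2 * x) \<le> 4 * modulus T p1 g x"
  using p_ge by (intro modulus_double) auto

lemma Z_mono: "x \<le> y \<Longrightarrow> Z x \<le> Z y"
  unfolding Z_def by (intro mult_mono modulus_mono) auto

lemma Z_double: "Z (2 * x) \<le> 16 * Z x"
proof -
  have "Z (2 * x) \<le> (4 * modulus T p0 f x) * (4 * modulus T p1 g x)"
    unfolding Z_def by (intro mult_mono modulus_double_f modulus_double_g) auto
  also have "\<dots> = (4 * 4) * Z x" by (simp add: Z_def ac_simps)
  finally show ?thesis by simp
qed

lemma measurable_modulus [measurable]: "modulus T p' f' \<in> borel_measurable borel"
  by (rule borel_measurable_mono_ennreal[OF modulus_mono])

lemma measurable_Z [measurable]: "Z \<in> borel_measurable borel"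
  by (rule borel_measurable_mono_ennreal[OF Z_mono])

lemma measurable_W [measurable]: "W \<in> borel_measurable borel"
  unfolding W_def by measurable

lemma divide_powr_add:
  assumes "0 < \<tau>"
  shows "x * y / ennreal (\<tau> powr \<gamma>) = (x / ennreal (\<tau> powr \<alpha>0)) * (y / ennreal (\<tau> powr \<alpha>1))"
proof -
  have "inverse (ennreal (\<tau> powr \<gamma>)) = inverse (ennreal (\<tau> powr \<alpha>0)) * inverse (ennreal (\<tau> powr \<alpha>1))"
    using assms by (simp add: \<gamma>_def powr_add inverse_ennreal ennreal_mult ennreal_inverse_mult)
  then show ?thesis by (simp add: divide_ennreal_def ac_simps)
qed

text \<open>Hoelder's inequality a second time, now in the scale variable; this is where 1/q2 = 1/q0
  + 1/q1 enters.\<close>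

lemma W_norm: "Lp_qnorm (dlog T) q2 W \<le> F * G"
proof -
  have "Lp_qnorm (dlog T) q2 W = Lp_qnorm (dlog T) q2 (\<lambda>\<tau>. (modulus T p0 f \<tau> / ennreal (\<tau> powr \<alpha>0)) * (modulus T p1 g \<tau> / ennreal (\<tau> powr \<alpha>1)))"
    by (intro Lp_qnorm_cong) (auto simp: W_def Z_def divide_powr_add)
  also have "\<dots> \<le> F * G"
    unfolding F_def G_def besov_seminorm_def by (intro Lp_qnorm_Holder q) measurable
  finally show ?thesis .
qed

lemma FG: "F < top" "G < top" "F * G < top"
  using f_finite g_finite by (auto simp: F_def G_def ennreal_mult_less_top)

lemma modulus_le_of_weighted:
  assumes "0 < \<tau>" "X / ennreal (\<tau> powr a) \<le> 4 * 4 * N"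
  shows "X \<le> 16 * ennreal (\<tau> powr a) * N"
proof -
  have "X = X / ennreal (\<tau> powr a) * ennreal (\<tau> powr a)" using assms by (simp add: divide_powr_cancel)
  also have "\<dots> \<le> 4 * 4 * N * ennreal (\<tau> powr a)" by (intro mult_right_mono assms) auto
  finally show ?thesis by (simp add: ac_simps)
qed

lemma modulus_f_le: "0 < \<tau> \<Longrightarrow> \<tau> \<le> T \<Longrightarrow> modulus T p0 f \<tau> \<le> 16 * ennreal (\<tau> powr \<alpha>0) * F"
  using weighted_sup_le[of q0 "modulus T p0 f" 4 \<tau> T \<alpha>0] q \<alpha> modulus_double_f modulus_mono
  by (intro modulus_le_of_weighted) (auto simp: F_def besov_seminorm_def)

lemma modulus_g_le: "0 < \<tau> \<Longrightarrow> \<tau> \<le> T \<Longrightarrow> modulus T p1 g \<tau> \<le> 16 * ennreal (\<tau> powr \<alpha>1) * G"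
  using weighted_sup_le[of q1 "modulus T p1 g" 4 \<tau> T \<alpha>1] q \<alpha> modulus_double_g modulus_mono
  by (intro modulus_le_of_weighted) (auto simp: G_def besov_seminorm_def)

text \<open>256 is 16 for each modulus, and 16 is the doubling factor 4 applied twice to span the
  window [\<tau>/4,\<tau>].\<close>

lemma Z_le:
  assumes "0 < \<tau>" "\<tau> \<le> T"
  shows "Z \<tau> \<le> ennreal (256 * \<tau> powr \<gamma>) * (F * G)"
proof -
  have "Z \<tau> \<le> (16 * ennreal (\<tau> powr \<alpha>0) * F) * (16 * ennreal (\<tau> powr \<alpha>1) * G)"
    unfolding Z_def using assms by (intro mult_mono modulus_f_le modulus_g_le) auto
  also have "\<dots> = (16 * 16) * (ennreal (\<tau> powr \<alpha>0) * ennreal (\<tau> powr \<alpha>1)) * (F * G)"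
    by (simp only: ac_simps)
  also have "\<dots> = ennreal (256 * \<tau> powr \<gamma>) * (F * G)"
    by (simp add: \<gamma>_def powr_add ennreal_mult)
  finally show ?thesis .
qed

text \<open>Hoelder separates the factors; translating the base point makes each an increment of
  step at most (w-u)h, so both moduli can be read at this common scale.\<close>

sublocale germ T p2 \<rho> f g Z
proof
  fix h u v w :: real
  assume h: "0 \<le> h" "h \<le> T" and u: "0 \<le> u" "u \<le> v" "v \<le> w" "w \<le> 1"
  have uh: "0 \<le> u * h" "u * h \<le> v * h" "v * h \<le> w * h" "w * h \<le> h"
    using h u mult_right_mono[of w 1 h] by (auto intro: mult_right_mono)
  have "Lp_norm_on (T - h) p2 (\<lambda>r. (f (r + v * h) - f (r + u * h)) * (g (r + w * h) - g (r + v * h)))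
    \<le> Lp_norm_on (T - h) p0 (\<lambda>r. f (r + v * h) - f (r + u * h)) * Lp_norm_on (T - h) p1 (\<lambda>r. g (r + w * h) - g (r + v * h))"
    by (intro Lp_norm_on_Holder p) measurable
  also have "\<dots> \<le> Z ((w - u) * h)"
    unfolding Z_def
  proof (intro mult_mono)
    have "Lp_norm_on (T - h) p0 (\<lambda>r. f (r + v * h) - f (r + u * h))
        \<le> Lp_norm_on (T - (v * h - u * h)) p0 (\<lambda>s. f (s + (v * h - u * h)) - f s)"
      using Lp_norm_on_shift_le[of p0 "\<lambda>s. f (s + (v * h - u * h)) - f s" "u * h" "T - h" "T - (v * h - u * h)"] p uh
      by (simp add: add.assoc)
    also have "\<dots> \<le> modulus T p0 f ((w - u) * h)"
      using uh by (intro modulus_upper) (auto simp: left_diff_distrib)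
    finally show "Lp_norm_on (T - h) p0 (\<lambda>r. f (r + v * h) - f (r + u * h)) \<le> modulus T p0 f ((w - u) * h)" .
    have "Lp_norm_on (T - h) p1 (\<lambda>r. g (r + w * h) - g (r + v * h))
        \<le> Lp_norm_on (T - (w * h - v * h)) p1 (\<lambda>s. g (s + (w * h - v * h)) - g s)"
      using Lp_norm_on_shift_le[of p1 "\<lambda>s. g (s + (w * h - v * h)) - g s" "v * h" "T - h" "T - (w * h - v * h)"] p uh
      by (simp add: add.assoc)
    also have "\<dots> \<le> modulus T p1 g ((w - u) * h)"
      using uh by (intro modulus_upper) (auto simp: left_diff_distrib)
    finally show "Lp_norm_on (T - h) p1 (\<lambda>r. g (r + w * h) - g (r + v * h)) \<le> modulus T p1 g ((w - u) * h)" .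
  qed auto
  finally show "Lp_norm_on (T - h) p2 (\<lambda>r. (f (r + v * h) - f (r + u * h)) * (g (r + w * h) - g (r + v * h))) \<le> Z ((w - u) * h)" .
qed (use \<rho> Z_mono in auto)

text \<open>\<open>Psi\<close> with the \<rho>-th power undone, so that \<open>U\<close> bounds the
  norm of the remainder itself.\<close>

definition "U \<tau> = enn_powr (Psi \<tau>) (1 / \<rho>)"

lemma U_mono: "x \<le> y \<Longrightarrow> U x \<le> U y"
  unfolding U_def using \<rho> by (intro enn_powr_mono Psi_mono) auto

lemma measurable_U [measurable]: "U \<in> borel_measurable borel"
  by (rule borel_measurable_mono_ennreal[OF U_mono])

lemma Psi_U: "Psi \<tau> = enn_powr (U \<tau>) \<rho>"
  using \<rho> by (simp add: U_def)

text \<open>256 bounds \<open>Z\<close>; the other factor is the sum of 2 times the powers of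
  2^(1-\<gamma>\<rho>), with the \<rho>-th power undone.\<close>

definition "subcritical_const = 256 * (2 / (1 - 2 powr (1 - \<gamma> * \<rho>))) powr (1 / \<rho>)"

lemma U_le_subcritical:
  assumes gt: "1 < \<gamma> * \<rho>" and t: "0 < \<tau>" "\<tau> \<le> T"
  shows "U \<tau> \<le> ennreal (subcritical_const * \<tau> powr \<gamma>) * (F * G)"
proof -
  define r :: real where "r = 2 powr (1 - \<gamma> * \<rho>)"
  have r: "0 \<le> r" "r < 1" using gt powr_less_mono[of "1 - \<gamma> * \<rho>" 0 "2::real"] by (auto simp: r_def)
  define c where "c = 2 * (256 * \<tau> powr \<gamma>) powr \<rho>"
  have c: "0 \<le> c" by (simp add: c_def)
  have "Psi \<tau> \<le> (\<Sum>n. ennreal c * ennreal (r ^ n) * enn_powr (F * G) \<rho>)"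
    unfolding Psi_def
  proof (intro suminf_le)
    fix n
    let ?u = "\<tau> / 2 ^ n"
    have "?u \<le> \<tau> / 1" using t by (intro divide_left_mono) auto
    then have u: "0 < ?u" "?u \<le> T" using t by auto
    have "enn_powr (Z ?u) \<rho> \<le> enn_powr (ennreal (256 * ?u powr \<gamma>) * (F * G)) \<rho>"
      using \<rho> u by (intro enn_powr_mono Z_le) auto
    also have "\<dots> = ennreal ((256 * ?u powr \<gamma>) powr \<rho>) * enn_powr (F * G) \<rho>"
      by (simp add: enn_powr_mult[of _ "F * G"] enn_powr_ennreal)
    finally have "2 ^ Suc n * enn_powr (Z ?u) \<rho> \<le> 2 ^ Suc n * (ennreal ((256 * ?u powr \<gamma>) powr \<rho>) * enn_powr (F * G) \<rho>)"
      by (intro mult_left_mono) auto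
    also have "2 ^ Suc n * (ennreal ((256 * ?u powr \<gamma>) powr \<rho>) * enn_powr (F * G) \<rho>)
       = ennreal (2 ^ Suc n * (256 * ?u powr \<gamma>) powr \<rho>) * enn_powr (F * G) \<rho>"
    proof -
      have "(2::ennreal) ^ Suc n = ennreal (2 ^ Suc n)" by (metis ennreal_numeral ennreal_power zero_le_numeral)
      then show ?thesis by (simp only: mult.assoc[symmetric] ennreal_mult[symmetric] zero_le_power zero_le_numeral powr_ge_zero)
    qed
    also have "2 ^ Suc n * (256 * ?u powr \<gamma>) powr \<rho> = c * r ^ n"
    proof -
      have "(?u powr \<gamma>) powr \<rho> = (\<tau> powr \<gamma>) powr \<rho> * 2 powr (- (real n * (\<gamma> * \<rho>)))"
        using t unfolding powr_realpow[symmetric, OF zero_less_numeral]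
        by (simp add: powr_divide powr_powr powr_minus_divide mult.assoc)
      moreover have "2 ^ n * 2 powr (- (real n * (\<gamma> * \<rho>))) = r ^ n"
        unfolding powr_realpow[symmetric, of 2, OF zero_less_numeral] r_def
        by (simp add: powr_power powr_add[symmetric] algebra_simps)
      ultimately show ?thesis by (simp add: c_def powr_mult)
    qed
    also have "ennreal (c * r ^ n) = ennreal c * ennreal (r ^ n)" using c r by (intro ennreal_mult) auto
    finally show "2 ^ Suc n * enn_powr (Z ?u) \<rho> \<le> ennreal c * ennreal (r ^ n) * enn_powr (F * G) \<rho>" .
  qed auto
  also have "\<dots> = ennreal c * (\<Sum>n. ennreal (r ^ n)) * enn_powr (F * G) \<rho>" by simp
  also have "\<dots> = ennreal (c * (1 / (1 - r))) * enn_powr (F * G) \<rho>"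
    unfolding suminf_geometric_ennreal[OF r] using c r by (simp only: ennreal_mult[symmetric] zero_le_divide_1_iff)
  finally have "U \<tau> \<le> enn_powr (ennreal (c * (1 / (1 - r))) * enn_powr (F * G) \<rho>) (1 / \<rho>)"
    unfolding U_def using \<rho> by (intro enn_powr_mono) auto
  also have "\<dots> = ennreal ((c * (1 / (1 - r))) powr (1 / \<rho>)) * (F * G)"
    using \<rho> c r by (subst enn_powr_mult) (simp add: enn_powr_ennreal)
  also have "(c * (1 / (1 - r))) powr (1 / \<rho>) = subcritical_const * \<tau> powr \<gamma>"
  proof -
    define y where "y = 256 * \<tau> powr \<gamma>"
    have E: "c * (1 / (1 - r)) = y powr \<rho> * (2 / (1 - r))" by (simp add: c_def y_def)
    have E2: "(y powr \<rho> * (2 / (1 - r))) powr (1 / \<rho>) = y * (2 / (1 - r)) powr (1 / \<rho>)"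
      using \<rho>(1) r by (subst powr_mult) (auto simp: powr_powr y_def)
    show ?thesis unfolding E E2 by (simp add: y_def subcritical_const_def r_def)
  qed
  finally show ?thesis .
qed

text \<open>9216 = 36 * 256. The 36 bounds 6^\<gamma> for \<gamma> < 2, where 6 is the 2 of
  \<open>Psi\<close> times the 3 of the critical sum, and 256 is the doubling factor of
  \<open>Z\<close> squared. The norm runs over (0,\<tau>] only, so it becomes small with
  \<tau>.\<close>

lemma U_le_critical_tail:
  assumes crit: "\<gamma> * \<rho> = 1" "q2 \<le> ennreal \<rho>" and t: "0 < \<tau>"
  shows "U \<tau> \<le> ennreal (9216 * \<tau> powr \<gamma>) * Lp_qnorm (dlog \<tau>) q2 W"
proof -
  have g: "\<gamma> = 1 / \<rho>" using crit \<rho> by (simp add: field_simps)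
  let ?N = "Lp_qnorm (dlog \<tau>) q2 W"
  have "Psi \<tau> = 2 * (\<Sum>n. 2 ^ n * enn_powr (Z (\<tau> / 2 ^ n)) \<rho>)"
    by (simp add: Psi_def mult.assoc)
  also have "\<dots> \<le> 2 * (3 * ennreal \<tau> * enn_powr (16 * 16 * ?N) \<rho>)"
    using critical_sum_le[of \<rho> q2 Z 16 \<tau>] \<rho> q2 crit t Z_mono Z_double
    by (intro mult_left_mono) (auto simp: W_def[abs_def] g)
  also have "\<dots> = ennreal (6 * \<tau>) * enn_powr (256 * ?N) \<rho>"
    using t by (simp add: ennreal_mult mult.assoc[symmetric])
  finally have "U \<tau> \<le> enn_powr (ennreal (6 * \<tau>) * enn_powr (256 * ?N) \<rho>) (1 / \<rho>)"
    unfolding U_def using \<rho> by (intro enn_powr_mono) auto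
  also have "\<dots> = ennreal ((6 * \<tau>) powr \<gamma>) * (256 * ?N)"
    using \<rho> t by (subst enn_powr_mult) (simp add: enn_powr_ennreal g)
  also have "\<dots> = ennreal ((6 * \<tau>) powr \<gamma> * 256) * ?N"
    by (simp add: ennreal_mult mult.assoc)
  also have "\<dots> \<le> ennreal (9216 * \<tau> powr \<gamma>) * ?N"
  proof (intro mult_right_mono ennreal_leI)
    have "(6::real) powr \<gamma> \<le> 6 powr 2" using \<gamma> by (intro powr_mono) auto
    then have "(6::real) powr \<gamma> * \<tau> powr \<gamma> * 256 \<le> 36 * \<tau> powr \<gamma> * 256"
      by (intro mult_right_mono) auto
    then show "(6 * \<tau>) powr \<gamma> * 256 \<le> 9216 * \<tau> powr \<gamma>" using t by (simp add: powr_mult)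
  qed auto
  finally show ?thesis .
qed

lemma U_le_critical:
  assumes crit: "\<gamma> * \<rho> = 1" "q2 \<le> ennreal \<rho>" and t: "0 < \<tau>" "\<tau> \<le> T"
  shows "U \<tau> \<le> ennreal (9216 * \<tau> powr \<gamma>) * (F * G)"
proof -
  have "Lp_qnorm (dlog \<tau>) q2 W \<le> F * G"
    using Lp_qnorm_dlog_mono_interval[OF q2(1) t(2), of W] W_norm by (auto intro: order_trans)
  then show ?thesis
    using U_le_critical_tail[OF crit t(1)] by (meson mult_left_mono order_trans zero_le)
qed

text \<open>The exceptional set may depend on h. This suffices, since moduli take a supremum over h
  of norms in the base point.\<close>

definition is_integral :: "(real \<Rightarrow> real) \<Rightarrow> bool" where
  "is_integral I \<longleftrightarrow> I \<in> borel_measurable borel \<and> (\<forall>h. 0 \<le> h \<longrightarrow> h \<le> T \<longrightarrow>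
    (AE r in lebesgue_on {0..T - h}. (\<lambda>n. riemann_sum f g (dyadic n) r (r + h)) \<longlonglongrightarrow> I (r + h) - I r))"

section \<open>Existence of the integral, its remainder and its seminorm\<close>

lemma germ_norm_le: "0 \<le> h \<Longrightarrow> h \<le> \<tau> \<Longrightarrow> Lp_norm_on (T - h) p2 (\<lambda>r. f r * (g (r + h) - g r)) \<le> Lp_norm_on T p0 f * modulus T p1 g \<tau>"
proof -
  assume h: "0 \<le> h" "h \<le> \<tau>"
  have "Lp_norm_on (T - h) p2 (\<lambda>r. f r * (g (r + h) - g r)) \<le> Lp_norm_on (T - h) p0 f * Lp_norm_on (T - h) p1 (\<lambda>r. g (r + h) - g r)"
    by (intro Lp_norm_on_Holder p) measurable
  also have "\<dots> \<le> Lp_norm_on T p0 f * modulus T p1 g \<tau>"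
    using h Lp_norm_on_shift_le[OF p(1) f, of 0 "T - h" T] by (intro mult_mono modulus_upper) auto
  finally show ?thesis .
qed

lemma modulus_T_finite: "modulus T p1 g T < top"
proof -
  have "16 * ennreal (T powr \<alpha>1) * G < top" using FG by (simp add: ennreal_mult_less_top)
  with modulus_g_le[of T] T show ?thesis by (auto intro: le_less_trans)
qed

lemma exists_is_integral:
  assumes "U T < top"
  obtains I where "is_integral I" "Lp_norm_on T p2 I < top"
proof (rule exists_integral)
  show "Psi T < top" using assms by (simp add: Psi_U)
  show "Lp_norm_on T p0 f * modulus T p1 g T < top"
    using f_Lp modulus_T_finite by (simp add: ennreal_mult_less_top)
qed (use T germ_norm_le in \<open>auto simp: is_integral_def intro!: that\<close>)

lemma riemann_sum_modulus2_le:
  assumes I: "is_integral I" and fin: "U T < top" and P: "unit_partition P" and t: "0 < \<tau>" "\<tau> \<le> T"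
  shows "modulus2 T p2 (\<lambda>s t. riemann_sum f g P s t - incr I s t) \<tau>
    \<le> enn_powr (chain_sum (\<lambda>u v. Psi ((v - u) * \<tau>)) P) (1 / \<rho>)"
  unfolding modulus2_def
proof (intro SUP_least)
  fix h assume h: "h \<in> {0..\<tau>}"
  have [measurable]: "I \<in> borel_measurable borel" using I by (simp add: is_integral_def)
  have "Psi T < top" using fin by (simp add: Psi_U)
  then have finh: "Psi h < top" using Psi_mono[of h T] h t by (auto intro: le_less_trans)
  have "N h (\<lambda>r. riemann_sum f g P r (r + h) - (I (r + h) - I r)) \<le> chain_sum (\<lambda>u v. Psi ((v - u) * h)) P"
    using I h t finh P by (intro N_riemann_sum_limit) (auto simp: is_integral_def)
  also have "\<dots> \<le> chain_sum (\<lambda>u v. Psi ((v - u) * \<tau>)) P"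
    unfolding chain_sum_nth
  proof (intro sum_mono Psi_mono mult_left_mono)
    fix k assume k: "k \<in> {1..<length P}"
    then show "0 \<le> P ! k - P ! (k - 1)"
      using unit_partitionD(4)[OF P] by (auto simp: sorted_wrt_iff_nth_less less_imp_le)
  qed (use h in auto)
  finally show "Lp_norm_on (T - h) p2 (\<lambda>r. riemann_sum f g P r (r + h) - incr I r (r + h)) \<le> enn_powr (chain_sum (\<lambda>u v. Psi ((v - u) * \<tau>)) P) (1 / \<rho>)"
    unfolding N_def incr_def using \<rho> by (simp add: enn_powr_le_swap)
qed

text \<open>The germ is the Riemann sum over the trivial partition \<open>dyadic 0\<close>, for
  which the bound on the error of partition sums is \<open>Psi\<close> itself.\<close>

lemma remainder_modulus2_le:
  assumes I: "is_integral I" and fin: "U T < top" and t: "0 < \<tau>" "\<tau> \<le> T"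
  shows "modulus2 T p2 (\<lambda>s t. incr I s t - f s * incr g s t) \<tau> \<le> U \<tau>"
proof -
  have "riemann_sum f g (dyadic 0) s t = f s * incr g s t" for s t
    by (simp add: riemann_sum_dyadic incr_def)
  moreover have "modulus2 T p2 (\<lambda>s t. A s t - B s t) \<tau> = modulus2 T p2 (\<lambda>s t. B s t - A s t) \<tau>" for A B
    by (simp add: modulus2_def Lp_norm_on_def abs_minus_commute)
  ultimately show ?thesis
    using riemann_sum_modulus2_le[OF I fin unit_partition_dyadic[of 0] t]
    unfolding chain_sum_Psi_dyadic by (simp add: U_def)
qed

text \<open>Shared by both seminorm estimates: \<beta> is \<alpha>0 for L^p2 and \<alpha>0 - 1/p0
  for L^p1. Division by \<tau>^\<alpha>1 leaves \<tau>^\<beta> on the remainder, and its q1-norm on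
  (0,T] is the source of the power T^\<beta>.\<close>

lemma seminorm_le_of_modulus:
  assumes Q: "Q < top" and L: "L < top" and H: "H < top" and K: "0 \<le> K"
    and mod: "\<And>\<tau>. 0 < \<tau> \<Longrightarrow> \<tau> \<le> T \<Longrightarrow>
      modulus T p I \<tau> \<le> Q * (L * modulus T p1 g \<tau> + ennreal (K * \<tau> powr (\<beta> + \<alpha>1)) * H)"
    and D: "0 \<le> D" "Lp_qnorm (dlog T) q1 (\<lambda>\<tau>. ennreal (\<tau> powr \<beta>)) \<le> ennreal (D * T powr \<beta>)"
  shows "besov_seminorm T \<alpha>1 p q1 I \<le> Q * ennreal (quasi_const q1 * (1 + K * D)) * (L * G + ennreal (T powr \<beta>) * H)"
proof -
  have [measurable]: "modulus T p I \<in> borel_measurable borel" by (rule measurable_modulus)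
  have w: "modulus T p I \<tau> / ennreal (\<tau> powr \<alpha>1) \<le> Q * (L * (modulus T p1 g \<tau> / ennreal (\<tau> powr \<alpha>1)) + ennreal K * H * ennreal (\<tau> powr \<beta>))"
    if t: "0 < \<tau>" "\<tau> \<le> T" for \<tau>
  proof -
    have "modulus T p I \<tau> / ennreal (\<tau> powr \<alpha>1) \<le> Q * (L * modulus T p1 g \<tau> + ennreal (K * \<tau> powr (\<beta> + \<alpha>1)) * H) / ennreal (\<tau> powr \<alpha>1)"
      by (intro divide_right_mono_ennreal mod t)
    also have "ennreal (K * \<tau> powr (\<beta> + \<alpha>1)) * H = (ennreal K * H * ennreal (\<tau> powr \<beta>)) * ennreal (\<tau> powr \<alpha>1)"
      using K by (simp add: powr_add ennreal_mult ac_simps)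
    also have "Q * (L * modulus T p1 g \<tau> + (ennreal K * H * ennreal (\<tau> powr \<beta>)) * ennreal (\<tau> powr \<alpha>1)) / ennreal (\<tau> powr \<alpha>1)
       = Q * (L * (modulus T p1 g \<tau> / ennreal (\<tau> powr \<alpha>1)) + ennreal K * H * ennreal (\<tau> powr \<beta>))"
    proof -
      have "x * ennreal (\<tau> powr \<alpha>1) / ennreal (\<tau> powr \<alpha>1) = x" for x
        using t by (intro mult_divide_eq_ennreal) auto
      then show ?thesis by (simp add: ennreal_times_divide[symmetric] add_divide_distrib_ennreal)
    qed
    finally show ?thesis .
  qed
  have "besov_seminorm T \<alpha>1 p q1 I \<le> Lp_qnorm (dlog T) q1 (\<lambda>\<tau>. Q * (L * (modulus T p1 g \<tau> / ennreal (\<tau> powr \<alpha>1)) + ennreal K * H * ennreal (\<tau> powr \<beta>)))"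
    unfolding besov_seminorm_def using w by (intro Lp_qnorm_mono q) auto
  also have "\<dots> = Q * Lp_qnorm (dlog T) q1 (\<lambda>\<tau>. L * (modulus T p1 g \<tau> / ennreal (\<tau> powr \<alpha>1)) + ennreal K * H * ennreal (\<tau> powr \<beta>))"
    using Q q by (intro Lp_qnorm_cmult) auto
  also have "\<dots> \<le> Q * (ennreal (quasi_const q1) * (Lp_qnorm (dlog T) q1 (\<lambda>\<tau>. L * (modulus T p1 g \<tau> / ennreal (\<tau> powr \<alpha>1))) + Lp_qnorm (dlog T) q1 (\<lambda>\<tau>. ennreal K * H * ennreal (\<tau> powr \<beta>))))"
    using q by (intro mult_left_mono Lp_qnorm_add_const) auto
  also have "Lp_qnorm (dlog T) q1 (\<lambda>\<tau>. L * (modulus T p1 g \<tau> / ennreal (\<tau> powr \<alpha>1))) = L * G"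
    unfolding G_def besov_seminorm_def using L q by (intro Lp_qnorm_cmult) auto
  also have "Lp_qnorm (dlog T) q1 (\<lambda>\<tau>. ennreal K * H * ennreal (\<tau> powr \<beta>)) = ennreal K * H * Lp_qnorm (dlog T) q1 (\<lambda>\<tau>. ennreal (\<tau> powr \<beta>))"
    using H q by (intro Lp_qnorm_cmult) (auto simp: ennreal_mult_less_top)
  also have "Q * (ennreal (quasi_const q1) * (L * G + ennreal K * H * Lp_qnorm (dlog T) q1 (\<lambda>\<tau>. ennreal (\<tau> powr \<beta>))))
     \<le> Q * (ennreal (quasi_const q1) * (L * G + ennreal K * H * ennreal (D * T powr \<beta>)))"
    by (intro mult_left_mono add_left_mono D) auto
  also have "\<dots> = Q * ennreal (quasi_const q1) * (1 * (L * G) + ennreal (K * D) * (ennreal (T powr \<beta>) * H))"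
    using K D by (simp add: ennreal_mult ac_simps)
  also have "\<dots> \<le> Q * ennreal (quasi_const q1) * (ennreal (1 + K * D) * (L * G) + ennreal (1 + K * D) * (ennreal (T powr \<beta>) * H))"
  proof (intro mult_left_mono add_mono mult_right_mono)
    show "1 \<le> ennreal (1 + K * D)" using K D by simp
    show "ennreal (K * D) \<le> ennreal (1 + K * D)" by (intro ennreal_leI) simp
  qed auto
  also have "\<dots> = Q * ennreal (quasi_const q1 * (1 + K * D)) * (L * G + ennreal (T powr \<beta>) * H)"
  proof -
    have "ennreal (quasi_const q1 * (1 + K * D)) = ennreal (quasi_const q1) * ennreal (1 + K * D)"
      using K D quasi_const_pos[of q1] by (intro ennreal_mult) auto
    then show ?thesis by (simp only: distrib_left mult.assoc)
  qed
  finally show ?thesis .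
qed

lemma integral_modulus_le:
  assumes I: "is_integral I" and fin: "U T < top" and t: "0 < \<tau>" "\<tau> \<le> T"
  shows "modulus T p2 I \<tau> \<le> ennreal (quasi_const p2) * (Lp_norm_on T p0 f * modulus T p1 g \<tau> + U \<tau>)"
  unfolding modulus_def[of T p2]
proof (intro SUP_least)
  fix h assume h: "h \<in> {0..\<tau>}"
  have [measurable]: "I \<in> borel_measurable borel" using I by (simp add: is_integral_def)
  have "Lp_norm_on (T - h) p2 (\<lambda>s. I (s + h) - I s)
     = Lp_norm_on (T - h) p2 (\<lambda>s. f s * (g (s + h) - g s) + (incr I s (s + h) - f s * incr g s (s + h)))"
    by (simp add: incr_def)
  also have "\<dots> \<le> ennreal (quasi_const p2) * (Lp_norm_on (T - h) p2 (\<lambda>s. f s * (g (s + h) - g s)) + Lp_norm_on (T - h) p2 (\<lambda>s. incr I s (s + h) - f s * incr g s (s + h)))"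
    unfolding incr_def by (intro Lp_norm_on_add_const p2) measurable
  also have "\<dots> \<le> ennreal (quasi_const p2) * (Lp_norm_on T p0 f * modulus T p1 g \<tau> + modulus2 T p2 (\<lambda>s t. incr I s t - f s * incr g s t) \<tau>)"
    using h by (intro mult_left_mono add_mono germ_norm_le) (auto simp: modulus2_def intro: SUP_upper2)
  also have "\<dots> \<le> ennreal (quasi_const p2) * (Lp_norm_on T p0 f * modulus T p1 g \<tau> + U \<tau>)"
    by (intro mult_left_mono add_left_mono remainder_modulus2_le I fin t) auto
  finally show "Lp_norm_on (T - h) p2 (\<lambda>s. I (s + h) - I s) \<le> ennreal (quasi_const p2) * (Lp_norm_on T p0 f * modulus T p1 g \<tau> + U \<tau>)" .
qed

lemma integral_seminorm_le:
  assumes I: "is_integral I" and K: "0 \<le> K" "\<And>\<tau>. 0 < \<tau> \<Longrightarrow> \<tau> \<le> T \<Longrightarrow> U \<tau> \<le> ennreal (K * \<tau> powr \<gamma>) * (F * G)"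
    and D: "0 \<le> D" "Lp_qnorm (dlog T) q1 (\<lambda>\<tau>. ennreal (\<tau> powr \<alpha>0)) \<le> ennreal (D * T powr \<alpha>0)"
  shows "besov_seminorm T \<alpha>1 p2 q1 I \<le> ennreal (quasi_const p2 * (quasi_const q1 * (1 + K * D))) *
     (Lp_norm_on T p0 f + ennreal (T powr \<alpha>0) * F) * G"
proof -
  have "U T \<le> ennreal (K * T powr \<gamma>) * (F * G)" using K T by auto
  also have "\<dots> < top" using FG by (simp add: ennreal_mult_less_top)
  finally have fin: "U T < top" .
  have "besov_seminorm T \<alpha>1 p2 q1 I \<le> ennreal (quasi_const p2) * ennreal (quasi_const q1 * (1 + K * D)) * (Lp_norm_on T p0 f * G + ennreal (T powr \<alpha>0) * (F * G))"
  proof (rule seminorm_le_of_modulus[OF _ f_Lp FG(3) K(1) _ D])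
    fix \<tau> assume t: "0 < \<tau>" "\<tau> \<le> T"
    show "modulus T p2 I \<tau> \<le> ennreal (quasi_const p2) * (Lp_norm_on T p0 f * modulus T p1 g \<tau> + ennreal (K * \<tau> powr (\<alpha>0 + \<alpha>1)) * (F * G))"
      using integral_modulus_le[OF I fin t] K(2)[OF t] unfolding \<gamma>_def
      by (meson add_left_mono mult_left_mono order_trans zero_le)
  qed simp
  also have "\<dots> = ennreal (quasi_const p2 * (quasi_const q1 * (1 + K * D))) * (Lp_norm_on T p0 f + ennreal (T powr \<alpha>0) * F) * G"
    using K D quasi_const_pos[of p2] quasi_const_pos[of q1]
    by (subst ennreal_mult[of "quasi_const p2"]) (auto simp: distrib_left distrib_right mult.assoc)
  finally show ?thesis .
qed

lemma remainder_subcritical_le: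
  assumes I: "is_integral I" and fin: "U T < top"
    and C: "\<forall>T>0. \<forall>Z. (\<forall>x y. x \<le> y \<longrightarrow> Z x \<le> Z y) \<longrightarrow>
      Lp_qnorm (dlog T) q2 (\<lambda>\<tau>. enn_powr (\<Sum>n. 2 ^ Suc n * enn_powr (Z (\<tau> / 2 ^ n)) \<rho>) (1 / \<rho>) / ennreal (\<tau> powr \<gamma>))
      \<le> ennreal C * Lp_qnorm (dlog T) q2 (\<lambda>\<tau>. Z \<tau> / ennreal (\<tau> powr \<gamma>))"
  shows "besov2_norm T (\<lambda>\<tau>. \<tau> powr \<gamma>) p2 q2 (\<lambda>s t. incr I s t - f s * incr g s t) \<le> ennreal C * F * G"
proof -
  have "besov2_norm T (\<lambda>\<tau>. \<tau> powr \<gamma>) p2 q2 (\<lambda>s t. incr I s t - f s * incr g s t)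
      \<le> Lp_qnorm (dlog T) q2 (\<lambda>\<tau>. U \<tau> / ennreal (\<tau> powr \<gamma>))"
    by (intro besov2_norm_le q2 remainder_modulus2_le I fin)
  also have "\<dots> \<le> ennreal C * Lp_qnorm (dlog T) q2 W"
    using C[rule_format, of T Z] Z_mono T by (simp add: U_def Psi_def W_def[abs_def])
  also have "\<dots> \<le> ennreal C * (F * G)" by (intro mult_left_mono W_norm) auto
  finally show ?thesis by (simp add: mult.assoc)
qed

text \<open>Interpolation between L^q2 and the uniform bound W \<le> c in the scale variable: W^r
  \<le> c^(r-s) W^s for s = q2.\<close>

lemma W_norm_finite:
  assumes "q2 \<le> ennreal r" "0 < r"
  shows "Lp_qnorm (dlog T) (ennreal r) W < top"
proof -
  obtain s where s: "0 < s" "q2 = ennreal s" using q2 assms by (cases q2) (auto simp: top_unique)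
  have sr: "s \<le> r" using assms s by simp
  define c where "c = 256 * (F * G)"
  have c: "c < top" using FG by (simp add: c_def ennreal_mult_less_top)
  have W: "W \<tau> \<le> c" if t: "0 < \<tau>" "\<tau> \<le> T" for \<tau>
  proof -
    have "W \<tau> \<le> ennreal (256 * \<tau> powr \<gamma>) * (F * G) / ennreal (\<tau> powr \<gamma>)"
      unfolding W_def by (intro divide_right_mono_ennreal Z_le t)
    also have "\<dots> = c * ennreal (\<tau> powr \<gamma>) / ennreal (\<tau> powr \<gamma>)" by (simp add: c_def ennreal_mult ac_simps)
    also have "\<dots> = c" using t by (intro mult_divide_eq_ennreal) auto
    finally show ?thesis .
  qed
  have "(\<integral>\<^sup>+\<tau>. enn_powr (W \<tau>) r \<partial>dlog T) \<le> (\<integral>\<^sup>+\<tau>. enn_powr c (r - s) * enn_powr (W \<tau>) s \<partial>dlog T)"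
  proof (intro nn_integral_mono)
    fix \<tau> assume "\<tau> \<in> space (dlog T)"
    then have "W \<tau> \<le> c" by (auto intro: W)
    then have "enn_powr (W \<tau>) (r - s) * enn_powr (W \<tau>) s \<le> enn_powr c (r - s) * enn_powr (W \<tau>) s"
      using sr by (intro mult_right_mono enn_powr_mono) auto
    also have "enn_powr (W \<tau>) (r - s) * enn_powr (W \<tau>) s = enn_powr (W \<tau>) r"
      by (cases "W \<tau>") (auto simp: enn_powr_ennreal powr_add[symmetric] simp flip: ennreal_mult)
    finally show "enn_powr (W \<tau>) r \<le> enn_powr c (r - s) * enn_powr (W \<tau>) s" .
  qed
  also have "\<dots> = enn_powr c (r - s) * enn_powr (Lp_qnorm (dlog T) q2 W) s"
    using s by (simp add: nn_integral_cmult Lp_qnorm_ennreal)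
  also have "\<dots> < top" using c W_norm FG by (auto simp: ennreal_mult_less_top intro: le_less_trans)
  finally show ?thesis using assms by (simp add: Lp_qnorm_ennreal)
qed

text \<open>The power l = min \<rho> r serves two purposes: l \<le> \<rho> distributes it over the
  cells of the partition, and l \<le> r makes the norm in the scale variable subadditive. By
  dilation a cell of relative length \<theta> contributes \<theta>^(\<gamma> l) times a fixed norm.
  Since \<gamma> l > 1, which uses r > 1/\<gamma>, summing over the cells leaves the factor
  mesh^(\<gamma> l - 1).\<close>

theorem riemann_sum_convergence_subcritical:
  assumes I: "is_integral I" and gt: "1 < \<gamma> * \<rho>" and fin: "U T < top"
    and r: "0 < r" "1 / \<gamma> < r" "q2 \<le> ennreal r"
  shows "((\<lambda>P. besov2_norm T (\<lambda>\<tau>. \<tau> powr \<gamma>) p2 (ennreal r) (\<lambda>s t. riemann_sum f g P s t - incr I s t)) \<longlongrightarrow> 0) mesh_to_0"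
proof -
  define V where "V \<tau> = U \<tau> / ennreal (\<tau> powr \<gamma>)" for \<tau>
  have [measurable]: "V \<in> borel_measurable borel" unfolding V_def by measurable
  define l where "l = min \<rho> r"
  have l: "0 < l" "l \<le> \<rho>" "ennreal l \<le> ennreal r" "0 < \<gamma> * l - 1"
  proof -
    show "0 < l" "l \<le> \<rho>" "ennreal l \<le> ennreal r" using \<rho> r by (auto simp: l_def intro: ennreal_leI)
    have "1 < \<gamma> * r" using r \<gamma> by (simp add: field_simps)
    then show "0 < \<gamma> * l - 1" using gt by (auto simp: l_def min_def)
  qed
  let ?q = "ennreal r"
  have q: "0 < ?q" using r by simp
  define B where "B = enn_powr (Lp_qnorm (dlog T) ?q V) l"
  have B: "B < top"
  proof -
    obtain C where "\<forall>T>0. \<forall>Z. (\<forall>x y. x \<le> y \<longrightarrow> Z x \<le> Z y) \<longrightarrow>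
      Lp_qnorm (dlog T) ?q (\<lambda>\<tau>. enn_powr (\<Sum>n. 2 ^ Suc n * enn_powr (Z (\<tau> / 2 ^ n)) \<rho>) (1 / \<rho>) / ennreal (\<tau> powr \<gamma>))
      \<le> ennreal C * Lp_qnorm (dlog T) ?q (\<lambda>\<tau>. Z \<tau> / ennreal (\<tau> powr \<gamma>))"
      using subcritical_norm_le[OF \<rho>(1) q gt] by blast
    from this[rule_format, of T Z] have "Lp_qnorm (dlog T) ?q V \<le> ennreal C * Lp_qnorm (dlog T) ?q W"
      using Z_mono T by (simp add: V_def[abs_def] U_def Psi_def W_def[abs_def])
    also have "\<dots> < top" using W_norm_finite[OF r(3,1)] by (simp add: ennreal_mult_less_top)
    finally show ?thesis by (simp add: B_def)
  qed
  define \<Phi> where "\<Phi> x = enn_powr (B * ennreal (x powr (\<gamma> * l - 1))) (1 / l)" for x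
  show ?thesis
  proof (rule mesh_to_0_tendsto)
    have "((\<lambda>x. x powr (\<gamma> * l - 1)) \<longlongrightarrow> 0) (at_right (0::real))"
      by (rule tendsto_zero_powrI[OF tendsto_ident_at tendsto_const _ l(4)]) (auto intro: eventually_mono[OF eventually_at_right_less])
    from tendsto_ennrealI[OF this] have "((\<lambda>x. ennreal (x powr (\<gamma> * l - 1))) \<longlongrightarrow> 0) (at_right 0)" by simp
    from ennreal_tendsto_cmult[OF B this] have "(\<Phi> \<longlongrightarrow> enn_powr (B * 0) (1 / l)) (at_right 0)"
      unfolding \<Phi>_def using l by (intro tendsto_enn_powr) auto
    then show "(\<Phi> \<longlongrightarrow> 0) (at_right 0)" by simp
  next
    fix P assume P: "unit_partition P"
    let ?K = "{1..<length P}"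
    define \<theta> where "\<theta> k = P ! k - P ! (k - 1)" for k
    have \<theta>: "0 < \<theta> k" "\<theta> k \<le> 1" if "k \<in> ?K" for k
    proof -
      show "0 < \<theta> k" unfolding \<theta>_def using unit_partitionD(4)[OF P] that by (auto simp: sorted_wrt_iff_nth_less)
      have "P ! k \<in> {0..1}" "P ! (k - 1) \<in> {0..1}"
        using that by (auto intro!: subsetD[OF unit_partitionD(5)[OF P] nth_mem] simp del: atLeastAtMost_iff)
      then show "\<theta> k \<le> 1" by (auto simp: \<theta>_def)
    qed
    have scaled: "Lp_qnorm (dlog T) ?q (\<lambda>\<tau>. ennreal (t powr \<gamma>) * V (t * \<tau>)) \<le> ennreal (t powr \<gamma>) * Lp_qnorm (dlog T) ?q V"
      if t: "0 < t" "t \<le> 1" for t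
    proof -
      have "t * T \<le> 1 * T" using t T by (intro mult_right_mono) auto
      then have "Lp_qnorm (dlog (t * T)) ?q V \<le> Lp_qnorm (dlog T) ?q V"
        by (intro Lp_qnorm_dlog_mono_interval q) auto
      then show ?thesis using t q by (simp add: Lp_qnorm_cmult Lp_qnorm_dlog_scale mult_left_mono)
    qed
    have pw: "enn_powr (chain_sum (\<lambda>u v. Psi ((v - u) * \<tau>)) P) (1 / \<rho>) / ennreal (\<tau> powr \<gamma>)
       \<le> enn_powr (\<Sum>k\<in>?K. enn_powr (ennreal (\<theta> k powr \<gamma>) * V (\<theta> k * \<tau>)) l) (1 / l)" if t: "0 < \<tau>" for \<tau>
    proof -
      define v where "v = ennreal (1 / \<tau> powr \<gamma>)"
      have v: "x / ennreal (\<tau> powr \<gamma>) = x * v" for x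
        using t by (simp add: v_def divide_ennreal_def inverse_ennreal inverse_eq_divide)
      have "enn_powr (\<Sum>k\<in>?K. Psi (\<theta> k * \<tau>)) (l / \<rho>) \<le> (\<Sum>k\<in>?K. enn_powr (Psi (\<theta> k * \<tau>)) (l / \<rho>))"
        using l \<rho> by (intro enn_powr_sum_le) auto
      also have "\<dots> = (\<Sum>k\<in>?K. enn_powr (U (\<theta> k * \<tau>)) l)"
        using \<rho> by (simp add: Psi_U enn_powr_powr)
      finally have "enn_powr (enn_powr (\<Sum>k\<in>?K. Psi (\<theta> k * \<tau>)) (1 / \<rho>)) l \<le> (\<Sum>k\<in>?K. enn_powr (U (\<theta> k * \<tau>)) l)"
        by (simp add: enn_powr_powr)
      then have "enn_powr (\<Sum>k\<in>?K. Psi (\<theta> k * \<tau>)) (1 / \<rho>) \<le> enn_powr (\<Sum>k\<in>?K. enn_powr (U (\<theta> k * \<tau>)) l) (1 / l)"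
        using l by (simp only: enn_powr_le_swap)
      then have "enn_powr (chain_sum (\<lambda>u v. Psi ((v - u) * \<tau>)) P) (1 / \<rho>) * v \<le> enn_powr (\<Sum>k\<in>?K. enn_powr (U (\<theta> k * \<tau>)) l) (1 / l) * v"
        unfolding chain_sum_nth \<theta>_def by (rule mult_right_mono) simp
      also have "\<dots> = enn_powr ((\<Sum>k\<in>?K. enn_powr (U (\<theta> k * \<tau>)) l) * enn_powr v l) (1 / l)"
        using l by (simp add: enn_powr_mult)
      also have "(\<Sum>k\<in>?K. enn_powr (U (\<theta> k * \<tau>)) l) * enn_powr v l = (\<Sum>k\<in>?K. enn_powr (ennreal (\<theta> k powr \<gamma>) * V (\<theta> k * \<tau>)) l)"
        unfolding sum_distrib_right
      proof (intro sum.cong refl)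
        fix k assume k: "k \<in> ?K"
        have "U (\<theta> k * \<tau>) = V (\<theta> k * \<tau>) * ennreal ((\<theta> k * \<tau>) powr \<gamma>)"
          using \<theta>[OF k] t by (simp add: V_def divide_powr_cancel)
        then have "U (\<theta> k * \<tau>) * v = V (\<theta> k * \<tau>) * (ennreal ((\<theta> k * \<tau>) powr \<gamma>) * ennreal (1 / \<tau> powr \<gamma>))"
          by (simp add: v_def mult.assoc)
        also have "ennreal ((\<theta> k * \<tau>) powr \<gamma>) * ennreal (1 / \<tau> powr \<gamma>) = ennreal (\<theta> k powr \<gamma>)"
          using \<theta>[OF k] t by (simp add: powr_mult flip: ennreal_mult)
        finally show "enn_powr (U (\<theta> k * \<tau>)) l * enn_powr v l = enn_powr (ennreal (\<theta> k powr \<gamma>) * V (\<theta> k * \<tau>)) l"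
          by (simp add: mult.commute flip: enn_powr_mult)
      qed
      finally show ?thesis unfolding v .
    qed
    let ?X = "besov2_norm T (\<lambda>\<tau>. \<tau> powr \<gamma>) p2 ?q (\<lambda>s t. riemann_sum f g P s t - incr I s t)"
    have [measurable]: "(\<lambda>\<tau>. chain_sum (\<lambda>u v. Psi ((v - u) * \<tau>)) P) \<in> borel_measurable borel"
      unfolding chain_sum_nth Psi_U by measurable
    have "?X \<le> Lp_qnorm (dlog T) ?q (\<lambda>\<tau>. enn_powr (chain_sum (\<lambda>u v. Psi ((v - u) * \<tau>)) P) (1 / \<rho>) / ennreal (\<tau> powr \<gamma>))"
      by (intro besov2_norm_le q riemann_sum_modulus2_le I fin P)
    also have "\<dots> \<le> Lp_qnorm (dlog T) ?q (\<lambda>\<tau>. enn_powr (\<Sum>k\<in>?K. enn_powr (ennreal (\<theta> k powr \<gamma>) * V (\<theta> k * \<tau>)) l) (1 / l))"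
      using pw by (intro Lp_qnorm_mono[OF q]) auto
    finally have "enn_powr ?X l \<le> enn_powr (Lp_qnorm (dlog T) ?q (\<lambda>\<tau>. enn_powr (\<Sum>k\<in>?K. enn_powr (ennreal (\<theta> k powr \<gamma>) * V (\<theta> k * \<tau>)) l) (1 / l))) l"
      using l by (intro enn_powr_mono) auto
    also have "\<dots> \<le> (\<Sum>k\<in>?K. enn_powr (Lp_qnorm (dlog T) ?q (\<lambda>\<tau>. ennreal (\<theta> k powr \<gamma>) * V (\<theta> k * \<tau>))) l)"
      using l by (intro Lp_qnorm_sum_powr) auto
    also have "\<dots> \<le> (\<Sum>k\<in>?K. ennreal (\<theta> k powr (\<gamma> * l)) * B)"
    proof (intro sum_mono)
      fix k assume k: "k \<in> ?K"
      have "enn_powr (Lp_qnorm (dlog T) ?q (\<lambda>\<tau>. ennreal (\<theta> k powr \<gamma>) * V (\<theta> k * \<tau>))) l \<le> enn_powr (ennreal (\<theta> k powr \<gamma>) * Lp_qnorm (dlog T) ?q V) l"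
        using l \<theta>[OF k] by (intro enn_powr_mono scaled) auto
      then show "enn_powr (Lp_qnorm (dlog T) ?q (\<lambda>\<tau>. ennreal (\<theta> k powr \<gamma>) * V (\<theta> k * \<tau>))) l \<le> ennreal (\<theta> k powr (\<gamma> * l)) * B"
        by (simp add: enn_powr_mult enn_powr_ennreal powr_powr B_def)
    qed
    also have "\<dots> = chain_sum (\<lambda>u v. ennreal ((v - u) powr (\<gamma> * l)) * B) P"
      by (simp add: chain_sum_nth \<theta>_def)
    also have "\<dots> \<le> B * ennreal (mesh P powr (\<gamma> * l - 1))"
    proof (rule chain_sum_mesh_le[OF P])
      fix t assume t: "0 < t" "t \<le> mesh P"
      have "t powr (\<gamma> * l) = t * t powr (\<gamma> * l - 1)" using t by (simp add: powr_diff)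
      also have "\<dots> \<le> t * mesh P powr (\<gamma> * l - 1)" using t l by (intro mult_left_mono powr_mono2) auto
      finally have "ennreal (t powr (\<gamma> * l)) * B \<le> ennreal (t * mesh P powr (\<gamma> * l - 1)) * B"
        by (intro mult_right_mono ennreal_leI) auto
      then show "ennreal (t powr (\<gamma> * l)) * B \<le> ennreal t * (B * ennreal (mesh P powr (\<gamma> * l - 1)))"
        using t by (simp add: ennreal_mult ac_simps)
    qed
    finally show "?X \<le> \<Phi> (mesh P)" unfolding \<Phi>_def using l by (simp add: enn_powr_le_swap)
  qed
qed

text \<open>As \<gamma>\<rho> = 1, the bound of a cell is linear in its length, so summation brings
  no gain. Smallness comes from the norm of \<open>W\<close>: the cells see only scales up to T
  times the mesh, where this norm tends to 0.\<close>

theorem riemann_sum_convergence_critical: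
  assumes I: "is_integral I" and crit: "\<gamma> * \<rho> = 1" "q2 \<le> ennreal \<rho>" and fin: "U T < top"
  shows "((\<lambda>P. besov2_norm T (\<lambda>\<tau>. \<tau> powr \<gamma>) p2 \<infinity> (\<lambda>s t. riemann_sum f g P s t - incr I s t)) \<longlongrightarrow> 0) mesh_to_0"
proof (rule mesh_to_0_tendsto)
  let ?\<Phi> = "\<lambda>x. ennreal 9216 * Lp_qnorm (dlog (T * x)) q2 W"
  have "q2 < top" using crit by (auto simp: less_top[symmetric] top_unique)
  moreover have "Lp_qnorm (dlog T) q2 W < top" using W_norm FG by (auto intro: le_less_trans)
  ultimately have lim: "((\<lambda>S. Lp_qnorm (dlog S) q2 W) \<longlongrightarrow> 0) (at_right 0)"
    using T q2 by (intro Lp_qnorm_dlog_tendsto_0) auto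
  have "filterlim (\<lambda>x. T * x) (at_right 0) (at_right 0)"
    using T by (intro filterlim_times_pos[OF filterlim_ident]) auto
  from ennreal_tendsto_cmult[OF _ filterlim_compose[OF lim this], of "ennreal 9216"]
  show "(?\<Phi> \<longlongrightarrow> 0) (at_right 0)" by simp
next
  fix P assume P: "unit_partition P"
  let ?N = "Lp_qnorm (dlog (T * mesh P)) q2 W"
  have pw: "enn_powr (chain_sum (\<lambda>u v. Psi ((v - u) * \<tau>)) P) (1 / \<rho>) / ennreal (\<tau> powr \<gamma>) \<le> ennreal 9216 * ?N"
    if t: "0 < \<tau>" "\<tau> \<le> T" for \<tau>
  proof -
    have "chain_sum (\<lambda>u v. Psi ((v - u) * \<tau>)) P \<le> ennreal (9216 powr \<rho> * \<tau>) * enn_powr ?N \<rho>"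
    proof (rule chain_sum_mesh_le[OF P])
      fix x assume x: "0 < x" "x \<le> mesh P"
      have "x * \<tau> \<le> mesh P * T" using x t by (intro mult_mono) auto
      then have "Lp_qnorm (dlog (x * \<tau>)) q2 W \<le> ?N"
        by (intro Lp_qnorm_dlog_mono_interval q2) (auto simp: mult.commute)
      then have "U (x * \<tau>) \<le> ennreal (9216 * (x * \<tau>) powr \<gamma>) * ?N"
        using U_le_critical_tail[OF crit, of "x * \<tau>"] x t by (meson mult_left_mono mult_pos_pos order_trans zero_le)
      then have "Psi (x * \<tau>) \<le> enn_powr (ennreal (9216 * (x * \<tau>) powr \<gamma>) * ?N) \<rho>"
        unfolding Psi_U using \<rho> by (intro enn_powr_mono) auto
      also have "\<dots> = ennreal ((9216 * (x * \<tau>) powr \<gamma>) powr \<rho>) * enn_powr ?N \<rho>"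
        by (simp add: enn_powr_mult enn_powr_ennreal)
      also have "(9216 * (x * \<tau>) powr \<gamma>) powr \<rho> = x * (9216 powr \<rho> * \<tau>)"
        using x t crit by (simp add: powr_mult powr_powr)
      finally show "Psi (x * \<tau>) \<le> ennreal x * (ennreal (9216 powr \<rho> * \<tau>) * enn_powr ?N \<rho>)"
        using x t by (simp add: ennreal_mult mult.assoc)
    qed
    then have "enn_powr (chain_sum (\<lambda>u v. Psi ((v - u) * \<tau>)) P) (1 / \<rho>) \<le> enn_powr (ennreal (9216 powr \<rho> * \<tau>) * enn_powr ?N \<rho>) (1 / \<rho>)"
      using \<rho> by (intro enn_powr_mono) auto
    also have "\<dots> = ennreal ((9216 powr \<rho> * \<tau>) powr (1 / \<rho>)) * ?N"
      using \<rho> t by (subst enn_powr_mult) (simp add: enn_powr_ennreal)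
    also have "(9216 powr \<rho> * \<tau>) powr (1 / \<rho>) = 9216 * \<tau> powr \<gamma>"
    proof -
      have "1 / \<rho> = \<gamma>" using crit \<rho> by (simp add: field_simps)
      then show ?thesis using t \<rho> by (simp add: powr_mult powr_powr) (use crit in \<open>simp add: mult.commute\<close>)
    qed
    finally have "enn_powr (chain_sum (\<lambda>u v. Psi ((v - u) * \<tau>)) P) (1 / \<rho>) / ennreal (\<tau> powr \<gamma>) \<le> ennreal (9216 * \<tau> powr \<gamma>) * ?N / ennreal (\<tau> powr \<gamma>)"
      by (rule divide_right_mono_ennreal)
    also have "\<dots> = (ennreal 9216 * ?N) * ennreal (\<tau> powr \<gamma>) / ennreal (\<tau> powr \<gamma>)"
      by (simp add: ennreal_mult ac_simps)
    also have "\<dots> = ennreal 9216 * ?N" using t by (intro mult_divide_eq_ennreal) auto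
    finally show ?thesis .
  qed
  have "besov2_norm T (\<lambda>\<tau>. \<tau> powr \<gamma>) p2 \<infinity> (\<lambda>s t. riemann_sum f g P s t - incr I s t)
    \<le> Lp_qnorm (dlog T) \<infinity> (\<lambda>\<tau>. enn_powr (chain_sum (\<lambda>u v. Psi ((v - u) * \<tau>)) P) (1 / \<rho>) / ennreal (\<tau> powr \<gamma>))"
    by (intro besov2_norm_le riemann_sum_modulus2_le I fin P) auto
  also have "\<dots> \<le> ennreal 9216 * ?N"
  proof -
    have [measurable]: "(\<lambda>\<tau>. chain_sum (\<lambda>u v. Psi ((v - u) * \<tau>)) P) \<in> borel_measurable borel"
      unfolding chain_sum_nth Psi_U by measurable
    show ?thesis unfolding infinity_ennreal_def Lp_qnorm_top using pw by (intro esssup_I AE_I2) auto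
  qed
  finally show "besov2_norm T (\<lambda>\<tau>. \<tau> powr \<gamma>) p2 \<infinity> (\<lambda>s t. riemann_sum f g P s t - incr I s t) \<le> ennreal 9216 * ?N" .
qed

end

subsection \<open>Continuous versions\<close>

lemma inverse_exponent:
  assumes "1 \<le> (p::ennreal)"
  shows "0 < p" "inverse p = ennreal (enn2real (inverse p))" "enn2real (inverse p) \<le> 1"
proof -
  show "0 < p" using assms by (metis less_le_trans zero_less_one)
  have "inverse p \<le> 1" using assms ennreal_inverse_le_iff[of p 1] by simp
  then show "inverse p = ennreal (enn2real (inverse p))" "enn2real (inverse p) \<le> 1"
    by (auto simp: ennreal_enn2real_if top_unique intro: enn2real_leI)
qed

lemma L1_le_Lp_finite_measure:
  assumes p: "1 \<le> p" and L: "0 < L" "emeasure M (space M) = ennreal L" and [measurable]: "F \<in> borel_measurable M"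
  shows "(\<integral>\<^sup>+u. F u \<partial>M) \<le> ennreal (L powr (1 - enn2real (inverse p))) * Lp_qnorm M p F"
proof -
  define e where "e = enn2real (inverse p)"
  have e: "0 < p" "inverse p = ennreal e" "0 \<le> e" "e \<le> 1"
    using inverse_exponent[OF p] by (auto simp: e_def)
  \<comment> \<open>The conjugate exponent; for p = 1 it is \<open>inverse 0\<close>, that is
    \<open>top\<close>.\<close>
  define p' where "p' = inverse (ennreal (1 - e))"
  have p'0: "0 < p'" unfolding p'_def by (simp add: ennreal_inverse_positive)
  have ip': "inverse p' = ennreal (1 - e)" by (simp add: p'_def)
  have conj: "inverse 1 = inverse p + inverse p'"
    using e by (simp add: ip' flip: ennreal_plus)
  have "(\<integral>\<^sup>+u. F u \<partial>M) = Lp_qnorm M 1 (\<lambda>u. F u * 1)"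
    using Lp_qnorm_ennreal[of 1 M F] by simp
  also have "\<dots> \<le> Lp_qnorm M p F * Lp_qnorm M p' (\<lambda>u. 1)"
    by (intro Lp_qnorm_Holder e p'0 conj) measurable
  finally have H: "(\<integral>\<^sup>+u. F u \<partial>M) \<le> Lp_qnorm M p F * Lp_qnorm M p' (\<lambda>u. 1)" .
  have "Lp_qnorm M p' (\<lambda>u. 1) \<le> ennreal (L powr (1 - e))"
    using p'0
  proof (cases rule: ennreal_exponent_cases)
    case (fin s)
    then have s: "1 / s = 1 - e" using ip' e by (simp add: inverse_ennreal inverse_eq_divide)
    then show ?thesis using fin L s by (simp add: Lp_qnorm_ennreal enn_powr_ennreal)
  next
    case top
    then have "1 - e = 0" using ip' e by simp
    then show ?thesis using top L by (auto simp: Lp_qnorm_top)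
  qed
  from order_trans[OF H mult_left_mono[OF this]] show ?thesis
    by (simp add: e_def mult.commute)
qed

lemma emeasure_lebesgue_on_Icc: "a \<le> b \<Longrightarrow> emeasure (lebesgue_on {a..b}) (space (lebesgue_on {a..b})) = ennreal (b - a :: real)"
  by (simp add: emeasure_restrict_space)

lemma Lp_qnorm_subinterval:
  fixes a b S :: real
  assumes p: "0 < p" and I: "0 \<le> a" "b \<le> S" and [measurable]: "F \<in> borel_measurable borel"
  shows "Lp_qnorm (lebesgue_on {a..b}) p F \<le> Lp_qnorm (lebesgue_on {0..S}) p F"
  using p
proof (cases rule: ennreal_exponent_cases)
  case (fin s)
  have "(\<integral>\<^sup>+x. enn_powr (F x) s \<partial>lebesgue_on {a..b}) \<le> (\<integral>\<^sup>+x. enn_powr (F x) s \<partial>lebesgue_on {0..S})"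
    unfolding nn_integral_lebesgue_on[OF atLeastAtMost_borel] using I
    by (intro nn_integral_mono mult_left_mono) (auto split: split_indicator)
  then show ?thesis using fin by (simp add: Lp_qnorm_ennreal enn_powr_mono)
next
  case top
  have "AE x in lebesgue_on {0..S}. F x \<le> esssup (lebesgue_on {0..S}) F" by (rule esssup_AE)
  then have "AE x in lebesgue_on {a..b}. F x \<le> esssup (lebesgue_on {0..S}) F"
    using I by (auto simp: AE_lebesgue_on_iff elim!: eventually_mono)
  then show ?thesis using top by (auto simp: Lp_qnorm_top)
qed

lemma L1_le_Lp:
  assumes p: "1 \<le> p" and L: "0 < L" "0 \<le> w" "w + L \<le> S" and [measurable]: "F \<in> borel_measurable borel"
  shows "(\<integral>\<^sup>+u. F u * indicator {w..w + L} u \<partial>lborel)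
    \<le> ennreal (L powr (1 - enn2real (inverse p))) * Lp_qnorm (lebesgue_on {0..S}) p F"
proof -
  let ?M = "lebesgue_on {w..w + L}"
  have "(\<integral>\<^sup>+u. F u * indicator {w..w + L} u \<partial>lborel) = (\<integral>\<^sup>+u. F u \<partial>?M)"
    by (simp add: nn_integral_lebesgue_on)
  also have "\<dots> \<le> ennreal (L powr (1 - enn2real (inverse p))) * Lp_qnorm ?M p F"
    using L emeasure_lebesgue_on_Icc[of w "w + L"] by (intro L1_le_Lp_finite_measure p) auto
  also have "\<dots> \<le> ennreal (L powr (1 - enn2real (inverse p))) * Lp_qnorm (lebesgue_on {0..S}) p F"
    using L inverse_exponent(1)[OF p] by (intro mult_left_mono Lp_qnorm_subinterval) auto
  finally show ?thesis .
qed

text \<open>A shear replaces pairs of points by a base point c and a step h in [0,\<epsilon>]. For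
  each h the integral over c is an L^1 norm over a window inside [0,T-h], which Hoelder bounds by
  the modulus; integrating over h gives \<epsilon>, and the two orders of u and x give the factor
  2.\<close>

lemma double_increment_le:
  fixes f :: "real \<Rightarrow> real"
  assumes p: "1 \<le> p" and [measurable]: "f \<in> borel_measurable borel"
    and M: "0 \<le> M" "0 < \<alpha>" "\<And>\<tau>. 0 < \<tau> \<Longrightarrow> \<tau> \<le> T \<Longrightarrow> modulus T p f \<tau> \<le> ennreal (M * \<tau> powr \<alpha>)"
    and w: "0 \<le> w" "w + L \<le> T" "0 < \<epsilon>" "\<epsilon> \<le> L"
  defines "I \<equiv> {w..w + L}"
  shows "(\<integral>\<^sup>+x. (\<integral>\<^sup>+u. ennreal \<bar>f u - f x\<bar> * (if u \<in> I \<and> x \<in> I \<and> \<bar>u - x\<bar> \<le> \<epsilon> then 1 else 0) \<partial>lborel) \<partial>lborel)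
    \<le> ennreal (2 * \<epsilon> * L powr (1 - enn2real (inverse p)) * (M * \<epsilon> powr \<alpha>))"
proof -
  have p0: "0 < p" using p by (metis less_le_trans zero_less_one)
  define e where "e = enn2real (inverse p)"
  define K where "K c t = (if w \<le> c \<and> c \<le> t \<and> t \<le> w + L \<and> t - c \<le> \<epsilon> then ennreal \<bar>f t - f c\<bar> else 0)" for c t
  have [measurable]: "(\<lambda>x. K (a x) (b x)) \<in> borel_measurable N"
    if [measurable]: "a \<in> borel_measurable N" "b \<in> borel_measurable N" for N and a b :: "'z \<Rightarrow> real"
    unfolding K_def by measurable
  define B where "B = ennreal (L powr (1 - e) * (M * \<epsilon> powr \<alpha>))"
  have e1: "e \<le> 1"
    using p ennreal_inverse_le_iff[of p 1] unfolding e_def by (intro enn2real_leI) auto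
  have inner: "(\<integral>\<^sup>+c. K c (c + h) \<partial>lborel) \<le> B * indicator {0..\<epsilon>} h" for h
  proof (cases "0 < h \<and> h \<le> \<epsilon> \<and> h < L")
    case True
    let ?G = "\<lambda>c. ennreal \<bar>f (c + h) - f c\<bar>"
    have "(\<integral>\<^sup>+c. K c (c + h) \<partial>lborel) = (\<integral>\<^sup>+c. ?G c * indicator {w..w + (L - h)} c \<partial>lborel)"
      using True by (intro nn_integral_cong) (auto simp: K_def split: split_indicator)
    also have "\<dots> \<le> ennreal ((L - h) powr (1 - e)) * Lp_qnorm (lebesgue_on {0..T - h}) p ?G"
      unfolding e_def using True w by (intro L1_le_Lp p) auto
    also have "\<dots> \<le> ennreal (L powr (1 - e)) * ennreal (M * \<epsilon> powr \<alpha>)"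
    proof (intro mult_mono ennreal_leI powr_mono2)
      have "Lp_qnorm (lebesgue_on {0..T - h}) p ?G \<le> modulus T p f h"
        using modulus_upper[of h h T p f] True by (simp add: Lp_norm_on_def)
      also have "\<dots> \<le> modulus T p f \<epsilon>" using True by (intro modulus_mono) auto
      also have "\<dots> \<le> ennreal (M * \<epsilon> powr \<alpha>)" using w by (intro M) auto
      finally show "Lp_qnorm (lebesgue_on {0..T - h}) p ?G \<le> ennreal (M * \<epsilon> powr \<alpha>)" .
    qed (use True e1 in auto)
    also have "\<dots> = B" using M by (simp add: B_def ennreal_mult)
    finally show ?thesis using True by simp
  next
    case False
    \<comment> \<open>At h = L only c = w is admissible. This boundary case is split off because the
      L^1 bound needs a window of positive length.\<close>
    have "AE c in lborel. K c (c + h) = 0"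
      using AE_lborel_singleton[of w]
    proof eventually_elim
      case (elim c)
      show ?case
      proof (cases "h = 0")
        case False
        then show ?thesis using \<open>\<not> (0 < h \<and> h \<le> \<epsilon> \<and> h < L)\<close> elim w by (auto simp: K_def)
      qed (simp add: K_def)
    qed
    then have "(\<integral>\<^sup>+c. K c (c + h) \<partial>lborel) = 0" by (subst nn_integral_0_iff_AE) auto
    then show ?thesis by simp
  qed
  have "(\<integral>\<^sup>+c. \<integral>\<^sup>+t. K c t \<partial>lborel \<partial>lborel) = (\<integral>\<^sup>+h. \<integral>\<^sup>+c. K c (c + h) \<partial>lborel \<partial>lborel)"
    by (rule nn_integral_lborel_shear) measurable
  also have "\<dots> \<le> (\<integral>\<^sup>+h. B * indicator {0..\<epsilon>} h \<partial>lborel)"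
    by (intro nn_integral_mono inner)
  also have "\<dots> = B * ennreal \<epsilon>" using w by (simp add: nn_integral_cmult_indicator)
  finally have KB: "(\<integral>\<^sup>+c. \<integral>\<^sup>+t. K c t \<partial>lborel \<partial>lborel) \<le> B * ennreal \<epsilon>" .
  have swap: "(\<integral>\<^sup>+x. \<integral>\<^sup>+u. K u x \<partial>lborel \<partial>lborel) = (\<integral>\<^sup>+x. \<integral>\<^sup>+u. K x u \<partial>lborel \<partial>lborel)"
    by (rule lborel_pair.Fubini') measurable
  have "(\<integral>\<^sup>+x. (\<integral>\<^sup>+u. ennreal \<bar>f u - f x\<bar> * (if u \<in> I \<and> x \<in> I \<and> \<bar>u - x\<bar> \<le> \<epsilon> then 1 else 0) \<partial>lborel) \<partial>lborel)
    \<le> (\<integral>\<^sup>+x. \<integral>\<^sup>+u. K x u + K u x \<partial>lborel \<partial>lborel)"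
    by (intro nn_integral_mono) (auto simp: K_def I_def abs_minus_commute)
  also have "\<dots> = (\<integral>\<^sup>+x. \<integral>\<^sup>+u. K x u \<partial>lborel \<partial>lborel) + (\<integral>\<^sup>+x. \<integral>\<^sup>+u. K u x \<partial>lborel \<partial>lborel)"
    by (simp add: nn_integral_add)
  also have "\<dots> \<le> B * ennreal \<epsilon> + B * ennreal \<epsilon>"
    unfolding swap by (intro add_mono KB)
  also have "\<dots> = ennreal (2 * \<epsilon> * L powr (1 - e) * (M * \<epsilon> powr \<alpha>))"
  proof -
    have "B * ennreal \<epsilon> = ennreal (L powr (1 - e) * (M * \<epsilon> powr \<alpha>) * \<epsilon>)"
      unfolding B_def using M w by (subst ennreal_mult[symmetric]) auto
    then show ?thesis using M w by (simp add: algebra_simps flip: ennreal_plus)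
  qed
  finally show ?thesis by (simp add: e_def)
qed

lemma measurable_double_increment:
  fixes f :: "real \<Rightarrow> real"
  assumes [measurable]: "f \<in> borel_measurable borel"
  shows "(\<lambda>v. \<integral>\<^sup>+u. ennreal \<bar>f u - f v\<bar> * (if u \<in> {a..b} \<and> v \<in> {a..b} \<and> \<bar>u - v\<bar> \<le> c then 1 else 0) \<partial>lborel) \<in> borel_measurable lborel"
  by measurable

section \<open>Interval averages and the continuous version\<close>

definition average :: "(real \<Rightarrow> real) \<Rightarrow> real \<Rightarrow> real \<Rightarrow> real" where
  "average f a b = (LINT u:{a..b}|lborel. f u) / (b - a)"

lemma average_diff_le:
  assumes ab: "a < b" and int: "set_integrable lborel {a..b} f"
  shows "ennreal \<bar>average f a b - c\<bar> \<le> ennreal (1 / (b - a)) * (\<integral>\<^sup>+u. ennreal \<bar>f u - c\<bar> * indicator {a..b} u \<partial>lborel)"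
proof -
  have ci: "set_integrable lborel {a..b} (\<lambda>u. c)"
    unfolding set_integrable_def using ab by (intro integrable_real_indicator[THEN integrable_scaleR_left]) auto
  have "(LINT u:{a..b}|lborel. f u - c) = (LINT u:{a..b}|lborel. f u) - (b - a) * c"
    using ab by (subst set_integral_diff(2)[OF int ci]) (simp add: set_lebesgue_integral_def)
  then have "average f a b - c = (LINT u:{a..b}|lborel. f u - c) / (b - a)"
    using ab by (simp add: average_def field_simps)
  then have "\<bar>average f a b - c\<bar> = 1 / (b - a) * \<bar>LINT u:{a..b}|lborel. f u - c\<bar>"
    using ab by simp
  then have "ennreal \<bar>average f a b - c\<bar> = ennreal (1 / (b - a)) * ennreal \<bar>LINT u:{a..b}|lborel. f u - c\<bar>"
    using ab by (simp only: ennreal_mult zero_le_divide_1_iff abs_ge_zero diff_ge_0_iff_ge less_imp_le)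
  also have "\<dots> \<le> ennreal (1 / (b - a)) * (\<integral>\<^sup>+u. ennreal (norm (indicator {a..b} u *\<^sub>R (f u - c))) \<partial>lborel)"
    using integral_norm_bound_ennreal[OF set_integral_diff(1)[OF int ci, unfolded set_integrable_def]]
    unfolding set_lebesgue_integral_def by (intro mult_left_mono) auto
  also have "(\<integral>\<^sup>+u. ennreal (norm (indicator {a..b} u *\<^sub>R (f u - c))) \<partial>lborel) = (\<integral>\<^sup>+u. ennreal \<bar>f u - c\<bar> * indicator {a..b} u \<partial>lborel)"
    by (intro nn_integral_cong) (auto split: split_indicator)
  finally show ?thesis .
qed

lemma continuous_on_average:
  assumes int: "set_integrable lborel {0..T} f"
    and ab: "continuous_on {0..T} a" "continuous_on {0..T} b" "\<And>x. x \<in> {0..T} \<Longrightarrow> 0 \<le> a x \<and> a x < b x \<and> b x \<le> T"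
  shows "continuous_on {0..T} (\<lambda>x. average f (a x) (b x))"
proof -
  have io: "f integrable_on {0..T}" using set_borel_integral_eq_integral(1)[OF int] .
  let ?\<Phi> = "\<lambda>x. integral {0..x} f"
  have \<Phi>: "continuous_on {0..T} ?\<Phi>" by (rule indefinite_integral_continuous_1[OF io])
  have eq: "average f (a x) (b x) = (?\<Phi> (b x) - ?\<Phi> (a x)) / (b x - a x)" if x: "x \<in> {0..T}" for x
  proof -
    have "set_integrable lborel {a x..b x} f"
      using ab(3)[OF x] by (intro set_integrable_subset[OF int]) auto
    then have "(LINT u:{a x..b x}|lborel. f u) = integral {a x..b x} f" by (rule set_borel_integral_eq_integral(2))
    moreover have "?\<Phi> (a x) + integral {a x..b x} f = ?\<Phi> (b x)"
      using ab(3)[OF x] by (intro Henstock_Kurzweil_Integration.integral_combine integrable_on_subinterval[OF io]) auto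
    ultimately show ?thesis by (simp add: average_def)
  qed
  have "continuous_on {0..T} (\<lambda>x. (?\<Phi> (b x) - ?\<Phi> (a x)) / (b x - a x))"
    using ab(3) by (intro continuous_intros continuous_on_compose2[OF \<Phi>] ab(1,2)) (fastforce simp: less_le)+
  then show ?thesis by (subst continuous_on_cong[OF refl eq])
qed

lemma set_integrable_of_Lp:
  assumes p: "1 \<le> p" and T: "0 < T" and [measurable]: "f \<in> borel_measurable borel" and fin: "Lp_norm_on T p f < top"
  shows "set_integrable lborel {0..T} f"
proof -
  have "(\<integral>\<^sup>+u. ennreal (norm (indicator {0..T} u *\<^sub>R f u)) \<partial>lborel) = (\<integral>\<^sup>+u. ennreal \<bar>f u\<bar> * indicator {0..0 + T} u \<partial>lborel)"
    by (intro nn_integral_cong) (auto split: split_indicator)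
  also have "\<dots> \<le> ennreal (T powr (1 - enn2real (inverse p))) * Lp_qnorm (lebesgue_on {0..T}) p (\<lambda>u. ennreal \<bar>f u\<bar>)"
    using T by (intro L1_le_Lp p) auto
  also have "\<dots> < top" using fin by (simp add: Lp_norm_on_def ennreal_mult_less_top)
  finally show ?thesis unfolding set_integrable_def by (intro integrableI_bounded) auto
qed

text \<open>The continuous version is the uniform limit of the averages over the windows
  \<open>[(1 - 2\<^sup>-\<^sup>n) x, (1 - 2\<^sup>-\<^sup>n) x + 2\<^sup>-\<^sup>n T]\<close>. They stay inside \<open>[0,T]\<close>, are nested in \<open>n\<close>, and for
  \<open>n = 0\<close> the average does not depend on \<open>x\<close>, which bounds the oscillation.\<close>

theorem exists_continuous_version:
  fixes f :: "real \<Rightarrow> real"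
  assumes p: "1 \<le> p" and T: "0 < T" and [measurable]: "f \<in> borel_measurable borel" and fin: "Lp_norm_on T p f < top"
    and M: "0 \<le> M" "\<And>\<tau>. 0 < \<tau> \<Longrightarrow> \<tau> \<le> T \<Longrightarrow> modulus T p f \<tau> \<le> ennreal (M * \<tau> powr \<alpha>)"
    and \<beta>: "\<beta> = \<alpha> - enn2real (inverse p)" "0 < \<beta>"
  obtains f' where "continuous_version T f f'"
    "\<And>x. 0 \<le> x \<Longrightarrow> x \<le> T \<Longrightarrow> \<bar>f' x - f' 0\<bar> \<le> 8 / (1 - 2 powr - \<beta>) * M * T powr \<beta>"
proof -
  define e where "e = enn2real (inverse p)"
  have \<alpha>: "0 < \<alpha>" using \<beta> enn2real_nonneg[of "inverse p"] by linarith
  have int: "set_integrable lborel {0..T} f" by (rule set_integrable_of_Lp[OF p T _ fin]) measurable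
  define \<epsilon> where "\<epsilon> n = T / 2 ^ n" for n :: nat
  define a where "a n x = (1 - 1 / 2 ^ n) * x" for n :: nat and x :: real
  define b where "b n x = a n x + \<epsilon> n" for n x
  have \<epsilon>0: "0 < \<epsilon> n" "\<epsilon> n \<le> T" for n
  proof -
    have "T / 2 ^ n \<le> T / 1" using T by (intro divide_left_mono) auto
    then show "0 < \<epsilon> n" "\<epsilon> n \<le> T" using T by (auto simp: \<epsilon>_def)
  qed
  have le1: "1 / 2 ^ n \<le> (1::real)" for n :: nat by (simp add: field_simps)
  have ab: "0 \<le> a n x" "a n x < b n x" "b n x \<le> T" "a n x \<le> a (Suc n) x" "b (Suc n) x \<le> b n x"
    "a n x \<le> x" "x \<le> b n x" if x: "0 \<le> x" "x \<le> T" for n x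
  proof -
    show "0 \<le> a n x" using x le1[of n] by (auto simp: a_def)
    show "a n x < b n x" using \<epsilon>0 by (simp add: b_def)
    have "1 / 2 ^ n * x \<le> 1 / 2 ^ n * T" using x by (intro mult_left_mono) auto
    then show "x \<le> b n x" by (simp add: a_def b_def \<epsilon>_def algebra_simps)
    have "0 \<le> (1 - 1 / 2 ^ n) * (T - x)" using x le1[of n] by simp
    moreover have "(1 - 1 / 2 ^ n) * (T - x) = T - b n x"
      by (simp add: a_def b_def \<epsilon>_def left_diff_distrib right_diff_distrib diff_divide_distrib)
    ultimately show "b n x \<le> T" by simp
    show "a n x \<le> x" using x by (simp add: a_def algebra_simps)
    show "a n x \<le> a (Suc n) x" using x unfolding a_def by (intro mult_right_mono) (auto simp: field_simps)
    have "0 \<le> 1 / 2 ^ Suc n * (T - x)" using x by simp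
    then show "b (Suc n) x \<le> b n x" by (simp add: a_def b_def \<epsilon>_def field_simps)
  qed
  define A where "A n x = average f (a n x) (b n x)" for n x
  have intab: "set_integrable lborel {a n x..b n x} f" if "0 \<le> x" "x \<le> T" for n x
    using ab[OF that] by (intro set_integrable_subset[OF int]) auto
  have Acont: "continuous_on {0..T} (A n)" for n
    unfolding A_def by (intro continuous_on_average int) (use ab in \<open>auto simp: b_def a_def intro!: continuous_intros\<close>)
  \<comment> \<open>Averaging over the windows n and n+1 has density 2/\<epsilon>^2 for \<epsilon> =
    \<open>\<epsilon> n\<close>. Times the double-increment bound 2 \<epsilon> \<epsilon>^(1-1/p) M
    \<epsilon>^\<alpha> this is 4 M \<epsilon>^\<beta>.\<close>
  define d where "d n = 4 * M * \<epsilon> n powr \<beta>" for n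
  have diff: "\<bar>A (Suc n) x - A n x\<bar> \<le> d n" if x: "0 \<le> x" "x \<le> T" for n x
  proof -
    let ?I = "{a n x..a n x + \<epsilon> n}"
    let ?h = "\<lambda>v. \<integral>\<^sup>+u. ennreal \<bar>f u - f v\<bar> * (if u \<in> ?I \<and> v \<in> ?I \<and> \<bar>u - v\<bar> \<le> \<epsilon> n then 1 else 0) \<partial>lborel"
    have len: "b n x - a n x = \<epsilon> n" for n by (simp add: b_def)
    have "ennreal \<bar>A (Suc n) x - A n x\<bar> \<le> ennreal (1 / \<epsilon> (Suc n)) * (\<integral>\<^sup>+v. ennreal \<bar>f v - A n x\<bar> * indicator {a (Suc n) x..b (Suc n) x} v \<partial>lborel)"
      using average_diff_le[OF ab(2)[OF x, of "Suc n"] intab[OF x], of "A n x"] by (simp only: A_def len)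
    also have "\<dots> \<le> ennreal (1 / \<epsilon> (Suc n)) * (\<integral>\<^sup>+v. ennreal (1 / \<epsilon> n) * ?h v \<partial>lborel)"
    proof (intro mult_left_mono nn_integral_mono)
      fix v
      show "ennreal \<bar>f v - A n x\<bar> * indicator {a (Suc n) x..b (Suc n) x} v \<le> ennreal (1 / \<epsilon> n) * ?h v"
      proof (cases "v \<in> {a (Suc n) x..b (Suc n) x}")
        case True
        then have v: "v \<in> ?I" using ab[OF x, of n] by (auto simp: b_def)
        have "ennreal \<bar>A n x - f v\<bar> \<le> ennreal (1 / \<epsilon> n) * (\<integral>\<^sup>+u. ennreal \<bar>f u - f v\<bar> * indicator {a n x..b n x} u \<partial>lborel)"
          using average_diff_le[OF ab(2)[OF x, of n] intab[OF x], of "f v"] by (simp only: A_def len)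
        also have "(\<integral>\<^sup>+u. ennreal \<bar>f u - f v\<bar> * indicator {a n x..b n x} u \<partial>lborel) = ?h v"
          using v by (intro nn_integral_cong) (auto simp: b_def split: split_indicator)
        finally show ?thesis using True by (simp add: abs_minus_commute)
      qed simp
    qed simp
    also have "\<dots> = ennreal (1 / \<epsilon> (Suc n)) * (ennreal (1 / \<epsilon> n) * (\<integral>\<^sup>+v. ?h v \<partial>lborel))"
      by (subst nn_integral_cmult[OF measurable_double_increment]) (simp_all add: assms(3))
    also have "\<dots> \<le> ennreal (1 / \<epsilon> (Suc n)) * (ennreal (1 / \<epsilon> n) * ennreal (2 * \<epsilon> n * \<epsilon> n powr (1 - e) * (M * \<epsilon> n powr \<alpha>)))"
      unfolding e_def using ab[OF x, of n] \<epsilon>0[of n] p M \<alpha>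
      by (intro mult_left_mono double_increment_le) (auto simp: b_def)
    also have "\<dots> = ennreal (1 / \<epsilon> (Suc n) * (1 / \<epsilon> n * (2 * \<epsilon> n * \<epsilon> n powr (1 - e) * (M * \<epsilon> n powr \<alpha>))))"
    proof -
      have "ennreal x * (ennreal y * ennreal z) = ennreal (x * (y * z))" if "0 \<le> x" "0 \<le> y" "0 \<le> z" for x y z
        using that by (simp add: ennreal_mult)
      then show ?thesis using \<epsilon>0[of n] \<epsilon>0[of "Suc n"] M(1) by simp
    qed
    also have "1 / \<epsilon> (Suc n) * (1 / \<epsilon> n * (2 * \<epsilon> n * \<epsilon> n powr (1 - e) * (M * \<epsilon> n powr \<alpha>))) = d n"
    proof -
      have "\<epsilon> (Suc n) = \<epsilon> n / 2" by (simp add: \<epsilon>_def)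
      moreover have "\<epsilon> n powr (1 - e) * \<epsilon> n powr \<alpha> = \<epsilon> n * \<epsilon> n powr \<beta>"
      proof -
        have "\<epsilon> n powr (1 - e) * \<epsilon> n powr \<alpha> = \<epsilon> n powr (1 + \<beta>)"
          by (simp add: \<beta>(1) e_def algebra_simps flip: powr_add)
        also have "\<dots> = \<epsilon> n * \<epsilon> n powr \<beta>" using \<epsilon>0[of n] by (simp add: powr_add)
        finally show ?thesis .
      qed
      ultimately show ?thesis using \<epsilon>0[of n] by (simp add: d_def field_simps)
    qed
    finally show ?thesis using M by (simp add: d_def)
  qed
  define r where "r = 2 powr - \<beta>"
  have r: "0 < r" "r < 1" using \<beta>(2) powr_less_mono[of "- \<beta>" 0 "2::real"] by (auto simp: r_def)
  have d: "d n = 4 * M * T powr \<beta> * r ^ n" for n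
  proof -
    have "\<epsilon> n powr \<beta> = T powr \<beta> * r ^ n"
      using T by (simp add: \<epsilon>_def r_def powr_divide powr_power powr_realpow[symmetric] powr_powr powr_minus_divide mult.commute)
    then show ?thesis by (simp add: d_def)
  qed
  have dsum: "summable d" "suminf d = 4 * M * T powr \<beta> / (1 - r)"
  proof -
    have "d sums (4 * M * T powr \<beta> * (1 / (1 - r)))"
      unfolding d[abs_def] using r by (intro sums_mult geometric_sums) auto
    then show "summable d" "suminf d = 4 * M * T powr \<beta> / (1 - r)" by (auto simp: sums_iff)
  qed
  have tele: "(\<Sum>k<n. A (Suc k) x - A k x) = A n x - A 0 x" for n x
    by (rule sum_lessThan_telescope[of "\<lambda>n. A n x"])
  define f' where "f' x = A 0 x + (\<Sum>n. A (Suc n) x - A n x)" for x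
  have ulim: "uniform_limit {0..T} (\<lambda>n x. \<Sum>k<n. A (Suc k) x - A k x) (\<lambda>x. \<Sum>n. A (Suc n) x - A n x) sequentially"
    using dsum diff by (intro Weierstrass_m_test) auto
  have "uniform_limit {0..T} (\<lambda>n x. A 0 x + (\<Sum>k<n. A (Suc k) x - A k x)) (\<lambda>x. A 0 x + (\<Sum>n. A (Suc n) x - A n x)) sequentially"
    by (intro uniform_limit_add ulim uniform_limit_const)
  then have ulim: "uniform_limit {0..T} A f' sequentially"
    by (simp add: tele f'_def[abs_def])
  have cont: "continuous_on {0..T} f'"
    using Acont by (intro uniform_limit_theorem[OF _ ulim]) auto
  have lim: "(\<lambda>n. A n x) \<longlonglongrightarrow> f' x" if "0 \<le> x" "x \<le> T" for x
    using tendsto_uniform_limitI[OF ulim] that by auto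
  have f'A0: "\<bar>f' x - A 0 x\<bar> \<le> 4 * M * T powr \<beta> / (1 - r)" if x: "0 \<le> x" "x \<le> T" for x
  proof -
    have s: "summable (\<lambda>n. \<bar>A (Suc n) x - A n x\<bar>)"
      using diff[OF x] by (intro summable_comparison_test[OF _ dsum(1)]) auto
    have "\<bar>f' x - A 0 x\<bar> \<le> (\<Sum>n. \<bar>A (Suc n) x - A n x\<bar>)"
      using summable_rabs[OF s] by (simp add: f'_def)
    also have "\<dots> \<le> suminf d" by (intro suminf_le s dsum(1) diff x)
    finally show ?thesis by (simp add: dsum(2))
  qed
  have osc: "\<bar>f' x - f' 0\<bar> \<le> 8 / (1 - r) * M * T powr \<beta>" if x: "0 \<le> x" "x \<le> T" for x
  proof -
    have "A 0 x = A 0 0" by (simp add: A_def a_def b_def)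
    then have "\<bar>f' x - f' 0\<bar> \<le> \<bar>f' x - A 0 x\<bar> + \<bar>f' 0 - A 0 0\<bar>" by simp
    also have "\<dots> \<le> 4 * M * T powr \<beta> / (1 - r) + 4 * M * T powr \<beta> / (1 - r)"
      using x T by (intro add_mono f'A0) auto
    finally show ?thesis by simp
  qed
  have Ameas [measurable]: "A n \<in> borel_measurable borel" for n
  proof -
    have [measurable]: "a n \<in> borel_measurable borel" "b n \<in> borel_measurable borel" unfolding a_def b_def by measurable
    have "average f (a n x) (b n x) = (LINT u|lborel. (if a n x \<le> u \<and> u \<le> b n x then f u else 0)) / (b n x - a n x)" for x
      unfolding average_def set_lebesgue_integral_def
      by (intro arg_cong2[where f="(/)"] Bochner_Integration.integral_cong) (auto split: split_indicator)
    then show ?thesis unfolding A_def by simp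
  qed
  \<comment> \<open>The averages tend to f in L^1 and pointwise to f', so Fatou gives f' = f
    a.e.\<close>
  let ?g = "\<lambda>n x. ennreal \<bar>A n x - f x\<bar> * indicator {0..T} x"
  have gle: "(\<integral>\<^sup>+x. ?g n x \<partial>lborel) \<le> ennreal (2 * T powr (1 - e) * (M * \<epsilon> n powr \<alpha>))" for n
  proof -
    let ?I = "{0..0 + T}"
    let ?h = "\<lambda>v. \<integral>\<^sup>+u. ennreal \<bar>f u - f v\<bar> * (if u \<in> ?I \<and> v \<in> ?I \<and> \<bar>u - v\<bar> \<le> \<epsilon> n then 1 else 0) \<partial>lborel"
    have "(\<integral>\<^sup>+x. ?g n x \<partial>lborel) \<le> (\<integral>\<^sup>+x. ennreal (1 / \<epsilon> n) * ?h x \<partial>lborel)"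
    proof (intro nn_integral_mono)
      fix x
      show "?g n x \<le> ennreal (1 / \<epsilon> n) * ?h x"
      proof (cases "x \<in> {0..T}")
        case True
        then have x: "0 \<le> x" "x \<le> T" by auto
        have len: "b n x - a n x = \<epsilon> n" by (simp add: b_def)
        have "ennreal \<bar>A n x - f x\<bar> \<le> ennreal (1 / \<epsilon> n) * (\<integral>\<^sup>+u. ennreal \<bar>f u - f x\<bar> * indicator {a n x..b n x} u \<partial>lborel)"
          using average_diff_le[OF ab(2)[OF x, of n] intab[OF x], of "f x"] by (simp only: A_def len)
        also have "\<dots> \<le> ennreal (1 / \<epsilon> n) * ?h x"
          using x ab[OF x, of n] by (intro mult_left_mono nn_integral_mono) (auto simp: b_def split: split_indicator)
        finally show ?thesis using True by simp
      qed simp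
    qed
    also have "\<dots> = ennreal (1 / \<epsilon> n) * (\<integral>\<^sup>+v. ?h v \<partial>lborel)"
      by (subst nn_integral_cmult[OF measurable_double_increment]) (simp_all add: assms(3))
    also have "\<dots> \<le> ennreal (1 / \<epsilon> n) * ennreal (2 * \<epsilon> n * T powr (1 - e) * (M * \<epsilon> n powr \<alpha>))"
      unfolding e_def using \<epsilon>0[of n] p M \<alpha> T by (intro mult_left_mono double_increment_le) auto
    also have "\<dots> = ennreal (2 * T powr (1 - e) * (M * \<epsilon> n powr \<alpha>))"
      using \<epsilon>0[of n] M by (simp flip: ennreal_mult)
    finally show ?thesis .
  qed
  have "(\<lambda>n. 2 * T powr (1 - e) * (M * \<epsilon> n powr \<alpha>)) \<longlonglongrightarrow> 2 * T powr (1 - e) * (M * 0)"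
  proof (intro tendsto_mult tendsto_const tendsto_zero_powrI[OF _ tendsto_const])
    have "(\<lambda>n. T * (1 / 2) ^ n) \<longlonglongrightarrow> T * 0" by (intro tendsto_mult tendsto_const LIMSEQ_realpow_zero) auto
    then show "\<epsilon> \<longlonglongrightarrow> 0" by (simp add: \<epsilon>_def[abs_def] power_one_over)
  qed (use \<alpha> less_imp_le[OF \<epsilon>0(1)] in auto)
  from tendsto_ennrealI[OF this] have "(\<lambda>n. ennreal (2 * T powr (1 - e) * (M * \<epsilon> n powr \<alpha>))) \<longlonglongrightarrow> 0" by simp
  then have "(\<lambda>n. \<integral>\<^sup>+x. ?g n x \<partial>lborel) \<longlonglongrightarrow> 0"
    by (rule tendsto_sandwich[OF _ _ tendsto_const, rotated 2]) (use gle in auto)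
  then have "liminf (\<lambda>n. \<integral>\<^sup>+x. ?g n x \<partial>lborel) = 0" by (intro lim_imp_Liminf) auto
  moreover have "(\<integral>\<^sup>+x. liminf (\<lambda>n. ?g n x) \<partial>lborel) \<le> liminf (\<lambda>n. \<integral>\<^sup>+x. ?g n x \<partial>lborel)"
    by (intro nn_integral_liminf) measurable
  ultimately have "(\<integral>\<^sup>+x. liminf (\<lambda>n. ?g n x) \<partial>lborel) = 0" by simp
  then have "AE x in lborel. liminf (\<lambda>n. ?g n x) = 0" by (subst (asm) nn_integral_0_iff_AE) auto
  then have "AE x in lborel. x \<in> {0..T} \<longrightarrow> f' x = f x"
  proof eventually_elim
    case (elim x)
    show ?case
    proof
      assume x: "x \<in> {0..T}"
      then have "(\<lambda>n. ?g n x) \<longlonglongrightarrow> ennreal \<bar>f' x - f x\<bar>"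
        using lim[of x] by (auto intro!: tendsto_intros)
      then have "liminf (\<lambda>n. ?g n x) = ennreal \<bar>f' x - f x\<bar>" by (intro lim_imp_Liminf) auto
      with elim show "f' x = f x" by simp
    qed
  qed
  then have "AE x in lebesgue_on {0..T}. f' x = f x" by (simp add: AE_lebesgue_on_iff)
  with cont have "continuous_version T f f'" by (simp add: continuous_version_def)
  with osc show thesis by (auto simp: r_def intro!: that)
qed

subsection \<open>Chaining in \<open>\<ell>\<^sup>p\<close>\<close>

lemma esssup_count_space:
  fixes F :: "'a \<Rightarrow> ennreal"
  shows "esssup (count_space A) F = (SUP k\<in>A. F k)"
  by (intro antisym SUP_least)
     (auto simp: esssup_le_iff AE_count_space intro: SUP_upper,
      use esssup_AE[of F "count_space A"] in \<open>auto simp: AE_count_space\<close>)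

lemma Lp_qnorm_count_space_finite:
  "finite A \<Longrightarrow> 0 < s \<Longrightarrow> Lp_qnorm (count_space A) (ennreal s) F = enn_powr (\<Sum>k\<in>A. enn_powr (F k) s) (1 / s)"
  by (simp add: Lp_qnorm_ennreal nn_integral_count_space_finite)

lemma Lp_qnorm_count_space_top: "Lp_qnorm (count_space A) top F = (SUP k\<in>A. F k)"
  by (simp add: Lp_qnorm_top esssup_count_space)

lemma measurable_Lp_qnorm_count_space:
  assumes p: "0 < p" and A: "finite A" and [measurable]: "\<And>k. (\<lambda>r. X r k) \<in> borel_measurable M"
  shows "(\<lambda>r. Lp_qnorm (count_space A) p (X r)) \<in> borel_measurable M"
  using p
proof (cases rule: ennreal_exponent_cases)
  case (fin s)
  then show ?thesis using A by (simp add: Lp_qnorm_count_space_finite)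
next
  case top
  then show ?thesis using A by (auto simp: Lp_qnorm_count_space_top intro!: borel_measurable_SUP countable_finite)
qed

text \<open>Hoelder on N points for p \<ge> 1, the inclusion of l^p in l^1 for p < 1. The exponent
  is written with a maximum to cover both; for p = p2 this maximum is 1/\<rho>.\<close>

lemma sum_le_counting_norm:
  assumes p: "ennreal (1 / 2) \<le> p" and N: "0 < N"
  shows "(\<Sum>k<N. x k) \<le> ennreal (real N powr (max 1 (enn2real (inverse p)) - enn2real (inverse p))) * Lp_qnorm (count_space {..<N}) p x"
proof (cases "1 \<le> p")
  case True
  have e: "enn2real (inverse p) \<le> 1" by (rule inverse_exponent(3)[OF True])
  have "(\<Sum>k<N. x k) = (\<integral>\<^sup>+k. x k \<partial>count_space {..<N})" by (simp add: nn_integral_count_space_finite)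
  also have "\<dots> \<le> ennreal (real N powr (1 - enn2real (inverse p))) * Lp_qnorm (count_space {..<N}) p x"
    using N by (intro L1_le_Lp_finite_measure True) (auto simp: ennreal_of_nat_eq_real_of_nat)
  finally show ?thesis using e by (simp add: max_absorb1)
next
  case False
  have p0: "0 < p" using p by (metis ennreal_less_zero_iff less_le_trans half_gt_zero zero_less_one)
  obtain s where s: "0 < s" "p = ennreal s" "s \<le> 1"
    using p0 False by (cases rule: ennreal_exponent_cases) (auto simp: not_le)
  have "enn2real (inverse p) = 1 / s" using s by (simp add: inverse_ennreal inverse_eq_divide)
  then have "max 1 (enn2real (inverse p)) - enn2real (inverse p) = 0" using s by (simp add: max_def)
  moreover have "(\<Sum>k<N. x k) \<le> enn_powr (\<Sum>k<N. enn_powr (x k) s) (1 / s)"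
    using s enn_powr_sum_le[of s x "{..<N}"] by (simp add: enn_powr_le_swap)
  ultimately show ?thesis using s N by (simp add: Lp_qnorm_count_space_finite)
qed

text \<open>A mean absolute increment that dominates the difference of the averages over two
  adjacent intervals of length \<epsilon>. It makes point increments of a continuous function
  accessible to integral norms.\<close>

definition window :: "(real \<Rightarrow> real) \<Rightarrow> real \<Rightarrow> real \<Rightarrow> ennreal" where
  "window f \<epsilon> y = ennreal (1 / \<epsilon>) * (\<integral>\<^sup>+u. ennreal \<bar>f (u + \<epsilon>) - f u\<bar> * indicator {y..y + \<epsilon>} u \<partial>lborel)"

text \<open>Inside one window, passing from L^1 to L^p costs \<epsilon>^(-1/p). The windows are
  disjoint, so the l^p norm of the local L^p norms is at most the global one.\<close>

lemma window_norm_le: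
  fixes N :: nat
  assumes p: "1 \<le> p" and \<epsilon>: "0 < \<epsilon>" and [measurable]: "f \<in> borel_measurable borel"
    and y: "\<And>k. k < N \<Longrightarrow> 0 \<le> y k \<and> y k + 2 * \<epsilon> \<le> T" and sep: "\<And>j k. j < k \<Longrightarrow> k < N \<Longrightarrow> y j + \<epsilon> < y k"
  shows "Lp_qnorm (count_space {..<N}) p (\<lambda>k. window f \<epsilon> (y k)) \<le> ennreal (\<epsilon> powr - enn2real (inverse p)) * modulus T p f \<epsilon>"
proof -
  let ?G = "\<lambda>u. ennreal \<bar>f (u + \<epsilon>) - f u\<bar>"
  define e where "e = enn2real (inverse p)"
  have p0: "0 < p" using inverse_exponent(1)[OF p] .
  have w: "window f \<epsilon> (y k) \<le> ennreal (\<epsilon> powr - e) * Lp_qnorm (lebesgue_on {y k..y k + \<epsilon>}) p ?G" for k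
  proof -
    have "window f \<epsilon> (y k) = ennreal (1 / \<epsilon>) * (\<integral>\<^sup>+u. ?G u \<partial>lebesgue_on {y k..y k + \<epsilon>})"
      by (simp add: window_def nn_integral_lebesgue_on)
    also have "\<dots> \<le> ennreal (1 / \<epsilon>) * (ennreal (\<epsilon> powr (1 - e)) * Lp_qnorm (lebesgue_on {y k..y k + \<epsilon>}) p ?G)"
      unfolding e_def using \<epsilon> emeasure_lebesgue_on_Icc[of "y k" "y k + \<epsilon>"]
      by (intro mult_left_mono L1_le_Lp_finite_measure p) auto
    also have "\<dots> = ennreal (\<epsilon> powr - e) * Lp_qnorm (lebesgue_on {y k..y k + \<epsilon>}) p ?G"
    proof -
      have "ennreal (1 / \<epsilon>) * ennreal (\<epsilon> powr (1 - e)) = ennreal (\<epsilon> powr - e)"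
        using \<epsilon> by (simp add: powr_diff powr_minus_divide flip: ennreal_mult)
      then show ?thesis by (simp add: mult.assoc[symmetric])
    qed
    finally show ?thesis .
  qed
  have "Lp_qnorm (count_space {..<N}) p (\<lambda>k. window f \<epsilon> (y k))
    \<le> Lp_qnorm (count_space {..<N}) p (\<lambda>k. ennreal (\<epsilon> powr - e) * Lp_qnorm (lebesgue_on {y k..y k + \<epsilon>}) p ?G)"
    by (intro Lp_qnorm_mono p0 w) auto
  also have "\<dots> = ennreal (\<epsilon> powr - e) * Lp_qnorm (count_space {..<N}) p (\<lambda>k. Lp_qnorm (lebesgue_on {y k..y k + \<epsilon>}) p ?G)"
    by (intro Lp_qnorm_cmult p0) auto
  also have "Lp_qnorm (count_space {..<N}) p (\<lambda>k. Lp_qnorm (lebesgue_on {y k..y k + \<epsilon>}) p ?G) \<le> Lp_qnorm (lebesgue_on {0..T - \<epsilon>}) p ?G"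
    using p0
  proof (cases rule: ennreal_exponent_cases)
    case (fin s)
    have "(\<Sum>k<N. \<integral>\<^sup>+u. enn_powr (?G u) s * indicator {y k..y k + \<epsilon>} u \<partial>lborel)
       = (\<integral>\<^sup>+u. enn_powr (?G u) s * (\<Sum>k<N. indicator {y k..y k + \<epsilon>} u) \<partial>lborel)"
      by (subst nn_integral_sum[symmetric]) (auto simp: sum_distrib_left)
    also have "\<dots> \<le> (\<integral>\<^sup>+u. enn_powr (?G u) s * indicator {0..T - \<epsilon>} u \<partial>lborel)"
    proof (intro nn_integral_mono mult_left_mono)
      fix u
      have disj: "disjoint_family_on (\<lambda>k. {y k..y k + \<epsilon>}) {..<N}"
        unfolding disjoint_family_on_def
      proof (intro ballI impI)
        fix i j assume "i \<in> {..<N}" "j \<in> {..<N}" "i \<noteq> j"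
        then have "y i + \<epsilon> < y j \<or> y j + \<epsilon> < y i"
          using sep[of i j] sep[of j i] by (metis lessThan_iff linorder_neqE_nat)
        then show "{y i..y i + \<epsilon>} \<inter> {y j..y j + \<epsilon>} = {}" by auto
      qed
      have "(\<Sum>k<N. indicator {y k..y k + \<epsilon>} u) = (indicator (\<Union>k<N. {y k..y k + \<epsilon>}) u :: ennreal)"
        using disj by (intro indicator_UN_disjoint[symmetric]) auto
      also have "\<dots> \<le> indicator {0..T - \<epsilon>} u"
      proof -
        have "u \<in> {0..T - \<epsilon>}" if "u \<in> (\<Union>k<N. {y k..y k + \<epsilon>})"
        proof -
          from that obtain k where "k < N" "y k \<le> u" "u \<le> y k + \<epsilon>" by auto
          then show ?thesis using y[of k] by auto
        qed
        then show ?thesis by (auto simp: indicator_def)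
      qed
      finally show "(\<Sum>k<N. indicator {y k..y k + \<epsilon>} u) \<le> (indicator {0..T - \<epsilon>} u :: ennreal)" .
    qed simp
    finally show ?thesis
      unfolding fin(2) Lp_qnorm_count_space_finite[OF finite_lessThan fin(1)]
      using fin(1) by (simp add: Lp_qnorm_ennreal nn_integral_lebesgue_on enn_powr_mono)
  next
    case top
    have "Lp_qnorm (lebesgue_on {y k..y k + \<epsilon>}) top ?G \<le> Lp_qnorm (lebesgue_on {0..T - \<epsilon>}) top ?G" if "k < N" for k
      using y[OF that] by (intro Lp_qnorm_subinterval) auto
    then show ?thesis using top by (auto simp: Lp_qnorm_count_space_top intro!: SUP_least)
  qed
  also have "\<dots> \<le> modulus T p f \<epsilon>"
    using modulus_upper[of \<epsilon> \<epsilon> T p f] \<epsilon> by (simp add: Lp_norm_on_def)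
  finally show ?thesis by (simp add: e_def mult_left_mono)
qed

lemma set_integral_shift:
  "(LINT u:{a + t..b + t}|lborel. f u) = (LINT u:{a..b}|lborel. f (u + t :: real) :: real)"
  unfolding set_lebesgue_integral_def
  by (subst lborel_integral_real_affine[of 1 _ t]) (auto simp: add.commute indicator_def intro!: Bochner_Integration.integral_cong)

lemma set_integrable_shift:
  "set_integrable lborel {a + t..b + t} f \<Longrightarrow> set_integrable lborel {a..b} (\<lambda>u. f (u + t :: real) :: real)"
  unfolding set_integrable_def
  by (drule lborel_integrable_real_affine[of _ 1 t]) (auto simp: add.commute indicator_def cong: if_cong)

lemma average_shift_diff_le:
  assumes \<epsilon>: "0 < \<epsilon>" and int: "set_integrable lborel {y..y + 2 * \<epsilon>} f"
  shows "ennreal \<bar>average f (y + \<epsilon>) (y + 2 * \<epsilon>) - average f y (y + \<epsilon>)\<bar> \<le> window f \<epsilon> y"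
proof -
  have i1: "set_integrable lborel {y..y + \<epsilon>} f" using \<epsilon> by (intro set_integrable_subset[OF int]) auto
  have "set_integrable lborel {y + \<epsilon>..(y + \<epsilon>) + \<epsilon>} f" using \<epsilon> by (intro set_integrable_subset[OF int]) auto
  then have i2: "set_integrable lborel {y..y + \<epsilon>} (\<lambda>u. f (u + \<epsilon>))" by (rule set_integrable_shift)
  have "average f (y + \<epsilon>) (y + 2 * \<epsilon>) = average (\<lambda>u. f (u + \<epsilon>)) y (y + \<epsilon>)"
    using set_integral_shift[of y \<epsilon> "y + \<epsilon>" f] by (simp add: average_def add.assoc)
  then have "average f (y + \<epsilon>) (y + 2 * \<epsilon>) - average f y (y + \<epsilon>) = average (\<lambda>u. f (u + \<epsilon>) - f u) y (y + \<epsilon>) - 0"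
    using set_integral_diff(2)[OF i2 i1] by (simp add: average_def diff_divide_distrib)
  then show ?thesis
    using average_diff_le[OF _ set_integral_diff(1)[OF i2 i1], of 0] \<epsilon> by (simp add: window_def)
qed

lemma average_halves:
  assumes \<epsilon>: "0 < \<epsilon>" and int: "set_integrable lborel {y..y + 2 * \<epsilon>} f"
  shows "average f y (y + 2 * \<epsilon>) = (average f y (y + \<epsilon>) + average f (y + \<epsilon>) (y + 2 * \<epsilon>)) / 2"
proof -
  have eq: "(LINT u:{a..b}|lborel. f u) = integral {a..b} f" if "y \<le> a" "b \<le> y + 2 * \<epsilon>" for a b
    using that by (intro set_borel_integral_eq_integral(2) set_integrable_subset[OF int]) auto
  have "integral {y..y + \<epsilon>} f + integral {y + \<epsilon>..y + 2 * \<epsilon>} f = integral {y..y + 2 * \<epsilon>} f"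
    using \<epsilon> by (intro Henstock_Kurzweil_Integration.integral_combine set_borel_integral_eq_integral(1)[OF int]) auto
  then show ?thesis using \<epsilon> by (simp add: average_def eq field_simps)
qed

text \<open>By continuity the averages over [y,y+\<delta>/2^n] tend to f(y). Halving changes such an
  average by half the difference between the averages on the two halves, which a window
  bounds.\<close>

lemma point_average_le:
  assumes y: "0 \<le> y" "0 < \<delta>" "y + \<delta> \<le> T" and cont: "continuous_on {0..T} f"
    and int: "set_integrable lborel {0..T} f"
  shows "ennreal \<bar>f y - average f y (y + \<delta>)\<bar> \<le> (\<Sum>n. window f (\<delta> / 2 ^ Suc n) y)"
proof -
  define A where "A n = average f y (y + \<delta> / 2 ^ n)" for n :: nat
  have le\<delta>: "\<delta> / 2 ^ n \<le> \<delta>" for n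
  proof -
    have "\<delta> / 2 ^ n \<le> \<delta> / 1" using y by (intro divide_left_mono) auto
    then show ?thesis by simp
  qed
  have sub: "set_integrable lborel {y..y + \<delta> / 2 ^ n} f" for n
    using y le\<delta>[of n] by (intro set_integrable_subset[OF int]) auto
  have step: "ennreal \<bar>A (Suc n) - A n\<bar> \<le> window f (\<delta> / 2 ^ Suc n) y" for n
  proof -
    let ?\<epsilon> = "\<delta> / 2 ^ Suc n"
    have two: "\<delta> / 2 ^ n = 2 * ?\<epsilon>" by simp
    have \<epsilon>: "0 < ?\<epsilon>" using y by simp
    have i: "set_integrable lborel {y..y + 2 * ?\<epsilon>} f" using sub[of n] by (simp only: two)
    have "A (Suc n) - A n = - (average f (y + ?\<epsilon>) (y + 2 * ?\<epsilon>) - average f y (y + ?\<epsilon>)) / 2"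
      unfolding A_def two average_halves[OF \<epsilon> i] by (simp add: field_simps)
    then have "ennreal \<bar>A (Suc n) - A n\<bar> \<le> ennreal \<bar>average f (y + ?\<epsilon>) (y + 2 * ?\<epsilon>) - average f y (y + ?\<epsilon>)\<bar>"
      by (intro ennreal_leI) (simp del: power_Suc)
    also have "\<dots> \<le> window f ?\<epsilon> y" by (rule average_shift_diff_le[OF \<epsilon> i])
    finally show ?thesis .
  qed
  have part: "ennreal \<bar>A n - A 0\<bar> \<le> (\<Sum>n. window f (\<delta> / 2 ^ Suc n) y)" for n
  proof -
    have "ennreal \<bar>A n - A 0\<bar> = ennreal \<bar>\<Sum>k<n. A (Suc k) - A k\<bar>" by (simp add: sum_lessThan_telescope)
    also have "\<dots> \<le> ennreal (\<Sum>k<n. \<bar>A (Suc k) - A k\<bar>)" by (intro ennreal_leI sum_abs)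
    also have "\<dots> = (\<Sum>k<n. ennreal \<bar>A (Suc k) - A k\<bar>)" by simp
    also have "\<dots> \<le> (\<Sum>k<n. window f (\<delta> / 2 ^ Suc k) y)" by (intro sum_mono step)
    also have "\<dots> \<le> (\<Sum>n. window f (\<delta> / 2 ^ Suc n) y)" by (intro sum_le_suminf) auto
    finally show ?thesis .
  qed
  have "A \<longlonglongrightarrow> f y"
  proof (rule LIMSEQ_I)
    fix r :: real assume r: "0 < r"
    have "y \<in> {0..T}" using y by auto
    with cont r obtain d where d: "0 < d" "\<And>u. u \<in> {0..T} \<Longrightarrow> \<bar>u - y\<bar> < d \<Longrightarrow> \<bar>f u - f y\<bar> < r / 2"
      unfolding continuous_on_iff dist_real_def by (metis half_gt_zero)
    have "(\<lambda>n. \<delta> * (1 / 2) ^ n) \<longlonglongrightarrow> \<delta> * 0" by (intro tendsto_mult tendsto_const LIMSEQ_realpow_zero) auto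
    then have "eventually (\<lambda>n. \<delta> / 2 ^ n < d) sequentially"
      using d(1) by (auto simp: power_one_over dest!: order_tendstoD(2)[of _ _ _ d])
    then obtain n0 where n0: "\<And>n. n \<ge> n0 \<Longrightarrow> \<delta> / 2 ^ n < d" by (auto simp: eventually_sequentially)
    have "norm (A n - f y) < r" if n: "n \<ge> n0" for n
    proof -
      let ?l = "\<delta> / 2 ^ n"
      have l: "0 < ?l" using y by simp
      have "ennreal \<bar>A n - f y\<bar> \<le> ennreal (1 / ?l) * (\<integral>\<^sup>+u. ennreal \<bar>f u - f y\<bar> * indicator {y..y + ?l} u \<partial>lborel)"
        using average_diff_le[OF _ sub[of n], of "f y"] l by (simp add: A_def)
      also have "\<dots> \<le> ennreal (1 / ?l) * (\<integral>\<^sup>+u. ennreal (r / 2) * indicator {y..y + ?l} u \<partial>lborel)"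
      proof (intro mult_left_mono nn_integral_mono)
        fix u
        show "ennreal \<bar>f u - f y\<bar> * indicator {y..y + ?l} u \<le> ennreal (r / 2) * indicator {y..y + ?l} u"
        proof (cases "u \<in> {y..y + ?l}")
          case True
          then have "\<bar>f u - f y\<bar> < r / 2" using n0[OF n] y le\<delta>[of n] by (intro d(2)) auto
          then show ?thesis using True by (auto intro: ennreal_leI)
        qed simp
      qed simp
      also have "\<dots> = ennreal (r / 2)"
      proof -
        have cancel: "ennreal (1 / x) * (ennreal z * ennreal x) = ennreal z" if "0 < x" "0 \<le> z" for x z
          using that by (simp flip: ennreal_mult)
        have "ennreal (1 / ?l) * (ennreal (r / 2) * ennreal ?l) = ennreal (r / 2)"
          by (rule cancel) (use l r in auto)
        moreover have "(\<integral>\<^sup>+u. ennreal (r / 2) * indicator {y..y + ?l} u \<partial>lborel) = ennreal (r / 2) * ennreal ?l"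
          using l by (subst nn_integral_cmult_indicator) auto
        ultimately show ?thesis by (simp only:)
      qed
      finally have "\<bar>A n - f y\<bar> \<le> r / 2" using r by simp
      then show ?thesis using r by simp
    qed
    then show "\<exists>n0. \<forall>n\<ge>n0. norm (A n - f y) < r" by blast
  qed
  then have "(\<lambda>n. ennreal \<bar>A n - A 0\<bar>) \<longlonglongrightarrow> ennreal \<bar>f y - A 0\<bar>" by (intro tendsto_intros)
  then have "ennreal \<bar>f y - A 0\<bar> \<le> (\<Sum>n. window f (\<delta> / 2 ^ Suc n) y)"
    by (rule LIMSEQ_le_const2) (use part in auto)
  then show ?thesis by (simp add: A_def)
qed

lemma increment_window_le:
  assumes y: "0 \<le> y" "0 < \<delta>" "y + 2 * \<delta> \<le> T" and cont: "continuous_on {0..T} f"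
    and int: "set_integrable lborel {0..T} f"
  shows "ennreal \<bar>f (y + \<delta>) - f y\<bar>
    \<le> (\<Sum>n. window f (\<delta> / 2 ^ Suc n) (y + \<delta>)) + ((\<Sum>n. window f (\<delta> / 2 ^ Suc n) y) + window f \<delta> y)"
proof -
  let ?a = "average f (y + \<delta>) (y + 2 * \<delta>)" and ?b = "average f y (y + \<delta>)"
  have "ennreal \<bar>f (y + \<delta>) - f y\<bar> \<le> ennreal (\<bar>f (y + \<delta>) - ?a\<bar> + (\<bar>f y - ?b\<bar> + \<bar>?a - ?b\<bar>))"
    by (intro ennreal_leI) linarith
  also have "\<dots> = ennreal \<bar>f (y + \<delta>) - ?a\<bar> + (ennreal \<bar>f y - ?b\<bar> + ennreal \<bar>?a - ?b\<bar>)"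
    by (simp add: ennreal_plus)
  also have "\<dots> \<le> (\<Sum>n. window f (\<delta> / 2 ^ Suc n) (y + \<delta>)) + ((\<Sum>n. window f (\<delta> / 2 ^ Suc n) y) + window f \<delta> y)"
  proof (intro add_mono)
    show "ennreal \<bar>f (y + \<delta>) - ?a\<bar> \<le> (\<Sum>n. window f (\<delta> / 2 ^ Suc n) (y + \<delta>))"
      using point_average_le[of "y + \<delta>" \<delta> T f] y cont int by (simp add: add.assoc del: power_Suc)
    show "ennreal \<bar>f y - ?b\<bar> \<le> (\<Sum>n. window f (\<delta> / 2 ^ Suc n) y)"
      using y by (intro point_average_le[OF _ _ _ cont int]) auto
    show "ennreal \<bar>?a - ?b\<bar> \<le> window f \<delta> y"
      using y by (intro average_shift_diff_le set_integrable_subset[OF int]) auto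
  qed
  finally show ?thesis .
qed

text \<open>Minkowski over the chaining levels. The points y_k are 2\<delta> apart, so at every
  level the windows are disjoint, and (\<delta>/2^n)^(-1/p) is \<delta>^(-1/p) times 2^(n/p). The
  bound is the same for all admissible base points r.\<close>

lemma chain_norm_le:
  fixes f :: "real \<Rightarrow> real"
  assumes p: "1 \<le> p" and \<delta>: "0 < \<delta>" and [measurable]: "f \<in> borel_measurable borel"
    and cont: "continuous_on {0..T} f" and int: "set_integrable lborel {0..T} f"
    and r: "0 \<le> r" "r + 2 * real N * \<delta> \<le> T"
  shows "Lp_qnorm (count_space {..<N}) p (\<lambda>k. ennreal \<bar>f (r + real (2 * k + 1) * \<delta>) - f (r + real (2 * k) * \<delta>)\<bar>)
    \<le> ennreal (2 * \<delta> powr - enn2real (inverse p)) * (\<Sum>n. ennreal ((2 powr enn2real (inverse p)) ^ n) * modulus T p f (\<delta> / 2 ^ n))"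
proof -
  define e where "e = enn2real (inverse p)"
  have p0: "0 < p" using inverse_exponent(1)[OF p] .
  define y where "y k = r + real (2 * k) * \<delta>" for k :: nat
  let ?L = "\<lambda>X. Lp_qnorm (count_space {..<N}) p X"
  have y1: "r + real (2 * k + 1) * \<delta> = y k + \<delta>" for k by (simp add: y_def algebra_simps)
  have yb: "0 \<le> y k \<and> y k + 2 * \<delta> \<le> T" if "k < N" for k
  proof -
    have "real (k + 1) \<le> real N" using that by (simp only: of_nat_le_iff)
    then have "real (k + 1) * (2 * \<delta>) \<le> real N * (2 * \<delta>)" using \<delta> by (intro mult_right_mono) auto
    then show ?thesis using r \<delta> by (simp add: y_def algebra_simps)
  qed
  have ysep: "y j + 2 * \<delta> \<le> y k" if "j < k" for j k
  proof -
    have "real (j + 1) \<le> real k" using that by (simp only: of_nat_le_iff)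
    then have "real (j + 1) * (2 * \<delta>) \<le> real k * (2 * \<delta>)" using \<delta> by (intro mult_right_mono) auto
    then show ?thesis by (simp add: y_def algebra_simps)
  qed
  have half: "0 < \<delta> / 2 ^ n" "\<delta> / 2 ^ n \<le> \<delta>" "2 * (\<delta> / 2 ^ Suc n) \<le> \<delta>" for n :: nat
  proof -
    have "\<delta> / 2 ^ n \<le> \<delta> / 1" using \<delta> by (intro divide_left_mono) auto
    then show "0 < \<delta> / 2 ^ n" "\<delta> / 2 ^ n \<le> \<delta>" "2 * (\<delta> / 2 ^ Suc n) \<le> \<delta>" using \<delta> by auto
  qed
  define V where "V n = ennreal ((\<delta> / 2 ^ n) powr - e) * modulus T p f (\<delta> / 2 ^ n)" for n :: nat
  have W: "?L (\<lambda>k. window f (\<delta> / 2 ^ n) (y k)) \<le> V n" for n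
    unfolding V_def e_def
  proof (intro window_norm_le p half)
    show "0 \<le> y k \<and> y k + 2 * (\<delta> / 2 ^ n) \<le> T" if "k < N" for k using yb[OF that] half(2)[of n] by linarith
    show "y j + \<delta> / 2 ^ n < y k" if "j < k" for j k using ysep[OF that] half(2)[of n] \<delta> by linarith
  qed measurable
  have W': "?L (\<lambda>k. window f (\<delta> / 2 ^ Suc n) (y k + \<delta>)) \<le> V (Suc n)" for n
    unfolding V_def e_def
  proof (intro window_norm_le p half)
    show "0 \<le> y k + \<delta> \<and> y k + \<delta> + 2 * (\<delta> / 2 ^ Suc n) \<le> T" if "k < N" for k using yb[OF that] half(3)[of n] \<delta> by linarith
    show "y j + \<delta> + \<delta> / 2 ^ Suc n < y k + \<delta>" if "j < k" for j k using ysep[OF that] half(2)[of "Suc n"] \<delta> by linarith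
  qed measurable
  have "?L (\<lambda>k. ennreal \<bar>f (y k + \<delta>) - f (y k)\<bar>)
      \<le> ?L (\<lambda>k. (\<Sum>n. window f (\<delta> / 2 ^ Suc n) (y k + \<delta>)) + ((\<Sum>n. window f (\<delta> / 2 ^ Suc n) (y k)) + window f \<delta> (y k)))"
    using yb \<delta> by (intro Lp_qnorm_mono p0 increment_window_le[OF _ _ _ cont int]) auto
  also have "\<dots> \<le> ?L (\<lambda>k. \<Sum>n. window f (\<delta> / 2 ^ Suc n) (y k + \<delta>)) + (?L (\<lambda>k. \<Sum>n. window f (\<delta> / 2 ^ Suc n) (y k)) + ?L (\<lambda>k. window f \<delta> (y k)))"
    by (intro order_trans[OF Lp_qnorm_add[OF p]] add_left_mono Lp_qnorm_add[OF p]) auto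
  also have "\<dots> \<le> (\<Sum>n. V (Suc n)) + ((\<Sum>n. V (Suc n)) + V 0)"
  proof (intro add_mono)
    show "?L (\<lambda>k. \<Sum>n. window f (\<delta> / 2 ^ Suc n) (y k + \<delta>)) \<le> (\<Sum>n. V (Suc n))"
      by (rule order_trans[OF Lp_qnorm_suminf[OF p]]) (auto intro!: suminf_le W' simp del: power_Suc)
    show "?L (\<lambda>k. \<Sum>n. window f (\<delta> / 2 ^ Suc n) (y k)) \<le> (\<Sum>n. V (Suc n))"
      by (rule order_trans[OF Lp_qnorm_suminf[OF p]]) (auto intro!: suminf_le W simp del: power_Suc)
    show "?L (\<lambda>k. window f \<delta> (y k)) \<le> V 0" using W[of 0] by simp
  qed
  \<comment> \<open>A further \<open>V 0\<close> completes both tails to the whole series, giving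
    the factor 2.\<close>
  also have "\<dots> \<le> (V 0 + (\<Sum>n. V (Suc n))) + (V 0 + (\<Sum>n. V (Suc n)))"
    by (rule add_mono, rule add_increasing, simp, rule order_refl, rule eq_refl, rule add.commute)
  also have "\<dots> = 2 * (\<Sum>n. V n)" by (simp add: ennreal_suminf_Suc[of V] mult_2)
  also have "V = (\<lambda>n. ennreal (\<delta> powr - e) * (ennreal ((2 powr e) ^ n) * modulus T p f (\<delta> / 2 ^ n)))"
  proof
    fix n
    have "(\<delta> / 2 ^ n) powr - e = \<delta> powr - e * (2 powr e) ^ n"
      using \<delta> by (simp add: powr_divide powr_minus_divide powr_realpow[symmetric] powr_powr powr_power mult.commute)
    then show "V n = ennreal (\<delta> powr - e) * (ennreal ((2 powr e) ^ n) * modulus T p f (\<delta> / 2 ^ n))"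
      by (simp add: V_def ennreal_mult mult.assoc)
  qed
  also have "2 * (\<Sum>n. ennreal (\<delta> powr - e) * (ennreal ((2 powr e) ^ n) * modulus T p f (\<delta> / 2 ^ n)))
    = ennreal (2 * \<delta> powr - e) * (\<Sum>n. ennreal ((2 powr e) ^ n) * modulus T p f (\<delta> / 2 ^ n))"
    by (simp add: ennreal_mult mult.assoc)
  finally show ?thesis by (simp only: y1 e_def[symmetric] y_def[symmetric])
qed

subsection \<open>The integral of a continuous integrand\<close>

lemma max_inverse_exponent:
  assumes "0 < (p::ennreal)"
  shows "max 1 (inverse p) = ennreal (1 / enn2real (min 1 p))"
    and "max 1 (enn2real (inverse p)) = 1 / enn2real (min 1 p)"
proof -
  have "max 1 (inverse p) = ennreal (1 / enn2real (min 1 p)) \<and> max 1 (enn2real (inverse p)) = 1 / enn2real (min 1 p)"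
  proof (cases "1 \<le> p")
    case True
    then show ?thesis using ennreal_inverse_le_iff[of p 1] inverse_exponent(3)[OF True]
      by (simp add: max_def min_def)
  next
    case False
    then obtain s where s: "0 < s" "p = ennreal s" "s \<le> 1"
      using assms by (cases p) (auto simp: not_le)
    then show ?thesis
      by (auto simp: max_def min_def inverse_ennreal inverse_eq_divide)
  qed
  then show "max 1 (inverse p) = ennreal (1 / enn2real (min 1 p))"
    "max 1 (enn2real (inverse p)) = 1 / enn2real (min 1 p)" by auto
qed

text \<open>The pointwise counterpart of the norm inequality over dyadic scales, with the same ratio
  c 2^-a < 1.\<close>

lemma geometric_scales_le:
  assumes X: "\<And>\<tau>. 0 < \<tau> \<Longrightarrow> \<tau> \<le> T \<Longrightarrow> X \<tau> \<le> ennreal (B * \<tau> powr a) * H" and B: "0 \<le> B"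
    and c: "0 < c" "c < 2 powr a" and t: "0 < \<tau>" "\<tau> \<le> T"
  shows "(\<Sum>n. ennreal (c ^ n) * X (\<tau> / 2 ^ n)) \<le> ennreal (B / (1 - c * 2 powr - a) * \<tau> powr a) * H"
proof -
  define r where "r = c * 2 powr - a"
  have r: "0 \<le> r" "r < 1" using c by (auto simp: r_def powr_minus field_simps)
  have "(\<Sum>n. ennreal (c ^ n) * X (\<tau> / 2 ^ n)) \<le> (\<Sum>n. ennreal (B * \<tau> powr a) * H * ennreal (r ^ n))"
  proof (intro suminf_le)
    fix n
    let ?u = "\<tau> / 2 ^ n"
    have "?u \<le> \<tau> / 1" using t by (intro divide_left_mono) auto
    then have "ennreal (c ^ n) * X ?u \<le> ennreal (c ^ n) * (ennreal (B * ?u powr a) * H)"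
      using t by (intro mult_left_mono X) auto
    also have "\<dots> = ennreal (c ^ n * (B * ?u powr a)) * H"
      using c B by (simp add: ennreal_mult mult.assoc)
    also have "c ^ n * (B * ?u powr a) = B * \<tau> powr a * r ^ n"
      using t by (simp add: r_def power_mult_distrib power_divide powr_divide powr_power powr_minus_divide powr_realpow[symmetric] powr_powr mult.commute)
    also have "ennreal (B * \<tau> powr a * r ^ n) * H = ennreal (B * \<tau> powr a) * H * ennreal (r ^ n)"
      using B r by (simp add: ennreal_mult ac_simps)
    finally show "ennreal (c ^ n) * X ?u \<le> ennreal (B * \<tau> powr a) * H * ennreal (r ^ n)" .
  qed auto
  also have "\<dots> = ennreal (B * \<tau> powr a) * H * ennreal (1 / (1 - r))"
    unfolding ennreal_suminf_cmult suminf_geometric_ennreal[OF r] ..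
  also have "\<dots> = ennreal (B / (1 - c * 2 powr - a) * \<tau> powr a) * H"
  proof -
    have "ennreal (B * \<tau> powr a) * ennreal (1 / (1 - r)) = ennreal (B / (1 - r) * \<tau> powr a)"
      using B r by (subst ennreal_mult[symmetric]) (auto simp: field_simps)
    then show ?thesis by (simp only: r_def[symmetric] ac_simps)
  qed
  finally show ?thesis .
qed

text \<open>With a continuous representative of f, increments over the cells make sense for every
  base point; 1/p0 < \<alpha>0 will make the chaining series converge.\<close>

locale young_continuous = young +
  assumes f_cont: "continuous_on {0..T} f"
    and p01: "1 \<le> p0" "1 \<le> p1" and e0: "enn2real (inverse p0) < \<alpha>0"
begin

definition "e0 = enn2real (inverse p0)"
definition "e1 = enn2real (inverse p1)"

lemma e0_bounds: "0 \<le> e0" "e0 \<le> 1" "e0 < \<alpha>0" "0 \<le> e1"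
  using inverse_exponent(3)[OF p01(1)] e0 by (auto simp: e0_def e1_def)

lemma rho_e: "1 / \<rho> = max 1 (e0 + e1)" "enn2real (inverse p2) = e0 + e1"
proof -
  have "inverse p2 = ennreal (e0 + e1)"
  proof -
    have "ennreal (e0 + e1) = ennreal e0 + ennreal e1" by (intro ennreal_plus) (auto simp: e0_def e1_def)
    also have "\<dots> = inverse p0 + inverse p1"
      unfolding e0_def e1_def inverse_exponent(2)[OF p01(1), symmetric] inverse_exponent(2)[OF p01(2), symmetric] ..
    finally show ?thesis using p(3) by simp
  qed
  then have "enn2real (inverse p2) = enn2real (ennreal (e0 + e1))" by (simp only:)
  also have "\<dots> = e0 + e1" by (rule enn2real_ennreal) (use e0_bounds in simp)
  finally show "enn2real (inverse p2) = e0 + e1" .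
  then show "1 / \<rho> = max 1 (e0 + e1)" using max_inverse_exponent(2)[OF p2(1)] by (simp add: \<rho>_def)
qed

text \<open>The chaining series that bounds the cell increments of f in l^p0, up to 2
  \<delta>^(-1/p0). It takes over the part of the modulus of f, and \<open>Y\<close> that of
  \<open>Z\<close>.\<close>

definition Vt :: "real \<Rightarrow> ennreal" where
  "Vt \<tau> = (\<Sum>n. ennreal ((2 powr e0) ^ n) * modulus T p0 f (\<tau> / 2 ^ n))"

definition Y :: "real \<Rightarrow> ennreal" where
  "Y \<tau> = Vt \<tau> * modulus T p1 g \<tau>"

lemma Vt_mono: "x \<le> y \<Longrightarrow> Vt x \<le> Vt y"
  unfolding Vt_def by (intro suminf_le mult_left_mono modulus_mono divide_right_mono) auto

lemma Vt_double: "Vt (2 * x) \<le> 4 * Vt x"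
proof -
  have "Vt (2 * x) \<le> (\<Sum>n. 4 * (ennreal ((2 powr e0) ^ n) * modulus T p0 f (x / 2 ^ n)))"
    unfolding Vt_def
  proof (intro suminf_le)
    fix n
    have "modulus T p0 f (2 * x / 2 ^ n) \<le> 4 * modulus T p0 f (x / 2 ^ n)"
      using modulus_double_f[of "x / 2 ^ n"] by simp
    then have "ennreal ((2 powr e0) ^ n) * modulus T p0 f (2 * x / 2 ^ n) \<le> ennreal ((2 powr e0) ^ n) * (4 * modulus T p0 f (x / 2 ^ n))"
      by (rule mult_left_mono) simp
    then show "ennreal ((2 powr e0) ^ n) * modulus T p0 f (2 * x / 2 ^ n) \<le> 4 * (ennreal ((2 powr e0) ^ n) * modulus T p0 f (x / 2 ^ n))"
      by (simp only: mult.left_commute)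
  qed auto
  then show ?thesis by (simp add: Vt_def)
qed

lemma Y_mono: "x \<le> y \<Longrightarrow> Y x \<le> Y y"
  unfolding Y_def by (intro mult_mono Vt_mono modulus_mono) auto

lemma Y_double: "Y (2 * x) \<le> 16 * Y x"
proof -
  have "Y (2 * x) \<le> (4 * Vt x) * (4 * modulus T p1 g x)"
    unfolding Y_def by (intro mult_mono Vt_double modulus_double_g) auto
  also have "\<dots> = (4 * 4) * Y x" by (simp add: Y_def ac_simps)
  finally show ?thesis by simp
qed

lemma measurable_Vt [measurable]: "Vt \<in> borel_measurable borel"
  by (rule borel_measurable_mono_ennreal[OF Vt_mono])

lemma measurable_Y [measurable]: "Y \<in> borel_measurable borel"
  by (rule borel_measurable_mono_ennreal[OF Y_mono])

definition level :: "real \<Rightarrow> nat \<Rightarrow> real \<Rightarrow> real" where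
  "level h n r = (\<Sum>k<2 ^ n. (f (r + real (2 * k + 1) * (h / 2 ^ Suc n)) - f (r + real (2 * k) * (h / 2 ^ Suc n)))
        * (g (r + real (2 * k + 2) * (h / 2 ^ Suc n)) - g (r + real (2 * k + 1) * (h / 2 ^ Suc n))))"

lemma measurable_level [measurable]: "level h n \<in> borel_measurable borel"
  unfolding level_def by measurable

lemma level_eq: "riemann_sum f g (dyadic (Suc n)) r (r + h) - riemann_sum f g (dyadic n) r (r + h) = level h n r"
  unfolding riemann_sum_dyadic_Suc level_def by (simp add: mult.commute)

text \<open>The increments of \<open>f\<close> along the \<open>2\<^sup>n\<close> cells are bounded in \<open>\<ell>\<^bsup>p0\<^esup>\<close> uniformly in the base point, those of
  \<open>g\<close> in \<open>\<ell>\<^bsup>p1\<^esup>\<close> after taking the \<open>L\<^bsup>p1\<^esup>\<close> norm over the base point.\<close>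

lemma level_norm_le:
  assumes h: "0 < h" "h \<le> T"
  shows "Lp_norm_on (T - h) p1 (level h n) \<le> ennreal (4 * h powr - e0 * (2 powr (1 / \<rho>)) ^ n) * Y (h / 2 ^ Suc n)"
proof -
  define N :: nat where "N = 2 ^ n"
  define \<delta> where "\<delta> = h / 2 ^ Suc n"
  have N0: "0 < N" by (simp add: N_def)
  have \<delta>: "0 < \<delta>" using h by (simp add: \<delta>_def)
  have hN: "2 * real N * \<delta> = h" by (simp add: N_def \<delta>_def)
  define c where "c r k = ennreal \<bar>f (r + real (2 * k + 1) * \<delta>) - f (r + real (2 * k) * \<delta>)\<bar>" for r :: real and k :: nat
  define d where "d r k = ennreal \<bar>g (r + real (2 * k + 2) * \<delta>) - g (r + real (2 * k + 1) * \<delta>)\<bar>" for r :: real and k :: nat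
  have [measurable]: "(\<lambda>r. d r k) \<in> borel_measurable borel" for k unfolding d_def by measurable
  define D where "D r = Lp_qnorm (count_space {..<N}) p1 (d r)" for r
  have [measurable]: "D \<in> borel_measurable borel"
    unfolding D_def using p by (intro measurable_Lp_qnorm_count_space) auto
  \<comment> \<open>The factor from f, independent of the base point; \<open>D\<close> carries the
    dependence on r.\<close>
  define A where "A = ennreal (real N powr (1 / \<rho> - (e0 + e1))) * (ennreal (2 * \<delta> powr - e0) * Vt \<delta>)"
  have pw: "ennreal \<bar>level h n r\<bar> \<le> A * D r" if r: "r \<in> {0..T - h}" for r
  proof -
    have "ennreal \<bar>level h n r\<bar> \<le> ennreal (\<Sum>k<N. \<bar>f (r + real (2 * k + 1) * \<delta>) - f (r + real (2 * k) * \<delta>)\<bar> * \<bar>g (r + real (2 * k + 2) * \<delta>) - g (r + real (2 * k + 1) * \<delta>)\<bar>)"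
      unfolding level_def N_def \<delta>_def abs_mult[symmetric] by (intro ennreal_leI sum_abs)
    also have "\<dots> = (\<Sum>k<N. c r k * d r k)"
      by (subst sum_ennreal[symmetric]) (auto simp: c_def d_def ennreal_mult)
    also have "\<dots> \<le> ennreal (real N powr (1 / \<rho> - (e0 + e1))) * Lp_qnorm (count_space {..<N}) p2 (\<lambda>k. c r k * d r k)"
      using sum_le_counting_norm[OF p_ge(1) N0, of "\<lambda>k. c r k * d r k"] by (simp add: rho_e)
    also have "\<dots> \<le> ennreal (real N powr (1 / \<rho> - (e0 + e1))) * (Lp_qnorm (count_space {..<N}) p0 (c r) * D r)"
      unfolding D_def by (intro mult_left_mono Lp_qnorm_Holder p) auto
    also have "\<dots> \<le> ennreal (real N powr (1 / \<rho> - (e0 + e1))) * ((ennreal (2 * \<delta> powr - e0) * Vt \<delta>) * D r)"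
    proof (intro mult_left_mono mult_right_mono)
      show "Lp_qnorm (count_space {..<N}) p0 (c r) \<le> ennreal (2 * \<delta> powr - e0) * Vt \<delta>"
        unfolding c_def Vt_def e0_def using r hN
        by (intro chain_norm_le[OF p01(1) \<delta> f f_cont] set_integrable_of_Lp[OF p01(1) T f f_Lp]) auto
    qed auto
    finally show ?thesis by (simp add: A_def mult.assoc)
  qed
  have Dn: "Lp_qnorm (lebesgue_on {0..T - h}) p1 D \<le> ennreal (real N powr e1) * modulus T p1 g \<delta>"
  proof -
    have dk: "Lp_qnorm (lebesgue_on {0..T - h}) p1 (\<lambda>r. d r k) \<le> modulus T p1 g \<delta>" if k: "k < N" for k
    proof -
      have "real (2 * k + 2) \<le> real (2 * N)" using k by (simp only: of_nat_le_iff)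
      then have "real (2 * k + 2) * \<delta> \<le> real (2 * N) * \<delta>" using \<delta> by (intro mult_right_mono) auto
      then have le: "(T - h) + real (2 * k + 1) * \<delta> \<le> T - \<delta>" using hN by (simp add: algebra_simps)
      have "Lp_qnorm (lebesgue_on {0..T - h}) p1 (\<lambda>r. d r k)
          = Lp_norm_on (T - h) p1 (\<lambda>r. g ((r + real (2 * k + 1) * \<delta>) + \<delta>) - g (r + real (2 * k + 1) * \<delta>))"
        unfolding Lp_norm_on_def d_def by (intro Lp_qnorm_cong) (simp add: algebra_simps)
      also have "\<dots> \<le> Lp_norm_on (T - \<delta>) p1 (\<lambda>r. g (r + \<delta>) - g r)"
        using Lp_norm_on_shift_le[of p1 "\<lambda>r. g (r + \<delta>) - g r" "real (2 * k + 1) * \<delta>" "T - h" "T - \<delta>"] p le \<delta> by simp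
      also have "\<dots> \<le> modulus T p1 g \<delta>" using \<delta> by (intro modulus_upper) auto
      finally show ?thesis .
    qed
    show ?thesis
      using p(2)
    proof (cases rule: ennreal_exponent_cases)
      case (fin s)
      have e1s: "e1 = 1 / s" by (rule trans[OF e1_def], unfold fin(2), use fin(1) in \<open>simp add: inverse_ennreal inverse_eq_divide\<close>)
      have "(\<integral>\<^sup>+r. enn_powr (D r) s \<partial>lebesgue_on {0..T - h}) = (\<Sum>k<N. \<integral>\<^sup>+r. enn_powr (d r k) s \<partial>lebesgue_on {0..T - h})"
        unfolding D_def using fin by (subst nn_integral_sum[symmetric]) (auto simp: Lp_qnorm_count_space_finite)
      also have "\<dots> \<le> (\<Sum>k<N. enn_powr (modulus T p1 g \<delta>) s)"
        using dk fin by (intro sum_mono) (simp add: Lp_qnorm_ennreal enn_powr_le_swap[symmetric] enn_powr_le_swap)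
      also have "\<dots> = ennreal (real N) * enn_powr (modulus T p1 g \<delta>) s"
        by (simp add: ennreal_of_nat_eq_real_of_nat)
      finally have "Lp_qnorm (lebesgue_on {0..T - h}) p1 D \<le> enn_powr (ennreal (real N) * enn_powr (modulus T p1 g \<delta>) s) (1 / s)"
        using fin by (simp add: Lp_qnorm_ennreal enn_powr_mono)
      also have "\<dots> = ennreal (real N powr e1) * modulus T p1 g \<delta>"
        unfolding e1s using fin(1) by (simp add: enn_powr_mult enn_powr_ennreal)
      finally show ?thesis .
    next
      case top
      have "AE r in lebesgue_on {0..T - h}. \<forall>k\<in>{..<N}. d r k \<le> modulus T p1 g \<delta>"
        using dk top by (intro AE_finite_allI) (auto simp: Lp_qnorm_top esssup_le_iff)
      then have "AE r in lebesgue_on {0..T - h}. D r \<le> modulus T p1 g \<delta>"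
        by eventually_elim (auto simp: D_def top Lp_qnorm_count_space_top intro: SUP_least)
      moreover have "e1 = 0" by (rule trans[OF e1_def], unfold top, simp)
      ultimately show ?thesis using top N0 by (auto simp: Lp_qnorm_top)
    qed
  qed
  have "Lp_norm_on (T - h) p1 (level h n) \<le> Lp_qnorm (lebesgue_on {0..T - h}) p1 (\<lambda>r. A * D r)"
    unfolding Lp_norm_on_def using pw p by (intro Lp_qnorm_mono) auto
  also have "\<dots> \<le> Lp_qnorm (lebesgue_on {0..T - h}) \<infinity> (\<lambda>r. A) * Lp_qnorm (lebesgue_on {0..T - h}) p1 D"
    using p by (intro Lp_qnorm_Holder) auto
  also have "\<dots> \<le> A * (ennreal (real N powr e1) * modulus T p1 g \<delta>)"
    by (intro mult_mono Dn) (auto simp: Lp_qnorm_top)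
  also have "\<dots> = (ennreal (real N powr (1 / \<rho> - (e0 + e1))) * ennreal (2 * \<delta> powr - e0) * ennreal (real N powr e1)) * Y \<delta>"
    by (simp only: A_def Y_def ac_simps)
  also have "\<dots> \<le> ennreal (4 * h powr - e0 * (2 powr (1 / \<rho>)) ^ n) * Y \<delta>"
  proof (intro mult_right_mono)
    \<comment> \<open>The powers of N collapse: 1/\<rho> - (e0+e1) from comparing l^1 with l^p2, e0
      from \<delta>^(-e0), e1 from the N cells of g. The constant 4 bounds 2 * 2^e0.\<close>
    have "\<delta> = h / (2 * real N)" using hN N0 by (simp add: field_simps)
    then have "\<delta> powr - e0 = h powr - e0 * (2 powr e0 * real N powr e0)"
      using h N0 by (simp add: powr_divide powr_minus_divide powr_mult)
    then have "real N powr (1 / \<rho> - (e0 + e1)) * (2 * \<delta> powr - e0) * real N powr e1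
      = 2 * 2 powr e0 * h powr - e0 * (real N powr (1 / \<rho> - (e0 + e1)) * real N powr e0 * real N powr e1)"
      by simp
    also have "real N powr (1 / \<rho> - (e0 + e1)) * real N powr e0 * real N powr e1 = real N powr (1 / \<rho>)"
      by (simp flip: powr_add)
    also have "real N powr (1 / \<rho>) = (2 powr (1 / \<rho>)) ^ n"
      by (simp add: N_def powr_realpow[symmetric] powr_powr powr_power mult.commute)
    also have "2 * 2 powr e0 * h powr - e0 * (2 powr (1 / \<rho>)) ^ n \<le> 4 * h powr - e0 * (2 powr (1 / \<rho>)) ^ n"
    proof -
      have "2 powr e0 \<le> 2 powr (1::real)" using e0_bounds by (intro powr_mono) auto
      then show ?thesis by (intro mult_right_mono) auto
    qed
    finally show "ennreal (real N powr (1 / \<rho> - (e0 + e1))) * ennreal (2 * \<delta> powr - e0) * ennreal (real N powr e1)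
      \<le> ennreal (4 * h powr - e0 * (2 powr (1 / \<rho>)) ^ n)"
      by (simp add: ennreal_leI flip: ennreal_mult)
  qed simp
  finally show ?thesis by (simp add: \<delta>_def)
qed

text \<open>Telescoping over the levels. As p1 \<ge> 1, the triangle inequality holds without
  powers, so the growth per level is 2^(1/\<rho>) instead of a factor 2 on \<rho>-th powers; Fatou
  passes to the limit.\<close>

lemma remainder_p1_le:
  assumes I: "is_integral I" and h: "0 < h" "h \<le> T"
  shows "Lp_norm_on (T - h) p1 (\<lambda>r. incr I r (r + h) - f r * incr g r (r + h))
    \<le> ennreal (4 * h powr - e0) * (\<Sum>n. ennreal ((2 powr (1 / \<rho>)) ^ n) * Y (h / 2 ^ n))"
proof -
  have [measurable]: "I \<in> borel_measurable borel" using I by (simp add: is_integral_def)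
  let ?S = "\<lambda>n r. riemann_sum f g (dyadic n) r (r + h)"
  let ?B = "ennreal (4 * h powr - e0) * (\<Sum>n. ennreal ((2 powr (1 / \<rho>)) ^ n) * Y (h / 2 ^ n))"
  have d0: "?S 0 r = f r * incr g r (r + h)" for r by (simp add: riemann_sum_dyadic incr_def)
  have "Lp_norm_on (T - h) p1 (\<lambda>r. ?S n r - ?S 0 r) \<le> ?B" for n
  proof -
    have "(\<lambda>r. ?S n r - ?S 0 r) = (\<lambda>r. \<Sum>j<n. level h j r)"
      unfolding level_eq[symmetric] by (rule ext, rule sum_lessThan_telescope[symmetric, of "\<lambda>n. ?S n r" for r])
    then have "Lp_norm_on (T - h) p1 (\<lambda>r. ?S n r - ?S 0 r) \<le> (\<Sum>j<n. Lp_norm_on (T - h) p1 (level h j))"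
      using Lp_norm_on_sum_quasi[of 1 p1 "level h" "T - h" "{..<n}"] p01 by simp
    also have "\<dots> \<le> (\<Sum>j<n. ennreal (4 * h powr - e0) * (ennreal ((2 powr (1 / \<rho>)) ^ j) * Y (h / 2 ^ j)))"
    proof (intro sum_mono)
      fix j
      have "h / 2 ^ Suc j \<le> h / 2 ^ j" using h by (intro divide_left_mono) auto
      then have "Y (h / 2 ^ Suc j) \<le> Y (h / 2 ^ j)" by (rule Y_mono)
      then have "Lp_norm_on (T - h) p1 (level h j) \<le> ennreal (4 * h powr - e0 * (2 powr (1 / \<rho>)) ^ j) * Y (h / 2 ^ j)"
        using level_norm_le[OF h, of j] by (meson mult_left_mono order_trans zero_le)
      then show "Lp_norm_on (T - h) p1 (level h j) \<le> ennreal (4 * h powr - e0) * (ennreal ((2 powr (1 / \<rho>)) ^ j) * Y (h / 2 ^ j))"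
        by (simp add: ennreal_mult mult.assoc)
    qed
    also have "\<dots> = ennreal (4 * h powr - e0) * (\<Sum>j<n. ennreal ((2 powr (1 / \<rho>)) ^ j) * Y (h / 2 ^ j))"
      by (simp add: sum_distrib_left)
    also have "\<dots> \<le> ?B" by (intro mult_left_mono sum_le_suminf) auto
    finally show ?thesis .
  qed
  then have B: "liminf (\<lambda>n. Lp_norm_on (T - h) p1 (\<lambda>r. ?S n r - ?S 0 r)) \<le> ?B"
    by (intro Liminf_le always_eventually) auto
  have "AE r in lebesgue_on {0..T - h}. (\<lambda>n. ?S n r) \<longlonglongrightarrow> I (r + h) - I r"
    using I h by (auto simp: is_integral_def)
  then have "AE r in lebesgue_on {0..T - h}. (\<lambda>n. ?S n r - ?S 0 r) \<longlonglongrightarrow> (I (r + h) - I r) - ?S 0 r"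
    by eventually_elim (intro tendsto_intros)
  then have "Lp_norm_on (T - h) p1 (\<lambda>r. (I (r + h) - I r) - ?S 0 r) \<le> liminf (\<lambda>n. Lp_norm_on (T - h) p1 (\<lambda>r. ?S n r - ?S 0 r))"
    using p by (intro Lp_norm_on_Fatou) auto
  with B show ?thesis unfolding d0 incr_def[of I] by (rule order_trans[rotated])
qed

definition "e_const = 1 / (1 - 2 powr e0 * 2 powr - \<alpha>0)"

text \<open>Two geometric sums: the inner one, in \<open>Vt\<close>, converges by 1/p0 < \<alpha>0,
  the outer one by 1/\<rho> < \<gamma>.\<close>

lemma level_sum_subcritical:
  assumes gt: "1 < \<gamma> * \<rho>" and t: "0 < \<tau>" "\<tau> \<le> T"
  shows "(\<Sum>n. ennreal ((2 powr (1 / \<rho>)) ^ n) * Y (\<tau> / 2 ^ n))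
    \<le> ennreal (256 * e_const / (1 - 2 powr (1 / \<rho>) * 2 powr - \<gamma>) * \<tau> powr \<gamma>) * (F * G)"
proof (rule geometric_scales_le[OF _ _ _ _ t])
  have "2 powr e0 < 2 powr \<alpha>0" using e0_bounds by (intro powr_less_mono) auto
  note lt = this
  have "e_const = 1 / (1 - 2 powr (e0 - \<alpha>0))" by (simp add: e_const_def powr_add[symmetric])
  moreover have "2 powr (e0 - \<alpha>0) < 2 powr (0::real)" using e0_bounds by (intro powr_less_mono) auto
  ultimately have ec: "0 \<le> e_const" by simp
  then show "0 \<le> 256 * e_const" by simp
  have "1 / \<rho> < \<gamma>" using gt \<rho> by (simp add: field_simps)
  then show "0 < 2 powr (1 / \<rho>)" "2 powr (1 / \<rho>) < 2 powr \<gamma>" by (auto intro: powr_less_mono)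
  fix \<tau> assume t: "0 < \<tau>" "\<tau> \<le> T"
  have "Vt \<tau> \<le> ennreal (16 / (1 - 2 powr e0 * 2 powr - \<alpha>0) * \<tau> powr \<alpha>0) * F"
    unfolding Vt_def
  proof (rule geometric_scales_le[OF _ _ _ lt t])
    fix u assume "0 < u" "u \<le> T"
    then show "modulus T p0 f u \<le> ennreal (16 * u powr \<alpha>0) * F" using modulus_f_le[of u] by (simp add: ennreal_mult)
  qed auto
  then have "Y \<tau> \<le> (ennreal (16 * e_const * \<tau> powr \<alpha>0) * F) * (16 * ennreal (\<tau> powr \<alpha>1) * G)"
    unfolding Y_def by (intro mult_mono modulus_g_le t) (auto simp: e_const_def)
  also have "\<dots> = (ennreal (16 * e_const * \<tau> powr \<alpha>0) * (ennreal 16 * ennreal (\<tau> powr \<alpha>1))) * (F * G)"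
    by (simp add: ac_simps)
  also have "ennreal (16 * e_const * \<tau> powr \<alpha>0) * (ennreal 16 * ennreal (\<tau> powr \<alpha>1)) = ennreal (16 * e_const * \<tau> powr \<alpha>0 * (16 * \<tau> powr \<alpha>1))"
    using ec by (simp only: ennreal_mult mult_nonneg_nonneg powr_ge_zero zero_le_numeral)
  also have "16 * e_const * \<tau> powr \<alpha>0 * (16 * \<tau> powr \<alpha>1) = 256 * e_const * \<tau> powr \<gamma>"
    by (simp add: \<gamma>_def powr_add)
  finally show "Y \<tau> \<le> ennreal (256 * e_const * \<tau> powr \<gamma>) * (F * G)" .
qed

text \<open>Now the outer sum is critical with m = 1 and needs \<open>Y\<close> in L^q2 of the
  scale. Hoelder separates \<open>Vt\<close> from the modulus of g, and the scale inequality removes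
  the chaining series. The constant is 768 = 3 * 16 * 16.\<close>

lemma level_sum_critical:
  assumes crit: "\<gamma> = 1" "\<rho> = 1" "q2 \<le> 1" and C: "0 \<le> C"
    "\<forall>T>0. \<forall>X. (\<forall>x y. x \<le> y \<longrightarrow> X x \<le> X y) \<longrightarrow>
      Lp_qnorm (dlog T) q0 (\<lambda>\<tau>. (\<Sum>n. ennreal ((2 powr e0) ^ n) * X (\<tau> / 2 ^ n)) / ennreal (\<tau> powr \<alpha>0))
      \<le> ennreal C * Lp_qnorm (dlog T) q0 (\<lambda>\<tau>. X \<tau> / ennreal (\<tau> powr \<alpha>0))"
    and t: "0 < \<tau>" "\<tau> \<le> T"
  shows "(\<Sum>n. ennreal ((2 powr (1 / \<rho>)) ^ n) * Y (\<tau> / 2 ^ n)) \<le> ennreal (768 * C * \<tau> powr \<gamma>) * (F * G)"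
proof -
  have "Lp_qnorm (dlog T) q2 (\<lambda>u. Y u / ennreal (u powr \<gamma>))
      = Lp_qnorm (dlog T) q2 (\<lambda>\<tau>. (Vt \<tau> / ennreal (\<tau> powr \<alpha>0)) * (modulus T p1 g \<tau> / ennreal (\<tau> powr \<alpha>1)))"
    by (intro Lp_qnorm_cong) (auto simp: Y_def divide_powr_add)
  also have "\<dots> \<le> Lp_qnorm (dlog T) q0 (\<lambda>\<tau>. Vt \<tau> / ennreal (\<tau> powr \<alpha>0)) * G"
    unfolding G_def besov_seminorm_def by (intro Lp_qnorm_Holder q) measurable
  also have "\<dots> \<le> (ennreal C * F) * G"
    using C(2)[rule_format, of T "modulus T p0 f"] T modulus_mono
    by (intro mult_right_mono) (auto simp: Vt_def F_def besov_seminorm_def)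
  finally have YN: "Lp_qnorm (dlog T) q2 (\<lambda>u. Y u / ennreal (u powr \<gamma>)) \<le> ennreal C * (F * G)"
    by (simp add: mult.assoc)
  have "(\<Sum>n. ennreal ((2 powr (1 / \<rho>)) ^ n) * Y (\<tau> / 2 ^ n)) = (\<Sum>n. 2 ^ n * enn_powr (Y (\<tau> / 2 ^ n)) 1)"
    using crit by (simp flip: ennreal_power)
  also have "\<dots> \<le> 3 * ennreal \<tau> * enn_powr (16 * 16 * Lp_qnorm (dlog \<tau>) q2 (\<lambda>u. Y u / ennreal (u powr (1 / 1)))) 1"
    using q2 crit t Y_mono Y_double by (intro critical_sum_le) auto
  also have "\<dots> \<le> 3 * ennreal \<tau> * (16 * 16 * (ennreal C * (F * G)))"
  proof -
    have "Lp_qnorm (dlog \<tau>) q2 (\<lambda>u. Y u / ennreal (u powr \<gamma>)) \<le> Lp_qnorm (dlog T) q2 (\<lambda>u. Y u / ennreal (u powr \<gamma>))"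
      using q2 t by (intro Lp_qnorm_dlog_mono_interval) auto
    with YN have "Lp_qnorm (dlog \<tau>) q2 (\<lambda>u. Y u / ennreal (u powr (1 / 1))) \<le> ennreal C * (F * G)"
      using crit by (auto intro: order_trans)
    then show ?thesis by (simp only: enn_powr_one) (intro mult_left_mono; simp)
  qed
  also have "\<dots> = ennreal (768 * C * \<tau> powr \<gamma>) * (F * G)"
  proof -
    have "ennreal (768 * C * \<tau> powr \<gamma>) = 768 * (ennreal C * ennreal \<tau>)"
      using crit t C by (simp add: ennreal_mult mult.assoc)
    moreover have "3 * x * (16 * 16 * (y * z)) = 768 * (y * x) * z" for x y z :: ennreal
    proof -
      have "3 * x * (16 * 16 * (y * z)) = (3 * (16 * 16)) * ((y * x) * z)" by (simp only: ac_simps)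
      then show ?thesis by (simp add: mult.assoc)
    qed
    ultimately show ?thesis by (simp only:)
  qed
  finally show ?thesis .
qed

text \<open>The germ is bounded by the supremum of f. In the remainder the chaining factor h^(-e0)
  lowers h^\<gamma> to h^(\<alpha>0 - e0 + \<alpha>1), which explains the power of T.\<close>

theorem integral_seminorm_p1_le:
  assumes I: "is_integral I"
    and K: "0 \<le> K" "\<And>\<tau>. 0 < \<tau> \<Longrightarrow> \<tau> \<le> T \<Longrightarrow>
      (\<Sum>n. ennreal ((2 powr (1 / \<rho>)) ^ n) * Y (\<tau> / 2 ^ n)) \<le> ennreal (K * \<tau> powr \<gamma>) * (F * G)"
    and B: "\<And>x. 0 \<le> x \<Longrightarrow> x \<le> T \<Longrightarrow> \<bar>f x\<bar> \<le> B"
    and D: "0 \<le> D" "Lp_qnorm (dlog T) q1 (\<lambda>\<tau>. ennreal (\<tau> powr (\<alpha>0 - e0))) \<le> ennreal (D * T powr (\<alpha>0 - e0))"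
  shows "besov_seminorm T \<alpha>1 p1 q1 I \<le> ennreal (quasi_const p1 * (quasi_const q1 * (1 + 4 * K * D))) *
    (ennreal B + ennreal (T powr (\<alpha>0 - e0)) * F) * G"
proof -
  have [measurable]: "I \<in> borel_measurable borel" using I by (simp add: is_integral_def)
  have "besov_seminorm T \<alpha>1 p1 q1 I \<le> ennreal (quasi_const p1) * ennreal (quasi_const q1 * (1 + 4 * K * D)) * (ennreal B * G + ennreal (T powr (\<alpha>0 - e0)) * (F * G))"
  proof (rule seminorm_le_of_modulus[OF _ _ FG(3) _ _ D])
    fix \<tau> assume t: "0 < \<tau>" "\<tau> \<le> T"
    show "modulus T p1 I \<tau> \<le> ennreal (quasi_const p1) * (ennreal B * modulus T p1 g \<tau> + ennreal (4 * K * \<tau> powr (\<alpha>0 - e0 + \<alpha>1)) * (F * G))"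
      unfolding modulus_def[of T p1 I]
    proof (intro SUP_least)
      fix h assume h: "h \<in> {0..\<tau>}"
      show "Lp_norm_on (T - h) p1 (\<lambda>s. I (s + h) - I s) \<le> ennreal (quasi_const p1) * (ennreal B * modulus T p1 g \<tau> + ennreal (4 * K * \<tau> powr (\<alpha>0 - e0 + \<alpha>1)) * (F * G))"
      proof (cases "h = 0")
        case True
        then show ?thesis using p by (simp add: Lp_norm_on_def Lp_qnorm_0)
      next
        case False
        then have h0: "0 < h" "h \<le> \<tau>" "h \<le> T" using h t by auto
        have "Lp_norm_on (T - h) p1 (\<lambda>s. I (s + h) - I s)
          = Lp_norm_on (T - h) p1 (\<lambda>s. f s * (g (s + h) - g s) + (incr I s (s + h) - f s * incr g s (s + h)))"
          by (simp add: incr_def)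
        also have "\<dots> \<le> ennreal (quasi_const p1) * (Lp_norm_on (T - h) p1 (\<lambda>s. f s * (g (s + h) - g s)) + Lp_norm_on (T - h) p1 (\<lambda>s. incr I s (s + h) - f s * incr g s (s + h)))"
          unfolding incr_def by (intro Lp_norm_on_add_const p) measurable
        also have "\<dots> \<le> ennreal (quasi_const p1) * (ennreal B * modulus T p1 g \<tau> + ennreal (4 * K * \<tau> powr (\<alpha>0 - e0 + \<alpha>1)) * (F * G))"
        proof (intro mult_left_mono add_mono)
          have "Lp_norm_on (T - h) p1 (\<lambda>s. f s * (g (s + h) - g s)) \<le> Lp_qnorm (lebesgue_on {0..T - h}) p1 (\<lambda>s. ennreal B * ennreal \<bar>g (s + h) - g s\<bar>)"
            unfolding Lp_norm_on_def
          proof (intro Lp_qnorm_mono p)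
            fix s assume "s \<in> space (lebesgue_on {0..T - h})"
            then have "\<bar>f s\<bar> \<le> B" using h0 by (intro B) auto
            then show "ennreal \<bar>f s * (g (s + h) - g s)\<bar> \<le> ennreal B * ennreal \<bar>g (s + h) - g s\<bar>"
              unfolding abs_mult ennreal_mult[OF abs_ge_zero abs_ge_zero] by (intro mult_right_mono ennreal_leI) auto
          qed measurable
          also have "\<dots> = ennreal B * Lp_norm_on (T - h) p1 (\<lambda>s. g (s + h) - g s)"
            unfolding Lp_norm_on_def using p by (intro Lp_qnorm_cmult) auto
          also have "\<dots> \<le> ennreal B * modulus T p1 g \<tau>" using h0 by (intro mult_left_mono modulus_upper) auto
          finally show "Lp_norm_on (T - h) p1 (\<lambda>s. f s * (g (s + h) - g s)) \<le> ennreal B * modulus T p1 g \<tau>" .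
          have "Lp_norm_on (T - h) p1 (\<lambda>s. incr I s (s + h) - f s * incr g s (s + h)) \<le> ennreal (4 * h powr - e0) * (ennreal (K * h powr \<gamma>) * (F * G))"
            using remainder_p1_le[OF I h0(1,3)] K(2)[OF h0(1,3)] by (meson mult_left_mono order_trans zero_le)
          also have "\<dots> = ennreal (4 * h powr - e0 * (K * h powr \<gamma>)) * (F * G)"
            using K by (simp add: ennreal_mult mult.assoc)
          also have "\<dots> \<le> ennreal (4 * K * \<tau> powr (\<alpha>0 - e0 + \<alpha>1)) * (F * G)"
          proof (intro mult_right_mono ennreal_leI)
            have "4 * h powr - e0 * (K * h powr \<gamma>) = 4 * K * h powr (\<alpha>0 - e0 + \<alpha>1)"
              by (simp add: \<gamma>_def algebra_simps flip: powr_add)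
            also have "\<dots> \<le> 4 * K * \<tau> powr (\<alpha>0 - e0 + \<alpha>1)"
              using K h0 e0_bounds \<alpha> by (intro mult_left_mono powr_mono2) auto
            finally show "4 * h powr - e0 * (K * h powr \<gamma>) \<le> 4 * K * \<tau> powr (\<alpha>0 - e0 + \<alpha>1)" .
          qed simp
          finally show "Lp_norm_on (T - h) p1 (\<lambda>s. incr I s (s + h) - f s * incr g s (s + h)) \<le> ennreal (4 * K * \<tau> powr (\<alpha>0 - e0 + \<alpha>1)) * (F * G)" .
        qed simp
        finally show ?thesis .
      qed
    qed
  qed (use K in auto)
  also have "\<dots> = ennreal (quasi_const p1 * (quasi_const q1 * (1 + 4 * K * D))) * (ennreal B + ennreal (T powr (\<alpha>0 - e0)) * F) * G"
    using K D quasi_const_pos[of p1] quasi_const_pos[of q1]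
    by (subst ennreal_mult[of "quasi_const p1"]) (auto simp: distrib_left distrib_right mult.assoc)
  finally show ?thesis .
qed

end

subsection \<open>Representatives and log-like weights\<close>

text \<open>Completeness of Lebesgue measure.\<close>

lemma measurable_lebesgue_on_AE_eq:
  fixes F G :: "real \<Rightarrow> real"
  assumes S: "S \<in> sets borel" and G: "G \<in> borel_measurable borel" and ae: "AE x in lebesgue_on S. F x = G x"
  shows "F \<in> borel_measurable (lebesgue_on S)"
proof -
  have SL: "S \<in> sets lebesgue" using S by simp
  have [measurable]: "S \<in> sets borel" "G \<in> borel_measurable borel" by fact+
  have "(\<lambda>x. if x \<in> S then G x else 0) \<in> borel_measurable borel" by measurable
  then have "(\<lambda>x. if x \<in> S then G x else 0) \<in> borel_measurable lebesgue"
    by (intro measurable_completion) simp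
  moreover have "AE x in lebesgue. (if x \<in> S then G x else 0) = (if x \<in> S then F x else 0)"
    using ae unfolding AE_lebesgue_on_iff[OF S] AE_completion_iff by eventually_elim auto
  ultimately have "(\<lambda>x. if x \<in> S then F x else 0) \<in> borel_measurable lebesgue"
    by (rule borel_measurable_AE)
  then show ?thesis by (simp add: borel_measurable_if[OF SL])
qed

lemma modulus2_cong_AE:
  assumes p: "0 < p" and A': "\<And>h. (\<lambda>r. A' r (r + h)) \<in> borel_measurable borel"
    and ae: "\<And>h. 0 \<le> h \<Longrightarrow> h \<le> T \<Longrightarrow> AE r in lebesgue_on {0..T - h}. A r (r + h) = A' r (r + h)"
  shows "modulus2 T p A \<tau> = modulus2 T p A' \<tau>"
  unfolding modulus2_def
proof (intro SUP_cong refl)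
  fix h assume h: "h \<in> {0..\<tau>}"
  show "Lp_norm_on (T - h) p (\<lambda>r. A r (r + h)) = Lp_norm_on (T - h) p (\<lambda>r. A' r (r + h))"
  proof (cases "h \<le> T")
    case True
    then have ae: "AE r in lebesgue_on {0..T - h}. A r (r + h) = A' r (r + h)" using h by (intro ae) auto
    have "(\<lambda>r. A r (r + h)) \<in> borel_measurable (lebesgue_on {0..T - h})"
      by (rule measurable_lebesgue_on_AE_eq[OF _ A' ae]) simp
    with ae show ?thesis using A'[of h] by (intro Lp_norm_on_cong_AE p) auto
  next
    \<comment> \<open>The interval from 0 to T-h is empty.\<close>
    case False
    then show ?thesis by (intro Lp_norm_on_cong) auto
  qed
qed

lemma modulus_eq_modulus2: "modulus T p f = modulus2 T p (incr f)"
  by (simp add: modulus_def modulus2_def incr_def fun_eq_iff)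

text \<open>Elements of the space are Lebesgue measurable on [0,T] only, while shifts and Fubini
  call for Borel functions on the line. The norms of increments do not notice the change, since a
  fixed shift preserves null sets.\<close>

locale representative =
  fixes T :: real and f f' :: "real \<Rightarrow> real"
  assumes f' [measurable]: "f' \<in> borel_measurable borel" and ae: "AE s in lebesgue_on {0..T}. f s = f' s"
begin

lemma shifted:
  assumes "0 \<le> b" "b \<le> h"
  shows "AE r in lebesgue_on {0..T - h}. f (r + b) = f' (r + b)"
  using AE_lebesgue_on_shift[OF ae, of b "T - h"] assms by auto

lemma modulus_eq: "0 < p \<Longrightarrow> modulus T p f = modulus T p f'"
proof
  fix \<tau> assume p: "0 < p"
  show "modulus T p f \<tau> = modulus T p f' \<tau>"
    unfolding modulus_eq_modulus2
  proof (rule modulus2_cong_AE[OF p])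
    fix h :: real assume h: "0 \<le> h"
    from shifted[of h h] shifted[of 0 h] h
    show "AE r in lebesgue_on {0..T - h}. incr f r (r + h) = incr f' r (r + h)"
      by (auto simp: incr_def elim: eventually_elim2)
  qed (simp add: incr_def)
qed

lemma seminorm_eq: "0 < p \<Longrightarrow> besov_seminorm T \<alpha> p q f = besov_seminorm T \<alpha> p q f'"
  by (simp add: besov_seminorm_def modulus_eq)

lemma norm_eq: "0 < p \<Longrightarrow> Lp_norm_on T p f = Lp_norm_on T p f'"
  using measurable_lebesgue_on_AE_eq[OF _ f' ae] by (intro Lp_norm_on_cong_AE ae) auto

end

lemma exists_borel_representative:
  assumes "f \<in> borel_measurable (lebesgue_on {0..T})"
  obtains f' where "representative T f f'"
proof -
  have S: "{0..T} \<in> sets lebesgue" by simp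
  have "(\<lambda>x. if x \<in> {0..T} then f x else 0) \<in> borel_measurable (completion lborel)"
    using assms borel_measurable_if[OF S, of f] by (simp only:)
  then obtain f' where f': "f' \<in> borel_measurable lborel" "AE x in lborel. (if x \<in> {0..T} then f x else 0) = f' x"
    using completion_ex_borel_measurable_real by blast
  have "AE s in lebesgue_on {0..T}. f s = f' s"
    unfolding AE_lebesgue_on_iff[OF atLeastAtMost_borel] using f'(2) by eventually_elim auto
  with f'(1) have "representative T f f'" by (simp add: representative_def)
  then show thesis by (rule that)
qed

text \<open>The representative is continuous as soon as 1/p < \<alpha>, so one function serves all
  claims. 128 is the 8 of the oscillation bound times the 16 with which the seminorm controls the
  modulus.\<close>

lemma exists_besov_representative:
  assumes T: "0 < T" and f: "f \<in> besov_space T \<alpha> p q" and \<alpha>: "0 < \<alpha>" "\<alpha> < 1"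
    and p: "ennreal (1 / 2) \<le> p" and q: "0 < q"
  obtains f' where "representative T f f'"
    "inverse p < ennreal \<alpha> \<Longrightarrow> 1 \<le> p \<and> enn2real (inverse p) < \<alpha> \<and> continuous_on {0..T} f' \<and>
      (\<forall>x. 0 \<le> x \<longrightarrow> x \<le> T \<longrightarrow> \<bar>f' x - f' 0\<bar> \<le>
        128 / (1 - 2 powr - (\<alpha> - enn2real (inverse p))) * enn2real (besov_seminorm T \<alpha> p q f) * T powr (\<alpha> - enn2real (inverse p)))"
proof -
  have p0: "0 < p" using p by (metis ennreal_less_zero_iff less_le_trans half_gt_zero zero_less_one)
  obtain f0 where "representative T f f0"
    using exists_borel_representative f unfolding besov_space_def by blast
  then interpret r: representative T f f0 .
  show thesis
  proof (cases "inverse p < ennreal \<alpha>")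
    case False
    then show ?thesis using that[of f0] r.representative_axioms by auto
  next
    case True
    define e where "e = enn2real (inverse p)"
    have "inverse p < 1" using True \<alpha> by (metis ennreal_less_one_iff less_trans)
    then have "inverse p \<le> inverse 1" by simp
    then have p1: "1 \<le> p" by (simp only: ennreal_inverse_le_iff)
    have e: "inverse p = ennreal e" "0 \<le> e" using inverse_exponent[OF p1] by (auto simp: e_def)
    have e\<alpha>: "e < \<alpha>" using True e by (simp add: ennreal_less_iff)
    define M where "M = 16 * enn2real (besov_seminorm T \<alpha> p q f)"
    have fin: "besov_seminorm T \<alpha> p q f < top" "Lp_norm_on T p f < top" using f by (auto simp: besov_space_def)
    have mod: "modulus T p f0 \<tau> \<le> ennreal (M * \<tau> powr \<alpha>)" if t: "0 < \<tau>" "\<tau> \<le> T" for \<tau>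
    proof -
      have "modulus T p f0 \<tau> = modulus T p f0 \<tau> / ennreal (\<tau> powr \<alpha>) * ennreal (\<tau> powr \<alpha>)"
        using t by (simp add: divide_powr_cancel)
      also have "\<dots> \<le> (4 * 4 * besov_seminorm T \<alpha> p q f0) * ennreal (\<tau> powr \<alpha>)"
        unfolding besov_seminorm_def using \<alpha> modulus_double[OF p r.f']
        by (intro mult_right_mono weighted_sup_le q t modulus_mono) auto
      also have "4 * 4 * besov_seminorm T \<alpha> p q f0 = ennreal M"
        using fin(1) by (simp add: M_def r.seminorm_eq[OF p0] ennreal_mult)
      finally show ?thesis by (simp add: M_def ennreal_mult)
    qed
    have fin0: "Lp_norm_on T p f0 < top" using fin(2) r.norm_eq[OF p0] by simp
    obtain f' where cv: "continuous_version T f0 f'"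
      and osc: "\<And>x. 0 \<le> x \<Longrightarrow> x \<le> T \<Longrightarrow> \<bar>f' x - f' 0\<bar> \<le> 8 / (1 - 2 powr - (\<alpha> - e)) * M * T powr (\<alpha> - e)"
      using exists_continuous_version[OF p1 T r.f' fin0 _ mod, of "\<alpha> - e"] e\<alpha> by (auto simp: M_def e_def)
    \<comment> \<open>Clamping the argument to [0,T] extends f' continuously, hence as a Borel
      function, to the line.\<close>
    define f'' where "f'' x = f' (max 0 (min T x))" for x
    have same: "f'' x = f' x" if "0 \<le> x" "x \<le> T" for x using that by (simp add: f''_def)
    have "continuous_on {0..T} f'" using cv by (simp add: continuous_version_def)
    then have cont: "continuous_on UNIV f''"
      unfolding f''_def by (rule continuous_on_compose2) (use T in \<open>auto intro!: continuous_intros\<close>)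
    have "representative T f f''"
    proof
      show "f'' \<in> borel_measurable borel" using cont by (rule borel_measurable_continuous_onI)
      have "AE s in lebesgue_on {0..T}. f' s = f0 s" using cv by (simp add: continuous_version_def)
      with r.ae show "AE s in lebesgue_on {0..T}. f s = f'' s"
        unfolding AE_lebesgue_on_iff[OF atLeastAtMost_borel] by eventually_elim (auto simp: same)
    qed
    moreover have "\<bar>f'' x - f'' 0\<bar> \<le> 128 / (1 - 2 powr - (\<alpha> - e)) * enn2real (besov_seminorm T \<alpha> p q f) * T powr (\<alpha> - e)"
      if "0 \<le> x" "x \<le> T" for x
      using osc[OF that] that T by (simp add: same M_def)
    ultimately show ?thesis
      using p1 e\<alpha> continuous_on_subset[OF cont, of "{0..T}"] by (intro that) (auto simp: e_def)
  qed
qed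

locale representatives = f: representative T f f' + g: representative T g g'
  for T f f' g g'
begin

lemma germ_eq:
  assumes p: "0 < p" and [measurable]: "I \<in> borel_measurable borel"
  shows "besov2_norm T \<omega> p q (\<lambda>s t. incr I s t - f s * incr g s t) = besov2_norm T \<omega> p q (\<lambda>s t. incr I s t - f' s * incr g' s t)"
proof -
  have "modulus2 T p (\<lambda>s t. incr I s t - f s * incr g s t) \<tau> = modulus2 T p (\<lambda>s t. incr I s t - f' s * incr g' s t) \<tau>" for \<tau>
  proof (rule modulus2_cong_AE[OF p])
    fix h :: real assume h: "0 \<le> h"
    from f.shifted[of 0 h] g.shifted[of 0 h] g.shifted[of h h] h
    have "AE r in lebesgue_on {0..T - h}. f r = f' r" "AE r in lebesgue_on {0..T - h}. g r = g' r"
      "AE r in lebesgue_on {0..T - h}. g (r + h) = g' (r + h)" by auto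
    then show "AE r in lebesgue_on {0..T - h}. incr I r (r + h) - f r * incr g r (r + h) = incr I r (r + h) - f' r * incr g' r (r + h)"
      by eventually_elim (simp add: incr_def)
  next
    have [measurable]: "f' \<in> borel_measurable borel" "g' \<in> borel_measurable borel" by (rule f.f' g.f')+
    show "(\<lambda>r. incr I r (r + h) - f' r * incr g' r (r + h)) \<in> borel_measurable borel" for h
      unfolding incr_def by measurable
  qed
  then show ?thesis by (simp add: besov2_norm_def)
qed

text \<open>A fixed partition and a fixed step involve finitely many shifts of the base point, so
  the null sets can be united.\<close>

lemma riemann_sum_eq:
  assumes p: "0 < p" and [measurable]: "I \<in> borel_measurable borel" and P: "unit_partition P"
  shows "besov2_norm T \<omega> p q (\<lambda>s t. riemann_sum f g P s t - incr I s t) = besov2_norm T \<omega> p q (\<lambda>s t. riemann_sum f' g' P s t - incr I s t)"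
proof -
  have "modulus2 T p (\<lambda>s t. riemann_sum f g P s t - incr I s t) \<tau> = modulus2 T p (\<lambda>s t. riemann_sum f' g' P s t - incr I s t) \<tau>" for \<tau>
  proof (rule modulus2_cong_AE[OF p])
    fix h :: real assume h: "0 \<le> h"
    have "AE r in lebesgue_on {0..T - h}. \<forall>k\<in>{..<length P}. f (r + P ! k * h) = f' (r + P ! k * h) \<and> g (r + P ! k * h) = g' (r + P ! k * h)"
    proof (intro AE_finite_allI AE_conjI)
      fix k assume "k \<in> {..<length P}"
      then have "P ! k \<in> {0..1}" using unit_partitionD(5)[OF P] nth_mem[of k P] by blast
      then have "0 \<le> P ! k * h" "P ! k * h \<le> h" using h mult_right_mono[of "P ! k" 1 h] by auto
      then show "AE r in lebesgue_on {0..T - h}. f (r + P ! k * h) = f' (r + P ! k * h)"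
        "AE r in lebesgue_on {0..T - h}. g (r + P ! k * h) = g' (r + P ! k * h)"
        by (auto intro: f.shifted g.shifted)
    qed simp
    then show "AE r in lebesgue_on {0..T - h}. riemann_sum f g P r (r + h) - incr I r (r + h) = riemann_sum f' g' P r (r + h) - incr I r (r + h)"
      by eventually_elim (auto simp: riemann_sum_def intro!: sum.cong)
  next
    have [measurable]: "f' \<in> borel_measurable borel" "g' \<in> borel_measurable borel" by (rule f.f' g.f')+
    show "(\<lambda>r. riemann_sum f' g' P r (r + h) - incr I r (r + h)) \<in> borel_measurable borel" for h
      unfolding incr_def by measurable
  qed
  then show ?thesis by (simp add: besov2_norm_def)
qed

lemma riemann_sum_tendsto_eq:
  assumes p: "0 < p" and I: "I \<in> borel_measurable borel"
  shows "((\<lambda>P. besov2_norm T \<omega> p q (\<lambda>s t. riemann_sum f g P s t - incr I s t)) \<longlongrightarrow> c) mesh_to_0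
    \<longleftrightarrow> ((\<lambda>P. besov2_norm T \<omega> p q (\<lambda>s t. riemann_sum f' g' P s t - incr I s t)) \<longlongrightarrow> c) mesh_to_0"
proof (rule tendsto_cong)
  have "eventually unit_partition mesh_to_0"
    unfolding mesh_to_0_def by (auto simp: eventually_inf_principal)
  then show "\<forall>\<^sub>F P in mesh_to_0. besov2_norm T \<omega> p q (\<lambda>s t. riemann_sum f g P s t - incr I s t) = besov2_norm T \<omega> p q (\<lambda>s t. riemann_sum f' g' P s t - incr I s t)"
    by eventually_elim (rule riemann_sum_eq[OF p I])
qed

end

text \<open>Chosen by \<open>SOME\<close> to make it a function of the exponents: the constants must
  be named before T, f and g are given.\<close>

definition powr_const :: "ennreal \<Rightarrow> real \<Rightarrow> real" where
  "powr_const q a = (SOME D. 0 \<le> D \<and> (\<forall>T>0. Lp_qnorm (dlog T) q (\<lambda>\<tau>. ennreal (\<tau> powr a)) \<le> ennreal (D * T powr a)))"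

lemma powr_const:
  assumes "0 < q" "0 < a"
  shows "0 \<le> powr_const q a" "0 < T \<Longrightarrow> Lp_qnorm (dlog T) q (\<lambda>\<tau>. ennreal (\<tau> powr a)) \<le> ennreal (powr_const q a * T powr a)"
  using someI_ex[OF Lp_qnorm_dlog_powr[OF assms]] by (auto simp: powr_const_def)

definition subcritical_norm_const :: "real \<Rightarrow> ennreal \<Rightarrow> real \<Rightarrow> real" where
  "subcritical_norm_const m q \<gamma> = (SOME C. 0 \<le> C \<and> (\<forall>T>0. \<forall>Z. (\<forall>x y. x \<le> y \<longrightarrow> Z x \<le> Z y) \<longrightarrow>
    Lp_qnorm (dlog T) q (\<lambda>\<tau>. enn_powr (\<Sum>n. 2 ^ Suc n * enn_powr (Z (\<tau> / 2 ^ n)) m) (1 / m) / ennreal (\<tau> powr \<gamma>))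
     \<le> ennreal C * Lp_qnorm (dlog T) q (\<lambda>\<tau>. Z \<tau> / ennreal (\<tau> powr \<gamma>))))"

lemmas subcritical_norm_const = someI_ex[OF subcritical_norm_le, folded subcritical_norm_const_def]

definition scales_const :: "ennreal \<Rightarrow> real \<Rightarrow> real \<Rightarrow> real" where
  "scales_const q c a = (SOME C. 0 \<le> C \<and> (\<forall>T>0. \<forall>X. (\<forall>x y. x \<le> y \<longrightarrow> X x \<le> X y) \<longrightarrow>
    Lp_qnorm (dlog T) q (\<lambda>\<tau>. (\<Sum>n. ennreal (c ^ n) * X (\<tau> / 2 ^ n)) / ennreal (\<tau> powr a))
     \<le> ennreal C * Lp_qnorm (dlog T) q (\<lambda>\<tau>. X \<tau> / ennreal (\<tau> powr a))))"

lemmas scales_const = someI_ex[OF dyadic_scales_norm_le, folded scales_const_def]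

context young
begin

lemma integral_in_besov_space:
  assumes I: "is_integral I" "Lp_norm_on T p2 I < top"
    and le: "besov_seminorm T \<alpha>1 p2 q1 I \<le> ennreal C * (Lp_norm_on T p0 f + ennreal (T powr \<alpha>0) * F) * G"
  shows "I \<in> besov_space T \<alpha>1 p2 q1"
proof -
  have "ennreal C * (Lp_norm_on T p0 f + ennreal (T powr \<alpha>0) * F) * G < top"
    using f_Lp FG by (auto simp: ennreal_mult_less_top)
  with le have "besov_seminorm T \<alpha>1 p2 q1 I < top" by (rule le_less_trans)
  then show ?thesis using I by (auto simp: besov_space_def is_integral_def intro: measurable_lebesgue_on_borel)
qed

lemma subcritical_const_nonneg: "1 < \<gamma> * \<rho> \<Longrightarrow> 0 \<le> subcritical_const"
  using powr_less_mono[of "1 - \<gamma> * \<rho>" 0 "2::real"] by (simp add: subcritical_const_def)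

lemma subcritical_result:
  assumes gt: "1 < \<gamma> * \<rho>"
  obtains I where "I \<in> besov_space T \<alpha>1 p2 q1" "is_integral I"
    "\<And>r. 0 < r \<Longrightarrow> 1 / \<gamma> < r \<Longrightarrow> q2 \<le> ennreal r \<Longrightarrow>
      ((\<lambda>P. besov2_norm T (\<lambda>\<tau>. \<tau> powr \<gamma>) p2 (ennreal r) (\<lambda>s t. riemann_sum f g P s t - incr I s t)) \<longlongrightarrow> 0) mesh_to_0"
    "besov2_norm T (\<lambda>\<tau>. \<tau> powr \<gamma>) p2 q2 (\<lambda>s t. incr I s t - f s * incr g s t) \<le> ennreal (subcritical_norm_const \<rho> q2 \<gamma>) * F * G"
    "besov_seminorm T \<alpha>1 p2 q1 I \<le> ennreal (quasi_const p2 * (quasi_const q1 * (1 + subcritical_const * powr_const q1 \<alpha>0))) *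
      (Lp_norm_on T p0 f + ennreal (T powr \<alpha>0) * F) * G"
proof -
  have "U T \<le> ennreal (subcritical_const * T powr \<gamma>) * (F * G)" using U_le_subcritical[OF gt] T by auto
  also have "\<dots> < top" using FG by (simp add: ennreal_mult_less_top)
  finally have fin: "U T < top" .
  obtain I where I: "is_integral I" "Lp_norm_on T p2 I < top" by (rule exists_is_integral[OF fin])
  have sn: "besov_seminorm T \<alpha>1 p2 q1 I \<le> ennreal (quasi_const p2 * (quasi_const q1 * (1 + subcritical_const * powr_const q1 \<alpha>0))) *
      (Lp_norm_on T p0 f + ennreal (T powr \<alpha>0) * F) * G"
    using powr_const[OF q(2) \<alpha>(1)] T
    by (intro integral_seminorm_le I subcritical_const_nonneg gt U_le_subcritical) auto
  show thesis
  proof (rule that[OF integral_in_besov_space[OF I sn] I(1) _ _ sn])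
    show "besov2_norm T (\<lambda>\<tau>. \<tau> powr \<gamma>) p2 q2 (\<lambda>s t. incr I s t - f s * incr g s t) \<le> ennreal (subcritical_norm_const \<rho> q2 \<gamma>) * F * G"
      using subcritical_norm_const[OF \<rho>(1) q2(1) gt] by (intro remainder_subcritical_le I fin) blast
  qed (rule riemann_sum_convergence_subcritical[OF I(1) gt fin])
qed

lemma critical_result:
  assumes crit: "\<gamma> * \<rho> = 1" "q2 \<le> ennreal \<rho>"
  obtains I where "I \<in> besov_space T \<alpha>1 p2 q1" "is_integral I"
    "((\<lambda>P. besov2_norm T (\<lambda>\<tau>. \<tau> powr \<gamma>) p2 \<infinity> (\<lambda>s t. riemann_sum f g P s t - incr I s t)) \<longlongrightarrow> 0) mesh_to_0"
    "\<And>\<tau>. 0 < \<tau> \<Longrightarrow> \<tau> \<le> T \<Longrightarrow> modulus2 T p2 (\<lambda>s t. incr I s t - f s * incr g s t) \<tau> \<le> ennreal (9216 * \<tau> powr \<gamma>) * (F * G)"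
    "besov_seminorm T \<alpha>1 p2 q1 I \<le> ennreal (quasi_const p2 * (quasi_const q1 * (1 + 9216 * powr_const q1 \<alpha>0))) *
      (Lp_norm_on T p0 f + ennreal (T powr \<alpha>0) * F) * G"
proof -
  have "U T \<le> ennreal (9216 * T powr \<gamma>) * (F * G)" using U_le_critical[OF crit] T by auto
  also have "\<dots> < top" using FG by (simp add: ennreal_mult_less_top)
  finally have fin: "U T < top" .
  obtain I where I: "is_integral I" "Lp_norm_on T p2 I < top" by (rule exists_is_integral[OF fin])
  have sn: "besov_seminorm T \<alpha>1 p2 q1 I \<le> ennreal (quasi_const p2 * (quasi_const q1 * (1 + 9216 * powr_const q1 \<alpha>0))) *
      (Lp_norm_on T p0 f + ennreal (T powr \<alpha>0) * F) * G"
    using powr_const[OF q(2) \<alpha>(1)] T by (intro integral_seminorm_le I U_le_critical crit) auto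
  show thesis
  proof (rule that[OF integral_in_besov_space[OF I sn] I(1) _ _ sn])
    fix \<tau> assume t: "0 < \<tau>" "\<tau> \<le> T"
    show "modulus2 T p2 (\<lambda>s t. incr I s t - f s * incr g s t) \<tau> \<le> ennreal (9216 * \<tau> powr \<gamma>) * (F * G)"
      using remainder_modulus2_le[OF I(1) fin t] U_le_critical[OF crit t] by (rule order_trans)
  qed (rule riemann_sum_convergence_critical[OF I(1) crit fin])
qed

end

context young_continuous
begin

text \<open>The supremum of f is at most |f(0)| plus its oscillation over [0,T], which is already a
  multiple of the second term of the bound.\<close>

lemma integral_seminorm_p1_osc_le:
  assumes I: "is_integral I"
    and K: "0 \<le> K" "\<And>\<tau>. 0 < \<tau> \<Longrightarrow> \<tau> \<le> T \<Longrightarrow>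
      (\<Sum>n. ennreal ((2 powr (1 / \<rho>)) ^ n) * Y (\<tau> / 2 ^ n)) \<le> ennreal (K * \<tau> powr \<gamma>) * (F * G)"
    and osc: "\<And>x. 0 \<le> x \<Longrightarrow> x \<le> T \<Longrightarrow> \<bar>f x - f 0\<bar> \<le> c * enn2real F * T powr (\<alpha>0 - e0)" and c: "0 \<le> c"
  shows "besov_seminorm T \<alpha>1 p1 q1 I \<le> ennreal (quasi_const p1 * (quasi_const q1 * (1 + 4 * K * powr_const q1 (\<alpha>0 - e0))) * (1 + c)) *
    (ennreal \<bar>f 0\<bar> + ennreal (T powr (\<alpha>0 - e0)) * F) * G"
proof -
  define B where "B = \<bar>f 0\<bar> + c * enn2real F * T powr (\<alpha>0 - e0)"
  define X where "X = ennreal (T powr (\<alpha>0 - e0)) * F"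
  define Q where "Q = quasi_const p1 * (quasi_const q1 * (1 + 4 * K * powr_const q1 (\<alpha>0 - e0)))"
  have \<beta>: "0 < \<alpha>0 - e0" using e0_bounds by simp
  have Q0: "0 \<le> Q" using quasi_const_pos[of p1] quasi_const_pos[of q1] K powr_const(1)[OF q(2) \<beta>] by (simp add: Q_def)
  have "\<bar>f x\<bar> \<le> B" if "0 \<le> x" "x \<le> T" for x using osc[OF that] by (simp add: B_def)
  then have "besov_seminorm T \<alpha>1 p1 q1 I \<le> ennreal Q * (ennreal B + X) * G"
    unfolding Q_def X_def using powr_const[OF q(2) \<beta>] T by (intro integral_seminorm_p1_le I K) auto
  also have "\<dots> \<le> ennreal Q * (ennreal (1 + c) * (ennreal \<bar>f 0\<bar> + X)) * G"
  proof (intro mult_right_mono mult_left_mono)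
    have "ennreal B = ennreal \<bar>f 0\<bar> + ennreal (c * enn2real F * T powr (\<alpha>0 - e0))"
      unfolding B_def using c by (intro ennreal_plus) auto
    also have "ennreal (c * enn2real F * T powr (\<alpha>0 - e0)) = ennreal c * X"
      using c FG by (simp add: X_def ennreal_mult ac_simps)
    finally have "ennreal B + X = ennreal \<bar>f 0\<bar> + (X + ennreal c * X)"
      by (simp add: ac_simps)
    also have "X + ennreal c * X = ennreal (1 + c) * X"
      using c by (simp add: distrib_right)
    finally have "ennreal B + X = ennreal \<bar>f 0\<bar> + ennreal (1 + c) * X" .
    also have "\<dots> \<le> ennreal (1 + c) * ennreal \<bar>f 0\<bar> + ennreal (1 + c) * X"
      using c mult_right_mono[of 1 "ennreal (1 + c)" "ennreal \<bar>f 0\<bar>"] by (intro add_right_mono) auto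
    finally show "ennreal B + X \<le> ennreal (1 + c) * (ennreal \<bar>f 0\<bar> + X)" by (simp add: distrib_left)
  qed auto
  also have "\<dots> = ennreal (Q * (1 + c)) * (ennreal \<bar>f 0\<bar> + X) * G"
    using Q0 c by (simp add: ennreal_mult mult.assoc)
  finally show ?thesis by (simp add: Q_def X_def)
qed

lemma p1_subcritical:
  assumes I: "is_integral I" and gt: "1 < \<gamma> * \<rho>"
    and osc: "\<And>x. 0 \<le> x \<Longrightarrow> x \<le> T \<Longrightarrow> \<bar>f x - f 0\<bar> \<le> c * enn2real F * T powr (\<alpha>0 - e0)" and c: "0 \<le> c"
  shows "besov_seminorm T \<alpha>1 p1 q1 I \<le> ennreal (quasi_const p1 * (quasi_const q1 *
      (1 + 4 * (256 * e_const / (1 - 2 powr (1 / \<rho>) * 2 powr - \<gamma>)) * powr_const q1 (\<alpha>0 - e0))) * (1 + c)) *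
    (ennreal \<bar>f 0\<bar> + ennreal (T powr (\<alpha>0 - e0)) * F) * G"
proof (rule integral_seminorm_p1_osc_le[OF I _ level_sum_subcritical[OF gt] osc c])
  have "2 powr (e0 - \<alpha>0) < 2 powr (0::real)" using e0_bounds by (intro powr_less_mono) auto
  then have 1: "2 powr e0 * 2 powr - \<alpha>0 < (1::real)" by (simp add: powr_add[symmetric])
  have "1 / \<rho> - \<gamma> < 0" using gt \<rho> by (simp add: field_simps)
  then have "2 powr (1 / \<rho> - \<gamma>) < 2 powr (0::real)" by (intro powr_less_mono) auto
  then have 2: "2 powr (1 / \<rho>) * 2 powr - \<gamma> < (1::real)" by (simp add: powr_add[symmetric])
  show "0 \<le> 256 * e_const / (1 - 2 powr (1 / \<rho>) * 2 powr - \<gamma>)" using 1 2 by (simp add: e_const_def)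
qed

lemma p1_critical:
  assumes I: "is_integral I" and crit: "\<gamma> = 1" "\<rho> = 1" "q2 \<le> 1"
    and osc: "\<And>x. 0 \<le> x \<Longrightarrow> x \<le> T \<Longrightarrow> \<bar>f x - f 0\<bar> \<le> c * enn2real F * T powr (\<alpha>0 - e0)" and c: "0 \<le> c"
  shows "besov_seminorm T \<alpha>1 p1 q1 I \<le> ennreal (quasi_const p1 * (quasi_const q1 *
      (1 + 4 * (768 * scales_const q0 (2 powr e0) \<alpha>0) * powr_const q1 (\<alpha>0 - e0))) * (1 + c)) *
    (ennreal \<bar>f 0\<bar> + ennreal (T powr (\<alpha>0 - e0)) * F) * G"
proof -
  have "2 powr e0 < 2 powr \<alpha>0" using e0_bounds by (intro powr_less_mono) auto
  note sc = scales_const[OF q(1) _ this, simplified]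
  show ?thesis
  proof (rule integral_seminorm_p1_osc_le[OF I _ _ osc c])
    show "0 \<le> 768 * scales_const q0 (2 powr e0) \<alpha>0" using sc by simp
    show "(\<Sum>n. ennreal ((2 powr (1 / \<rho>)) ^ n) * Y (\<tau> / 2 ^ n)) \<le> ennreal (768 * scales_const q0 (2 powr e0) \<alpha>0 * \<tau> powr \<gamma>) * (F * G)"
      if "0 < \<tau>" "\<tau> \<le> T" for \<tau>
      using sc by (intro level_sum_critical crit that) auto
  qed
qed

end

text \<open>Extended by 0 to the left and by \<open>top\<close> beyond T, 1/L is monotone on the
  whole line and therefore Borel. The integrability in \<open>log_like\<close> then says that its
  norm is finite.\<close>

lemma log_like_norm:
  assumes L: "log_like T L" and r: "0 < r"
  defines "V \<equiv> \<lambda>h. if h \<le> 0 then 0 else if h \<le> T then ennreal (1 / L r h) else top"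
  shows "V \<in> borel_measurable borel" "Lp_qnorm (dlog T) r V < top"
proof -
  have pos: "0 < L r h" if "0 < h" "h \<le> T" for h using L r that by (auto simp: log_like_def)
  have anti: "L r y \<le> L r x" if "0 < x" "x \<le> y" "y \<le> T" for x y
    using L r that unfolding log_like_def monotone_on_def by auto
  show V [measurable]: "V \<in> borel_measurable borel"
  proof (rule borel_measurable_mono_ennreal)
    fix x y :: real assume "x \<le> y"
    then show "V x \<le> V y" using anti[of x y] pos[of y] pos[of x]
      by (auto simp: V_def intro!: ennreal_leI divide_left_mono)
  qed
  show "Lp_qnorm (dlog T) r V < top"
    using r
  proof (cases rule: ennreal_exponent_cases)
    case (fin s)
    have "(\<integral>\<^sup>+h. ennreal (L r h powr - enn2real r) \<partial>dlog T) < \<infinity>"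
      using L[unfolded log_like_def, rule_format, OF r] fin by simp
    then have "(\<integral>\<^sup>+h. ennreal (L r h powr - s) \<partial>dlog T) < top"
      using fin by simp
    moreover have "(\<integral>\<^sup>+h. enn_powr (V h) s \<partial>dlog T) = (\<integral>\<^sup>+h. ennreal (L r h powr - s) \<partial>dlog T)"
      using pos by (intro nn_integral_cong) (auto simp: V_def enn_powr_ennreal less_imp_le powr_divide powr_minus_divide)
    ultimately show ?thesis using fin by (simp add: Lp_qnorm_ennreal)
  next
    case top
    have "bdd_above ((\<lambda>h. 1 / L r h) ` {0<..T})"
      using L r top unfolding log_like_def by auto
    then obtain M where M: "\<And>h. 0 < h \<Longrightarrow> h \<le> T \<Longrightarrow> 1 / L r h \<le> M" unfolding bdd_above_def by (metis greaterThanAtMost_iff imageI)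
    have "esssup (dlog T) V \<le> ennreal M"
    proof (intro esssup_I AE_I2)
      show "V \<in> borel_measurable (dlog T)" by measurable
    qed (use M in \<open>auto simp: V_def intro!: ennreal_leI\<close>)
    then have "esssup (dlog T) V < top" by (rule le_less_trans) simp
    then show ?thesis using top by (simp add: Lp_qnorm_top)
  qed
qed

definition log_const :: "real \<Rightarrow> (ennreal \<Rightarrow> real \<Rightarrow> real) \<Rightarrow> ennreal \<Rightarrow> real" where
  "log_const T L r = enn2real (Lp_qnorm (dlog T) r (\<lambda>h. if h \<le> 0 then 0 else if h \<le> T then ennreal (1 / L r h) else top))"

text \<open>A bound of the modulus by \<tau>^\<gamma> at every scale leaves only the norm of 1/L, so
  all admissible r follow from one uniform estimate.\<close>

lemma besov2_norm_log_like_le: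
  assumes L: "log_like T L" and r: "0 < r" and H: "H < top" and K: "0 \<le> K"
    and le: "\<And>\<tau>. 0 < \<tau> \<Longrightarrow> \<tau> \<le> T \<Longrightarrow> modulus2 T p A \<tau> \<le> ennreal (K * \<tau> powr \<gamma>) * H"
  shows "besov2_norm T (\<lambda>h. h powr \<gamma> * L r h) p r A \<le> ennreal (K * log_const T L r) * H"
proof -
  define V where "V = (\<lambda>h. if h \<le> 0 then 0 else if h \<le> T then ennreal (1 / L r h) else top)"
  have V [measurable]: "V \<in> borel_measurable borel" "Lp_qnorm (dlog T) r V < top"
    using log_like_norm[OF L r] by (auto simp: V_def)
  have pos: "0 < L r h" if "0 < h" "h \<le> T" for h using L r that by (auto simp: log_like_def)
  have [measurable]: "modulus2 T p A \<in> borel_measurable borel" by (rule borel_measurable_mono_ennreal[OF modulus2_mono])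
  have "besov2_norm T (\<lambda>h. h powr \<gamma> * L r h) p r A = Lp_qnorm (dlog T) r (\<lambda>\<tau>. modulus2 T p A \<tau> / ennreal (\<tau> powr \<gamma>) * V \<tau>)"
    unfolding besov2_norm_def
  proof (intro Lp_qnorm_cong)
    fix \<tau> assume "\<tau> \<in> space (dlog T)"
    then have t: "0 < \<tau>" "\<tau> \<le> T" by auto
    have "inverse (ennreal (\<tau> powr \<gamma> * L r \<tau>)) = inverse (ennreal (\<tau> powr \<gamma>)) * V \<tau>"
      using t pos[OF t] by (simp add: V_def inverse_ennreal ennreal_mult ennreal_inverse_mult inverse_eq_divide)
    then show "modulus2 T p A \<tau> / ennreal (\<tau> powr \<gamma> * L r \<tau>) = modulus2 T p A \<tau> / ennreal (\<tau> powr \<gamma>) * V \<tau>"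
      by (simp add: divide_ennreal_def mult.assoc)
  qed
  also have "\<dots> \<le> Lp_qnorm (dlog T) r (\<lambda>\<tau>. ennreal K * H * V \<tau>)"
  proof (intro Lp_qnorm_mono r)
    fix \<tau> assume "\<tau> \<in> space (dlog T)"
    then have t: "0 < \<tau>" "\<tau> \<le> T" by auto
    have "modulus2 T p A \<tau> / ennreal (\<tau> powr \<gamma>) \<le> ennreal (K * \<tau> powr \<gamma>) * H / ennreal (\<tau> powr \<gamma>)"
      by (intro divide_right_mono_ennreal le t)
    also have "\<dots> = ennreal K * H * ennreal (\<tau> powr \<gamma>) / ennreal (\<tau> powr \<gamma>)"
      using K by (simp add: ennreal_mult ac_simps)
    also have "\<dots> = ennreal K * H" using t by (intro mult_divide_eq_ennreal) auto
    finally show "modulus2 T p A \<tau> / ennreal (\<tau> powr \<gamma>) * V \<tau> \<le> ennreal K * H * V \<tau>"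
      by (rule mult_right_mono) simp
  qed measurable
  also have "\<dots> = ennreal K * H * Lp_qnorm (dlog T) r V"
    using H by (intro Lp_qnorm_cmult r) (auto simp: ennreal_mult_less_top)
  also have "Lp_qnorm (dlog T) r V = ennreal (log_const T L r)"
    using V(2) by (simp add: log_const_def V_def)
  finally show ?thesis using K by (simp add: ennreal_mult log_const_def ac_simps)
qed

subsection \<open>The subcritical and the critical regime\<close>

lemma inverse_less_ennreal_D: "inverse p < ennreal a \<Longrightarrow> enn2real (inverse p) < a"
  by (cases "inverse p") (auto simp: ennreal_less_iff)

locale besov_pair =
  fixes T \<alpha>0 \<alpha>1 :: real and p0 p1 p2 q0 q1 q2 :: ennreal and f g :: "real \<Rightarrow> real"
  assumes T: "0 < T" and \<alpha>: "\<alpha>0 \<in> {0<..<1}" "\<alpha>1 \<in> {0<..<1}"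
    and p: "0 < p0" "0 < p1" "inverse p2 = inverse p0 + inverse p1"
    and q: "0 < q0" "0 < q1" "inverse q2 = inverse q0 + inverse q1"
    and f: "f \<in> besov_space T \<alpha>0 p0 q0" and g: "g \<in> besov_space T \<alpha>1 p1 q1"
    and gamma_ge: "max 1 (inverse p2) \<le> ennreal (\<alpha>0 + \<alpha>1)"
begin

lemma p2: "0 < p2" "p2 \<le> p0" "p2 \<le> p1" by (rule exponent_sum_pos[OF p])+
lemma q2: "0 < q2" "q2 \<le> q0" "q2 \<le> q1" by (rule exponent_sum_pos[OF q])+

lemma gamma_ge': "1 / enn2real (min 1 p2) \<le> \<alpha>0 + \<alpha>1"
  using gamma_ge \<alpha> by (simp add: max_inverse_exponent(1)[OF p2(1)] del: ennreal_plus)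

lemma exists_young:
  obtains f' g' where "representatives T f f' g g'" "young T \<alpha>0 \<alpha>1 p0 p1 p2 q0 q1 q2 f' g'"
    "inverse p0 < ennreal \<alpha>0 \<Longrightarrow> inverse p1 < ennreal \<alpha>1 \<Longrightarrow>
      young_continuous T \<alpha>0 \<alpha>1 p0 p1 p2 q0 q1 q2 f' g' \<and> continuous_version T f f' \<and>
      (\<forall>x. 0 \<le> x \<longrightarrow> x \<le> T \<longrightarrow> \<bar>f' x - f' 0\<bar> \<le>
        128 / (1 - 2 powr - (\<alpha>0 - enn2real (inverse p0))) * enn2real (besov_seminorm T \<alpha>0 p0 q0 f) * T powr (\<alpha>0 - enn2real (inverse p0)))"
proof -
  \<comment> \<open>Both indices are below 1, so 1/p2 \<le> 2 and each exponent is at least 1/2, as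
    doubling requires.\<close>
  have "inverse p2 \<le> ennreal (\<alpha>0 + \<alpha>1)" using gamma_ge by simp
  also have "\<dots> \<le> ennreal 2" using \<alpha> by (intro ennreal_leI) auto
  finally have "inverse p2 \<le> ennreal 2" .
  then have "inverse p2 \<le> inverse (ennreal (1 / 2))" by (simp add: inverse_ennreal)
  then have "ennreal (1 / 2) \<le> p2" by (simp only: ennreal_inverse_le_iff)
  then have p_ge: "ennreal (1 / 2) \<le> p0" "ennreal (1 / 2) \<le> p1" using p2(2,3) order_trans by blast+
  obtain f' where f': "representative T f f'"
    "inverse p0 < ennreal \<alpha>0 \<Longrightarrow> 1 \<le> p0 \<and> enn2real (inverse p0) < \<alpha>0 \<and> continuous_on {0..T} f' \<and>
      (\<forall>x. 0 \<le> x \<longrightarrow> x \<le> T \<longrightarrow> \<bar>f' x - f' 0\<bar> \<le>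
        128 / (1 - 2 powr - (\<alpha>0 - enn2real (inverse p0))) * enn2real (besov_seminorm T \<alpha>0 p0 q0 f) * T powr (\<alpha>0 - enn2real (inverse p0)))"
    using exists_besov_representative[OF T f _ _ p_ge(1) q(1)] \<alpha> by auto
  obtain g' where g': "representative T g g'" "inverse p1 < ennreal \<alpha>1 \<Longrightarrow> 1 \<le> p1"
    using exists_besov_representative[OF T g _ _ p_ge(2) q(2)] \<alpha> by auto
  interpret r: representatives T f f' g g' using f'(1) g'(1) by (rule representatives.intro)
  have y: "young T \<alpha>0 \<alpha>1 p0 p1 p2 q0 q1 q2 f' g'"
    using T \<alpha> p q f g gamma_ge' r.f.f' r.g.f'
    by unfold_locales (auto simp: besov_space_def r.f.norm_eq r.f.seminorm_eq r.g.seminorm_eq)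
  moreover have "continuous_version T f f'" if "continuous_on {0..T} f'"
    using that r.f.ae unfolding continuous_version_def by (auto elim: eventually_mono)
  ultimately show thesis
    using f'(2) g'(2) r.representatives_axioms
    by (intro that[of f' g']) (auto simp: young_continuous_def young_continuous_axioms_def)
qed

end

text \<open>The sum 1 + c for the oscillation constant c of the continuous representative.\<close>

definition "osc_const \<alpha> p = 1 + 128 / (1 - 2 powr - (\<alpha> - enn2real (inverse p)))"

definition "subcritical_const_p2 \<alpha>0 \<alpha>1 p2 q1 =
  quasi_const p2 * (quasi_const q1 * (1 + young.subcritical_const \<alpha>0 \<alpha>1 p2 * powr_const q1 \<alpha>0))"

definition "subcritical_const_p1 \<alpha>0 \<alpha>1 p0 p1 p2 q1 =
  quasi_const p1 * (quasi_const q1 * (1 + 4 * (256 * young_continuous.e_const \<alpha>0 p0 /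
    (1 - 2 powr (1 / young.\<rho> p2) * 2 powr - young.\<gamma> \<alpha>0 \<alpha>1)) * powr_const q1 (\<alpha>0 - young_continuous.e0 p0))) * osc_const \<alpha>0 p0"

definition "critical_const_p2 \<alpha>0 p2 q1 = quasi_const p2 * (quasi_const q1 * (1 + 9216 * powr_const q1 \<alpha>0))"

definition "critical_const_p1 \<alpha>0 p0 p1 q0 q1 =
  quasi_const p1 * (quasi_const q1 * (1 + 4 * (768 * scales_const q0 (2 powr young_continuous.e0 p0) \<alpha>0) *
    powr_const q1 (\<alpha>0 - young_continuous.e0 p0))) * osc_const \<alpha>0 p0"

context besov_pair
begin

lemma osc_const_minus_1: "inverse p0 < ennreal \<alpha>0 \<Longrightarrow> 0 \<le> osc_const \<alpha>0 p0 - 1"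
proof -
  assume *: "inverse p0 < ennreal \<alpha>0"
  then have "enn2real (inverse p0) < \<alpha>0" by (rule inverse_less_ennreal_D)
  then have "2 powr - (\<alpha>0 - enn2real (inverse p0)) < 2 powr (0::real)" by (intro powr_less_mono) auto
  then show ?thesis by (simp add: osc_const_def)
qed

lemma subcritical:
  assumes gt: "max 1 (inverse p2) < ennreal (\<alpha>0 + \<alpha>1)"
  shows "\<exists>I \<in> besov_space T \<alpha>1 p2 q1.
    (\<forall>r::real. r > 0 \<and> r > 1 / (\<alpha>0 + \<alpha>1) \<and> ennreal r \<ge> q2 \<longrightarrow>
      ((\<lambda>P. besov2_norm T (\<lambda>\<tau>. \<tau> powr (\<alpha>0 + \<alpha>1)) p2 (ennreal r)
        (\<lambda>s t. riemann_sum f g P s t - incr I s t)) \<longlongrightarrow> 0) mesh_to_0) \<and>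
    besov2_norm T (\<lambda>\<tau>. \<tau> powr (\<alpha>0 + \<alpha>1)) p2 q2 (\<lambda>s t. incr I s t - f s * incr g s t)
      \<le> ennreal (subcritical_norm_const (enn2real (min 1 p2)) q2 (\<alpha>0 + \<alpha>1)) *
        besov_seminorm T \<alpha>0 p0 q0 f * besov_seminorm T \<alpha>1 p1 q1 g \<and>
    besov_seminorm T \<alpha>1 p2 q1 I
      \<le> ennreal (subcritical_const_p2 \<alpha>0 \<alpha>1 p2 q1) *
        (Lp_norm_on T p0 f + ennreal (T powr \<alpha>0) * besov_seminorm T \<alpha>0 p0 q0 f) * besov_seminorm T \<alpha>1 p1 q1 g \<and>
    (ennreal \<alpha>0 > inverse p0 \<and> ennreal \<alpha>1 > inverse p1 \<longrightarrow>
      (\<exists>f'. continuous_version T f f' \<and>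
        besov_seminorm T \<alpha>1 p1 q1 I
          \<le> ennreal (subcritical_const_p1 \<alpha>0 \<alpha>1 p0 p1 p2 q1) *
            (ennreal \<bar>f' 0\<bar> + ennreal (T powr (\<alpha>0 - enn2real (inverse p0))) * besov_seminorm T \<alpha>0 p0 q0 f) *
            besov_seminorm T \<alpha>1 p1 q1 g))"
proof -
  obtain f' g' where r: "representatives T f f' g g'" and y: "young T \<alpha>0 \<alpha>1 p0 p1 p2 q0 q1 q2 f' g'"
    and cont: "inverse p0 < ennreal \<alpha>0 \<Longrightarrow> inverse p1 < ennreal \<alpha>1 \<Longrightarrow>
      young_continuous T \<alpha>0 \<alpha>1 p0 p1 p2 q0 q1 q2 f' g' \<and> continuous_version T f f' \<and>
      (\<forall>x. 0 \<le> x \<longrightarrow> x \<le> T \<longrightarrow> \<bar>f' x - f' 0\<bar> \<le>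
        128 / (1 - 2 powr - (\<alpha>0 - enn2real (inverse p0))) * enn2real (besov_seminorm T \<alpha>0 p0 q0 f) * T powr (\<alpha>0 - enn2real (inverse p0)))"
    by (rule exists_young) blast
  interpret r: representatives T f f' g g' by (rule r)
  interpret y: young T \<alpha>0 \<alpha>1 p0 p1 p2 q0 q1 q2 f' g' by (rule y)
  have F: "y.F = besov_seminorm T \<alpha>0 p0 q0 f" and G: "y.G = besov_seminorm T \<alpha>1 p1 q1 g"
    and N: "Lp_norm_on T p0 f' = Lp_norm_on T p0 f"
    using p by (simp_all add: y.F_def y.G_def r.f.seminorm_eq r.g.seminorm_eq r.f.norm_eq)
  have "1 / y.\<rho> < \<alpha>0 + \<alpha>1"
    using gt \<alpha> y.\<rho>(1) by (simp add: max_inverse_exponent(1)[OF p2(1)] y.\<rho>_def ennreal_less_iff)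
  then have gt': "1 < y.\<gamma> * y.\<rho>" using y.\<rho>(1) by (simp add: y.\<gamma>_def field_simps)
  obtain I where I: "I \<in> besov_space T \<alpha>1 p2 q1" "y.is_integral I"
    and conv: "\<And>r. 0 < r \<Longrightarrow> 1 / y.\<gamma> < r \<Longrightarrow> q2 \<le> ennreal r \<Longrightarrow>
      ((\<lambda>P. besov2_norm T (\<lambda>\<tau>. \<tau> powr y.\<gamma>) p2 (ennreal r) (\<lambda>s t. riemann_sum f' g' P s t - incr I s t)) \<longlongrightarrow> 0) mesh_to_0"
    and rem: "besov2_norm T (\<lambda>\<tau>. \<tau> powr y.\<gamma>) p2 q2 (\<lambda>s t. incr I s t - f' s * incr g' s t)
      \<le> ennreal (subcritical_norm_const y.\<rho> q2 y.\<gamma>) * y.F * y.G"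
    and semi: "besov_seminorm T \<alpha>1 p2 q1 I \<le> ennreal (quasi_const p2 * (quasi_const q1 * (1 + y.subcritical_const * powr_const q1 \<alpha>0))) *
      (Lp_norm_on T p0 f' + ennreal (T powr \<alpha>0) * y.F) * y.G"
    by (rule y.subcritical_result[OF gt']) blast
  have Ib: "I \<in> borel_measurable borel" using I(2) by (simp add: y.is_integral_def)
  show ?thesis
  proof (intro bexI[OF _ I(1)] conjI allI impI)
    fix r :: real assume "0 < r \<and> 1 / (\<alpha>0 + \<alpha>1) < r \<and> q2 \<le> ennreal r"
    then show "((\<lambda>P. besov2_norm T (\<lambda>\<tau>. \<tau> powr (\<alpha>0 + \<alpha>1)) p2 (ennreal r)
        (\<lambda>s t. riemann_sum f g P s t - incr I s t)) \<longlongrightarrow> 0) mesh_to_0"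
      using conv[of r] by (simp add: r.riemann_sum_tendsto_eq[OF p2(1) Ib] y.\<gamma>_def)
  next
    assume "inverse p0 < ennreal \<alpha>0 \<and> inverse p1 < ennreal \<alpha>1"
    then have small: "inverse p0 < ennreal \<alpha>0" "inverse p1 < ennreal \<alpha>1" by auto
    note c = cont[OF small]
    interpret c: young_continuous T \<alpha>0 \<alpha>1 p0 p1 p2 q0 q1 q2 f' g' using c by blast
    have "besov_seminorm T \<alpha>1 p1 q1 I \<le> ennreal (subcritical_const_p1 \<alpha>0 \<alpha>1 p0 p1 p2 q1) *
        (ennreal \<bar>f' 0\<bar> + ennreal (T powr (\<alpha>0 - c.e0)) * y.F) * y.G"
      using c.p1_subcritical[OF I(2) gt' _ osc_const_minus_1[OF small(1)]] c
      by (simp add: subcritical_const_p1_def F c.e0_def osc_const_def)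
    then show "\<exists>f'. continuous_version T f f' \<and>
        besov_seminorm T \<alpha>1 p1 q1 I
          \<le> ennreal (subcritical_const_p1 \<alpha>0 \<alpha>1 p0 p1 p2 q1) *
            (ennreal \<bar>f' 0\<bar> + ennreal (T powr (\<alpha>0 - enn2real (inverse p0))) * besov_seminorm T \<alpha>0 p0 q0 f) *
            besov_seminorm T \<alpha>1 p1 q1 g"
      using c by (auto simp: F G c.e0_def)
  qed (use rem semi in \<open>simp_all add: F G N y.\<gamma>_def y.\<rho>_def r.germ_eq[OF p2(1) Ib] subcritical_const_p2_def\<close>)
qed

lemma critical:
  assumes eq: "ennreal (\<alpha>0 + \<alpha>1) = max 1 (inverse p2)" and le: "max 1 (inverse p2) \<le> inverse q2" and L: "log_like T L"
  shows "\<exists>I \<in> besov_space T \<alpha>1 p2 q1.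
    ((\<lambda>P. besov2_norm T (\<lambda>\<tau>. \<tau> powr max 1 (enn2real (inverse p2))) p2 \<infinity>
            (\<lambda>s t. riemann_sum f g P s t - incr I s t)) \<longlongrightarrow> 0) mesh_to_0 \<and>
    (\<forall>r. q2 \<le> r \<longrightarrow>
      besov2_norm T (\<lambda>h. h powr max 1 (enn2real (inverse p2)) * L r h) p2 r
          (\<lambda>s t. incr I s t - f s * incr g s t)
        \<le> ennreal (9216 * log_const T L r) * besov_seminorm T \<alpha>0 p0 q0 f * besov_seminorm T \<alpha>1 p1 q1 g) \<and>
    besov_seminorm T \<alpha>1 p2 q1 I
      \<le> ennreal (critical_const_p2 \<alpha>0 p2 q1 * max 1 (1 / L q2 T)) *
        (Lp_norm_on T p0 f + ennreal (T powr \<alpha>0 * L q2 T) * besov_seminorm T \<alpha>0 p0 q0 f) * besov_seminorm T \<alpha>1 p1 q1 g \<and>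
    (ennreal \<alpha>0 > inverse p0 \<and> ennreal \<alpha>1 > inverse p1 \<longrightarrow>
      \<alpha>0 + \<alpha>1 = 1 \<and>
      (\<exists>f'. continuous_version T f f' \<and>
        besov_seminorm T \<alpha>1 p1 q1 I
          \<le> ennreal (critical_const_p1 \<alpha>0 p0 p1 q0 q1) *
            (ennreal \<bar>f' 0\<bar> + ennreal (T powr (\<alpha>0 - enn2real (inverse p0)) * (1 + L q2 T)) * besov_seminorm T \<alpha>0 p0 q0 f) *
            besov_seminorm T \<alpha>1 p1 q1 g))"
proof -
  obtain f' g' where r: "representatives T f f' g g'" and y: "young T \<alpha>0 \<alpha>1 p0 p1 p2 q0 q1 q2 f' g'"
    and cont: "inverse p0 < ennreal \<alpha>0 \<Longrightarrow> inverse p1 < ennreal \<alpha>1 \<Longrightarrow>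
      young_continuous T \<alpha>0 \<alpha>1 p0 p1 p2 q0 q1 q2 f' g' \<and> continuous_version T f f' \<and>
      (\<forall>x. 0 \<le> x \<longrightarrow> x \<le> T \<longrightarrow> \<bar>f' x - f' 0\<bar> \<le>
        128 / (1 - 2 powr - (\<alpha>0 - enn2real (inverse p0))) * enn2real (besov_seminorm T \<alpha>0 p0 q0 f) * T powr (\<alpha>0 - enn2real (inverse p0)))"
    by (rule exists_young) blast
  interpret r: representatives T f f' g g' by (rule r)
  interpret y: young T \<alpha>0 \<alpha>1 p0 p1 p2 q0 q1 q2 f' g' by (rule y)
  have F: "y.F = besov_seminorm T \<alpha>0 p0 q0 f" and G: "y.G = besov_seminorm T \<alpha>1 p1 q1 g"
    and N: "Lp_norm_on T p0 f' = Lp_norm_on T p0 f"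
    using p by (simp_all add: y.F_def y.G_def r.f.seminorm_eq r.g.seminorm_eq r.f.norm_eq)
  have \<gamma>\<rho>: "y.\<gamma> = 1 / y.\<rho>"
  proof -
    have "ennreal y.\<gamma> = ennreal (1 / y.\<rho>)" using eq by (simp add: max_inverse_exponent(1)[OF p2(1)] y.\<rho>_def y.\<gamma>_def)
    then show ?thesis using y.\<gamma>(1) y.\<rho>(1) by (simp add: ennreal_inj)
  qed
  then have crit1: "y.\<gamma> * y.\<rho> = 1" using y.\<rho>(1) by simp
  have \<gamma>_max: "max 1 (enn2real (inverse p2)) = y.\<gamma>" by (simp add: \<gamma>\<rho> max_inverse_exponent(2)[OF p2(1)] y.\<rho>_def)
  have crit2: "q2 \<le> ennreal y.\<rho>"
  proof -
    have "inverse (ennreal y.\<rho>) \<le> inverse q2"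
      using le y.\<rho>(1) by (simp add: max_inverse_exponent(1)[OF p2(1)] y.\<rho>_def[symmetric] inverse_ennreal inverse_eq_divide)
    then show ?thesis by (simp only: ennreal_inverse_le_iff)
  qed
  have L0: "0 < L q2 T" using L q2(1) T by (auto simp: log_like_def)
  obtain I where I: "I \<in> besov_space T \<alpha>1 p2 q1" "y.is_integral I"
    and conv: "((\<lambda>P. besov2_norm T (\<lambda>\<tau>. \<tau> powr y.\<gamma>) p2 \<infinity> (\<lambda>s t. riemann_sum f' g' P s t - incr I s t)) \<longlongrightarrow> 0) mesh_to_0"
    and rem: "\<And>\<tau>. 0 < \<tau> \<Longrightarrow> \<tau> \<le> T \<Longrightarrow> modulus2 T p2 (\<lambda>s t. incr I s t - f' s * incr g' s t) \<tau> \<le> ennreal (9216 * \<tau> powr y.\<gamma>) * (y.F * y.G)"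
    and semi: "besov_seminorm T \<alpha>1 p2 q1 I \<le> ennreal (quasi_const p2 * (quasi_const q1 * (1 + 9216 * powr_const q1 \<alpha>0))) *
      (Lp_norm_on T p0 f' + ennreal (T powr \<alpha>0) * y.F) * y.G"
    by (rule y.critical_result[OF crit1 crit2]) blast
  have Ib: "I \<in> borel_measurable borel" using I(2) by (simp add: y.is_integral_def)
  have FG: "y.F * y.G < top" using y.FG by (simp add: ennreal_mult_less_top)
  show ?thesis
  proof (intro bexI[OF _ I(1)] conjI allI impI)
    show "((\<lambda>P. besov2_norm T (\<lambda>\<tau>. \<tau> powr max 1 (enn2real (inverse p2))) p2 \<infinity>
            (\<lambda>s t. riemann_sum f g P s t - incr I s t)) \<longlongrightarrow> 0) mesh_to_0"
      unfolding \<gamma>_max r.riemann_sum_tendsto_eq[OF p2(1) Ib] by (rule conv)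
  next
    fix r assume "q2 \<le> r"
    then have "0 < r" using q2(1) by (rule less_le_trans[rotated])
    from besov2_norm_log_like_le[OF L this FG _ rem]
    show "besov2_norm T (\<lambda>h. h powr max 1 (enn2real (inverse p2)) * L r h) p2 r (\<lambda>s t. incr I s t - f s * incr g s t)
        \<le> ennreal (9216 * log_const T L r) * besov_seminorm T \<alpha>0 p0 q0 f * besov_seminorm T \<alpha>1 p1 q1 g"
      by (simp add: \<gamma>_max r.germ_eq[OF p2(1) Ib] F G mult.assoc)
  next
    \<comment> \<open>\<open>L q2 T\<close> may be less than 1. This factor, permitted since the
      constants may depend on \<open>L\<close>, compensates for it.\<close>
    define m where "m = max 1 (1 / L q2 T)"
    have m: "1 \<le> m" "1 \<le> m * L q2 T" using L0 by (auto simp: m_def max_def field_simps)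
    have C: "0 \<le> critical_const_p2 \<alpha>0 p2 q1"
      using quasi_const_pos[of p2] quasi_const_pos[of q1] powr_const(1)[OF q(2), of \<alpha>0] \<alpha> by (simp add: critical_const_p2_def)
    have "Lp_norm_on T p0 f + ennreal (T powr \<alpha>0) * y.F \<le> ennreal m * Lp_norm_on T p0 f + ennreal m * (ennreal (T powr \<alpha>0 * L q2 T) * y.F)"
    proof (intro add_mono)
      show "Lp_norm_on T p0 f \<le> ennreal m * Lp_norm_on T p0 f"
        using m mult_right_mono[of 1 "ennreal m" "Lp_norm_on T p0 f"] by simp
      have "ennreal (T powr \<alpha>0) * y.F \<le> ennreal (m * (T powr \<alpha>0 * L q2 T)) * y.F"
        using m mult_left_mono[OF m(2), of "T powr \<alpha>0"] by (intro mult_right_mono ennreal_leI) (auto simp: ac_simps)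
      also have "\<dots> = ennreal m * (ennreal (T powr \<alpha>0 * L q2 T) * y.F)"
        using m L0 by (simp add: ennreal_mult mult.assoc)
      finally show "ennreal (T powr \<alpha>0) * y.F \<le> ennreal m * (ennreal (T powr \<alpha>0 * L q2 T) * y.F)" .
    qed
    also have "\<dots> = ennreal m * (Lp_norm_on T p0 f + ennreal (T powr \<alpha>0 * L q2 T) * y.F)" by (simp add: distrib_left)
    finally have "ennreal (critical_const_p2 \<alpha>0 p2 q1) * (Lp_norm_on T p0 f + ennreal (T powr \<alpha>0) * y.F) * y.G
      \<le> ennreal (critical_const_p2 \<alpha>0 p2 q1) * (ennreal m * (Lp_norm_on T p0 f + ennreal (T powr \<alpha>0 * L q2 T) * y.F)) * y.G"
      by (intro mult_right_mono mult_left_mono) auto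
    with semi have "besov_seminorm T \<alpha>1 p2 q1 I \<le> \<dots>" by (simp add: critical_const_p2_def N)
    then show "besov_seminorm T \<alpha>1 p2 q1 I
      \<le> ennreal (critical_const_p2 \<alpha>0 p2 q1 * max 1 (1 / L q2 T)) *
        (Lp_norm_on T p0 f + ennreal (T powr \<alpha>0 * L q2 T) * besov_seminorm T \<alpha>0 p0 q0 f) * besov_seminorm T \<alpha>1 p1 q1 g"
      using m C by (simp add: F G m_def[symmetric] ennreal_mult mult.assoc)
  next
    assume "inverse p0 < ennreal \<alpha>0 \<and> inverse p1 < ennreal \<alpha>1"
    then have small: "inverse p0 < ennreal \<alpha>0" "inverse p1 < ennreal \<alpha>1" by auto
    note c = cont[OF small]
    interpret c: young_continuous T \<alpha>0 \<alpha>1 p0 p1 p2 q0 q1 q2 f' g' using c by blast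
    have e1: "c.e1 < \<alpha>1"
      unfolding c.e1_def using small(2) by (rule inverse_less_ennreal_D)
    \<comment> \<open>\<gamma> is the maximum of 1 and e0 + e1, while e0 + e1 < \<alpha>0 +
      \<alpha>1 = \<gamma>; so the maximum is 1.\<close>
    have \<gamma>1: "y.\<gamma> = 1" using c.rho_e(1) e1 c.e0_bounds \<gamma>\<rho> by (auto simp: max_def y.\<gamma>_def split: if_splits)
    then show "\<alpha>0 + \<alpha>1 = 1" by (simp add: y.\<gamma>_def)
    have \<rho>1: "y.\<rho> = 1" using crit1 \<gamma>1 by simp
    have "besov_seminorm T \<alpha>1 p1 q1 I \<le> ennreal (critical_const_p1 \<alpha>0 p0 p1 q0 q1) *
        (ennreal \<bar>f' 0\<bar> + ennreal (T powr (\<alpha>0 - c.e0)) * y.F) * y.G"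
      using c.p1_critical[OF I(2) \<gamma>1 \<rho>1 _ _ osc_const_minus_1[OF small(1)]] c crit2
      by (simp add: critical_const_p1_def F c.e0_def osc_const_def \<rho>1)
    also have "\<dots> \<le> ennreal (critical_const_p1 \<alpha>0 p0 p1 q0 q1) *
        (ennreal \<bar>f' 0\<bar> + ennreal (T powr (\<alpha>0 - c.e0) * (1 + L q2 T)) * y.F) * y.G"
      using L0 mult_left_mono[of 1 "1 + L q2 T" "T powr (\<alpha>0 - c.e0)"]
      by (intro mult_right_mono mult_left_mono add_left_mono ennreal_leI) auto
    finally show "\<exists>f'. continuous_version T f f' \<and>
        besov_seminorm T \<alpha>1 p1 q1 I
          \<le> ennreal (critical_const_p1 \<alpha>0 p0 p1 q0 q1) *
            (ennreal \<bar>f' 0\<bar> + ennreal (T powr (\<alpha>0 - enn2real (inverse p0)) * (1 + L q2 T)) * besov_seminorm T \<alpha>0 p0 q0 f) *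
            besov_seminorm T \<alpha>1 p1 q1 g"
      using c by (auto simp: F G c.e0_def)
  qed
qed

end

theorem theorem4p1:
  shows
  "(\<exists>(C1 :: real \<Rightarrow> ennreal \<Rightarrow> ennreal \<Rightarrow> real)
     (C2 :: real \<Rightarrow> real \<Rightarrow> ennreal \<Rightarrow> ennreal \<Rightarrow> ennreal \<Rightarrow> ennreal \<Rightarrow> real)
     (C3 :: real \<Rightarrow> real \<Rightarrow> ennreal \<Rightarrow> ennreal \<Rightarrow> ennreal \<Rightarrow> ennreal \<Rightarrow> real).
    \<forall>(T::real) (\<alpha>\<^sub>0::real) (\<alpha>\<^sub>1::real) (\<gamma>::real) (p\<^sub>0::ennreal) (p\<^sub>1::ennreal) (p\<^sub>2::ennreal)
      (q\<^sub>0::ennreal) (q\<^sub>1::ennreal) (q\<^sub>2::ennreal) (f::real \<Rightarrow> real) (g::real \<Rightarrow> real).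
      0 < T \<and> \<alpha>\<^sub>0 \<in> {0<..<1} \<and> \<alpha>\<^sub>1 \<in> {0<..<1} \<and> 0 < p\<^sub>0 \<and> 0 < p\<^sub>1 \<and> 0 < q\<^sub>0 \<and> 0 < q\<^sub>1 \<and>
      \<gamma> = \<alpha>\<^sub>0 + \<alpha>\<^sub>1 \<and>
      inverse p\<^sub>2 = inverse p\<^sub>0 + inverse p\<^sub>1 \<and> inverse q\<^sub>2 = inverse q\<^sub>0 + inverse q\<^sub>1 \<and>
      f \<in> besov_space T \<alpha>\<^sub>0 p\<^sub>0 q\<^sub>0 \<and> g \<in> besov_space T \<alpha>\<^sub>1 p\<^sub>1 q\<^sub>1 \<and>
      ennreal \<gamma> > max 1 (inverse p\<^sub>2)
      \<longrightarrow>
      (\<exists>I \<in> besov_space T \<alpha>\<^sub>1 p\<^sub>2 q\<^sub>1.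
        (\<forall>r::real. r > 0 \<and> r > 1 / \<gamma> \<and> ennreal r \<ge> q\<^sub>2 \<longrightarrow>
          ((\<lambda>P. besov2_norm T (\<lambda>\<tau>. \<tau> powr \<gamma>) p\<^sub>2 (ennreal r)
                  (\<lambda>s t. riemann_sum f g P s t - incr I s t)) \<longlongrightarrow> 0) mesh_to_0) \<and>
        besov2_norm T (\<lambda>\<tau>. \<tau> powr \<gamma>) p\<^sub>2 q\<^sub>2 (\<lambda>s t. incr I s t - f s * incr g s t)
          \<le> ennreal (C1 \<gamma> p\<^sub>2 q\<^sub>2) * besov_seminorm T \<alpha>\<^sub>0 p\<^sub>0 q\<^sub>0 f * besov_seminorm T \<alpha>\<^sub>1 p\<^sub>1 q\<^sub>1 g \<and>
        besov_seminorm T \<alpha>\<^sub>1 p\<^sub>2 q\<^sub>1 I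
          \<le> ennreal (C2 \<alpha>\<^sub>0 \<alpha>\<^sub>1 p\<^sub>0 p\<^sub>1 q\<^sub>0 q\<^sub>1) *
            (Lp_norm_on T p\<^sub>0 f + ennreal (T powr \<alpha>\<^sub>0) * besov_seminorm T \<alpha>\<^sub>0 p\<^sub>0 q\<^sub>0 f) *
            besov_seminorm T \<alpha>\<^sub>1 p\<^sub>1 q\<^sub>1 g \<and>
        (ennreal \<alpha>\<^sub>0 > inverse p\<^sub>0 \<and> ennreal \<alpha>\<^sub>1 > inverse p\<^sub>1 \<longrightarrow>
          (\<exists>f'. continuous_version T f f' \<and>
            besov_seminorm T \<alpha>\<^sub>1 p\<^sub>1 q\<^sub>1 I
              \<le> ennreal (C3 \<alpha>\<^sub>0 \<alpha>\<^sub>1 p\<^sub>0 p\<^sub>1 q\<^sub>0 q\<^sub>1) *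
                (ennreal \<bar>f' 0\<bar> + ennreal (T powr (\<alpha>\<^sub>0 - enn2real (inverse p\<^sub>0))) *
                   besov_seminorm T \<alpha>\<^sub>0 p\<^sub>0 q\<^sub>0 f) *
                besov_seminorm T \<alpha>\<^sub>1 p\<^sub>1 q\<^sub>1 g))))
   \<and>
   (\<forall>(T::real) (L :: ennreal \<Rightarrow> real \<Rightarrow> real). 0 < T \<and> log_like T L \<longrightarrow>
    (\<exists>(C1 :: ennreal \<Rightarrow> ennreal \<Rightarrow> real)
      (C2 :: real \<Rightarrow> real \<Rightarrow> ennreal \<Rightarrow> ennreal \<Rightarrow> ennreal \<Rightarrow> ennreal \<Rightarrow> real)
      (C3 :: real \<Rightarrow> real \<Rightarrow> ennreal \<Rightarrow> ennreal \<Rightarrow> ennreal \<Rightarrow> ennreal \<Rightarrow> real).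
    \<forall>(\<alpha>\<^sub>0::real) (\<alpha>\<^sub>1::real) (\<gamma>::real) (p\<^sub>0::ennreal) (p\<^sub>1::ennreal) (p\<^sub>2::ennreal)
      (q\<^sub>0::ennreal) (q\<^sub>1::ennreal) (q\<^sub>2::ennreal) (f::real \<Rightarrow> real) (g::real \<Rightarrow> real).
      \<alpha>\<^sub>0 \<in> {0<..<1} \<and> \<alpha>\<^sub>1 \<in> {0<..<1} \<and> 0 < p\<^sub>0 \<and> 0 < p\<^sub>1 \<and> 0 < q\<^sub>0 \<and> 0 < q\<^sub>1 \<and>
      \<gamma> = \<alpha>\<^sub>0 + \<alpha>\<^sub>1 \<and>
      inverse p\<^sub>2 = inverse p\<^sub>0 + inverse p\<^sub>1 \<and> inverse q\<^sub>2 = inverse q\<^sub>0 + inverse q\<^sub>1 \<and>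
      f \<in> besov_space T \<alpha>\<^sub>0 p\<^sub>0 q\<^sub>0 \<and> g \<in> besov_space T \<alpha>\<^sub>1 p\<^sub>1 q\<^sub>1 \<and>
      ennreal \<gamma> = max 1 (inverse p\<^sub>2) \<and> max 1 (inverse p\<^sub>2) \<le> inverse q\<^sub>2
      \<longrightarrow>
      (\<exists>I \<in> besov_space T \<alpha>\<^sub>1 p\<^sub>2 q\<^sub>1.
        ((\<lambda>P. besov2_norm T (\<lambda>\<tau>. \<tau> powr max 1 (enn2real (inverse p\<^sub>2))) p\<^sub>2 \<infinity>
                (\<lambda>s t. riemann_sum f g P s t - incr I s t)) \<longlongrightarrow> 0) mesh_to_0 \<and>
        (\<forall>r. q\<^sub>2 \<le> r \<longrightarrow>
          besov2_norm T (\<lambda>h. h powr max 1 (enn2real (inverse p\<^sub>2)) * L r h) p\<^sub>2 r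
              (\<lambda>s t. incr I s t - f s * incr g s t)
            \<le> ennreal (C1 p\<^sub>2 r) * besov_seminorm T \<alpha>\<^sub>0 p\<^sub>0 q\<^sub>0 f * besov_seminorm T \<alpha>\<^sub>1 p\<^sub>1 q\<^sub>1 g) \<and>
        besov_seminorm T \<alpha>\<^sub>1 p\<^sub>2 q\<^sub>1 I
          \<le> ennreal (C2 \<alpha>\<^sub>0 \<alpha>\<^sub>1 p\<^sub>0 p\<^sub>1 q\<^sub>0 q\<^sub>1) *
            (Lp_norm_on T p\<^sub>0 f + ennreal (T powr \<alpha>\<^sub>0 * L q\<^sub>2 T) * besov_seminorm T \<alpha>\<^sub>0 p\<^sub>0 q\<^sub>0 f) *
            besov_seminorm T \<alpha>\<^sub>1 p\<^sub>1 q\<^sub>1 g \<and>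
        (ennreal \<alpha>\<^sub>0 > inverse p\<^sub>0 \<and> ennreal \<alpha>\<^sub>1 > inverse p\<^sub>1 \<longrightarrow>
          \<gamma> = 1 \<and>
          (\<exists>f'. continuous_version T f f' \<and>
            besov_seminorm T \<alpha>\<^sub>1 p\<^sub>1 q\<^sub>1 I
              \<le> ennreal (C3 \<alpha>\<^sub>0 \<alpha>\<^sub>1 p\<^sub>0 p\<^sub>1 q\<^sub>0 q\<^sub>1) *
                (ennreal \<bar>f' 0\<bar> + ennreal (T powr (\<alpha>\<^sub>0 - enn2real (inverse p\<^sub>0)) * (1 + L q\<^sub>2 T)) *
                   besov_seminorm T \<alpha>\<^sub>0 p\<^sub>0 q\<^sub>0 f) *
                besov_seminorm T \<alpha>\<^sub>1 p\<^sub>1 q\<^sub>1 g)))))"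
proof (rule conjI, goal_cases)
  case 1
  show ?case
  \<comment> \<open>\<open>C2\<close> and \<open>C3\<close> do not receive p2 as an argument; it is
    recovered from p0 and p1.\<close>
  proof (rule exI[of _ "\<lambda>\<gamma> p2 q2. subcritical_norm_const (enn2real (min 1 p2)) q2 \<gamma>"],
      rule exI[of _ "\<lambda>\<alpha>0 \<alpha>1 p0 p1 q0 q1. subcritical_const_p2 \<alpha>0 \<alpha>1 (inverse (inverse p0 + inverse p1)) q1"],
      rule exI[of _ "\<lambda>\<alpha>0 \<alpha>1 p0 p1 q0 q1. subcritical_const_p1 \<alpha>0 \<alpha>1 p0 p1 (inverse (inverse p0 + inverse p1)) q1"],
      intro allI impI, goal_cases)
    case (1 T \<alpha>0 \<alpha>1 \<gamma> p0 p1 p2 q0 q1 q2 f g)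
    then have \<gamma>: "\<gamma> = \<alpha>0 + \<alpha>1" and inv: "inverse p2 = inverse p0 + inverse p1" by auto
    have p2': "inverse (inverse p0 + inverse p1) = p2" unfolding inv[symmetric] by simp
    from 1 have gt: "max 1 (inverse p2) < ennreal (\<alpha>0 + \<alpha>1)" unfolding \<gamma> by blast
    from 1 less_imp_le[OF gt] interpret besov_pair T \<alpha>0 \<alpha>1 p0 p1 p2 q0 q1 q2 f g by unfold_locales auto
    from subcritical[OF gt] show ?case unfolding \<gamma> p2' .
  qed
next
  case 2
  show ?case
  proof (intro allI impI, elim conjE, goal_cases)
    case (1 T L)
    show ?case
    \<comment> \<open>T and \<open>L\<close> are fixed before the constants here, so
      \<open>log_const\<close> and the value of \<open>L\<close> at T may enter them.\<close>
    proof (rule exI[of _ "\<lambda>p2 r. 9216 * log_const T L r"],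
        rule exI[of _ "\<lambda>\<alpha>0 \<alpha>1 p0 p1 q0 q1. critical_const_p2 \<alpha>0 (inverse (inverse p0 + inverse p1)) q1 *
          max 1 (1 / L (inverse (inverse q0 + inverse q1)) T)"],
        rule exI[of _ "\<lambda>\<alpha>0 \<alpha>1 p0 p1 q0 q1. critical_const_p1 \<alpha>0 p0 p1 q0 q1"],
        intro allI impI, goal_cases)
      case (1 \<alpha>0 \<alpha>1 \<gamma> p0 p1 p2 q0 q1 q2 f g)
      then have \<gamma>: "\<gamma> = \<alpha>0 + \<alpha>1" and inv: "inverse p2 = inverse p0 + inverse p1" "inverse q2 = inverse q0 + inverse q1" by auto
      have p2': "inverse (inverse p0 + inverse p1) = p2" and q2': "inverse (inverse q0 + inverse q1) = q2"
        unfolding inv[symmetric] by simp_all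
      from 1 \<open>0 < T\<close> interpret besov_pair T \<alpha>0 \<alpha>1 p0 p1 p2 q0 q1 q2 f g by unfold_locales auto
      from 1 have "ennreal (\<alpha>0 + \<alpha>1) = max 1 (inverse p2)" "max 1 (inverse p2) \<le> inverse q2"
        unfolding \<gamma> by blast+
      from critical[OF this \<open>log_like T L\<close>] show ?case unfolding \<gamma> p2' q2' .
    qed
  qed
qed

end
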